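(* Over $\mathbb C$, there are isomorphisms of $B_n$-representations $$\mathcal G_{n,1}\cong\mathrm{Ind}_{Z_{(\emptyset,(n))}}^{B_n}\rho_{(\emptyset,(n))}\cong\mathfrak g_{(\emptyset,(n))}\mathbb C[B_n],\qquad \mathcal G_{n-1,0}\cong\mathrm{Ind}_{Z_{((n),\emptyset)}}^{B_n}\rho_{((n),\emptyset)}\cong\mathfrak g_{((n),\emptyset)}\mathbb C[B_n].$$
   Context: $B_n$: bijections of $[n]^\pm=\{1,\bar1,\dots,n,\bar n\}$ commuting with bar; $t_i$ swaps $i,\bar i$; $w_{0,J}=\prod_{i\in J}t_i$, $w_0=w_{0,[n]}$. The ring $\mathcal G$: let $\mathcal Z_n^1=\{(x_1,\dots,x_n)\in(\mathbb R\setminus\{0\})^n: x_i\ne x_j,\ x_i\neq -1/x_j\text{ for }i\ne j\}$ with $B_n$ acting by permuting coordinates and $t_i:x_i\mapsto -1/x_i$. With $x_{\bar i}:=-1/x_i$, define locally constant functions $z_i=[x_i>0]$ ($i\in[n]^\pm$) and $z_{ij}=[x_i<x_j]$ ($i\ne j\in[n]^\pm$). In $H^0(\mathcal Z_n^1;\mathbb C)$ let $F_k$ be the span of products of at most $k$ of these functions and $\mathrm{gr}_k=F_k/F_{k-1}$; let $P_{k,\ell}\subseteq\mathrm{gr}_k$ be the span of images of products of $k$ such functions at least $\ell$ of which are of the form $z_i$; set $\mathcal G_{k,\ell}=P_{k,\ell}/P_{k,\ell+1}$, with the induced $B_n$-action. Centralizers and characters: $\omega_m=e^{2\pi i/m}$.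 Let $c\in B_n$ be the $n$-cycle $i\mapsto i+1$ ($i<n$), $n\mapsto1$; $Z_{((n),\emptyset)}$ is its centralizer, generated by $c$ and $w_0$, and $\rho_{((n),\emptyset)}$ is the linear character with $c\mapsto\omega_n$, $w_0\mapsto1$. Let $d=cw_0$ if $n$ is odd and $d=(1\,2\cdots n)^-$ ($i\mapsto i+1$ for $i<n$, $n\mapsto\bar1$) if $n$ is even; $Z_{(\emptyset,(n))}=\langle d\rangle$ is its centralizer and $\rho_{(\emptyset,(n))}(d)=\omega_{2n}$. Idempotents: for a signed composition $p=(p_1,\dots,p_\ell)$ of $n$ (nonzero integers, $\sum|p_i|=n$) with signs $\zeta_i$, $\hat p_i=|p_1|+\dots+|p_i|$, $\hat p=\{\hat p_1,\dots,\hat p_{\ell-1}\}$, $\Lambda(p_i)=\{\hat p_{i-1}+1,\dots,\hat p_i\}$; $\overleftarrow p$ is the signed partition formed by positive parts and absolute values of negative parts, each sorted decreasingly; $X_A=\sum_{w\in S_n,\mathrm{Des}(w)\subseteq A}w$; for an interval $J=\{a+1,\dots,a+m\}$, $r_J=\sum_{A\subseteq\{a+1,\dots,a+m-1\}}\frac{(-1)^{|A|}}{|A|+1}X^J_A$ with $X^J_A$ the sum of permutations of $J$ (fixing the rest) with descents $\{a+i:w(a+i)>w(a+i+1)\}\subseteq A$; $\epsilon^\pm_J=\frac12(1\pm w_{0,J})$; $I_p=X_{\hat p}\epsilon^{\zeta_1}_{\Lambda(p_1)}r_{\Lambda(p_1)}\cdots\epsilon^{\zeta_\ell}_{\Lambda(p_\ell)}r_{\Lambda(p_\ell)}$;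 $\mathfrak g_{(\lambda^+,\lambda^-)}=\frac1{\ell(\lambda)!}\sum_{\overleftarrow p=(\lambda^+,\lambda^-)}I_p$ with $\ell(\lambda)=\ell(\lambda^+)+\ell(\lambda^-)$. *)

theory Defs
  imports
    "HOL-Analysis.Analysis"
    "HOL-Combinatorics.Permutations"
    "HOL-Algebra.Module"
    "HOL-Algebra.AbelCoset"
begin

section \<open>Complex representations of a group\<close>

definition complex_ring :: "complex ring" where
  "complex_ring = \<lparr>carrier = UNIV, mult = (*), one = 1, zero = 0, add = (+)\<rparr>"

text \<open>The fields \<open>mult\<close> and \<open>one\<close> inherited from the record of rings play no role for
  modules; they are left unspecified below except for the group algebra.\<close>

record ('g, 'v) rep = "(complex, 'v) module" +
  act :: "'g \<Rightarrow> 'v \<Rightarrow> 'v"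

definition representation :: "'g monoid \<Rightarrow> ('g, 'v) rep \<Rightarrow> bool" where
  "representation G V \<longleftrightarrow>
     Group.group G \<and> Module.module complex_ring V \<and>
     (\<forall>g\<in>carrier G. \<forall>v\<in>carrier V. act V g v \<in> carrier V) \<and>
     (\<forall>g\<in>carrier G. \<forall>v\<in>carrier V. \<forall>w\<in>carrier V.
        act V g (v \<oplus>\<^bsub>V\<^esub> w) = act V g v \<oplus>\<^bsub>V\<^esub> act V g w) \<and>
     (\<forall>g\<in>carrier G. \<forall>a. \<forall>v\<in>carrier V. act V g (a \<odot>\<^bsub>V\<^esub> v) = a \<odot>\<^bsub>V\<^esub> act V g v) \<and>
     (\<forall>v\<in>carrier V. act V \<one>\<^bsub>G\<^esub> v = v) \<and>
     (\<forall>g\<in>carrier G. \<forall>h\<in>carrier G. \<forall>v\<in>carrier V.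
        act V (g \<otimes>\<^bsub>G\<^esub> h) v = act V g (act V h v))"

definition rep_isomorphic :: "'g monoid \<Rightarrow> ('g, 'v) rep \<Rightarrow> ('g, 'w) rep \<Rightarrow> bool" where
  "rep_isomorphic G V W \<longleftrightarrow>
     representation G V \<and> representation G W \<and>
     (\<exists>\<phi>. bij_betw \<phi> (carrier V) (carrier W) \<and>
        (\<forall>v\<in>carrier V. \<forall>w\<in>carrier V. \<phi> (v \<oplus>\<^bsub>V\<^esub> w) = \<phi> v \<oplus>\<^bsub>W\<^esub> \<phi> w) \<and>
        (\<forall>a. \<forall>v\<in>carrier V. \<phi> (a \<odot>\<^bsub>V\<^esub> v) = a \<odot>\<^bsub>W\<^esub> \<phi> v) \<and>
        (\<forall>g\<in>carrier G. \<forall>v\<in>carrier V. \<phi> (act V g v) = act W g (\<phi> v)))"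

definition lin_span :: "('g, 'v) rep \<Rightarrow> 'v set \<Rightarrow> 'v set" where
  "lin_span V S = \<Inter> {U. submodule U complex_ring V \<and> S \<subseteq> U}"

definition subrep :: "('g, 'v) rep \<Rightarrow> 'v set \<Rightarrow> ('g, 'v) rep" where
  "subrep V U = V\<lparr>carrier := U\<rparr>"

text \<open>The quotient \<open>V / U\<close>. Scalar multiplication is a union of cosets rather than an
  elementwise image, since the elementwise image under the scalar \<open>0\<close> is not a coset.\<close>

definition quot_rep :: "('g, 'v) rep \<Rightarrow> 'v set \<Rightarrow> ('g, 'v set) rep" where
  "quot_rep V U =
     \<lparr>carrier = a_rcosets\<^bsub>V\<^esub> U, mult = undefined, one = undefined,
      zero = U, add = (\<lambda>X Y. X <+>\<^bsub>V\<^esub> Y),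
      smult = (\<lambda>a X. \<Union>x\<in>X. U +>\<^bsub>V\<^esub> (a \<odot>\<^bsub>V\<^esub> x)),
      act = (\<lambda>g X. act V g ` X)\<rparr>"


subsection \<open>Linear characters and induction\<close>

definition centralizer :: "'g monoid \<Rightarrow> 'g \<Rightarrow> 'g set" where
  "centralizer G x = {g \<in> carrier G. g \<otimes>\<^bsub>G\<^esub> x = x \<otimes>\<^bsub>G\<^esub> g}"

definition linear_character :: "'g monoid \<Rightarrow> 'g set \<Rightarrow> ('g \<Rightarrow> complex) \<Rightarrow> bool" where
  "linear_character G H \<rho> \<longleftrightarrow>
     \<rho> \<in> hom (G\<lparr>carrier := H\<rparr>) (units_of complex_ring) \<and> \<rho> \<in> extensional H"

text \<open>\<open>Ind\<close> from \<open>H\<close> to \<open>G\<close> of a linear character \<open>\<rho>\<close>, for finite \<open>G\<close>: functions \<open>f\<close> on \<open>G\<close>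
  with \<open>f (g h) = \<rho> (h)\<inverse> f (g)\<close> for \<open>h\<close> in \<open>H\<close>, with \<open>G\<close> acting by left translation.
  The function supported on \<open>H\<close> with \<open>f h = \<rho> (h)\<inverse>\<close> spans the copy of \<open>\<rho>\<close>.\<close>

definition ind_rep :: "'g monoid \<Rightarrow> 'g set \<Rightarrow> ('g \<Rightarrow> complex) \<Rightarrow> ('g, 'g \<Rightarrow> complex) rep" where
  "ind_rep G H \<rho> =
     \<lparr>carrier = {f. (\<forall>g. g \<notin> carrier G \<longrightarrow> f g = 0) \<and>
                    (\<forall>g\<in>carrier G. \<forall>h\<in>H. f (g \<otimes>\<^bsub>G\<^esub> h) = inverse (\<rho> h) * f g)},
      mult = undefined, one = undefined,
      zero = (\<lambda>_. 0), add = (\<lambda>f f' g. f g + f' g),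
      smult = (\<lambda>a f g. a * f g),
      act = (\<lambda>x f g. if g \<in> carrier G then f (inv\<^bsub>G\<^esub> x \<otimes>\<^bsub>G\<^esub> g) else 0)\<rparr>"


subsection \<open>Group algebra of a finite group\<close>

definition group_algebra :: "'g monoid \<Rightarrow> (complex, 'g \<Rightarrow> complex) module" where
  "group_algebra G =
     \<lparr>carrier = {a. \<forall>g. g \<notin> carrier G \<longrightarrow> a g = 0},
      mult = (\<lambda>a b g. \<Sum>(u, v) \<in> {(u, v) \<in> carrier G \<times> carrier G. u \<otimes>\<^bsub>G\<^esub> v = g}. a u * b v),
      one = (\<lambda>g. of_bool (g = \<one>\<^bsub>G\<^esub>)),
      zero = (\<lambda>_. 0), add = (\<lambda>a b g. a g + b g),
      smult = (\<lambda>c a g. c * a g)\<rparr>"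

text \<open>The right ideal \<open>a \<complex>[G]\<close>; its right \<open>G\<close>-module structure is read as a left action,
  \<open>g\<close> acting by right multiplication with \<open>g\<inverse>\<close>.\<close>

definition right_ideal_rep :: "'g monoid \<Rightarrow> ('g \<Rightarrow> complex) \<Rightarrow> ('g, 'g \<Rightarrow> complex) rep" where
  "right_ideal_rep G a =
     \<lparr>carrier = {a \<otimes>\<^bsub>group_algebra G\<^esub> b | b. b \<in> carrier (group_algebra G)},
      mult = undefined, one = undefined,
      zero = \<zero>\<^bsub>group_algebra G\<^esub>, add = add (group_algebra G),
      smult = smult (group_algebra G),
      act = (\<lambda>g b. b \<otimes>\<^bsub>group_algebra G\<^esub> (\<lambda>h. of_bool (h = inv\<^bsub>G\<^esub> g)))\<rparr>"


section \<open>The hyperoctahedral group\<close>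

text \<open>The barred letter of \<open>i\<close> is the integer \<open>- i\<close>.\<close>

definition signed_set :: "nat \<Rightarrow> int set" where
  "signed_set n = {- int n..int n} - {0}"

definition hyperoct :: "nat \<Rightarrow> (int \<Rightarrow> int) monoid" where
  "hyperoct n =
     \<lparr>carrier = {w. w permutes signed_set n \<and> (\<forall>i. w (- i) = - w i)},
      mult = (\<circ>), one = id\<rparr>"

definition w0_on :: "int set \<Rightarrow> int \<Rightarrow> int" where
  "w0_on J i = (if \<bar>i\<bar> \<in> J then - i else i)"

abbreviation w0 :: "nat \<Rightarrow> int \<Rightarrow> int" where
  "w0 n \<equiv> w0_on {1..int n}"

definition odd_extension :: "(int \<Rightarrow> int) \<Rightarrow> int \<Rightarrow> int" where
  "odd_extension f i = (if i < 0 then - f (- i) else f i)"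

definition pos_cycle :: "nat \<Rightarrow> int \<Rightarrow> int" where
  "pos_cycle n = odd_extension
     (\<lambda>i. if 1 \<le> i \<and> i < int n then i + 1 else if i = int n then 1 else i)"

definition neg_cycle :: "nat \<Rightarrow> int \<Rightarrow> int" where
  "neg_cycle n = odd_extension
     (\<lambda>i. if 1 \<le> i \<and> i < int n then i + 1 else if i = int n then - 1 else i)"

definition d_elt :: "nat \<Rightarrow> int \<Rightarrow> int" where
  "d_elt n = (if odd n then pos_cycle n \<circ> w0 n else neg_cycle n)"

definition omega :: "nat \<Rightarrow> complex" where
  "omega m = exp (2 * of_real pi * \<i> / of_nat m)"

definition Z_pos :: "nat \<Rightarrow> (int \<Rightarrow> int) set" where
  "Z_pos n = centralizer (hyperoct n) (pos_cycle n)"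

definition Z_neg :: "nat \<Rightarrow> (int \<Rightarrow> int) set" where
  "Z_neg n = centralizer (hyperoct n) (d_elt n)"

text \<open>For \<open>n \<ge> 1\<close> the characters below exist and are unique: \<open>Z_pos n\<close> is the direct product of the
  cyclic groups generated by \<open>pos_cycle n\<close> (order \<open>n\<close>) and \<open>w0 n\<close> (order \<open>2\<close>), and \<open>Z_neg n\<close> is
  cyclic of order \<open>2 n\<close>, generated by \<open>d_elt n\<close>.\<close>

definition rho_pos :: "nat \<Rightarrow> (int \<Rightarrow> int) \<Rightarrow> complex" where
  "rho_pos n = (THE \<rho>. linear_character (hyperoct n) (Z_pos n) \<rho> \<and>
                       \<rho> (pos_cycle n) = omega n \<and> \<rho> (w0 n) = 1)"

definition rho_neg :: "nat \<Rightarrow> (int \<Rightarrow> int) \<Rightarrow> complex" where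
  "rho_neg n = (THE \<rho>. linear_character (hyperoct n) (Z_neg n) \<rho> \<and>
                       \<rho> (d_elt n) = omega (2 * n))"


section \<open>The space \<open>\<Z>\<^sub>n\<^sup>1\<close> and the bigraded pieces of its ring of locally constant functions\<close>

definition Zspace :: "nat \<Rightarrow> (int \<Rightarrow> real) set" where
  "Zspace n = {x \<in> {1..int n} \<rightarrow>\<^sub>E (UNIV - {0}).
     \<forall>i\<in>{1..int n}. \<forall>j\<in>{1..int n}. i \<noteq> j \<longrightarrow> x i \<noteq> x j \<and> x i \<noteq> - 1 / x j}"

definition Ztop :: "nat \<Rightarrow> (int \<Rightarrow> real) topology" where
  "Ztop n = subtopology (product_topology (\<lambda>_. euclideanreal) {1..int n}) (Zspace n)"

definition coord :: "(int \<Rightarrow> real) \<Rightarrow> int \<Rightarrow> real" where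
  "coord x i = (if 0 < i then x i else - 1 / x (- i))"

text \<open>The left action with \<open>(w x)\<^sub>i = x\<^sub>j\<close> for \<open>j = w\<inverse> i\<close> in \<open>signed_set n\<close>.\<close>

definition point_act :: "nat \<Rightarrow> (int \<Rightarrow> int) \<Rightarrow> (int \<Rightarrow> real) \<Rightarrow> (int \<Rightarrow> real)" where
  "point_act n w x = (\<lambda>i\<in>{1..int n}. coord x ((inv\<^bsub>hyperoct n\<^esub> w) i))"

definition H0 :: "nat \<Rightarrow> (int \<Rightarrow> int, (int \<Rightarrow> real) \<Rightarrow> complex) rep" where
  "H0 n =
     \<lparr>carrier = {f \<in> extensional (Zspace n).
        \<forall>x\<in>Zspace n. \<exists>U. openin (Ztop n) U \<and> x \<in> U \<and> (\<forall>y\<in>U. f y = f x)},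
      mult = undefined, one = undefined,
      zero = (\<lambda>x\<in>Zspace n. 0),
      add = (\<lambda>f g. \<lambda>x\<in>Zspace n. f x + g x),
      smult = (\<lambda>a f. \<lambda>x\<in>Zspace n. a * f x),
      act = (\<lambda>w f. \<lambda>x\<in>Zspace n. f (point_act n (inv\<^bsub>hyperoct n\<^esub> w) x))\<rparr>"

definition z_one :: "nat \<Rightarrow> int \<Rightarrow> (int \<Rightarrow> real) \<Rightarrow> complex" where
  "z_one n i = (\<lambda>x\<in>Zspace n. of_bool (0 < coord x i))"

definition z_two :: "nat \<Rightarrow> int \<Rightarrow> int \<Rightarrow> (int \<Rightarrow> real) \<Rightarrow> complex" where
  "z_two n i j = (\<lambda>x\<in>Zspace n. of_bool (coord x i < coord x j))"

definition gens_one :: "nat \<Rightarrow> ((int \<Rightarrow> real) \<Rightarrow> complex) set" where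
  "gens_one n = {z_one n i | i. i \<in> signed_set n}"

definition gens_two :: "nat \<Rightarrow> ((int \<Rightarrow> real) \<Rightarrow> complex) set" where
  "gens_two n = {z_two n i j | i j. i \<in> signed_set n \<and> j \<in> signed_set n \<and> i \<noteq> j}"

definition prod_fun :: "nat \<Rightarrow> ((int \<Rightarrow> real) \<Rightarrow> complex) list \<Rightarrow> (int \<Rightarrow> real) \<Rightarrow> complex" where
  "prod_fun n fs = (\<lambda>x\<in>Zspace n. \<Prod>f\<leftarrow>fs. f x)"

text \<open>The filtration index is an integer so that \<open>F\<^sub>k\<close> with \<open>k = - 1\<close> is the zero space.\<close>

definition Fil :: "nat \<Rightarrow> int \<Rightarrow> ((int \<Rightarrow> real) \<Rightarrow> complex) set" where
  "Fil n k = lin_span (H0 n)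
     {prod_fun n fs | fs. set fs \<subseteq> gens_one n \<union> gens_two n \<and> int (length fs) \<le> k}"

definition gr :: "nat \<Rightarrow> nat \<Rightarrow> (int \<Rightarrow> int, ((int \<Rightarrow> real) \<Rightarrow> complex) set) rep" where
  "gr n k = quot_rep (subrep (H0 n) (Fil n (int k))) (Fil n (int k - 1))"

text \<open>A factor \<open>z_two n i (- i)\<close> is the function \<open>z_one n (- i)\<close>, so counting factors as functions
  or as labelled symbols gives the same span.\<close>

definition P_span :: "nat \<Rightarrow> nat \<Rightarrow> nat \<Rightarrow> ((int \<Rightarrow> real) \<Rightarrow> complex) set set" where
  "P_span n k l = lin_span (gr n k)
     {Fil n (int k - 1) +>\<^bsub>H0 n\<^esub> prod_fun n fs | fs.
        set fs \<subseteq> gens_one n \<union> gens_two n \<and> length fs = k \<and>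
        l \<le> length (filter (\<lambda>f. f \<in> gens_one n) fs)}"

definition G_piece ::
    "nat \<Rightarrow> nat \<Rightarrow> nat \<Rightarrow> (int \<Rightarrow> int, ((int \<Rightarrow> real) \<Rightarrow> complex) set set) rep" where
  "G_piece n k l = quot_rep (subrep (gr n k) (P_span n k l)) (P_span n k (l + 1))"


section \<open>The idempotents \<open>\<gg>\<^sub>\<lambda>\<close>\<close>

definition perms_on :: "nat \<Rightarrow> int set \<Rightarrow> (int \<Rightarrow> int) set" where
  "perms_on n J = {w \<in> carrier (hyperoct n). w ` J = J \<and> (\<forall>i\<in>{1..int n} - J. w i = i)}"

definition descents :: "int set \<Rightarrow> (int \<Rightarrow> int) \<Rightarrow> int set" where
  "descents J w = {i. i \<in> J \<and> i + 1 \<in> J \<and> w i > w (i + 1)}"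

text \<open>\<open>X_sum n J A\<close> is \<open>X\<^sub>A\<^sup>J\<close>; the element \<open>X\<^sub>A\<close> is the case \<open>J = {1..n}\<close>.\<close>

definition X_sum :: "nat \<Rightarrow> int set \<Rightarrow> int set \<Rightarrow> (int \<Rightarrow> int) \<Rightarrow> complex" where
  "X_sum n J A = (\<lambda>w. of_bool (w \<in> perms_on n J \<and> descents J w \<subseteq> A))"

definition r_elt :: "nat \<Rightarrow> int set \<Rightarrow> (int \<Rightarrow> int) \<Rightarrow> complex" where
  "r_elt n J = (\<lambda>w. \<Sum>A \<in> Pow {i. i \<in> J \<and> i + 1 \<in> J}.
     (- 1) ^ card A / of_nat (card A + 1) * X_sum n J A w)"

definition eps_elt :: "int \<Rightarrow> int set \<Rightarrow> (int \<Rightarrow> int) \<Rightarrow> complex" where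
  "eps_elt s J = (\<lambda>w. (of_bool (w = id) + of_int s * of_bool (w = w0_on J)) / 2)"

definition signed_compositions :: "nat \<Rightarrow> int list set" where
  "signed_compositions n = {p. 0 \<notin> set p \<and> (\<Sum>a\<leftarrow>p. \<bar>a\<bar>) = int n}"

definition partial_sum :: "int list \<Rightarrow> nat \<Rightarrow> int" where
  "partial_sum p i = (\<Sum>a\<leftarrow>take i p. \<bar>a\<bar>)"

definition hat_set :: "int list \<Rightarrow> int set" where
  "hat_set p = {partial_sum p i | i. 1 \<le> i \<and> i < length p}"

text \<open>Parts are indexed from \<open>0\<close>: \<open>block p i\<close> is \<open>\<Lambda>\<close> of the part \<open>p ! i\<close>.\<close>

definition block :: "int list \<Rightarrow> nat \<Rightarrow> int set" where
  "block p i = {partial_sum p i + 1..partial_sum p (i + 1)}"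

definition signed_partition_of :: "int list \<Rightarrow> int list \<times> int list" where
  "signed_partition_of p =
     (rev (sort (filter (\<lambda>a. 0 < a) p)), rev (sort (map abs (filter (\<lambda>a. a < 0) p))))"

definition I_elt :: "nat \<Rightarrow> int list \<Rightarrow> (int \<Rightarrow> int) \<Rightarrow> complex" where
  "I_elt n p =
     X_sum n {1..int n} (hat_set p) \<otimes>\<^bsub>group_algebra (hyperoct n)\<^esub>
     foldr (\<lambda>a b. a \<otimes>\<^bsub>group_algebra (hyperoct n)\<^esub> b)
       (map (\<lambda>i. eps_elt (sgn (p ! i)) (block p i) \<otimes>\<^bsub>group_algebra (hyperoct n)\<^esub>
                  r_elt n (block p i)) [0..<length p])
       \<one>\<^bsub>group_algebra (hyperoct n)\<^esub>"

definition g_elt :: "nat \<Rightarrow> int list \<times> int list \<Rightarrow> (int \<Rightarrow> int) \<Rightarrow> complex" where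
  "g_elt n lam = (\<lambda>w. 1 / fact (length (fst lam) + length (snd lam)) *
     (\<Sum>p \<in> {p \<in> signed_compositions n. signed_partition_of p = lam}. I_elt n p w))"

end

theory Submission
  imports Defs "HOL-Algebra.Generated_Groups" "HOL-Computational_Algebra.Polynomial"
begin

text \<open>All six representations are compared with a left ideal \<open>\<complex>[B\<^sub>n] r\<close>, where \<open>r\<close> is the image under
  inversion of \<open>\<epsilon>\<^sup>\<plusminus> r\<^bsub>[n]\<^esub>\<close>. The basic fact is that \<open>r\<close> annihilates from the right every function on \<open>B\<^sub>n\<close>
  that splits, that is, depends on a word only through its signs and the relative order inside two complementary
  sets of letters: sums of \<open>r\<close> over shuffles vanish. Hence \<open>r\<close> is idempotent, and inversion turns the
  right ideals into these left ideals.

  For the induced representations, Klyachko's element \<open>\<kappa>\<close>, a sum of words weighted by powers of a root of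
  unity given by the major index, is an eigenvector for the centralizer and satisfies \<open>\<kappa> r = r\<close>. Since
  \<open>r\<close> is idempotent with \<open>r(1) = 1/|Z|\<close>, a trace argument shows that right multiplication by \<open>r\<close> is an
  isomorphism.

  For the pieces of the ring of locally constant functions, evaluate a function at one point of each of the
  components of the space, which are indexed by \<open>B\<^sub>n\<close>, and multiply by \<open>r\<close>. A product of generators with
  fewer than \<open>n - 1\<close> factors \<open>z\<^sub>i\<^sub>j\<close> evaluates to a split function, because its graph is disconnected, and
  is therefore killed. Conversely, expanding \<open>\<delta>\<^sub>u r\<close> into sums over words that increase on blocks shows that
  the kernel consists of such products and lower order terms.\<close>

section \<open>Representations and their quotients\<close>

text \<open>Why \<open>r\<close> kills shuffles: a word with \<open>m\<close> letters and
  \<open>d\<close> descents has \<open>(t + m - 1 - d) choose m\<close> compatible colourings with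
  \<open>t\<close> colours, a polynomial in \<open>t\<close> whose linear coefficient
  \<open>dcoef m d\<close> is the coefficient of the word in \<open>r_elt\<close>. Numbers of
  colourings multiply under shuffling, and a product of two polynomials without constant term has no
  linear term. Why two signs occur: a chain of n - 1 links prescribes an order but no signs. It
  evaluates to \<open>dl u + dl (u \<circ> w0 n)\<close> plus terms with one change of sign, which
  are killed, so its image is \<open>1 + s\<close> times that of \<open>dl u\<close>. For s = 1
  chains generate the image; for s = -1 all products of fewer than n generators die, and one further
  factor z_i isolates \<open>dl u\<close>. The obstacle is that \<open>t -> -1/t\<close> is
  increasing on each half line only, so a link and its barred copy are different functions. Their
  difference consists of z_i's, which is what the second grading discards.\<close>

lemma complex_ring_simps [simp]:
  "carrier complex_ring = UNIV" "x \<otimes>\<^bsub>complex_ring\<^esub> y = x * y" "\<one>\<^bsub>complex_ring\<^esub> = 1"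
  "\<zero>\<^bsub>complex_ring\<^esub> = 0" "x \<oplus>\<^bsub>complex_ring\<^esub> y = x + y"
  by (simp_all add: complex_ring_def)

lemma cring_complex_ring: "cring complex_ring"
proof (rule cringI)
  show "abelian_group complex_ring"
    by (rule abelian_groupI) (auto simp: algebra_simps intro: exI[of _ "- x" for x])
  show "comm_monoid complex_ring"
    by (rule comm_monoidI) (auto simp: algebra_simps)
qed (auto simp: algebra_simps)

text \<open>Additive inverses come from \<open>s0\<close>: scaling by \<open>-1\<close> gives one,
  since scaling by \<open>0\<close> gives zero.\<close>

lemma complex_moduleI:
  fixes V :: "(complex, 'v, 'm) module_scheme"
  assumes z: "\<zero>\<^bsub>V\<^esub> \<in> carrier V"
    and a: "\<And>x y. x \<in> carrier V \<Longrightarrow> y \<in> carrier V \<Longrightarrow> x \<oplus>\<^bsub>V\<^esub> y \<in> carrier V"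
    and s: "\<And>a x. x \<in> carrier V \<Longrightarrow> a \<odot>\<^bsub>V\<^esub> x \<in> carrier V"
    and aa: "\<And>x y w. x \<in> carrier V \<Longrightarrow> y \<in> carrier V \<Longrightarrow> w \<in> carrier V \<Longrightarrow>
      x \<oplus>\<^bsub>V\<^esub> y \<oplus>\<^bsub>V\<^esub> w = x \<oplus>\<^bsub>V\<^esub> (y \<oplus>\<^bsub>V\<^esub> w)"
    and ac: "\<And>x y. x \<in> carrier V \<Longrightarrow> y \<in> carrier V \<Longrightarrow> x \<oplus>\<^bsub>V\<^esub> y = y \<oplus>\<^bsub>V\<^esub> x"
    and az: "\<And>x. x \<in> carrier V \<Longrightarrow> \<zero>\<^bsub>V\<^esub> \<oplus>\<^bsub>V\<^esub> x = x"
    and sl: "\<And>a b x. x \<in> carrier V \<Longrightarrow> (a + b) \<odot>\<^bsub>V\<^esub> x = a \<odot>\<^bsub>V\<^esub> x \<oplus>\<^bsub>V\<^esub> b \<odot>\<^bsub>V\<^esub> x"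
    and sr: "\<And>a x y. x \<in> carrier V \<Longrightarrow> y \<in> carrier V \<Longrightarrow>
      a \<odot>\<^bsub>V\<^esub> (x \<oplus>\<^bsub>V\<^esub> y) = a \<odot>\<^bsub>V\<^esub> x \<oplus>\<^bsub>V\<^esub> a \<odot>\<^bsub>V\<^esub> y"
    and sa: "\<And>a b x. x \<in> carrier V \<Longrightarrow> (a * b) \<odot>\<^bsub>V\<^esub> x = a \<odot>\<^bsub>V\<^esub> (b \<odot>\<^bsub>V\<^esub> x)"
    and s1: "\<And>x. x \<in> carrier V \<Longrightarrow> 1 \<odot>\<^bsub>V\<^esub> x = x"
    and s0: "\<And>x. x \<in> carrier V \<Longrightarrow> 0 \<odot>\<^bsub>V\<^esub> x = \<zero>\<^bsub>V\<^esub>"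
  shows "Module.module complex_ring V"
proof (rule moduleI)
  show "abelian_group V"
  proof (rule abelian_groupI)
    fix x assume x: "x \<in> carrier V"
    have "(-1) \<odot>\<^bsub>V\<^esub> x \<oplus>\<^bsub>V\<^esub> x = \<zero>\<^bsub>V\<^esub>"
      using sl[OF x, of "-1" 1] by (simp add: s1[OF x] s0[OF x])
    then show "\<exists>y\<in>carrier V. y \<oplus>\<^bsub>V\<^esub> x = \<zero>\<^bsub>V\<^esub>"
      using s[OF x] by blast
  qed (use assms in auto)
qed (use assms cring_complex_ring in auto)

lemma complex_submoduleI:
  assumes M: "Module.module complex_ring M" and "H \<subseteq> carrier M" "\<zero>\<^bsub>M\<^esub> \<in> H"
    and "\<And>a b. a \<in> H \<Longrightarrow> b \<in> H \<Longrightarrow> a \<oplus>\<^bsub>M\<^esub> b \<in> H"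
    and s: "\<And>a x. x \<in> H \<Longrightarrow> a \<odot>\<^bsub>M\<^esub> x \<in> H"
  shows "submodule H complex_ring M"
proof -
  interpret Module.module complex_ring M by (rule M)
  show ?thesis
  proof (rule submoduleI)
    fix x assume x: "x \<in> H"
    then have "(\<ominus>\<^bsub>complex_ring\<^esub> \<one>\<^bsub>complex_ring\<^esub>) \<odot>\<^bsub>M\<^esub> x = \<ominus>\<^bsub>M\<^esub> x"
      using assms(2) smult_l_minus[of "\<one>\<^bsub>complex_ring\<^esub>" x] smult_one by auto
    then show "\<ominus>\<^bsub>M\<^esub> x \<in> H"
      using s[OF x] by metis
  qed (use assms in auto)
qed

lemma submoduleD:
  assumes "submodule U complex_ring V"
  shows "U \<subseteq> carrier V" "\<zero>\<^bsub>V\<^esub> \<in> U" "\<And>a b. a \<in> U \<Longrightarrow> b \<in> U \<Longrightarrow> a \<oplus>\<^bsub>V\<^esub> b \<in> U"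
    "\<And>a x. x \<in> U \<Longrightarrow> a \<odot>\<^bsub>V\<^esub> x \<in> U"
  using subgroup.subset[OF submodule.axioms(1)[OF assms]]
    subgroup.one_closed[OF submodule.axioms(1)[OF assms]]
    subgroup.m_closed[OF submodule.axioms(1)[OF assms]]
    submodule.smult_closed[OF assms]
  by auto

lemma representationI:
  assumes "Group.group G" "Module.module complex_ring V"
    and "\<And>g v. g \<in> carrier G \<Longrightarrow> v \<in> carrier V \<Longrightarrow> act V g v \<in> carrier V"
    and "\<And>g v w. g \<in> carrier G \<Longrightarrow> v \<in> carrier V \<Longrightarrow> w \<in> carrier V \<Longrightarrow>
      act V g (v \<oplus>\<^bsub>V\<^esub> w) = act V g v \<oplus>\<^bsub>V\<^esub> act V g w"
    and "\<And>g a v. g \<in> carrier G \<Longrightarrow> v \<in> carrier V \<Longrightarrow> act V g (a \<odot>\<^bsub>V\<^esub> v) = a \<odot>\<^bsub>V\<^esub> act V g v"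
    and "\<And>v. v \<in> carrier V \<Longrightarrow> act V \<one>\<^bsub>G\<^esub> v = v"
    and "\<And>g h v. g \<in> carrier G \<Longrightarrow> h \<in> carrier G \<Longrightarrow> v \<in> carrier V \<Longrightarrow>
      act V (g \<otimes>\<^bsub>G\<^esub> h) v = act V g (act V h v)"
  shows "representation G V"
  using assms by (simp add: representation_def)

text \<open>Each axiom for \<open>V\<close> is tested after applying the injective map \<phi>, where
  it holds in \<open>W\<close>. That \<open>V\<close> is a representation thus comes out together
  with the isomorphism, which is how \<open>ind_rep\<close> and \<open>right_ideal_rep\<close> are
  handled.\<close>

lemma rep_transport:
  fixes V :: "('g, 'v) rep" and W :: "('g, 'w) rep"
  assumes W: "representation G W" and bij: "bij_betw \<phi> (carrier V) (carrier W)"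
    and z: "\<zero>\<^bsub>V\<^esub> \<in> carrier V" "\<phi> \<zero>\<^bsub>V\<^esub> = \<zero>\<^bsub>W\<^esub>"
    and ac: "\<And>v w. v \<in> carrier V \<Longrightarrow> w \<in> carrier V \<Longrightarrow> v \<oplus>\<^bsub>V\<^esub> w \<in> carrier V"
    and a: "\<And>v w. v \<in> carrier V \<Longrightarrow> w \<in> carrier V \<Longrightarrow> \<phi> (v \<oplus>\<^bsub>V\<^esub> w) = \<phi> v \<oplus>\<^bsub>W\<^esub> \<phi> w"
    and sc: "\<And>c v. v \<in> carrier V \<Longrightarrow> c \<odot>\<^bsub>V\<^esub> v \<in> carrier V"
    and s: "\<And>c v. v \<in> carrier V \<Longrightarrow> \<phi> (c \<odot>\<^bsub>V\<^esub> v) = c \<odot>\<^bsub>W\<^esub> \<phi> v"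
    and gc: "\<And>g v. g \<in> carrier G \<Longrightarrow> v \<in> carrier V \<Longrightarrow> act V g v \<in> carrier V"
    and g: "\<And>g v. g \<in> carrier G \<Longrightarrow> v \<in> carrier V \<Longrightarrow> \<phi> (act V g v) = act W g (\<phi> v)"
  shows "rep_isomorphic G V W"
proof -
  have grp: "Group.group G" and mod: "Module.module complex_ring W"
    using W by (auto simp: representation_def)
  interpret G: Group.group G by (rule grp)
  interpret M: Module.module complex_ring W by (rule mod)
  have inW: "\<phi> v \<in> carrier W" if "v \<in> carrier V" for v
    using bij that by (auto simp: bij_betw_def)
  have eqI: "x = y" if "x \<in> carrier V" "y \<in> carrier V" "\<phi> x = \<phi> y" for x y
    using bij that by (auto simp: bij_betw_def dest: inj_onD)
  note smult0 = M.smult_l_null[simplified] and smult1 = M.smult_one[simplified]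
    and sl = M.smult_l_distr[simplified] and sr = M.smult_r_distr[simplified]
    and sa = M.smult_assoc1[simplified]
  have mod_V: "Module.module complex_ring V"
  proof (rule complex_moduleI)
    show "x \<oplus>\<^bsub>V\<^esub> y \<oplus>\<^bsub>V\<^esub> w = x \<oplus>\<^bsub>V\<^esub> (y \<oplus>\<^bsub>V\<^esub> w)"
      if "x \<in> carrier V" "y \<in> carrier V" "w \<in> carrier V" for x y w
      using that by (intro eqI) (simp_all add: ac a inW M.a_assoc)
    show "x \<oplus>\<^bsub>V\<^esub> y = y \<oplus>\<^bsub>V\<^esub> x" if "x \<in> carrier V" "y \<in> carrier V" for x y
      using that by (intro eqI) (simp_all add: ac a inW M.a_comm)
    show "\<zero>\<^bsub>V\<^esub> \<oplus>\<^bsub>V\<^esub> x = x" if "x \<in> carrier V" for x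
      using that by (intro eqI) (simp_all add: z ac a inW)
    show "(c + d) \<odot>\<^bsub>V\<^esub> x = c \<odot>\<^bsub>V\<^esub> x \<oplus>\<^bsub>V\<^esub> d \<odot>\<^bsub>V\<^esub> x" if "x \<in> carrier V" for c d x
      using that by (intro eqI) (simp_all add: ac sc a s inW sl)
    show "c \<odot>\<^bsub>V\<^esub> (x \<oplus>\<^bsub>V\<^esub> y) = c \<odot>\<^bsub>V\<^esub> x \<oplus>\<^bsub>V\<^esub> c \<odot>\<^bsub>V\<^esub> y"
      if "x \<in> carrier V" "y \<in> carrier V" for c x y
      using that by (intro eqI) (simp_all add: ac sc a s inW sr)
    show "(c * d) \<odot>\<^bsub>V\<^esub> x = c \<odot>\<^bsub>V\<^esub> (d \<odot>\<^bsub>V\<^esub> x)" if "x \<in> carrier V" for c d x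
      using that by (intro eqI) (simp_all add: sc s inW sa)
    show "1 \<odot>\<^bsub>V\<^esub> x = x" if "x \<in> carrier V" for x
      using that by (intro eqI) (simp_all add: sc s inW smult1)
    show "0 \<odot>\<^bsub>V\<^esub> x = \<zero>\<^bsub>V\<^esub>" if "x \<in> carrier V" for x
      using that by (intro eqI) (simp_all add: z sc s inW smult0)
  qed (use z ac sc in auto)
  have gW: "act W \<one>\<^bsub>G\<^esub> w = w" "act W (h \<otimes>\<^bsub>G\<^esub> k) w = act W h (act W k w)"
    "act W h (v \<oplus>\<^bsub>W\<^esub> w) = act W h v \<oplus>\<^bsub>W\<^esub> act W h w" "act W h (c \<odot>\<^bsub>W\<^esub> w) = c \<odot>\<^bsub>W\<^esub> act W h w"
    if "w \<in> carrier W" "h \<in> carrier G" "k \<in> carrier G" "v \<in> carrier W" for c v w h k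
    using W that by (simp_all add: representation_def)
  have "representation G V"
  proof (rule representationI[OF grp mod_V])
    show "act V h (v \<oplus>\<^bsub>V\<^esub> w) = act V h v \<oplus>\<^bsub>V\<^esub> act V h w"
      if "h \<in> carrier G" "v \<in> carrier V" "w \<in> carrier V" for h v w
      using that by (intro eqI) (simp_all add: ac a gc g gW(3)[of _ h] inW)
    show "act V h (c \<odot>\<^bsub>V\<^esub> v) = c \<odot>\<^bsub>V\<^esub> act V h v" if "h \<in> carrier G" "v \<in> carrier V" for h c v
      using that by (intro eqI) (simp_all add: sc s gc g gW(4)[of "\<phi> v" h h "\<phi> v"] inW)
    show "act V \<one>\<^bsub>G\<^esub> v = v" if "v \<in> carrier V" for v
      using that by (intro eqI) (simp_all add: gc g gW(1)[of "\<phi> v" "\<one>\<^bsub>G\<^esub>" "\<one>\<^bsub>G\<^esub>" "\<phi> v"] inW)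
    show "act V (h \<otimes>\<^bsub>G\<^esub> k) v = act V h (act V k v)"
      if "h \<in> carrier G" "k \<in> carrier G" "v \<in> carrier V" for h k v
      using that by (intro eqI) (simp_all add: gc g gW(2)[of "\<phi> v" h k "\<phi> v"] inW)
  qed (rule gc)
  then show ?thesis
    using W bij a s g unfolding rep_isomorphic_def by blast
qed

lemma rep_isomorphic_sym:
  assumes "rep_isomorphic G V W" shows "rep_isomorphic G W V"
proof -
  obtain \<phi> where V: "representation G V" and W: "representation G W"
    and bij: "bij_betw \<phi> (carrier V) (carrier W)"
    and a: "\<And>v w. v \<in> carrier V \<Longrightarrow> w \<in> carrier V \<Longrightarrow> \<phi> (v \<oplus>\<^bsub>V\<^esub> w) = \<phi> v \<oplus>\<^bsub>W\<^esub> \<phi> w"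
    and s: "\<And>c v. v \<in> carrier V \<Longrightarrow> \<phi> (c \<odot>\<^bsub>V\<^esub> v) = c \<odot>\<^bsub>W\<^esub> \<phi> v"
    and g: "\<And>g v. g \<in> carrier G \<Longrightarrow> v \<in> carrier V \<Longrightarrow> \<phi> (act V g v) = act W g (\<phi> v)"
    using assms unfolding rep_isomorphic_def by blast
  interpret M: Module.module complex_ring V using V by (simp add: representation_def)
  define \<psi> where "\<psi> = inv_into (carrier V) \<phi>"
  have \<psi>: "bij_betw \<psi> (carrier W) (carrier V)"
    unfolding \<psi>_def by (rule bij_betw_inv_into[OF bij])
  have \<psi>\<phi>: "\<psi> (\<phi> v) = v" if "v \<in> carrier V" for v
    unfolding \<psi>_def using bij that by (simp add: bij_betw_def)
  have ex: "\<exists>v\<in>carrier V. w = \<phi> v" if "w \<in> carrier W" for w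
    using bij that by (auto simp: bij_betw_def)
  have gc: "act V h v \<in> carrier V" if "h \<in> carrier G" "v \<in> carrier V" for h v
    using V that by (auto simp: representation_def)
  have "\<psi> (v \<oplus>\<^bsub>W\<^esub> w) = \<psi> v \<oplus>\<^bsub>V\<^esub> \<psi> w" if "v \<in> carrier W" "w \<in> carrier W" for v w
    using ex[OF that(1)] ex[OF that(2)] by (auto simp: \<psi>\<phi> simp flip: a)
  moreover have "\<psi> (c \<odot>\<^bsub>W\<^esub> w) = c \<odot>\<^bsub>V\<^esub> \<psi> w" if "w \<in> carrier W" for c w
    using ex[OF that(1)] M.smult_closed by (auto simp: \<psi>\<phi> simp flip: s)
  moreover have "\<psi> (act W h w) = act V h (\<psi> w)" if "h \<in> carrier G" "w \<in> carrier W" for h w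
    using ex[OF that(2)] that(1) by (auto simp: \<psi>\<phi> gc simp flip: g)
  ultimately show ?thesis
    unfolding rep_isomorphic_def using V W \<psi> by blast
qed

lemma rep_isomorphic_trans:
  assumes "rep_isomorphic G U V" "rep_isomorphic G V W" shows "rep_isomorphic G U W"
proof -
  obtain \<phi> where \<phi>: "bij_betw \<phi> (carrier U) (carrier V)"
    "\<And>v w. v \<in> carrier U \<Longrightarrow> w \<in> carrier U \<Longrightarrow> \<phi> (v \<oplus>\<^bsub>U\<^esub> w) = \<phi> v \<oplus>\<^bsub>V\<^esub> \<phi> w"
    "\<And>c v. v \<in> carrier U \<Longrightarrow> \<phi> (c \<odot>\<^bsub>U\<^esub> v) = c \<odot>\<^bsub>V\<^esub> \<phi> v"
    "\<And>g v. g \<in> carrier G \<Longrightarrow> v \<in> carrier U \<Longrightarrow> \<phi> (act U g v) = act V g (\<phi> v)"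
    using assms(1) unfolding rep_isomorphic_def by blast
  obtain \<psi> where \<psi>: "bij_betw \<psi> (carrier V) (carrier W)"
    "\<And>v w. v \<in> carrier V \<Longrightarrow> w \<in> carrier V \<Longrightarrow> \<psi> (v \<oplus>\<^bsub>V\<^esub> w) = \<psi> v \<oplus>\<^bsub>W\<^esub> \<psi> w"
    "\<And>c v. v \<in> carrier V \<Longrightarrow> \<psi> (c \<odot>\<^bsub>V\<^esub> v) = c \<odot>\<^bsub>W\<^esub> \<psi> v"
    "\<And>g v. g \<in> carrier G \<Longrightarrow> v \<in> carrier V \<Longrightarrow> \<psi> (act V g v) = act W g (\<psi> v)"
    using assms(2) unfolding rep_isomorphic_def by blast
  have in_V: "\<phi> v \<in> carrier V" if "v \<in> carrier U" for v
    using \<phi>(1) that by (auto simp: bij_betw_def)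
  have "bij_betw (\<psi> \<circ> \<phi>) (carrier U) (carrier W)"
    by (rule bij_betw_trans[OF \<phi>(1) \<psi>(1)])
  then show ?thesis
    using assms unfolding rep_isomorphic_def
    by (intro conjI exI[of _ "\<psi> \<circ> \<phi>"]) (auto simp: \<phi>(2-) \<psi>(2-) in_V)
qed

lemma lin_span_submodule:
  assumes "Module.module complex_ring V" "S \<subseteq> carrier V"
  shows "submodule (lin_span V S) complex_ring V"
proof -
  interpret Module.module complex_ring V by (rule assms)
  have "carrier V \<in> {U. submodule U complex_ring V \<and> S \<subseteq> U}"
    using carrier_is_submodule assms by auto
  then show ?thesis
    by (intro complex_submoduleI[OF assms(1)])
      (auto simp: lin_span_def submoduleD(2) intro: submoduleD(3,4))
qed

lemma lin_span_superset: "S \<subseteq> lin_span V S"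
  by (auto simp: lin_span_def)

lemma lin_span_least: "submodule U complex_ring V \<Longrightarrow> S \<subseteq> U \<Longrightarrow> lin_span V S \<subseteq> U"
  by (auto simp: lin_span_def)

lemma lin_span_mono: "S \<subseteq> S' \<Longrightarrow> lin_span V S \<subseteq> lin_span V S'"
  by (auto simp: lin_span_def)

lemma representation_subrep:
  assumes V: "representation G V" and U: "submodule U complex_ring V"
    and "\<And>g u. g \<in> carrier G \<Longrightarrow> u \<in> U \<Longrightarrow> act V g u \<in> U"
  shows "representation G (subrep V U)"
proof -
  have "Module.module complex_ring (subrep V U)"
    unfolding subrep_def using V
    by (intro submodule.submodule_is_module[OF U]) (simp add: representation_def)
  then show ?thesis
    using assms(3) V submoduleD(1)[OF U]
    by (auto simp: representation_def subrep_def subset_iff)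
qed

text \<open>A bigraded piece is a quotient inside a quotient, so this situation is met twice: for
  \<open>F_{k-1}\<close> in \<open>F_k\<close>, and for \<open>P_{k,l+1}\<close> in
  \<open>P_{k,l}\<close>.\<close>

locale stable_submodule =
  fixes G :: "'g monoid" and V :: "('g, 'v) rep" and U :: "'v set"
  assumes rep: "representation G V" and sub: "submodule U complex_ring V"
    and stable: "\<And>g u. g \<in> carrier G \<Longrightarrow> u \<in> U \<Longrightarrow> act V g u \<in> U"
begin

sublocale G: Group.group G using rep by (simp add: representation_def)
sublocale M: Module.module complex_ring V using rep by (simp add: representation_def)

sublocale abelian_subgroup U V
  by (intro abelian_subgroupI3 additive_subgroup.intro submodule.axioms(1)[OF sub]) unfold_locales

lemma act_add: "g \<in> carrier G \<Longrightarrow> v \<in> carrier V \<Longrightarrow> w \<in> carrier V \<Longrightarrow>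
  act V g (v \<oplus>\<^bsub>V\<^esub> w) = act V g v \<oplus>\<^bsub>V\<^esub> act V g w"
  and act_smult: "g \<in> carrier G \<Longrightarrow> v \<in> carrier V \<Longrightarrow> act V g (a \<odot>\<^bsub>V\<^esub> v) = a \<odot>\<^bsub>V\<^esub> act V g v"
  and act_closed: "g \<in> carrier G \<Longrightarrow> v \<in> carrier V \<Longrightarrow> act V g v \<in> carrier V"
  and act_one: "v \<in> carrier V \<Longrightarrow> act V \<one>\<^bsub>G\<^esub> v = v"
  and act_mult: "g \<in> carrier G \<Longrightarrow> h \<in> carrier G \<Longrightarrow> v \<in> carrier V \<Longrightarrow>
    act V (g \<otimes>\<^bsub>G\<^esub> h) v = act V g (act V h v)"
  using rep by (auto simp: representation_def)

lemma rcoset_eq: "U +>\<^bsub>V\<^esub> x = {u \<oplus>\<^bsub>V\<^esub> x | u. u \<in> U}"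
  by (auto simp: a_r_coset_def')

lemma sub_closed: "u \<in> U \<Longrightarrow> u \<in> carrier V"
  using submoduleD(1)[OF sub] by auto

lemma coset_eqI:
  assumes "u \<in> U" "x \<in> carrier V" "y = u \<oplus>\<^bsub>V\<^esub> x"
  shows "U +>\<^bsub>V\<^esub> y = U +>\<^bsub>V\<^esub> x"
  using M.a_repr_independence[of y U x] assms a_subgroup
  by (auto simp: rcoset_eq)

lemma quot_carrier: "carrier (quot_rep V U) = (\<lambda>x. U +>\<^bsub>V\<^esub> x) ` carrier V"
  by (auto simp: quot_rep_def A_RCOSETS_def')

lemma quot_zero: "\<zero>\<^bsub>quot_rep V U\<^esub> = U +>\<^bsub>V\<^esub> \<zero>\<^bsub>V\<^esub>"
  using sub_closed by (force simp: quot_rep_def rcoset_eq)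

lemma quot_add: "x \<in> carrier V \<Longrightarrow> y \<in> carrier V \<Longrightarrow>
  (U +>\<^bsub>V\<^esub> x) \<oplus>\<^bsub>quot_rep V U\<^esub> (U +>\<^bsub>V\<^esub> y) = U +>\<^bsub>V\<^esub> (x \<oplus>\<^bsub>V\<^esub> y)"
  by (simp add: quot_rep_def a_rcos_sum)

lemma quot_smult:
  assumes "x \<in> carrier V"
  shows "a \<odot>\<^bsub>quot_rep V U\<^esub> (U +>\<^bsub>V\<^esub> x) = U +>\<^bsub>V\<^esub> (a \<odot>\<^bsub>V\<^esub> x)"
proof -
  have "U +>\<^bsub>V\<^esub> (a \<odot>\<^bsub>V\<^esub> y) = U +>\<^bsub>V\<^esub> (a \<odot>\<^bsub>V\<^esub> x)" if y: "y \<in> U +>\<^bsub>V\<^esub> x" for y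
  proof -
    obtain u where u: "u \<in> U" "y = u \<oplus>\<^bsub>V\<^esub> x"
      using y by (auto simp: rcoset_eq)
    have "a \<odot>\<^bsub>V\<^esub> y = a \<odot>\<^bsub>V\<^esub> u \<oplus>\<^bsub>V\<^esub> a \<odot>\<^bsub>V\<^esub> x"
      unfolding u(2) by (rule M.smult_r_distr) (simp_all add: sub_closed u(1) assms)
    moreover have "a \<odot>\<^bsub>V\<^esub> x \<in> carrier V"
      by (rule M.smult_closed) (simp_all add: assms)
    ultimately show ?thesis
      by (intro coset_eqI[OF submoduleD(4)[OF sub u(1)]])
  qed
  moreover have "x \<in> U +>\<^bsub>V\<^esub> x"
    by (rule a_rcos_self[OF assms])
  ultimately have "(\<Union>y\<in>U +>\<^bsub>V\<^esub> x. U +>\<^bsub>V\<^esub> (a \<odot>\<^bsub>V\<^esub> y)) = U +>\<^bsub>V\<^esub> (a \<odot>\<^bsub>V\<^esub> x)"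
    by blast
  then show ?thesis
    by (simp add: quot_rep_def)
qed

lemma quot_act:
  assumes "g \<in> carrier G" "x \<in> carrier V"
  shows "act (quot_rep V U) g (U +>\<^bsub>V\<^esub> x) = U +>\<^bsub>V\<^esub> (act V g x)"
proof -
  have *: "act V g ` (U +>\<^bsub>V\<^esub> x) = {u \<oplus>\<^bsub>V\<^esub> act V g x | u. u \<in> act V g ` U}"
    using assms sub_closed by (force simp: rcoset_eq act_add)
  have "act V g ` U = U"
  proof
    \<comment> \<open>Equality and not just inclusion makes the image of a coset a coset; the
      inverse of \<open>g\<close> preserves \<open>U\<close> as well.\<close>
    show "U \<subseteq> act V g ` U"
    proof
      fix u assume "u \<in> U"
      then have "u = act V g (act V (inv\<^bsub>G\<^esub> g) u)"
        using assms sub_closed by (simp add: act_one flip: act_mult)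
      then show "u \<in> act V g ` U"
        using stable[of "inv\<^bsub>G\<^esub> g" u] \<open>u \<in> U\<close> assms by auto
    qed
  qed (use stable assms in auto)
  then show ?thesis
    using * by (simp add: quot_rep_def rcoset_eq)
qed

lemma quot_representation: "representation G (quot_rep V U)"
proof (rule representationI)
  show "Module.module complex_ring (quot_rep V U)"
    by (rule complex_moduleI)
      (auto simp: quot_carrier quot_zero quot_add quot_smult M.a_ac
        M.smult_l_distr[simplified] M.smult_r_distr[simplified] M.smult_assoc1[simplified]
        M.smult_one[simplified] M.smult_l_null[simplified])
qed (auto simp: quot_carrier quot_zero quot_add quot_smult quot_act act_closed act_add act_smult
    act_one act_mult)

text \<open>The induced map reads off an arbitrary representative. By \<open>ker\<close> the
  representatives of one coset have the same image, and different cosets have different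
  images.\<close>

lemma quot_iso:
  assumes W: "representation G W"
    and \<phi>: "\<phi> ` carrier V = carrier W" "\<phi> \<zero>\<^bsub>V\<^esub> = \<zero>\<^bsub>W\<^esub>"
    and a: "\<And>v w. v \<in> carrier V \<Longrightarrow> w \<in> carrier V \<Longrightarrow> \<phi> (v \<oplus>\<^bsub>V\<^esub> w) = \<phi> v \<oplus>\<^bsub>W\<^esub> \<phi> w"
    and s: "\<And>c v. v \<in> carrier V \<Longrightarrow> \<phi> (c \<odot>\<^bsub>V\<^esub> v) = c \<odot>\<^bsub>W\<^esub> \<phi> v"
    and g: "\<And>g v. g \<in> carrier G \<Longrightarrow> v \<in> carrier V \<Longrightarrow> \<phi> (act V g v) = act W g (\<phi> v)"
    and ker: "\<And>v. v \<in> carrier V \<Longrightarrow> \<phi> v = \<zero>\<^bsub>W\<^esub> \<longleftrightarrow> v \<in> U"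
  shows "rep_isomorphic G (quot_rep V U) W"
proof -
  interpret W: Module.module complex_ring W using W by (simp add: representation_def)
  have inW: "\<phi> v \<in> carrier W" if "v \<in> carrier V" for v using \<phi> that by auto
  define \<psi> where "\<psi> X = \<phi> (SOME x. x \<in> X)" for X
  have \<psi>: "\<psi> (U +>\<^bsub>V\<^esub> x) = \<phi> x" if x: "x \<in> carrier V" for x
  proof -
    have "(SOME y. y \<in> U +>\<^bsub>V\<^esub> x) \<in> U +>\<^bsub>V\<^esub> x"
      using a_rcos_self[OF x] by (rule someI)
    then obtain u where "u \<in> U" "(SOME y. y \<in> U +>\<^bsub>V\<^esub> x) = u \<oplus>\<^bsub>V\<^esub> x"
      by (auto simp: rcoset_eq)
    then show ?thesis
      using x ker sub_closed inW by (auto simp: \<psi>_def a)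
  qed
  have inj: "U +>\<^bsub>V\<^esub> x = U +>\<^bsub>V\<^esub> y" if "x \<in> carrier V" "y \<in> carrier V" "\<phi> x = \<phi> y" for x y
  proof -
    have "\<phi> (x \<oplus>\<^bsub>V\<^esub> (-1) \<odot>\<^bsub>V\<^esub> y) = 1 \<odot>\<^bsub>W\<^esub> \<phi> y \<oplus>\<^bsub>W\<^esub> (-1) \<odot>\<^bsub>W\<^esub> \<phi> y"
      using that M.smult_closed inW W.smult_one[simplified] by (simp add: a s)
    also have "\<dots> = \<zero>\<^bsub>W\<^esub>"
      using W.smult_l_distr[of 1 "-1" "\<phi> y"] inW that W.smult_l_null[simplified] by simp
    finally have u: "x \<oplus>\<^bsub>V\<^esub> (-1) \<odot>\<^bsub>V\<^esub> y \<in> U"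
      using that M.smult_closed by (subst ker[symmetric]) auto
    have "(-1) \<odot>\<^bsub>V\<^esub> y \<oplus>\<^bsub>V\<^esub> y = \<zero>\<^bsub>V\<^esub>"
      using M.smult_l_distr[of "-1" 1 y] that M.smult_l_null[simplified] M.smult_one[simplified]
      by simp
    then have "x = x \<oplus>\<^bsub>V\<^esub> (-1) \<odot>\<^bsub>V\<^esub> y \<oplus>\<^bsub>V\<^esub> y"
      using that M.smult_closed by (simp add: M.a_assoc)
    then show ?thesis
      using coset_eqI u that by blast
  qed
  show ?thesis
  proof (rule rep_transport[OF W, of \<psi>])
    have "inj_on \<psi> (carrier (quot_rep V U))"
    proof (rule inj_onI)
      fix X Y
      assume "X \<in> carrier (quot_rep V U)" "Y \<in> carrier (quot_rep V U)" and eq: "\<psi> X = \<psi> Y"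
      then obtain x y where "x \<in> carrier V" "y \<in> carrier V" "X = U +>\<^bsub>V\<^esub> x" "Y = U +>\<^bsub>V\<^esub> y"
        unfolding quot_carrier by blast
      then show "X = Y"
        using inj[of x y] eq by (simp add: \<psi>)
    qed
    moreover have "\<psi> ` carrier (quot_rep V U) = carrier W"
      unfolding quot_carrier \<phi>(1)[symmetric] image_image by (rule image_cong) (simp_all add: \<psi>)
    ultimately show "bij_betw \<psi> (carrier (quot_rep V U)) (carrier W)"
      by (simp add: bij_betw_def)
  qed (auto simp: quot_carrier quot_zero quot_add quot_smult quot_act act_closed \<psi> \<phi> a s g)
qed

end

section \<open>Left ideals of the group algebra\<close>

text \<open>Gram-Schmidt by induction, without independence: the induction hypothesis projects both
  \<open>v k\<close> and \<open>y\<close> off \<open>S\<close>, and \<open>l\<close> then removes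
  from the residue of \<open>y\<close> its component along the residue \<open>w\<close> of
  \<open>v k\<close>.\<close>

lemma orthogonal_projection_exists:
  fixes v :: "'i \<Rightarrow> 'x \<Rightarrow> complex"
  assumes "finite S" "finite X"
  shows "\<exists>b. \<forall>i\<in>S. (\<Sum>x\<in>X. (y x - (\<Sum>j\<in>S. b j * v j x)) * cnj (v i x)) = 0"
  using assms(1)
proof (induction S arbitrary: y rule: finite_induct)
  case empty
  then show ?case by simp
next
  case (insert k S)
  obtain c where c: "(\<Sum>x\<in>X. (v k x - (\<Sum>j\<in>S. c j * v j x)) * cnj (v i x)) = 0" if "i \<in> S" for i
    using insert.IH[of "v k"] by blast
  obtain d where d: "(\<Sum>x\<in>X. (y x - (\<Sum>j\<in>S. d j * v j x)) * cnj (v i x)) = 0" if "i \<in> S" for i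
    using insert.IH[of y] by blast
  define w where "w x = v k x - (\<Sum>j\<in>S. c j * v j x)" for x
  define e where "e x = y x - (\<Sum>j\<in>S. d j * v j x)" for x
  define N where "N = (\<Sum>x\<in>X. w x * cnj (w x))"
  \<comment> \<open>If \<open>N = 0\<close>, the quotient is 0 by convention; \<open>w\<close> then
    vanishes on \<open>X\<close> and no correction is called for.\<close>
  define l where "l = (\<Sum>x\<in>X. e x * cnj (w x)) / N"
  define b where "b j = (if j = k then l else d j - l * c j)" for j
  have res: "y x - (\<Sum>j\<in>insert k S. b j * v j x) = e x - l * w x" for x
  proof -
    have "(\<Sum>j\<in>S. b j * v j x) = (\<Sum>j\<in>S. d j * v j x) - l * (\<Sum>j\<in>S. c j * v j x)"
      using insert.hyps unfolding b_def sum_distrib_left sum_subtractf[symmetric]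
      by (intro sum.cong) (auto simp: algebra_simps)
    then show ?thesis
      using insert.hyps by (simp add: b_def e_def w_def algebra_simps)
  qed
  have orth: "(\<Sum>x\<in>X. (e x - l * w x) * cnj (v i x)) = 0" if "i \<in> S" for i
  proof -
    have "(\<Sum>x\<in>X. (e x - l * w x) * cnj (v i x)) =
      (\<Sum>x\<in>X. e x * cnj (v i x)) - l * (\<Sum>x\<in>X. w x * cnj (v i x))"
      by (simp add: algebra_simps sum_subtractf sum_distrib_left)
    then show ?thesis using c[OF that] d[OF that] by (simp add: e_def w_def)
  qed
  have "(\<Sum>x\<in>X. (e x - l * w x) * cnj (v k x)) = 0"
  proof -
    have "(\<Sum>x\<in>X. (e x - l * w x) * cnj (v k x)) =
      (\<Sum>x\<in>X. (e x - l * w x) * cnj (w x)) +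
      (\<Sum>x\<in>X. \<Sum>j\<in>S. cnj (c j) * ((e x - l * w x) * cnj (v j x)))"
    proof -
      have "t * cnj (v k x) = t * cnj (w x) + (\<Sum>j\<in>S. cnj (c j) * (t * cnj (v j x)))" for t x
        by (simp add: w_def algebra_simps sum_distrib_left)
      then show ?thesis by (simp add: sum.distrib)
    qed
    also have "(\<Sum>x\<in>X. \<Sum>j\<in>S. cnj (c j) * ((e x - l * w x) * cnj (v j x))) = 0"
      by (subst sum.swap) (simp add: orth flip: sum_distrib_left)
    also have "(\<Sum>x\<in>X. (e x - l * w x) * cnj (w x)) = (\<Sum>x\<in>X. e x * cnj (w x)) - l * N"
      by (simp add: N_def algebra_simps sum_subtractf sum_distrib_left)
    also have "\<dots> = 0"
    proof (cases "N = 0")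
      case True
      have "N = of_real (\<Sum>x\<in>X. (cmod (w x))\<^sup>2)"
        by (simp add: N_def complex_norm_square[symmetric] del: of_real_power)
      then have "(\<Sum>x\<in>X. (cmod (w x))\<^sup>2) = 0" unfolding True by (metis of_real_eq_0_iff)
      then have "w x = 0" if "x \<in> X" for x
        using assms(2) that by (simp add: sum_nonneg_eq_0_iff)
      then show ?thesis using True by simp
    qed (simp add: l_def)
    finally show ?thesis by simp
  qed
  then show ?case
    using orth by (intro exI[of _ b] ballI) (auto simp: res)
qed

lemma complex_units:
  "carrier (units_of complex_ring) = {x. x \<noteq> 0}" "x \<otimes>\<^bsub>units_of complex_ring\<^esub> y = x * y"
proof -
  have "(\<exists>y. y * x = 1 \<and> x * y = 1) \<longleftrightarrow> x \<noteq> 0" for x :: complex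
    by (metis left_inverse mult_zero_left right_inverse zero_neq_one)
  then show "carrier (units_of complex_ring) = {x. x \<noteq> 0}" "x \<otimes>\<^bsub>units_of complex_ring\<^esub> y = x * y"
    by (auto simp: units_of_def Units_def)
qed

section \<open>Convolution in the group algebra of a finite group\<close>

locale finite_group = Group.group G for G :: "'a monoid" (structure) +
  assumes fin: "finite (carrier G)"
begin

abbreviation conv (infixl \<open>\<star>\<close> 70) where "a \<star> b \<equiv> a \<otimes>\<^bsub>group_algebra G\<^esub> b"

definition GA :: "('a \<Rightarrow> complex) set" where
  "GA = {a. \<forall>g. g \<notin> carrier G \<longrightarrow> a g = 0}"

abbreviation dl :: "'a \<Rightarrow> 'a \<Rightarrow> complex" where "dl g \<equiv> (\<lambda>h. of_bool (h = g))"

text \<open>The antipode. It reverses products and so exchanges right and left ideals.\<close>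

definition antip :: "('a \<Rightarrow> complex) \<Rightarrow> 'a \<Rightarrow> complex" where
  "antip a = (\<lambda>g. if g \<in> carrier G then a (inv g) else 0)"

lemma inv_mult_cancel: "x \<in> carrier G \<Longrightarrow> y \<in> carrier G \<Longrightarrow> inv x \<otimes> (x \<otimes> y) = y"
  and mult_inv_cancel: "x \<in> carrier G \<Longrightarrow> y \<in> carrier G \<Longrightarrow> x \<otimes> (inv x \<otimes> y) = y"
  by (simp_all add: m_assoc[symmetric])

lemma bij_inv: "bij_betw (\<lambda>x. inv x) (carrier G) (carrier G)"
  by (rule bij_betw_byWitness[of _ "\<lambda>x. inv x"]) auto

lemma bij_lmult: "x \<in> carrier G \<Longrightarrow> bij_betw (\<lambda>y. x \<otimes> y) (carrier G) (carrier G)"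
  by (rule bij_betw_byWitness[of _ "\<lambda>y. inv x \<otimes> y"])
    (auto simp: inv_mult_cancel mult_inv_cancel)

lemma bij_rmult: "x \<in> carrier G \<Longrightarrow> bij_betw (\<lambda>y. y \<otimes> x) (carrier G) (carrier G)"
  by (rule bij_betw_byWitness[of _ "\<lambda>y. y \<otimes> inv x"]) (auto simp: m_assoc)

lemma conv_apply:
  assumes g: "g \<in> carrier G"
  shows "(a \<star> b) g = (\<Sum>u\<in>carrier G. a u * b (inv u \<otimes> g))"
proof -
  have "{(u, v) \<in> carrier G \<times> carrier G. u \<otimes> v = g} = (\<lambda>u. (u, inv u \<otimes> g)) ` carrier G"
    using g by (auto simp: inv_mult_cancel mult_inv_cancel)
  then show ?thesis
    by (simp add: group_algebra_def sum.reindex inj_on_def)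
qed

lemma conv_out: "g \<notin> carrier G \<Longrightarrow> (a \<star> b) g = 0"
proof -
  assume "g \<notin> carrier G"
  then have "{(u, v) \<in> carrier G \<times> carrier G. u \<otimes> v = g} = {}" by auto
  then show ?thesis by (simp only: group_algebra_def monoid.simps sum.empty)
qed

lemma conv_in_GA [simp]: "a \<star> b \<in> GA"
  by (simp add: GA_def conv_out)

lemma GA_out: "a \<in> GA \<Longrightarrow> g \<notin> carrier G \<Longrightarrow> a g = 0"
  by (simp add: GA_def)

lemma GA_eqI:
  assumes "a \<in> GA" "b \<in> GA" "\<And>g. g \<in> carrier G \<Longrightarrow> a g = b g"
  shows "a = b"
proof
  fix g show "a g = b g" using assms by (cases "g \<in> carrier G") (auto simp: GA_out)
qed

lemma conv_apply':
  assumes g: "g \<in> carrier G"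
  shows "(a \<star> b) g = (\<Sum>v\<in>carrier G. a (g \<otimes> inv v) * b v)"
proof -
  have "(\<Sum>v\<in>carrier G. a (g \<otimes> inv v) * b v) =
    (\<Sum>u\<in>carrier G. a (g \<otimes> inv (inv u \<otimes> g)) * b (inv u \<otimes> g))"
    using bij_betw_trans[OF bij_inv bij_rmult[OF g]]
    by (intro sum.reindex_bij_betw[symmetric]) (simp add: comp_def)
  also have "\<dots> = (\<Sum>u\<in>carrier G. a u * b (inv u \<otimes> g))"
    using g by (intro sum.cong refl) (simp add: inv_mult_group mult_inv_cancel)
  finally show ?thesis using g by (simp add: conv_apply)
qed

lemma conv_cong:
  assumes "\<And>g. g \<in> carrier G \<Longrightarrow> a g = a' g" "\<And>g. g \<in> carrier G \<Longrightarrow> b g = b' g"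
  shows "a \<star> b = a' \<star> b'"
proof
  fix g show "(a \<star> b) g = (a' \<star> b') g"
    by (cases "g \<in> carrier G") (auto simp: conv_apply conv_out assms)
qed

lemma conv_assoc: "(a \<star> b) \<star> c = a \<star> (b \<star> c)"
proof
  fix g show "((a \<star> b) \<star> c) g = (a \<star> (b \<star> c)) g"
  proof (cases "g \<in> carrier G")
    case g: True
    have "((a \<star> b) \<star> c) g =
      (\<Sum>w\<in>carrier G. \<Sum>u\<in>carrier G. a u * b (inv u \<otimes> w) * c (inv w \<otimes> g))"
      by (simp add: conv_apply g sum_distrib_right)
    also have "\<dots> = (\<Sum>u\<in>carrier G. \<Sum>w\<in>carrier G. a u * b (inv u \<otimes> w) * c (inv w \<otimes> g))"
      by (rule sum.swap)
    also have "\<dots> = (\<Sum>u\<in>carrier G. \<Sum>v\<in>carrier G. a u * b v * c (inv v \<otimes> (inv u \<otimes> g)))"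
    proof (rule sum.cong[OF refl])
      fix u assume u: "u \<in> carrier G"
      have "(\<Sum>w\<in>carrier G. a u * b (inv u \<otimes> w) * c (inv w \<otimes> g)) =
        (\<Sum>v\<in>carrier G. a u * b (inv u \<otimes> (u \<otimes> v)) * c (inv (u \<otimes> v) \<otimes> g))"
        by (rule sum.reindex_bij_betw[OF bij_lmult[OF u], symmetric])
      also have "\<dots> = (\<Sum>v\<in>carrier G. a u * b v * c (inv v \<otimes> (inv u \<otimes> g)))"
        using u g by (intro sum.cong refl) (simp add: inv_mult_cancel inv_mult_group m_assoc)
      finally show "(\<Sum>w\<in>carrier G. a u * b (inv u \<otimes> w) * c (inv w \<otimes> g)) =
        (\<Sum>v\<in>carrier G. a u * b v * c (inv v \<otimes> (inv u \<otimes> g)))" .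
    qed
    also have "\<dots> = (a \<star> (b \<star> c)) g"
      by (simp add: conv_apply g sum_distrib_left mult.assoc)
    finally show ?thesis .
  qed (simp add: conv_out)
qed

lemma conv_add_left: "(\<lambda>g. a g + b g) \<star> c = (\<lambda>g. (a \<star> c) g + (b \<star> c) g)"
  and conv_diff_left: "(\<lambda>g. a g - b g) \<star> c = (\<lambda>g. (a \<star> c) g - (b \<star> c) g)"
  and conv_diff_right: "c \<star> (\<lambda>g. a g - b g) = (\<lambda>g. (c \<star> a) g - (c \<star> b) g)"
  and conv_smult_left: "(\<lambda>g. k * a g) \<star> c = (\<lambda>g. k * (a \<star> c) g)"
  and conv_zero_left [simp]: "(\<lambda>g. 0) \<star> c = (\<lambda>g. 0)"
  by (rule ext; case_tac "g \<in> carrier G"; simp add: conv_apply conv_out algebra_simps sum.distrib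
      sum_subtractf sum_distrib_left)+

lemma conv_sum_left: "(\<lambda>g. \<Sum>i\<in>I. f i g) \<star> c = (\<lambda>g. \<Sum>i\<in>I. (f i \<star> c) g)"
proof
  fix g show "((\<lambda>g. \<Sum>i\<in>I. f i g) \<star> c) g = (\<Sum>i\<in>I. (f i \<star> c) g)"
    by (cases "g \<in> carrier G") (simp_all add: conv_apply conv_out sum_distrib_right sum.swap[of _ I])
qed

lemma dl_in_GA: "g \<in> carrier G \<Longrightarrow> dl g \<in> GA"
  by (auto simp: GA_def)

lemma dl_conv: "g \<in> carrier G \<Longrightarrow> h \<in> carrier G \<Longrightarrow> (dl g \<star> a) h = a (inv g \<otimes> h)"
  by (simp add: conv_apply fin)

lemma conv_dl: "g \<in> carrier G \<Longrightarrow> h \<in> carrier G \<Longrightarrow> (a \<star> dl g) h = a (h \<otimes> inv g)"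
  by (simp add: conv_apply' fin)

lemma conv_expand: "a \<star> r = (\<lambda>g. \<Sum>u\<in>carrier G. a u * (dl u \<star> r) g)"
proof
  fix g show "(a \<star> r) g = (\<Sum>u\<in>carrier G. a u * (dl u \<star> r) g)"
    by (cases "g \<in> carrier G") (simp_all add: conv_apply[of g a] dl_conv conv_out)
qed

lemma one_conv: "a \<in> GA \<Longrightarrow> dl \<one> \<star> a = a"
  by (rule GA_eqI) (simp_all add: dl_conv)

lemma conv_one: "a \<in> GA \<Longrightarrow> a \<star> dl \<one> = a"
  by (rule GA_eqI) (simp_all add: conv_dl)

text \<open>Up to the factor \<open>card (carrier G)\<close>, the value at the identity is the trace
  on the regular representation.\<close>

lemma conv_trace: "(a \<star> b) \<one> = (b \<star> a) \<one>"
  by (simp add: conv_apply[of \<one> a] conv_apply'[of \<one> b] mult.commute)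

lemma antip_in_GA: "antip a \<in> GA"
  by (simp add: antip_def GA_def)

lemma antip_antip: "a \<in> GA \<Longrightarrow> antip (antip a) = a"
  by (auto simp: antip_def GA_def)

lemma antip_conv: "antip (a \<star> b) = antip b \<star> antip a"
proof
  fix g show "antip (a \<star> b) g = (antip b \<star> antip a) g"
  proof (cases "g \<in> carrier G")
    case g: True
    have "(antip b \<star> antip a) g = (\<Sum>u\<in>carrier G. b (inv u) * a (inv (inv u \<otimes> g)))"
      by (simp add: conv_apply g antip_def)
    also have "\<dots> = (\<Sum>u\<in>carrier G. b u * a (inv (u \<otimes> g)))"
      by (rule sum.reindex_bij_betw[OF bij_inv])
    also have "\<dots> = (a \<star> b) (inv g)"
      using g by (simp add: conv_apply' inv_mult_group mult.commute)
    finally show ?thesis by (simp add: antip_def g)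
  qed (simp add: antip_def conv_out)
qed

text \<open>Kaplansky's argument: \<open>f\<close> is equivalent to the self-adjoint idempotent \<open>p\<close> that projects
  orthogonally onto \<open>f \<complex>[G]\<close>, and the trace of the latter is its squared norm.\<close>

lemma idempotent_trace_zero:
  assumes f: "f \<in> GA" "f \<star> f = f" "f \<one> = 0"
  shows "f = (\<lambda>_. 0)"
proof -
  obtain b where b: "(\<Sum>x\<in>carrier G. (dl \<one> x - (\<Sum>j\<in>carrier G. b j * (f \<star> dl j) x)) *
      cnj ((f \<star> dl g) x)) = 0" if "g \<in> carrier G" for g
    using orthogonal_projection_exists[OF fin fin, of "dl \<one>" "\<lambda>j. f \<star> dl j"] by blast
  define p where "p = f \<star> b"
  have p: "p x = (\<Sum>j\<in>carrier G. b j * f (x \<otimes> inv j))" if "x \<in> carrier G" for x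
    unfolding p_def conv_apply'[OF that] by (simp add: mult.commute)
  \<comment> \<open>Orthogonality of \<open>1 - p\<close> to all translates of \<open>f\<close> says
    \<open>f = p' f\<close>, where \<open>p'\<close> is the adjoint of \<open>p\<close>, given by
    \<open>p' x = cnj (p (inv x))\<close>.\<close>
  have f_eq: "f h = (\<Sum>x\<in>carrier G. cnj (p x) * f (x \<otimes> h))" if h: "h \<in> carrier G" for h
  proof -
    have "0 = (\<Sum>x\<in>carrier G. (dl \<one> x - p x) * cnj (f (x \<otimes> h)))"
      using b[of "inv h"] h by (simp add: conv_dl p cong: sum.cong)
    also have "\<dots> = cnj (f h) - (\<Sum>x\<in>carrier G. p x * cnj (f (x \<otimes> h)))"
      using fin h by (simp add: algebra_simps sum_subtractf)
    finally have "cnj (f h) = (\<Sum>x\<in>carrier G. p x * cnj (f (x \<otimes> h)))" by simp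
    then have "cnj (cnj (f h)) = cnj (\<Sum>x\<in>carrier G. p x * cnj (f (x \<otimes> h)))" by simp
    then show ?thesis by simp
  qed
  \<comment> \<open>Right multiplication by \<open>b\<close> turns \<open>f = p' f\<close> into
    \<open>p = p' p\<close>. The right side is self-adjoint, so \<open>p = p'\<close>, which is
    \<open>p_inv\<close>.\<close>
  have p_eq: "p h = (\<Sum>x\<in>carrier G. cnj (p x) * p (x \<otimes> h))" if h: "h \<in> carrier G" for h
  proof -
    have "p h = (\<Sum>j\<in>carrier G. \<Sum>x\<in>carrier G. b j * (cnj (p x) * f (x \<otimes> (h \<otimes> inv j))))"
      unfolding p[OF h] sum_distrib_left[symmetric] using h by (intro sum.cong) (auto simp: f_eq[of "h \<otimes> inv _"])
    also have "\<dots> = (\<Sum>x\<in>carrier G. cnj (p x) * p (x \<otimes> h))"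
      using h by (subst sum.swap) (auto simp: p m_assoc sum_distrib_left algebra_simps intro!: sum.cong)
    finally show ?thesis .
  qed
  have p_inv: "p (inv h) = cnj (p h)" if h: "h \<in> carrier G" for h
  proof -
    have "p (inv h) = (\<Sum>x\<in>carrier G. cnj (p x) * p (x \<otimes> inv h))"
      by (rule p_eq) (simp add: h)
    also have "\<dots> = (\<Sum>y\<in>carrier G. cnj (p (y \<otimes> h)) * p (y \<otimes> h \<otimes> inv h))"
      by (rule sum.reindex_bij_betw[OF bij_rmult[OF h], symmetric])
    also have "\<dots> = cnj (\<Sum>y\<in>carrier G. cnj (p y) * p (y \<otimes> h))"
      using h by (auto simp: m_assoc mult.commute intro!: sum.cong)
    finally show ?thesis using p_eq[OF h] by simp
  qed
  have pf: "(p \<star> f) h = f h" if h: "h \<in> carrier G" for h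
  proof -
    have "(p \<star> f) h = (\<Sum>u\<in>carrier G. p (inv u) * f (inv (inv u) \<otimes> h))"
      unfolding conv_apply[OF h] by (rule sum.reindex_bij_betw[OF bij_inv, symmetric])
    then show ?thesis using f_eq[OF h] by (simp add: p_inv)
  qed
  have fp: "f \<star> p = p"
    by (simp add: p_def f(2) flip: conv_assoc)
  \<comment> \<open>From \<open>p f = f\<close> and \<open>f p = p\<close> the two idempotents have
    equal traces.\<close>
  have "p \<one> = 0"
    using pf[of \<one>] conv_trace[of p f] f(3) fp by simp
  moreover have "p \<one> = of_real (\<Sum>x\<in>carrier G. (cmod (p x))\<^sup>2)"
    using p_eq[of \<one>]
    by (simp add: mult.commute complex_norm_square[symmetric] del: of_real_power cong: sum.cong)
  ultimately have "(\<Sum>x\<in>carrier G. (cmod (p x))\<^sup>2) = 0" by (metis of_real_eq_0_iff)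
  then have "p x = 0" if "x \<in> carrier G" for x
    using fin that by (simp add: sum_nonneg_eq_0_iff)
  then have "(p \<star> f) h = 0" for h
    by (cases "h \<in> carrier G") (simp_all add: conv_apply conv_out)
  then show ?thesis
    using pf GA_out[OF f(1)] by metis
qed

section \<open>Left ideals as representations, compared with right ideals and induced
  representations\<close>

definition left_ideal_rep :: "('a \<Rightarrow> complex) \<Rightarrow> ('a, 'a \<Rightarrow> complex) rep" where
  "left_ideal_rep r =
     \<lparr>carrier = {b \<star> r | b. b \<in> GA}, mult = undefined, one = undefined,
      zero = (\<lambda>_. 0), add = (\<lambda>a b g. a g + b g), smult = (\<lambda>c a g. c * a g),
      act = (\<lambda>g a. dl g \<star> a)\<rparr>"

lemma GA_add: "a \<in> GA \<Longrightarrow> b \<in> GA \<Longrightarrow> (\<lambda>g. a g + b g) \<in> GA"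
  and GA_smult: "a \<in> GA \<Longrightarrow> (\<lambda>g. c * a g) \<in> GA"
  and GA_zero: "(\<lambda>g. 0) \<in> GA"
  by (auto simp: GA_def)

lemma conv_add_right: "c \<star> (\<lambda>g. a g + b g) = (\<lambda>g. (c \<star> a) g + (c \<star> b) g)"
  and conv_smult_right: "c \<star> (\<lambda>g. k * a g) = (\<lambda>g. k * (c \<star> a) g)"
  by (rule ext; case_tac "g \<in> carrier G"; simp add: conv_apply conv_out algebra_simps sum.distrib
      sum_distrib_left)+

lemma dl_mult: "g \<in> carrier G \<Longrightarrow> h \<in> carrier G \<Longrightarrow> dl (g \<otimes> h) = dl g \<star> dl h"
  by (rule GA_eqI) (auto simp: dl_in_GA dl_conv inv_mult_cancel mult_inv_cancel)

lemma left_ideal_representation: "representation G (left_ideal_rep r)"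
proof (rule representationI)
  show "Group.group G" by (rule group_axioms)
  show "Module.module complex_ring (left_ideal_rep r)"
  proof (rule complex_moduleI)
    show "\<zero>\<^bsub>left_ideal_rep r\<^esub> \<in> carrier (left_ideal_rep r)"
      using GA_zero by (force simp: left_ideal_rep_def)
    show "x \<oplus>\<^bsub>left_ideal_rep r\<^esub> y \<in> carrier (left_ideal_rep r)"
      if "x \<in> carrier (left_ideal_rep r)" "y \<in> carrier (left_ideal_rep r)" for x y
      using that GA_add by (fastforce simp: left_ideal_rep_def conv_add_left[symmetric])
    show "a \<odot>\<^bsub>left_ideal_rep r\<^esub> x \<in> carrier (left_ideal_rep r)"
      if "x \<in> carrier (left_ideal_rep r)" for a x
      using that GA_smult by (fastforce simp: left_ideal_rep_def conv_smult_left[symmetric])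
  qed (auto simp: left_ideal_rep_def algebra_simps)
  show "act (left_ideal_rep r) g v \<in> carrier (left_ideal_rep r)"
    if "g \<in> carrier G" "v \<in> carrier (left_ideal_rep r)" for g v
    using that conv_in_GA by (auto simp: left_ideal_rep_def conv_assoc[symmetric])
  show "act (left_ideal_rep r) \<one> v = v" if "v \<in> carrier (left_ideal_rep r)" for v
    using that by (auto simp: left_ideal_rep_def one_conv)
qed (auto simp: left_ideal_rep_def conv_add_right conv_smult_right dl_mult conv_assoc)

lemma right_ideal_iso:
  assumes a: "a \<in> GA"
  shows "rep_isomorphic G (right_ideal_rep G a) (left_ideal_rep (antip a))"
proof -
  let ?R = "right_ideal_rep G a"
  have GA: "carrier (group_algebra G) = GA" by (simp add: group_algebra_def GA_def)
  have car: "carrier ?R = {a \<star> b | b. b \<in> GA}"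
    by (simp add: right_ideal_rep_def GA)
  have zero: "\<zero>\<^bsub>?R\<^esub> = (\<lambda>_. 0)" and add: "x \<oplus>\<^bsub>?R\<^esub> y = (\<lambda>g. x g + y g)"
    and smult: "c \<odot>\<^bsub>?R\<^esub> x = (\<lambda>g. c * x g)" and act: "act ?R g x = x \<star> dl (inv g)" for x y c g
    by (simp_all add: right_ideal_rep_def group_algebra_def)
  show ?thesis
  proof (rule rep_transport[OF left_ideal_representation, of antip])
    have "inj_on antip (carrier ?R)"
      by (rule inj_on_inverseI[of _ antip]) (auto simp: car antip_antip)
    moreover have "antip ` carrier ?R = carrier (left_ideal_rep (antip a))"
    proof (intro equalityI subsetI)
      fix y assume "y \<in> antip ` carrier ?R"
      then show "y \<in> carrier (left_ideal_rep (antip a))"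
        using antip_in_GA by (auto simp: car left_ideal_rep_def antip_conv)
    next
      fix y assume "y \<in> carrier (left_ideal_rep (antip a))"
      then obtain b where b: "b \<in> GA" "y = b \<star> antip a" by (auto simp: left_ideal_rep_def)
      then have "y = antip (a \<star> antip b)" by (simp add: antip_conv antip_antip)
      then show "y \<in> antip ` carrier ?R" using antip_in_GA by (auto simp: car)
    qed
    ultimately show "bij_betw antip (carrier ?R) (carrier (left_ideal_rep (antip a)))"
      by (simp add: bij_betw_def)
    have "a \<star> (\<lambda>_. 0) = (\<lambda>_. 0)"
      using conv_smult_right[of a 0 "\<lambda>_. 0"] by simp
    then show "\<zero>\<^bsub>?R\<^esub> \<in> carrier ?R"
      using GA_zero unfolding car zero by force
    show "v \<oplus>\<^bsub>?R\<^esub> w \<in> carrier ?R" if "v \<in> carrier ?R" "w \<in> carrier ?R" for v w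
      using that GA_add by (fastforce simp: car add conv_add_right[symmetric])
    show "c \<odot>\<^bsub>?R\<^esub> v \<in> carrier ?R" if "v \<in> carrier ?R" for c v
      using that GA_smult by (fastforce simp: car smult conv_smult_right[symmetric])
    show "act ?R g v \<in> carrier ?R" if "g \<in> carrier G" "v \<in> carrier ?R" for g v
      using that by (auto simp: car act conv_assoc)
    show "antip (act ?R g v) = act (left_ideal_rep (antip a)) g (antip v)"
      if "g \<in> carrier G" "v \<in> carrier ?R" for g v
    proof -
      have "antip (dl (inv g)) = dl g"
        using that inv_inv by (intro ext) (auto simp: antip_def)
      then show ?thesis by (simp add: act antip_conv left_ideal_rep_def)
    qed
  qed (auto simp: zero add smult left_ideal_rep_def antip_def)
qed

text \<open>The idempotent \<open>e\<close> of the character \<rho> generates the induced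
  representation as a left ideal. From \<open>\<kappa> r = r\<close> and
  \<open>\<kappa> e = \<kappa>\<close>, the element \<open>q = e r \<kappa>\<close> is an idempotent
  with \<open>e q = q = q e\<close>, and \<open>e\<close> and \<open>q\<close> both have the value
  \<open>1 / card H\<close> at the identity. So \<open>e - q\<close> is an idempotent of trace zero,
  hence \<open>e = e r \<kappa>\<close>: right multiplication by \<kappa> inverts right
  multiplication by \<open>r\<close>.\<close>

lemma ind_iso:
  assumes H: "subgroup H G" and \<rho>: "linear_character G H \<rho>"
    and \<kappa>: "\<kappa> \<in> carrier (ind_rep G H \<rho>)" "\<kappa> \<star> r = r"
    and r: "r \<star> r = r" "r \<one> = 1 / of_nat (card H)"
  shows "rep_isomorphic G (ind_rep G H \<rho>) (left_ideal_rep r)"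
proof -
  interpret H: subgroup H G by (rule H)
  have finH: "finite H" using fin H.subset finite_subset by blast
  have cardH: "card H \<noteq> 0" using finH H.one_closed by (auto simp del: H.one_closed)
  have \<rho>_mult: "\<rho> (h \<otimes> k) = \<rho> h * \<rho> k" and \<rho>_nz: "\<rho> h \<noteq> 0" if "h \<in> H" "k \<in> H" for h k
    using \<rho> that by (auto simp: linear_character_def hom_def complex_units Pi_def)
  have \<rho>_one: "\<rho> \<one> = 1" using \<rho>_mult[of \<one> \<one>] \<rho>_nz[of \<one> \<one>] by simp
  have \<rho>_inv: "\<rho> (inv h) = inverse (\<rho> h)" if "h \<in> H" for h
    using \<rho>_mult[of h "inv h"] \<rho>_one that by (auto simp: inverse_unique)
  define e where "e g = (if g \<in> H then inverse (\<rho> g) / of_nat (card H) else 0)" for g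
  have car: "carrier (ind_rep G H \<rho>) = {f \<in> GA. \<forall>g\<in>carrier G. \<forall>h\<in>H. f (g \<otimes> h) = inverse (\<rho> h) * f g}"
    by (auto simp: ind_rep_def GA_def)
  have absorb: "f \<star> e = f" if f: "f \<in> carrier (ind_rep G H \<rho>)" for f
  proof
    fix g show "(f \<star> e) g = f g"
    proof (cases "g \<in> carrier G")
      case g: True
      have "(f \<star> e) g = (\<Sum>v\<in>H. f (g \<otimes> inv v) * e v)"
        unfolding conv_apply'[OF g] by (rule sum.mono_neutral_right) (use fin in \<open>auto simp: e_def\<close>)
      also have "\<dots> = (\<Sum>v\<in>H. f g / of_nat (card H))"
        using f g \<rho>_nz by (intro sum.cong refl) (simp add: car \<rho>_inv e_def)
      finally show ?thesis using cardH by simp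
    qed (use f in \<open>auto simp: conv_out car GA_out\<close>)
  qed
  have e_shift: "e (g \<otimes> h) = inverse (\<rho> h) * e g" if "g \<in> carrier G" "h \<in> H" for g h
  proof (cases "g \<in> H")
    case True
    then show ?thesis using that by (simp add: e_def \<rho>_mult)
  next
    case False
    then have "g \<otimes> h \<notin> H"
      using that H.m_closed[of "g \<otimes> h" "inv h"] by (auto simp: m_assoc)
    then show ?thesis using False by (simp add: e_def)
  qed
  have conv_e: "a \<star> e \<in> carrier (ind_rep G H \<rho>)" for a
    using e_shift by (auto simp: car conv_apply sum_distrib_left m_assoc[symmetric] algebra_simps)
  have e_GA: "e \<in> GA" by (auto simp: GA_def e_def)
  have "e \<in> carrier (ind_rep G H \<rho>)" using e_GA e_shift by (auto simp: car)
  then have ee: "e \<star> e = e" by (rule absorb)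
  have \<kappa>e: "\<kappa> \<star> e = \<kappa>" by (rule absorb[OF \<kappa>(1)])
  define q where "q = e \<star> (r \<star> \<kappa>)"
  have qe: "q \<star> e = q" by (simp add: q_def conv_assoc \<kappa>e)
  have eq: "e \<star> q = q" by (simp add: q_def ee flip: conv_assoc)
  have qq: "q \<star> q = q"
  proof -
    have "q \<star> q = e \<star> (r \<star> ((\<kappa> \<star> e) \<star> (r \<star> \<kappa>)))" by (simp add: q_def conv_assoc)
    also have "\<dots> = e \<star> (r \<star> ((\<kappa> \<star> r) \<star> \<kappa>))" by (simp add: \<kappa>e conv_assoc)
    also have "\<dots> = e \<star> ((r \<star> r) \<star> \<kappa>)" by (simp only: \<kappa>(2) conv_assoc)
    finally show ?thesis by (simp add: r(1) q_def)
  qed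
  have "q \<one> = ((r \<star> \<kappa>) \<star> e) \<one>" unfolding q_def by (rule conv_trace)
  also have "\<dots> = (\<kappa> \<star> r) \<one>" by (simp add: conv_assoc \<kappa>e conv_trace[of r])
  finally have q1: "q \<one> = e \<one>" by (simp add: \<kappa>(2) r(2) e_def \<rho>_one)
  have "(\<lambda>g. e g - q g) = (\<lambda>_. 0)"
  proof (rule idempotent_trace_zero)
    show "(\<lambda>g. e g - q g) \<in> GA" using e_GA by (auto simp: GA_def q_def conv_out)
    show "(\<lambda>g. e g - q g) \<star> (\<lambda>g. e g - q g) = (\<lambda>g. e g - q g)"
      by (simp add: conv_diff_left conv_diff_right ee eq qe qq)
  qed (simp add: q1)
  then have e_q: "e = q" by (auto simp: fun_eq_iff)
  have recover: "(x \<star> r) \<star> \<kappa> = x" if x: "x \<in> carrier (ind_rep G H \<rho>)" for x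
  proof -
    have "(x \<star> r) \<star> \<kappa> = ((x \<star> e) \<star> r) \<star> \<kappa>" by (simp add: absorb[OF x])
    also have "\<dots> = x \<star> e" by (subst (2) e_q) (simp add: q_def conv_assoc)
    finally show ?thesis by (simp add: absorb[OF x])
  qed
  have ind_ideal: "b \<star> \<kappa> \<in> carrier (ind_rep G H \<rho>)" for b
    using conv_e[of "b \<star> \<kappa>"] by (simp add: conv_assoc \<kappa>e)
  have act: "act (ind_rep G H \<rho>) g x = dl g \<star> x" if "g \<in> carrier G" for g x
    using that by (auto simp: ind_rep_def dl_conv conv_out)
  show ?thesis
  proof (rule rep_transport[OF left_ideal_representation, of "\<lambda>x. x \<star> r"])
    have "inj_on (\<lambda>x. x \<star> r) (carrier (ind_rep G H \<rho>))"
      by (rule inj_on_inverseI[of _ "\<lambda>x. x \<star> \<kappa>"]) (rule recover)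
    moreover have "(\<lambda>x. x \<star> r) ` carrier (ind_rep G H \<rho>) = carrier (left_ideal_rep r)"
    proof
      show "(\<lambda>x. x \<star> r) ` carrier (ind_rep G H \<rho>) \<subseteq> carrier (left_ideal_rep r)"
        by (auto simp: left_ideal_rep_def car)
      show "carrier (left_ideal_rep r) \<subseteq> (\<lambda>x. x \<star> r) ` carrier (ind_rep G H \<rho>)"
      proof
        fix y assume "y \<in> carrier (left_ideal_rep r)"
        then obtain b where "y = b \<star> r" by (auto simp: left_ideal_rep_def)
        then have "y = (b \<star> \<kappa>) \<star> r" by (simp add: conv_assoc \<kappa>(2))
        then show "y \<in> (\<lambda>x. x \<star> r) ` carrier (ind_rep G H \<rho>)" using ind_ideal by blast
      qed
    qed
    ultimately show "bij_betw (\<lambda>x. x \<star> r) (carrier (ind_rep G H \<rho>)) (carrier (left_ideal_rep r))"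
      by (simp add: bij_betw_def)
    show "act (ind_rep G H \<rho>) g v \<in> carrier (ind_rep G H \<rho>)"
      if "g \<in> carrier G" "v \<in> carrier (ind_rep G H \<rho>)" for g v
      using conv_e[of "dl g \<star> v"] that by (simp add: act conv_assoc absorb)
    show "act (ind_rep G H \<rho>) g v \<star> r = act (left_ideal_rep r) g (v \<star> r)"
      if "g \<in> carrier G" "v \<in> carrier (ind_rep G H \<rho>)" for g v
      using that by (simp add: act left_ideal_rep_def conv_assoc)
  qed (auto simp: ind_rep_def left_ideal_rep_def conv_add_left conv_smult_left algebra_simps)
qed

text \<open>The characters are given by definite descriptions, so existence and uniqueness have to
  be proved. Existence is read off a simultaneous eigenvector \<kappa> for the right translations by
  \<open>Y\<close>: its eigenvalues are multiplicative on the generated subgroup, and each is pinned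
  down at \<sigma>, where \<kappa> does not vanish. This replaces any discussion of relations
  between the generators.\<close>

lemma linear_character_generate:
  assumes Y: "Y \<subseteq> carrier G" and \<kappa>: "\<sigma> \<in> carrier G" "\<kappa> \<sigma> \<noteq> 0"
    and \<xi>: "\<And>y. y \<in> Y \<Longrightarrow> \<xi> y \<noteq> 0"
      "\<And>y g. y \<in> Y \<Longrightarrow> g \<in> carrier G \<Longrightarrow> \<kappa> (g \<otimes> y) = inverse (\<xi> y) * \<kappa> g"
  shows "\<exists>!\<rho>. linear_character G (generate G Y) \<rho> \<and> (\<forall>y\<in>Y. \<rho> y = \<xi> y)"
    and "linear_character G (generate G Y) \<rho> \<Longrightarrow> \<forall>y\<in>Y. \<rho> y = \<xi> y \<Longrightarrow> h \<in> generate G Y \<Longrightarrow>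
      g \<in> carrier G \<Longrightarrow> \<kappa> (g \<otimes> h) = inverse (\<rho> h) * \<kappa> g"
proof -
  let ?H = "generate G Y"
  have HG: "h \<in> carrier G" if "h \<in> ?H" for h
    using generate_in_carrier[OF Y that] .
  interpret H: subgroup ?H G by (rule generate_is_subgroup[OF Y])
  have ex: "\<exists>l. l \<noteq> 0 \<and> (\<forall>g\<in>carrier G. \<kappa> (g \<otimes> h) = inverse l * \<kappa> g)" if "h \<in> ?H" for h
    using that
  proof (induction rule: generate.induct)
    case one
    then show ?case by (intro exI[of _ 1]) auto
  next
    case (incl h)
    then show ?case using \<xi> by blast
  next
    case (inv h)
    have "\<kappa> (g \<otimes> inv h) = \<xi> h * \<kappa> g" if g: "g \<in> carrier G" for g
      using \<xi>(2)[OF inv, of "g \<otimes> inv h"] \<xi>(1)[OF inv] g inv Y by (auto simp: m_assoc field_simps)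
    then show ?case using \<xi>(1)[OF inv] by (intro exI[of _ "inverse (\<xi> h)"]) auto
  next
    case (eng h1 h2)
    obtain l1 l2 where l: "l1 \<noteq> 0" "l2 \<noteq> 0" "\<And>g. g \<in> carrier G \<Longrightarrow> \<kappa> (g \<otimes> h1) = inverse l1 * \<kappa> g"
      "\<And>g. g \<in> carrier G \<Longrightarrow> \<kappa> (g \<otimes> h2) = inverse l2 * \<kappa> g"
      using eng by blast
    have "\<kappa> (g \<otimes> (h1 \<otimes> h2)) = inverse (l1 * l2) * \<kappa> g" if g: "g \<in> carrier G" for g
      using g HG eng(1,2) by (simp add: m_assoc[symmetric] l)
    then show ?case using l(1,2) by (intro exI[of _ "l1 * l2"]) auto
  qed
  then obtain L where L: "\<And>h. h \<in> ?H \<Longrightarrow> L h \<noteq> 0"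
    "\<And>h g. h \<in> ?H \<Longrightarrow> g \<in> carrier G \<Longrightarrow> \<kappa> (g \<otimes> h) = inverse (L h) * \<kappa> g"
    by metis
  have L_eqI: "L h = l" if "h \<in> ?H" "\<kappa> (\<sigma> \<otimes> h) = inverse l * \<kappa> \<sigma>" for h l
    using L(2)[OF that(1) \<kappa>(1)] that(2) \<kappa>(2) by simp
  have mult: "L (h \<otimes> k) = L h * L k" if "h \<in> ?H" "k \<in> ?H" for h k
    using that HG \<kappa>(1) by (intro L_eqI) (simp_all add: m_assoc[symmetric] L(2))
  have L\<xi>: "L y = \<xi> y" if "y \<in> Y" for y
    using that \<xi>(2)[OF that \<kappa>(1)] by (intro L_eqI) (auto intro: generate.incl)
  define \<rho>0 where "\<rho>0 = restrict L ?H"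
  have \<rho>0: "linear_character G ?H \<rho>0" "\<forall>y\<in>Y. \<rho>0 y = \<xi> y"
    using L(1) mult L\<xi> generate.incl[of _ Y G]
    by (auto simp: linear_character_def hom_def complex_units \<rho>0_def)
  have uniq: "\<rho> = \<rho>0" if \<rho>: "linear_character G ?H \<rho>" "\<forall>y\<in>Y. \<rho> y = \<xi> y" for \<rho>
  proof -
    have \<rho>_mult: "\<rho> (h \<otimes> k) = \<rho> h * \<rho> k" and \<rho>_nz: "\<rho> h \<noteq> 0" if "h \<in> ?H" "k \<in> ?H" for h k
      using \<rho>(1) that by (auto simp: linear_character_def hom_def complex_units Pi_def)
    have one: "\<rho> \<one> = 1"
      using \<rho>_mult[of \<one> \<one>] \<rho>_nz[of \<one> \<one>] generate.one[of G Y] by simp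
    have L1: "L \<one> = 1" using \<kappa> generate.one[of G Y] by (intro L_eqI) auto
    have "\<rho> h = L h" if "h \<in> ?H" for h
      using that
    proof (induction rule: generate.induct)
      case (inv h)
      have h: "h \<in> ?H" "inv h \<in> ?H" "h \<in> carrier G" using inv Y by (auto intro: generate.intros)
      have "\<rho> (inv h) * \<rho> h = 1" "L (inv h) * L h = 1"
        using \<rho>_mult[OF h(2,1)] mult[OF h(2,1)] h(3) one L1 by simp_all
      moreover have "\<rho> h = L h" using inv \<rho>(2) L\<xi> by simp
      ultimately show ?case using L(1)[OF h(1)] by (metis mult_right_cancel)
    qed (use one L1 \<rho>(2) L\<xi> \<rho>_mult mult in auto)
    moreover have "\<rho> h = undefined" if "h \<notin> ?H" for h
      using \<rho>(1) that by (auto simp: linear_character_def extensional_def)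
    ultimately show ?thesis by (auto simp: \<rho>0_def)
  qed
  show "\<exists>!\<rho>. linear_character G ?H \<rho> \<and> (\<forall>y\<in>Y. \<rho> y = \<xi> y)"
    using \<rho>0 uniq by blast
  show "\<kappa> (g \<otimes> h) = inverse (\<rho> h) * \<kappa> g"
    if "linear_character G ?H \<rho>" "\<forall>y\<in>Y. \<rho> y = \<xi> y" "h \<in> ?H" "g \<in> carrier G"
    using uniq[OF that(1,2)] L(2)[OF that(3,4)] that(3) by (simp add: \<rho>0_def)
qed

end

section \<open>Descents and shuffles\<close>

text \<open>Both keys order the letters as their positions in \<open>u\<close> do.\<close>

lemma sorted_wrt_key_eq:
  fixes f g :: "'c \<Rightarrow> 'k :: linorder"
  shows "sorted_wrt (\<lambda>x y. f x < f y) u \<Longrightarrow> sorted_wrt (\<lambda>x y. g x < g y) u \<Longrightarrow>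
    x \<in> set u \<Longrightarrow> y \<in> set u \<Longrightarrow> f x < f y \<longleftrightarrow> g x < g y"
  by (induction u) (auto dest: order_less_asym)

section \<open>Colourings compatible with a word\<close>

fun des :: "'a::linorder list \<Rightarrow> nat" where
  "des (x # y # w) = (if x > y then 1 else 0) + des (y # w)"
| "des _ = 0"

lemma des_less: "w \<noteq> [] \<Longrightarrow> des w < length w"
  by (induction w rule: des.induct) auto

text \<open>The words sorted by \<open>stable_less c\<close> are those with which the colouring \<open>c\<close> is compatible in the
  sense of P-partitions: \<open>c\<close> increases weakly along the word, and strictly at descents.\<close>

definition stable_less :: "('a::linorder \<Rightarrow> nat) \<Rightarrow> 'a \<Rightarrow> 'a \<Rightarrow> bool" where
  "stable_less c x y \<longleftrightarrow> c x < c y \<or> c x = c y \<and> x < y"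

text \<open>The lower bound \<open>l\<close> serves the recursion in \<open>card_colourings\<close>,
  where the colour of the first letter bounds the later ones from below.\<close>

definition colourings :: "nat \<Rightarrow> nat \<Rightarrow> 'a::linorder list \<Rightarrow> ('a \<Rightarrow> nat) set" where
  "colourings l t w = {c \<in> set w \<rightarrow>\<^sub>E {l..<t}. sorted_wrt (stable_less c) w}"

lemma finite_colourings: "finite (colourings l t w)"
  unfolding colourings_def by (rule finite_subset[OF _ finite_PiE[of "set w" "\<lambda>_. {l..<t}"]]) auto

lemma stable_less_trans: "stable_less c x y \<Longrightarrow> stable_less c y z \<Longrightarrow> stable_less c x z"
  and stable_less_irrefl: "\<not> stable_less c x x"
  and stable_less_total: "x \<noteq> y \<Longrightarrow> stable_less c x y \<or> stable_less c y x"
  by (auto simp: stable_less_def)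

lemma sorted_wrt_stable_unique:
  "sorted_wrt (stable_less c) xs \<Longrightarrow> sorted_wrt (stable_less c) ys \<Longrightarrow> set xs = set ys \<Longrightarrow> xs = ys"
proof (induction xs arbitrary: ys)
  case (Cons x xs)
  then obtain y zs where ys: "ys = y # zs" by (cases ys) auto
  have "x = y"
  proof (rule ccontr)
    assume "x \<noteq> y"
    then have "stable_less c x y" "stable_less c y x" using Cons.prems ys by auto
    then show False using stable_less_trans stable_less_irrefl by blast
  qed
  moreover have "x \<notin> set xs" "y \<notin> set zs"
    using Cons.prems(1,2) ys stable_less_irrefl by (metis sorted_wrt.simps(2))+
  then have "set xs = set zs" using Cons.prems(3) ys \<open>x = y\<close> by auto
  ultimately show ?case using Cons ys by auto
qed simp

lemma merge_exists:
  "sorted_wrt (stable_less c) u \<Longrightarrow> sorted_wrt (stable_less c) v \<Longrightarrow> set u \<inter> set v = {} \<Longrightarrow>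
    \<exists>w\<in>shuffles u v. sorted_wrt (stable_less c) w"
proof (induction u v rule: shuffles.induct)
  case (3 x xs y ys)
  show ?case
  proof (cases "stable_less c x y")
    case True
    obtain w where w: "w \<in> shuffles xs (y # ys)" "sorted_wrt (stable_less c) w"
      using 3 by auto
    have "stable_less c x z" if "z \<in> set w" for z
      using that set_shuffles[OF w(1)] 3(3,4) True stable_less_trans[of c x y] by auto
    then show ?thesis using w by (intro bexI[of _ "x # w"]) auto
  next
    case False
    then have yx: "stable_less c y x" using 3(5) stable_less_total by auto
    obtain w where w: "w \<in> shuffles (x # xs) ys" "sorted_wrt (stable_less c) w"
      using 3 by auto
    have "stable_less c y z" if "z \<in> set w" for z
      using that set_shuffles[OF w(1)] 3(3,4) yx stable_less_trans[of c y x] by auto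
    then show ?thesis using w by (intro bexI[of _ "y # w"]) auto
  qed
qed auto

lemma sorted_wrt_shuffles:
  "w \<in> shuffles u v \<Longrightarrow> sorted_wrt R w \<Longrightarrow> sorted_wrt R u \<and> sorted_wrt R v"
proof (induction u v arbitrary: w rule: shuffles.induct)
  case (3 x xs y ys)
  from 3(3) consider w' where "w = x # w'" "w' \<in> shuffles xs (y # ys)"
    | w' where "w = y # w'" "w' \<in> shuffles (x # xs) ys" by auto
  then show ?case
  proof cases
    case 1
    then show ?thesis using 3(1)[OF 1(2)] 3(4) set_shuffles[OF 1(2)] by auto
  next
    case 2
    then show ?thesis using 3(2)[OF 2(2)] 3(4) set_shuffles[OF 2(2)] by auto
  qed
qed auto

lemma sorted_wrt_stable_cong:
  "(\<And>x. x \<in> set w \<Longrightarrow> c x = d x) \<Longrightarrow> sorted_wrt (stable_less c) w \<longleftrightarrow> sorted_wrt (stable_less d) w"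
  by (induction w) (auto simp: stable_less_def)

text \<open>A colouring compatible with both \<open>u\<close> and \<open>v\<close> sorts their
  letters, by colour and then by letter, into exactly one word, and that word is a shuffle. So the
  set \<open>C\<close> is partitioned by the shuffles; restricted to \<open>u\<close> and to
  \<open>v\<close>, its elements are also the pairs of compatible colourings.\<close>

lemma card_colourings_shuffles:
  assumes "set u \<inter> set v = {}"
  shows "(\<Sum>w\<in>shuffles u v. card (colourings l t w)) = card (colourings l t u) * card (colourings l t v)"
proof -
  define C where "C = {c \<in> (set u \<union> set v) \<rightarrow>\<^sub>E {l..<t}. sorted_wrt (stable_less c) u \<and> sorted_wrt (stable_less c) v}"
  have "C = (\<Union>w\<in>shuffles u v. colourings l t w)"
  proof (intro equalityI subsetI)
    fix c assume c: "c \<in> C"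
    then obtain w where "w \<in> shuffles u v" "sorted_wrt (stable_less c) w"
      using merge_exists[of c u v] assms by (auto simp: C_def)
    then show "c \<in> (\<Union>w\<in>shuffles u v. colourings l t w)"
      using c set_shuffles[of w u v] by (auto simp: C_def colourings_def intro!: bexI[of _ w])
  qed (auto simp: C_def colourings_def set_shuffles dest: sorted_wrt_shuffles)
  moreover have "colourings l t w \<inter> colourings l t w' = {}"
    if "w \<in> shuffles u v" "w' \<in> shuffles u v" "w \<noteq> w'" for w w'
    using that set_shuffles[of w u v] set_shuffles[of w' u v] sorted_wrt_stable_unique[of _ w w']
    by (auto simp: colourings_def)
  ultimately have "card C = (\<Sum>w\<in>shuffles u v. card (colourings l t w))"
    by (simp add: card_UN_disjoint finite_colourings)
  moreover have "bij_betw (\<lambda>c. (restrict c (set u), restrict c (set v))) C (colourings l t u \<times> colourings l t v)"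
  proof (rule bij_betw_byWitness[of _ "\<lambda>(c, d) x. if x \<in> set u then c x else d x"])
    show "\<forall>a\<in>C. (\<lambda>(c, d) x. if x \<in> set u then c x else d x) (restrict a (set u), restrict a (set v)) = a"
      by (auto simp: C_def PiE_def extensional_def fun_eq_iff)
    show "\<forall>a\<in>colourings l t u \<times> colourings l t v.
      (restrict ((\<lambda>(c, d) x. if x \<in> set u then c x else d x) a) (set u),
       restrict ((\<lambda>(c, d) x. if x \<in> set u then c x else d x) a) (set v)) = a"
      using assms by (auto simp: colourings_def PiE_def extensional_def fun_eq_iff)
    show "(\<lambda>c. (restrict c (set u), restrict c (set v))) ` C \<subseteq> colourings l t u \<times> colourings l t v"
      by (auto simp: C_def colourings_def sorted_wrt_stable_cong[of u "restrict _ (set u)"]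
          sorted_wrt_stable_cong[of v "restrict _ (set v)"])
    show "(\<lambda>(c, d) x. if x \<in> set u then c x else d x) ` (colourings l t u \<times> colourings l t v) \<subseteq> C"
    proof safe
      fix c d assume cd: "c \<in> colourings l t u" "d \<in> colourings l t v"
      let ?e = "\<lambda>x. if x \<in> set u then c x else d x"
      have "sorted_wrt (stable_less ?e) u \<longleftrightarrow> sorted_wrt (stable_less c) u"
        by (rule sorted_wrt_stable_cong) simp
      moreover have "sorted_wrt (stable_less ?e) v \<longleftrightarrow> sorted_wrt (stable_less d) v"
        using assms by (intro sorted_wrt_stable_cong) auto
      ultimately have "sorted_wrt (stable_less ?e) u" "sorted_wrt (stable_less ?e) v"
        using cd by (auto simp: colourings_def)
      then show "?e \<in> C" using cd by (auto simp: C_def colourings_def PiE_def extensional_def Pi_def)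
    qed
  qed
  then have "card C = card (colourings l t u) * card (colourings l t v)"
    by (simp add: bij_betw_same_card card_cartesian_product)
  ultimately show ?thesis by simp
qed

text \<open>The hockey-stick identity; \<open>k \<le> m\<close> makes the right side vanish at
  \<open>T = 0\<close>.\<close>

lemma sum_choose_shift: "k \<le> m \<Longrightarrow> (\<Sum>j<T. (j + k) choose m) = (T + k) choose (m + 1)"
  by (induction T) (auto simp: binomial_eq_0)

text \<open>Once the first letter has colour \<open>d\<close>, the rest is a compatible colouring
  with lower bound \<open>d\<close>, raised to \<open>d + 1\<close> if the word begins with a
  descent. The sum over \<open>d\<close> is the hockey-stick identity.\<close>

lemma card_colourings:
  "distinct w \<Longrightarrow> w \<noteq> [] \<Longrightarrow> l \<le> t \<Longrightarrow>
    card (colourings l t w) = (t - l + length w - 1 - des w) choose length w"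
proof (induction w arbitrary: l rule: des.induct)
  case (1 x y w)
  let ?v = "y # w"
  define e where "e = (if x > y then 1 else 0 :: nat)"
  have sorted_iff: "sorted_wrt (stable_less c) (x # ?v) \<longleftrightarrow> sorted_wrt (stable_less c) ?v \<and> c x + e \<le> c y" for c
  proof -
    have "stable_less c x y \<longleftrightarrow> c x + e \<le> c y"
      using 1(2) by (auto simp: stable_less_def e_def)
    then show ?thesis using stable_less_trans[of c x y] by auto
  qed
  have ge: "c y \<le> c z" if "sorted_wrt (stable_less c) ?v" "z \<in> set ?v" for c z
    using that by (auto simp: stable_less_def)
  define S where "S = Sigma {l..<t} (\<lambda>d. colourings (d + e) t ?v)"
  have "bij_betw (\<lambda>(d, c). c(x := d)) S (colourings l t (x # ?v))"
  proof (rule bij_betw_byWitness[of _ "\<lambda>c. (c x, c(x := undefined))"])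
    show "\<forall>a\<in>S. (\<lambda>c. (c x, c(x := undefined))) ((\<lambda>(d, c). c(x := d)) a) = a"
      using 1(2) by (auto simp: S_def colourings_def PiE_def extensional_def fun_eq_iff)
    show "\<forall>c\<in>colourings l t (x # ?v). (\<lambda>(d, c). c(x := d)) (c x, c(x := undefined)) = c"
      by auto
    show "(\<lambda>(d, c). c(x := d)) ` S \<subseteq> colourings l t (x # ?v)"
    proof safe
      fix d c assume dc: "(d, c) \<in> S"
      let ?c = "c(x := d)"
      have "sorted_wrt (stable_less ?c) ?v \<longleftrightarrow> sorted_wrt (stable_less c) ?v"
        using 1(2) by (intro sorted_wrt_stable_cong) auto
      then have "sorted_wrt (stable_less ?c) ?v"
        using dc by (auto simp: S_def colourings_def)
      then have "sorted_wrt (stable_less ?c) (x # ?v)"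
        unfolding sorted_iff using dc 1(2) by (auto simp: S_def colourings_def)
      moreover have "?c \<in> set (x # ?v) \<rightarrow>\<^sub>E {l..<t}"
        using dc by (auto simp: S_def colourings_def PiE_def extensional_def Pi_def)
      ultimately show "?c \<in> colourings l t (x # ?v)" by (simp add: colourings_def)
    qed
    show "(\<lambda>c. (c x, c(x := undefined))) ` colourings l t (x # ?v) \<subseteq> S"
    proof safe
      fix c assume c: "c \<in> colourings l t (x # ?v)"
      let ?c = "c(x := undefined)"
      have s: "sorted_wrt (stable_less c) ?v" "c x + e \<le> c y"
        using c sorted_iff[of c] by (auto simp: colourings_def)
      have "sorted_wrt (stable_less ?c) ?v \<longleftrightarrow> sorted_wrt (stable_less c) ?v"
        using 1(2) by (intro sorted_wrt_stable_cong) auto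
      moreover have "?c \<in> set ?v \<rightarrow>\<^sub>E {c x + e..<t}"
        using c s ge[OF s(1)] 1(2)
        by (force simp: colourings_def PiE_def extensional_def Pi_def)
      ultimately show "(c x, ?c) \<in> S" using c s by (auto simp: S_def colourings_def)
    qed
  qed
  then have "card (colourings l t (x # ?v)) = card S" by (simp add: bij_betw_same_card)
  also have "\<dots> = (\<Sum>d\<in>{l..<t}. card (colourings (d + e) t ?v))"
    unfolding S_def by (rule card_SigmaI) (auto simp: finite_colourings)
  also have "\<dots> = (\<Sum>d\<in>{l..<t}. (t - (d + e) + length ?v - 1 - des ?v) choose length ?v)"
    using 1 by (intro sum.cong refl) (auto simp: e_def)
  \<comment> \<open>Colours are counted from the top, \<open>j = t - 1 - d\<close>, which is the
    form of \<open>sum_choose_shift\<close>.\<close>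
  also have "\<dots> = (\<Sum>j<t - l. (j + (length ?v - des ?v - e)) choose length ?v)"
  proof (rule sum.reindex_bij_witness[of _ "\<lambda>j. t - 1 - j" "\<lambda>d. t - 1 - d"])
    fix d assume d: "d \<in> {l..<t}"
    have "des ?v < length ?v" by (rule des_less) simp
    then show "(t - 1 - d + (length ?v - des ?v - e)) choose length ?v =
      (t - (d + e) + length ?v - 1 - des ?v) choose length ?v"
      using d by (intro arg_cong[of _ _ "\<lambda>k. k choose length ?v"]) (auto simp: e_def)
  qed auto
  also have "\<dots> = (t - l + (length ?v - des ?v - e)) choose (length ?v + 1)"
    by (rule sum_choose_shift) simp
  also have "t - l + (length ?v - des ?v - e) = t - l + length (x # ?v) - 1 - des (x # ?v)"
    using des_less[of ?v] by (auto simp: e_def)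
  finally show ?case by simp
next
  case ("2_2" x)
  have "colourings l t [x] = {x} \<rightarrow>\<^sub>E {l..<t}" by (auto simp: colourings_def)
  then show ?case by (simp add: card_PiE)
qed simp

text \<open>For \<open>d < n\<close> this is the linear coefficient in \<open>t\<close> of
  \<open>(t + n - 1 - d) choose n\<close>. It is also \<open>(-1)^d / n\<close> divided by
  \<open>(n - 1) choose d\<close>, the coefficient of a permutation with \<open>d\<close> descents
  in the first Eulerian idempotent.\<close>

definition dcoef :: "nat \<Rightarrow> nat \<Rightarrow> complex" where
  "dcoef n d = (-1) ^ d * fact d * fact (n - 1 - d) / fact n"

text \<open>With \<open>n = k + 1 + d\<close> the numerator of the binomial coefficient is the
  product of the numbers from \<open>t + k\<close> down to \<open>t - d\<close>. It contains the
  factor \<open>t\<close>; \<open>Q\<close> collects the others.\<close>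

lemma choose_polynomial:
  assumes "d < n"
  shows "\<exists>Q :: complex poly. poly Q 0 = dcoef n d \<and>
    (\<forall>t::nat. of_nat ((t + n - 1 - d) choose n) = of_nat t * poly Q (of_nat t))"
proof -
  obtain k where n: "n = k + 1 + d" using assms by (metis add.commute add.left_commute less_iff_Suc_add plus_1_eq_Suc)
  define Q :: "complex poly" where "Q = Polynomial.smult (1 / fact n)
    ((\<Prod>i<k. [:of_nat (i + 1), 1:]) * (\<Prod>j<d. [:- of_nat (j + 1), 1:]))"
  have f: "(\<Prod>i<m. of_nat (i + 1) :: complex) = fact m" for m
    by (induction m) (auto simp: algebra_simps)
  have "(\<Prod>j<d. - of_nat (j + 1) :: complex) = (-1) ^ d * fact d"
    unfolding f[symmetric] by (induction d) (auto simp: algebra_simps)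
  then have "poly Q 0 = dcoef n d"
    using f[of k] by (simp add: Q_def dcoef_def poly_prod n)
  moreover have "of_nat ((t + n - 1 - d) choose n) = of_nat t * poly Q (of_nat t)" for t :: nat
  proof -
    have "(of_nat ((t + k) choose n) :: complex) = (\<Prod>i = 0..<n. of_nat (t + k) - of_nat i) / fact n"
      by (simp add: binomial_gbinomial gbinomial_prod_rev)
    also have "(\<Prod>i = 0..<n. of_nat (t + k) - of_nat i :: complex) =
      (\<Prod>i = 0..<Suc k. of_nat (t + k) - of_nat i) * (\<Prod>i = Suc k..<Suc k + d. of_nat (t + k) - of_nat i)"
      by (simp only: n Suc_eq_plus1 prod.atLeastLessThan_concat le_add1 zero_le)
    also have "(\<Prod>i = 0..<Suc k. of_nat (t + k) - of_nat i :: complex) = (\<Prod>i<Suc k. of_nat (t + i))"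
      by (rule prod.reindex_bij_witness[of _ "\<lambda>i. k - i" "\<lambda>i. k - i"]) (auto simp: of_nat_diff)
    also have "\<dots> = of_nat t * (\<Prod>i<k. of_nat t + of_nat (i + 1))"
      by (simp add: prod.lessThan_Suc_shift add.assoc del: prod.lessThan_Suc)
    also have "(\<Prod>i = Suc k..<Suc k + d. of_nat (t + k) - of_nat i :: complex) = (\<Prod>j<d. of_nat t - of_nat (j + 1))"
      by (rule prod.reindex_bij_witness[of _ "\<lambda>j. j + Suc k" "\<lambda>i. i - Suc k"]) (auto simp: of_nat_diff algebra_simps)
    finally show ?thesis
      by (simp add: Q_def n poly_prod algebra_simps)
  qed
  ultimately show ?thesis by blast
qed

text \<open>The counting polynomials of all shuffles add up to the product of those of
  \<open>u\<close> and \<open>v\<close>. Both of these are divisible by \<open>t\<close>, so the sum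
  has no linear term.\<close>

lemma sum_shuffles_dcoef:
  assumes uv: "set u \<inter> set v = {}" "distinct u" "distinct v" "u \<noteq> []" "v \<noteq> []"
  shows "(\<Sum>w\<in>shuffles u v. dcoef (length w) (des w)) = 0"
proof -
  have "\<exists>Q :: complex poly. poly Q 0 = dcoef (length w) (des w) \<and>
    (\<forall>t::nat. of_nat (card (colourings 0 t w)) = of_nat t * poly Q (of_nat t))"
    if "distinct w" "w \<noteq> []" for w
    using choose_polynomial[OF des_less[OF that(2)]] card_colourings[OF that, of 0] by simp
  then obtain Q :: "'a list \<Rightarrow> complex poly" where
    Q0: "\<And>w. distinct w \<Longrightarrow> w \<noteq> [] \<Longrightarrow> poly (Q w) 0 = dcoef (length w) (des w)" and
    Q: "\<And>w t. distinct w \<Longrightarrow> w \<noteq> [] \<Longrightarrow> of_nat (card (colourings 0 t w)) = of_nat t * poly (Q w) (of_nat t)"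
    by metis
  have sh: "distinct w" "w \<noteq> []" if "w \<in> shuffles u v" for w
    using that distinct_disjoint_shuffles[of u v w] uv by auto
  define p where "p = (\<Sum>w\<in>shuffles u v. Q w)"
  define q where "q = [:0, 1:] * (Q u * Q v)"
  \<comment> \<open>A factor \<open>t\<close> is cancelled here, so the comparison is made at
    positive integers; infinitely many suffice to identify the polynomials.\<close>
  have "poly p (of_nat (Suc t)) = poly q (of_nat (Suc t))" for t
  proof -
    let ?t = "of_nat (Suc t) :: complex"
    have "?t * poly p ?t = (\<Sum>w\<in>shuffles u v. of_nat (card (colourings 0 (Suc t) w)))"
      unfolding p_def poly_sum sum_distrib_left by (intro sum.cong refl Q[symmetric] sh)
    also have "\<dots> = of_nat (card (colourings 0 (Suc t) u)) * of_nat (card (colourings 0 (Suc t) v))"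
      by (metis card_colourings_shuffles[OF uv(1)] of_nat_mult of_nat_sum)
    also have "\<dots> = ?t * poly q ?t"
      using Q uv by (simp only: q_def) (simp add: algebra_simps)
    finally show ?thesis by (metis mult_left_cancel of_nat_neq_0)
  qed
  then have "range (\<lambda>t. of_nat (Suc t)) \<subseteq> {x. poly (p - q) x = 0}" by auto
  moreover have "infinite (range (\<lambda>t. of_nat (Suc t) :: complex))"
    by (intro range_inj_infinite injI) (metis Suc_inject of_nat_eq_iff)
  ultimately have "p - q = 0" using poly_roots_finite[of "p - q"] finite_subset by blast
  then have "poly p 0 = poly q 0" by simp
  then show ?thesis using Q0 sh by (simp add: p_def q_def poly_sum)
qed

text \<open>Words with the same subword of letters satisfying \<open>P\<close> and the same subword
  of other letters are the shuffles of these two subwords. On each such class \<open>h\<close> is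
  constant and the weights sum to zero; \<open>x\<close> and \<open>y\<close> ensure that neither
  subword is empty.\<close>

lemma sum_words_dcoef:
  fixes h :: "'a::linorder list \<Rightarrow> complex"
  assumes S: "finite S" "x \<in> S" "P x" "y \<in> S" "\<not> P y"
    and h: "\<And>w w'. distinct w \<Longrightarrow> distinct w' \<Longrightarrow> set w = S \<Longrightarrow> set w' = S \<Longrightarrow>
      filter P w = filter P w' \<Longrightarrow> filter (\<lambda>x. \<not> P x) w = filter (\<lambda>x. \<not> P x) w' \<Longrightarrow> h w = h w'"
  shows "(\<Sum>w | distinct w \<and> set w = S. h w * dcoef (card S) (des w)) = 0"
proof -
  let ?F = "\<lambda>w. (filter P w, filter (\<lambda>x. \<not> P x) w)"
  let ?W = "{w. distinct w \<and> set w = S}"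
  have fin: "finite ?W" using finite_subset_distinct[OF S(1)] by (rule finite_subset[rotated]) auto
  have "(\<Sum>w\<in>?W. h w * dcoef (card S) (des w)) =
    (\<Sum>uv\<in>?F ` ?W. \<Sum>w\<in>{w \<in> ?W. ?F w = uv}. h w * dcoef (card S) (des w))"
    by (rule sum.image_gen[OF fin])
  also have "\<dots> = 0"
  proof (rule sum.neutral, safe)
    fix z assume z: "distinct z" "S = set z"
    define u where "u = filter P z"
    define v where "v = filter (\<lambda>x. \<not> P x) z"
    have fib: "{w \<in> ?W. ?F w = ?F z} = shuffles u v"
    proof (intro equalityI subsetI)
      fix w assume "w \<in> {w \<in> ?W. ?F w = ?F z}"
      then show "w \<in> shuffles u v"
        using partition_in_shuffles[of w P] by (auto simp: u_def v_def)
    next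
      fix w assume w: "w \<in> shuffles u v"
      then have "filter P w = u" "filter (\<lambda>x. \<not> P x) w = v"
        using filter_shuffles[of P u v] filter_shuffles[of "\<lambda>x. \<not> P x" u v]
        by (auto simp: u_def v_def)
      moreover have "distinct w" "set w = S"
        using w z distinct_disjoint_shuffles[of u v w] set_shuffles[of w u v]
        by (auto simp: u_def v_def)
      ultimately show "w \<in> {w \<in> ?W. ?F w = ?F z}"
        by (auto simp: u_def v_def)
    qed
    have "(\<Sum>w\<in>{w \<in> ?W. ?F w = ?F z}. h w * dcoef (card S) (des w)) =
      (\<Sum>w\<in>shuffles u v. h z * dcoef (length w) (des w))"
    proof (rule sum.cong[OF fib])
      fix w assume "w \<in> shuffles u v"
      then have w: "distinct w" "set w = S" "?F w = ?F z" using fib by blast+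
      then have "h w = h z" using z by (intro h) auto
      then show "h w * dcoef (card S) (des w) = h z * dcoef (length w) (des w)"
        using w distinct_card[of w] by simp
    qed
    also have "\<dots> = 0"
      using sum_shuffles_dcoef[of u v] z S by (auto simp: u_def v_def filter_empty_conv simp flip: sum_distrib_left)
    finally show "(\<Sum>w | w \<in> {w. distinct w \<and> set w = set z} \<and> ?F w = ?F z.
        h w * dcoef (card (set z)) (des w)) = 0"
      using z by simp
  qed
  finally show ?thesis by simp
qed

text \<open>With \<open>d = card D\<close> and \<open>f = card F\<close>, both sides are
  \<open>(-1)^d\<close> times the Beta integral of \<open>x^d (1 - x)^f\<close> over the unit
  interval. The induction instead splits the sum by whether \<open>B\<close> contains the new
  element, a recursion of Pascal type.\<close>

lemma sum_supersets:
  assumes "finite F" "finite D" "D \<inter> F = {}"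
  shows "(\<Sum>B\<in>Pow F. (-1) ^ card (D \<union> B) / of_nat (card (D \<union> B) + 1)) = dcoef (card D + card F + 1) (card D)"
  using assms
proof (induction F arbitrary: D rule: finite_induct)
  case empty
  then show ?case by (simp add: dcoef_def)
next
  case (insert x F)
  have "(\<Sum>B\<in>Pow (insert x F). (-1) ^ card (D \<union> B) / of_nat (card (D \<union> B) + 1) :: complex) =
    (\<Sum>B\<in>Pow F. (-1) ^ card (D \<union> B) / of_nat (card (D \<union> B) + 1)) +
    (\<Sum>B\<in>insert x ` Pow F. (-1) ^ card (D \<union> B) / of_nat (card (D \<union> B) + 1))"
    unfolding Pow_insert using insert.hyps by (intro sum.union_disjoint) auto
  also have "(\<Sum>B\<in>insert x ` Pow F. (-1) ^ card (D \<union> B) / of_nat (card (D \<union> B) + 1) :: complex) =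
    (\<Sum>B\<in>Pow F. (-1) ^ card (insert x D \<union> B) / of_nat (card (insert x D \<union> B) + 1))"
    using insert.hyps by (subst sum.reindex) (auto simp: inj_on_def insert_ident)
  also have "(\<Sum>B\<in>Pow F. (-1) ^ card (D \<union> B) / of_nat (card (D \<union> B) + 1)) = dcoef (card D + card F + 1) (card D)"
    using insert.prems by (intro insert.IH) auto
  also have "(\<Sum>B\<in>Pow F. (-1) ^ card (insert x D \<union> B) / of_nat (card (insert x D \<union> B) + 1)) =
    dcoef (card (insert x D) + card F + 1) (card (insert x D))"
    using insert.prems insert.hyps by (intro insert.IH) auto
  also have "dcoef (card D + card F + 1) (card D) + dcoef (card (insert x D) + card F + 1) (card (insert x D)) =
    dcoef (card D + card (insert x F) + 1) (card D)"
  proof -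
    have "dcoef (d + f + 1) d + dcoef (d + f + 2) (d + 1) = dcoef (d + f + 2) d" for d f
    proof -
      have "(of_nat (d + f + 2) :: complex) \<noteq> 0" by (metis add_2_eq_Suc' of_nat_neq_0)
      moreover have "fact (d + f + 2) = (of_nat (d + f + 2) * fact (d + f + 1) :: complex)"
        by (simp add: fact_reduce)
      ultimately show ?thesis
        by (simp add: dcoef_def divide_simps) (simp add: algebra_simps)
    qed
    then show ?thesis using insert.hyps insert.prems by simp
  qed
  finally show ?case .
qed

section \<open>The hyperoctahedral group\<close>

lemma signed_set_iff: "i \<in> signed_set n \<longleftrightarrow> i \<noteq> 0 \<and> \<bar>i\<bar> \<le> int n"
  by (auto simp: signed_set_def)

lemma hyperoct_simps [simp]:
  "x \<otimes>\<^bsub>hyperoct n\<^esub> y = x \<circ> y" "\<one>\<^bsub>hyperoct n\<^esub> = id"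
  by (simp_all add: hyperoct_def)

lemma hyperoct_iff: "w \<in> carrier (hyperoct n) \<longleftrightarrow> w permutes signed_set n \<and> (\<forall>i. w (- i) = - w i)"
  by (simp add: hyperoct_def)

lemma group_hyperoct: "Group.group (hyperoct n)"
proof (rule groupI)
  fix x assume x: "x \<in> carrier (hyperoct n)"
  then have p: "x permutes signed_set n" by (simp add: hyperoct_iff)
  let ?y = "inv_into UNIV x"
  have "?y (- i) = - ?y i" for i
  proof -
    have "x (- ?y i) = - i" using x permutes_inverses(1)[OF p] by (simp add: hyperoct_iff)
    then show ?thesis using permutes_inverses(2)[OF p] by metis
  qed
  then have "?y \<in> carrier (hyperoct n)" using permutes_inv[OF p] by (simp add: hyperoct_iff)
  moreover have "?y \<circ> x = id" using permutes_inv_o(2)[OF p] .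
  ultimately show "\<exists>y\<in>carrier (hyperoct n). y \<otimes>\<^bsub>hyperoct n\<^esub> x = \<one>\<^bsub>hyperoct n\<^esub>"
    by auto
qed (auto simp: hyperoct_iff permutes_compose permutes_id comp_assoc)

locale hyperoctahedral =
  fixes n :: nat
  assumes n_pos: "n \<ge> 1"
begin

sublocale finite_group "hyperoct n"
proof (intro finite_group.intro group_hyperoct finite_group_axioms.intro)
  have "carrier (hyperoct n) \<subseteq> {w. w permutes signed_set n}" by (auto simp: hyperoct_iff)
  then show "finite (carrier (hyperoct n))"
    by (rule finite_subset) (simp add: finite_permutations signed_set_def)
qed

abbreviation hconv (infixl \<open>\<star>\<close> 70) where "a \<star> b \<equiv> a \<otimes>\<^bsub>group_algebra (hyperoct n)\<^esub> b"
abbreviation B where "B \<equiv> carrier (hyperoct n)"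
abbreviation L where "L \<equiv> {1..int n}"
abbreviation ss where "ss \<equiv> signed_set n"
abbreviation S where "S \<equiv> perms_on n L"
abbreviation bi where "bi w \<equiv> inv\<^bsub>hyperoct n\<^esub> w"
abbreviation E where "E \<equiv> {1..int n - 1}"

lemma B_odd: "w \<in> B \<Longrightarrow> w (- i) = - w i"
  by (simp add: hyperoct_iff)

lemma bi_apply [simp]: "w \<in> B \<Longrightarrow> w (bi w i) = i" "w \<in> B \<Longrightarrow> bi w (w i) = i"
proof -
  assume w: "w \<in> B"
  have "w \<circ> bi w = id" "bi w \<circ> w = id" using r_inv[OF w] l_inv[OF w] by simp_all
  then show "w (bi w i) = i" "bi w (w i) = i" by (auto simp: fun_eq_iff)
qed

lemma comp_in_B [simp, intro]: "u \<in> B \<Longrightarrow> v \<in> B \<Longrightarrow> u \<circ> v \<in> B"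
  using m_closed by simp

lemma bi_in_B [simp, intro]: "w \<in> B \<Longrightarrow> bi w \<in> B"
  by (rule inv_closed)

lemma id_in_B [simp, intro]: "id \<in> B"
  using one_closed by simp

lemma bi_comp: "u \<in> B \<Longrightarrow> v \<in> B \<Longrightarrow> bi (u \<circ> v) = bi v \<circ> bi u"
  using inv_mult_group by simp

lemma bi_bi: "u \<in> B \<Longrightarrow> bi (bi u) = u"
  by (rule inv_inv)

lemma bi_id: "bi id = id"
  using inv_one by simp

lemma B_ss [simp]: "w \<in> B \<Longrightarrow> w i \<in> ss \<longleftrightarrow> i \<in> ss"
  by (simp add: hyperoct_iff permutes_in_image)

lemma B_fix: "w \<in> B \<Longrightarrow> i \<notin> ss \<Longrightarrow> w i = i"
  by (metis hyperoct_iff permutes_not_in)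

lemma B_inj: "w \<in> B \<Longrightarrow> w i = w j \<longleftrightarrow> i = j"
  by (metis bi_apply(2))

lemma L_ss: "i \<in> L \<Longrightarrow> i \<in> ss"
  by (simp add: signed_set_iff)

lemma abs_L: "i \<in> ss \<longleftrightarrow> \<bar>i\<bar> \<in> L"
  by (auto simp: signed_set_iff)

lemma B_abs: "w \<in> B \<Longrightarrow> \<bar>w \<bar>i\<bar>\<bar> = \<bar>w i\<bar>"
  by (cases "0 \<le> i") (simp_all add: B_odd[of w "i"])

lemma B_eqI:
  assumes "u \<in> B" "v \<in> B" "\<And>i. i \<in> L \<Longrightarrow> u i = v i"
  shows "u = v"
proof
  fix i
  consider "i \<in> L" | "- i \<in> L" | "i \<notin> ss" by (force simp: signed_set_iff)
  then show "u i = v i"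
  proof cases
    case 2
    then have "u (- i) = v (- i)" by (rule assms(3))
    then show ?thesis using assms(1,2) by (simp add: B_odd)
  qed (use assms in \<open>auto simp: B_fix\<close>)
qed

lemma S_iff: "w \<in> S \<longleftrightarrow> w \<in> B \<and> w ` L = L"
  by (simp add: perms_on_def)

lemma S_B: "w \<in> S \<Longrightarrow> w \<in> B"
  by (simp add: S_iff)

lemma S_L: "w \<in> S \<Longrightarrow> i \<in> L \<Longrightarrow> w i \<in> L"
  by (auto simp: S_iff)

lemma S_I:
  assumes "w \<in> B" "\<And>i. i \<in> L \<Longrightarrow> 0 < w i"
  shows "w \<in> S"
proof -
  have "w i \<in> L" if "i \<in> L" for i
    using assms(2)[OF that] B_ss[OF assms(1), of i] L_ss[OF that] by (auto simp: signed_set_iff)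
  then have "w ` L \<subseteq> L" by blast
  then have "w ` L = L"
    using endo_inj_surj[of L w] B_inj[OF assms(1)] by (auto simp: inj_on_def)
  then show ?thesis using assms(1) by (simp add: S_iff)
qed

lemma S_pos: "w \<in> S \<Longrightarrow> i \<in> ss \<Longrightarrow> 0 < w i \<longleftrightarrow> 0 < i"
proof -
  assume w: "w \<in> S" and i: "i \<in> ss"
  show ?thesis
  proof (cases "0 < i")
    case True
    then have "i \<in> L" using i by (auto simp: signed_set_iff)
    then show ?thesis using S_L[OF w] True by fastforce
  next
    case False
    then have "- i \<in> L" using i by (auto simp: signed_set_iff)
    then show ?thesis using S_L[OF w, of "- i"] False B_odd[OF S_B[OF w]] by auto
  qed
qed

lemma S_comp: "u \<in> S \<Longrightarrow> v \<in> S \<Longrightarrow> u \<circ> v \<in> S"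
proof (rule S_I)
  fix i assume "u \<in> S" "v \<in> S" "i \<in> L"
  then show "0 < (u \<circ> v) i" using S_L[of u "v i"] S_L[of v i] by simp
qed (auto simp: S_B)

lemma S_bi: "u \<in> S \<Longrightarrow> bi u \<in> S"
proof (rule S_I)
  fix i assume u: "u \<in> S" and i: "i \<in> L"
  then have "bi u i \<in> ss" using S_B L_ss by simp
  then show "0 < bi u i" using S_pos[OF u, of "bi u i"] u i by (simp add: S_B)
qed (auto simp: S_B)

lemma id_in_S: "id \<in> S"
  by (auto intro!: S_I)

lemma w0_apply: "w0 n i = (if i \<in> ss then - i else i)"
  using abs_L[of i] by (auto simp: w0_on_def)

lemma w0_on_in_B: "J \<subseteq> L \<Longrightarrow> w0_on J \<in> B"
proof -
  assume J: "J \<subseteq> L"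
  have *: "w0_on J (w0_on J i) = i" for i by (simp add: w0_on_def)
  have "w0_on J permutes ss"
    using J by (intro bij_imp_permutes bij_betw_byWitness[of _ "w0_on J"])
      (auto simp: * w0_on_def abs_L)
  then show ?thesis by (auto simp: hyperoct_iff w0_on_def)
qed

lemma w0_in_B [simp]: "w0 n \<in> B"
  by (rule w0_on_in_B) simp

lemma w0_comm: "w \<in> B \<Longrightarrow> w0 n \<circ> w = w \<circ> w0 n"
  by (auto simp: fun_eq_iff w0_apply B_odd)

lemma w0_w0: "w0 n \<circ> w0 n = id"
  by (auto simp: fun_eq_iff w0_apply signed_set_iff)

lemma bi_w0: "bi (w0 n) = w0 n"
  using inv_equality[of "w0 n" "w0 n"] by (simp add: w0_w0)

lemma w0_w0': "w \<circ> w0 n \<circ> w0 n = w"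
  by (simp add: comp_assoc w0_w0)

lemma w0_neg: "w \<in> B \<Longrightarrow> i \<in> ss \<Longrightarrow> (w \<circ> w0 n) i = - w i"
  by (simp add: w0_apply B_odd)

lemma w0_notin_S: "w \<in> S \<Longrightarrow> w \<circ> w0 n \<notin> S"
  using n_pos S_pos[of w 1] S_pos[of "w \<circ> w0 n" 1] w0_neg[OF S_B, of w 1]
  by (auto simp: signed_set_iff)

lemma odd_extension_in_S:
  assumes f: "f permutes L"
  shows "odd_extension f \<in> S" "\<And>i. i \<in> L \<Longrightarrow> odd_extension f i = f i"
proof -
  let ?w = "odd_extension f"
  have fL: "f i \<in> L \<longleftrightarrow> i \<in> L" for i by (rule permutes_in_image[OF f])
  have fo: "f i = i" if "i \<notin> L" for i by (rule permutes_not_in[OF f that])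
  have w: "?w i = (if i < 0 then - f (- i) else f i)" for i by (simp add: odd_extension_def)
  have odd: "?w (- i) = - ?w i" for i using fo[of 0] by (auto simp: w)
  have pos: "0 < ?w i \<longleftrightarrow> 0 < i" for i
    using fL[of i] fo[of i] fL[of "- i"] fo[of "- i"] by (auto simp: w)
  have inj: "inj ?w"
  proof (rule injI)
    fix i j assume eq: "?w i = ?w j"
    have "i < 0 \<longleftrightarrow> j < 0" using pos[of "- i"] pos[of "- j"] eq by (simp add: odd)
    then show "i = j" using eq by (auto simp: w split: if_splits dest: injD[OF permutes_inj[OF f]])
  qed
  have ss: "?w i \<in> ss" if "i \<in> ss" for i
  proof -
    have "f \<bar>i\<bar> \<in> L" using that fL abs_L by blast
    then show ?thesis by (cases "i < 0") (auto simp: w signed_set_iff)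
  qed
  have "?w permutes ss"
  proof (rule bij_imp_permutes)
    have i: "inj_on ?w ss" using inj inj_on_subset by blast
    have "?w ` ss = ss"
    proof (rule endo_inj_surj[OF _ _ i])
      show "finite ss" by (simp add: signed_set_def)
      show "?w ` ss \<subseteq> ss" using ss by blast
    qed
    then show "bij_betw ?w ss ss" using i by (simp add: bij_betw_def)
    fix i assume "i \<notin> ss"
    then show "?w i = i" using fo[of i] fo[of "- i"] by (auto simp: w signed_set_iff)
  qed
  then have "?w \<in> B" using odd by (simp add: hyperoct_iff)
  then show "?w \<in> S" using pos by (intro S_I) auto
  show "?w i = f i" if "i \<in> L" for i using that by (simp add: w)
qed

text \<open>\<open>bi \<tau>\<close> is the rank function of \<open>y\<close>, so \<tau> lists the
  letters by increasing value of \<open>y\<close>.\<close>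

lemma sorting_exists:
  fixes y :: "int \<Rightarrow> real"
  assumes inj: "inj_on y L"
  obtains \<tau> where "\<tau> \<in> S" "\<And>i j. i \<in> L \<Longrightarrow> j \<in> L \<Longrightarrow> bi \<tau> i < bi \<tau> j \<longleftrightarrow> y i < y j"
proof -
  define rk where "rk i = (if i \<in> L then int (card {j \<in> L. y j \<le> y i}) else i)" for i
  have less: "rk i < rk j" if "i \<in> L" "j \<in> L" "y i < y j" for i j
  proof -
    have "j \<in> {k \<in> L. y k \<le> y j}" "j \<notin> {k \<in> L. y k \<le> y i}" using that by auto
    moreover have "{k \<in> L. y k \<le> y i} \<subseteq> {k \<in> L. y k \<le> y j}" using that by auto
    ultimately have "{k \<in> L. y k \<le> y i} \<subset> {k \<in> L. y k \<le> y j}" by blast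
    moreover have "finite {k \<in> L. y k \<le> y j}" by (rule finite_subset[of _ L]) auto
    ultimately have "card {k \<in> L. y k \<le> y i} < card {k \<in> L. y k \<le> y j}" by (rule psubset_card_mono[rotated])
    then show ?thesis using that by (simp add: rk_def)
  qed
  have iff: "rk i < rk j \<longleftrightarrow> y i < y j" if "i \<in> L" "j \<in> L" for i j
    using less[OF that] less[OF that(2,1)] inj_onD[OF inj _ that]
    by (cases "y i" "y j" rule: linorder_cases) auto
  have rkL: "rk i \<in> L" if "i \<in> L" for i
  proof -
    have "{j \<in> L. y j \<le> y i} \<noteq> {}" using that by blast
    moreover have "finite {j \<in> L. y j \<le> y i}" by (rule finite_subset[of _ L]) auto
    ultimately have "0 < card {j \<in> L. y j \<le> y i}" by (metis card_gt_0_iff)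
    moreover have "card {j \<in> L. y j \<le> y i} \<le> card L" by (rule card_mono) auto
    ultimately show ?thesis using that by (simp add: rk_def)
  qed
  have inj_rk: "inj_on rk L"
  proof (rule inj_onI)
    fix i j assume ij: "i \<in> L" "j \<in> L" "rk i = rk j"
    then have "\<not> y i < y j" "\<not> y j < y i"
      using iff[OF ij(1,2)] iff[OF ij(2,1)] by simp_all
    then show "i = j" using ij inj_onD[OF inj] by (metis linorder_neq_iff)
  qed
  moreover have "rk ` L = L"
    using rkL by (intro endo_inj_surj[OF _ _ inj_rk]) blast+
  ultimately have "bij_betw rk L L" by (simp add: bij_betw_def)
  then have "rk permutes L"
    by (rule bij_imp_permutes) (auto simp: rk_def)
  note w = odd_extension_in_S[OF this]
  show ?thesis
    using w iff by (intro that[of "bi (odd_extension rk)"]) (simp_all add: S_bi bi_bi S_B)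
qed

text \<open>Without descents \<open>w\<close> increases on \<open>L\<close>: induction upwards from
  1 gives \<open>i \<le> w i\<close>, downwards from \<open>n\<close> the reverse.\<close>

lemma increasing_id:
  assumes w: "w \<in> S" and d: "descents L w = {}"
  shows "w = id"
proof -
  have incr: "w i < w (i + 1)" if "i \<in> L" "i + 1 \<in> L" for i
    using d that B_inj[OF S_B[OF w], of i "i + 1"] by (force simp: descents_def)
  have lb: "i \<le> w i" if "i \<in> L" for i
  proof -
    have "1 \<le> i" using that by simp
    then show ?thesis using that
    proof (induction i rule: int_ge_induct)
      case base
      then show ?case using S_L[OF w, of 1] by simp
    next
      case (step i)
      then show ?case using incr[of i] by simp
    qed
  qed
  have ub: "w i \<le> i" if "i \<in> L" for i
  proof -
    have "i \<le> int n" using that by simp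
    then show ?thesis using that
    proof (induction i rule: int_le_induct)
      case base
      then show ?case using S_L[OF w, of "int n"] by simp
    next
      case (step i)
      then show ?case using incr[of "i - 1"] by simp
    qed
  qed
  show ?thesis using lb ub S_B[OF w] by (intro B_eqI) (auto intro: antisym)
qed

lemma E_alt: "{i. i \<in> L \<and> i + 1 \<in> L} = E"
  by auto

lemma descents_E: "descents L w \<subseteq> E"
  by (auto simp: descents_def)

text \<open>The coefficient of \<open>w\<close> collects the sets \<open>A\<close> containing its
  descent set, which is the sum evaluated in \<open>sum_supersets\<close>.\<close>

lemma r_elt_eq:
  "r_elt n L w = (if w \<in> S then dcoef n (card (descents L w)) else 0)"
proof (cases "w \<in> S")
  case True
  let ?D = "descents L w"
  have D: "?D \<subseteq> E" "finite ?D" using descents_E[of w] finite_subset[of ?D E] by auto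
  have "r_elt n L w = (\<Sum>A\<in>Pow E. if ?D \<subseteq> A then (-1) ^ card A / of_nat (card A + 1) else 0)"
    unfolding r_elt_def E_alt X_sum_def using True by (intro sum.cong) auto
  also have "\<dots> = (\<Sum>A\<in>{A \<in> Pow E. ?D \<subseteq> A}. (-1) ^ card A / of_nat (card A + 1))"
    by (rule sum.inter_filter[symmetric]) simp
  also have "\<dots> = (\<Sum>A\<in>Pow (E - ?D). (-1) ^ card (?D \<union> A) / of_nat (card (?D \<union> A) + 1))"
    using D(1) by (intro sum.reindex_bij_witness[of _ "\<lambda>A. ?D \<union> A" "\<lambda>A. A - ?D"]) (auto simp: Un_absorb1)
  also have "\<dots> = dcoef (card ?D + card (E - ?D) + 1) (card ?D)"
    using D by (intro sum_supersets) auto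
  also have "card ?D + card (E - ?D) + 1 = n"
    using D card_mono[of E ?D] n_pos by (simp add: card_Diff_subset)
  finally show ?thesis using True by simp
qed (simp add: r_elt_def X_sum_def)

text \<open>The image of \<open>\<epsilon>\<^sup>\<plusminus> r\<close> under inversion of group elements.\<close>

definition prim :: "int \<Rightarrow> (int \<Rightarrow> int) \<Rightarrow> complex" where
  "prim s w = (if w \<in> B then (r_elt n L (bi w) + of_int s * r_elt n L (w0 n \<circ> bi w)) / 2 else 0)"

text \<open>Coordinate \<open>k\<close> of the base point with \<open>x_i = i\<close>, barred
  letters included: for \<open>k = -i\<close> it is \<open>-1/i\<close>. Coordinate \<open>i\<close>
  of the point chosen in the component of \<open>w\<close> is \<open>cval (bi w i)\<close>.\<close>

definition cval :: "int \<Rightarrow> real" where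
  "cval k = (if 0 < k then real_of_int k else 1 / real_of_int k)"

text \<open>Functions that only see the signs and the relative order of letters within \<open>p\<close> and
  within its complement; on words they are the combinations of shuffles of the two parts.\<close>

definition split_fun :: "int set \<Rightarrow> ((int \<Rightarrow> int) \<Rightarrow> complex) \<Rightarrow> bool" where
  "split_fun p h \<longleftrightarrow> (\<forall>\<sigma>\<in>B. \<forall>\<tau>\<in>B.
     (\<forall>i\<in>ss. 0 < bi \<sigma> i \<longleftrightarrow> 0 < bi \<tau> i) \<and>
     (\<forall>i\<in>ss. \<forall>j\<in>ss. (\<bar>i\<bar> \<in> p \<longleftrightarrow> \<bar>j\<bar> \<in> p) \<longrightarrow>
        (cval (bi \<sigma> i) < cval (bi \<sigma> j) \<longleftrightarrow> cval (bi \<tau> i) < cval (bi \<tau> j))) \<longrightarrow> h \<sigma> = h \<tau>)"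

lemma split_funD:
  assumes "split_fun p h" "\<sigma> \<in> B" "\<tau> \<in> B"
    and "\<And>i. i \<in> ss \<Longrightarrow> 0 < bi \<sigma> i \<longleftrightarrow> 0 < bi \<tau> i"
    and "\<And>i j. i \<in> ss \<Longrightarrow> j \<in> ss \<Longrightarrow> (\<bar>i\<bar> \<in> p \<longleftrightarrow> \<bar>j\<bar> \<in> p) \<Longrightarrow>
      cval (bi \<sigma> i) < cval (bi \<sigma> j) \<longleftrightarrow> cval (bi \<tau> i) < cval (bi \<tau> j)"
  shows "h \<sigma> = h \<tau>"
  by (rule assms(1)[unfolded split_fun_def, THEN bspec, OF assms(2), THEN bspec, OF assms(3), THEN mp])
    (intro conjI ballI impI assms(4,5))

lemma cval_pos: "i \<in> ss \<Longrightarrow> 0 < cval i \<longleftrightarrow> 0 < i"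
  by (auto simp: cval_def signed_set_iff)

text \<open>The resulting order is \<open>-1 < -2 < ... < -n < 1 < 2 < ... < n\<close>: within each
  sign, absolute values increase.\<close>

lemma cval_less:
  "i \<in> ss \<Longrightarrow> j \<in> ss \<Longrightarrow> cval i < cval j \<longleftrightarrow>
    (if 0 < i then 0 < j \<and> i < j else 0 < j \<or> - i < - j)"
proof -
  assume "i \<in> ss" "j \<in> ss"
  then have nz: "i \<noteq> 0" "j \<noteq> 0" by (auto simp: signed_set_iff)
  have neg: "1 / real_of_int i < 1 / real_of_int j \<longleftrightarrow> j < i" if "i < 0" "j < 0"
    using that by (simp add: divide_simps) 
  have lt0: "1 / real_of_int k < 0" if "k < 0" for k using that by simp
  show ?thesis
  proof (cases "0 < i")
    case True
    have "\<not> real_of_int i < 1 / real_of_int j" if "j < 0"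
      using lt0[OF that] True by linarith
    then show ?thesis using True nz by (cases "0 < j") (auto simp: cval_def)
  next
    case False
    then have "1 / real_of_int i < real_of_int j" if "0 < j"
      using lt0[of i] nz that by linarith
    then show ?thesis using False neg nz by (cases "0 < j") (auto simp: cval_def)
  qed
qed

section \<open>Permutations as words, and the annihilation of split functions\<close>

lemma des_map_upto: "des (map f [a..b]) = card {i \<in> {a..<b}. f (i + 1) < (f i :: int)}"
proof (induction "nat (b - a)" arbitrary: a)
  case 0
  then have "b \<le> a" by simp
  then have "des (map f [a..b]) = 0" "{i \<in> {a..<b}. f (i + 1) < f i} = {}"
    by (auto simp: upto.simps)
  then show ?case by (simp only: card.empty)
next
  case (Suc m)
  then have ab: "a < b" by simp
  then have "map f [a..b] = f a # map f [a + 1..b]" "map f [a + 1..b] = f (a + 1) # map f [a + 2..b]"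
    using upto.simps[of a b] upto.simps[of "a + 1" b] by (auto simp: algebra_simps)
  then have "des (map f [a..b]) = (if f (a + 1) < f a then 1 else 0) + des (map f [a + 1..b])"
    by simp
  also have "des (map f [a + 1..b]) = card {i \<in> {a + 1..<b}. f (i + 1) < f i}"
    using Suc by (intro Suc.hyps(1)) simp
  also have "(if f (a + 1) < f a then 1 else 0) + \<dots> = card {i \<in> {a..<b}. f (i + 1) < f i}"
  proof -
    define X where "X = {i \<in> {a + 1..<b}. f (i + 1) < f i}"
    have "{i \<in> {a..<b}. f (i + 1) < f i} = (if f (a + 1) < f a then insert a X else X)"
      using ab by (auto simp: order_le_less X_def)
    moreover have "finite X" "a \<notin> X" by (auto simp: X_def intro: finite_subset[of _ "{a..b}"])
    ultimately show ?thesis unfolding X_def[symmetric] by simp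
  qed
  finally show ?case .
qed

lemma des_word: "des (map w [1..int n]) = card (descents L w)"
  unfolding des_map_upto descents_def by (rule arg_cong[of _ _ card]) auto

lemma bij_word: "bij_betw (\<lambda>w. map w [1..int n]) S {xs. distinct xs \<and> set xs = L}"
  unfolding bij_betw_def
proof
  show "inj_on (\<lambda>w. map w [1..int n]) S"
    by (rule inj_onI) (auto intro: B_eqI simp: S_B)
  show "(\<lambda>w. map w [1..int n]) ` S = {xs. distinct xs \<and> set xs = L}"
  proof (intro equalityI subsetI)
    fix xs assume "xs \<in> (\<lambda>w. map w [1..int n]) ` S"
    then show "xs \<in> {xs. distinct xs \<and> set xs = L}"
      by (auto simp: distinct_map inj_on_def B_inj S_B S_iff)
  next
    fix xs assume "xs \<in> {xs. distinct xs \<and> set xs = L}"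
    then have xs: "distinct xs" "set xs = L" "length xs = n"
      using distinct_card[of xs] by auto
    define f where "f i = (if i \<in> L then xs ! nat (i - 1) else i)" for i
    have "inj_on f L"
      using xs by (auto simp: inj_on_def f_def nth_eq_iff_index_eq)
    moreover have "f ` L \<subseteq> L"
      using xs nth_mem[of _ xs] by (auto simp: f_def)
    ultimately have "f ` L = L" by (intro endo_inj_surj) auto
    then have "bij_betw f L L" using \<open>inj_on f L\<close> by (simp add: bij_betw_def)
    then have "f permutes L" by (rule bij_imp_permutes) (auto simp: f_def)
    note w = odd_extension_in_S[OF this]
    have "map (odd_extension f) [1..int n] = xs"
    proof (rule nth_equalityI)
      fix k assume "k < length (map (odd_extension f) [1..int n])"
      then have k: "k < n" by simp
      then have "1 + int k \<in> L" by auto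
      then have "odd_extension f (1 + int k) = f (1 + int k)" using w(2) by blast
      also have "\<dots> = xs ! k" using \<open>1 + int k \<in> L\<close> by (simp add: f_def)
      finally show "map (odd_extension f) [1..int n] ! k = xs ! k" using k by simp
    qed (simp add: xs)
    then show "xs \<in> (\<lambda>w. map w [1..int n]) ` S" using w(1) by force
  qed
qed

lemma sorted_word: "w \<in> S \<Longrightarrow> sorted_wrt (\<lambda>x y. bi w x < bi w y) (map w [1..int n])"
  by (simp add: sorted_wrt_map S_B sorted_wrt_iff_nth_less)

text \<open>The sum runs over words \<pi> in the positive letters, and
  \<open>\<sigma> \<circ> \<pi>\<close> replaces each letter \<open>x\<close> by
  \<open>\<sigma> x\<close>. The signs then depend on \<sigma> alone; whatever else \<open>h\<close>
  sees is determined by the two subwords of letters with \<open>\<bar>\<sigma> x\<bar>\<close>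
  inside and outside \<open>p\<close>, so \<open>sum_words_dcoef\<close> applies.\<close>

lemma split_sum_zero:
  assumes p: "a \<in> L" "a \<in> p" "b \<in> L" "b \<notin> p" and h: "split_fun p h" and \<sigma>: "\<sigma> \<in> B"
  shows "(\<Sum>\<pi>\<in>S. h (\<sigma> \<circ> \<pi>) * r_elt n L \<pi>) = 0"
proof -
  let ?wd = "\<lambda>w. map w [1..int n]"
  define g where "g = inv_into S ?wd"
  have g: "g xs \<in> S" "?wd (g xs) = xs" if "distinct xs" "set xs = L" for xs
    using that bij_betw_apply[OF bij_betw_inv_into[OF bij_word], of xs]
      bij_betw_inv_into_right[OF bij_word, of xs] by (simp_all add: g_def)
  have "(\<Sum>\<pi>\<in>S. h (\<sigma> \<circ> \<pi>) * r_elt n L \<pi>) =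
    (\<Sum>\<pi>\<in>S. h (\<sigma> \<circ> g (?wd \<pi>)) * dcoef n (des (?wd \<pi>)))"
    by (intro sum.cong refl) (simp add: r_elt_eq des_word g_def bij_betw_inv_into_left[OF bij_word])
  also have "\<dots> = (\<Sum>xs | distinct xs \<and> set xs = L. h (\<sigma> \<circ> g xs) * dcoef (card L) (des xs))"
    using sum.reindex_bij_betw[OF bij_word, of "\<lambda>xs. h (\<sigma> \<circ> g xs) * dcoef (card L) (des xs)"] by simp
  also have "\<dots> = 0"
  proof (rule sum_words_dcoef[where P = "\<lambda>x. \<bar>\<sigma> x\<bar> \<in> p" and x = "\<bar>bi \<sigma> a\<bar>" and y = "\<bar>bi \<sigma> b\<bar>"])
    have "bi \<sigma> a \<in> ss" "bi \<sigma> b \<in> ss" using p L_ss \<sigma> by simp_all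
    then show "\<bar>bi \<sigma> a\<bar> \<in> L" "\<bar>bi \<sigma> b\<bar> \<in> L" using abs_L by blast+
    show "\<bar>\<sigma> \<bar>bi \<sigma> a\<bar>\<bar> \<in> p" "\<not> \<bar>\<sigma> \<bar>bi \<sigma> b\<bar>\<bar> \<in> p" using p \<sigma> by (simp_all add: B_abs)
  next
    fix xs ys :: "int list"
    let ?P = "\<lambda>x. \<bar>\<sigma> x\<bar> \<in> p"
    assume xs: "distinct xs" "set xs = L" and ys: "distinct ys" "set ys = L"
      and eq: "filter ?P xs = filter ?P ys" "filter (\<lambda>x. \<not> ?P x) xs = filter (\<lambda>x. \<not> ?P x) ys"
    note x = g[OF xs] and y = g[OF ys]
    have ord: "bi (g xs) k < bi (g xs) l \<longleftrightarrow> bi (g ys) k < bi (g ys) l"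
      if "k \<in> L" "l \<in> L" "?P k \<longleftrightarrow> ?P l" for k l
    proof -
      have sx: "sorted_wrt (\<lambda>x y. bi (g xs) x < bi (g xs) y) (filter Q xs)" for Q
        using sorted_wrt_filter[OF sorted_word[OF x(1)], of Q] unfolding x(2) .
      have sy: "sorted_wrt (\<lambda>x y. bi (g ys) x < bi (g ys) y) (filter Q ys)" for Q
        using sorted_wrt_filter[OF sorted_word[OF y(1)], of Q] unfolding y(2) .
      show ?thesis
      proof (cases "?P k")
        case True
        then show ?thesis
          using that xs ys sorted_wrt_key_eq[OF sx[of ?P], of "bi (g ys)" k l] sy[of ?P] eq by simp
      next
        case False
        then show ?thesis
          using that xs ys sorted_wrt_key_eq[OF sx[of "\<lambda>x. \<not> ?P x"], of "bi (g ys)" k l]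
            sy[of "\<lambda>x. \<not> ?P x"] eq by simp
      qed
    qed
    have bx: "bi (\<sigma> \<circ> g xs) i = bi (g xs) (bi \<sigma> i)" and by': "bi (\<sigma> \<circ> g ys) i = bi (g ys) (bi \<sigma> i)" for i
      using \<sigma> x(1) y(1) by (simp_all add: bi_comp S_B)
    have pos: "0 < bi (g zs) i \<longleftrightarrow> 0 < i" if "i \<in> ss" "g zs \<in> S" for i zs
      using S_pos[OF S_bi[OF that(2)] that(1)] .
    show "h (\<sigma> \<circ> g xs) = h (\<sigma> \<circ> g ys)"
    proof (rule split_funD[OF h])
      fix i assume "i \<in> ss"
      then show "0 < bi (\<sigma> \<circ> g xs) i \<longleftrightarrow> 0 < bi (\<sigma> \<circ> g ys) i"
        using pos[of "bi \<sigma> i"] x y \<sigma> by (simp add: bx by')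
    next
      fix i j assume ij: "i \<in> ss" "j \<in> ss" "\<bar>i\<bar> \<in> p \<longleftrightarrow> \<bar>j\<bar> \<in> p"
      let ?k = "bi \<sigma> i" and ?l = "bi \<sigma> j"
      have kl: "?k \<in> ss" "?l \<in> ss" using ij \<sigma> by simp_all
      have "?P \<bar>?k\<bar> \<longleftrightarrow> ?P \<bar>?l\<bar>" using ij(3) \<sigma> by (simp add: B_abs)
      \<comment> \<open>Absolute values suffice: by \<open>cval_less\<close>, letters of different
        sign compare by sign alone and letters of equal sign by absolute value.\<close>
      then have o: "bi (g xs) \<bar>?k\<bar> < bi (g xs) \<bar>?l\<bar> \<longleftrightarrow> bi (g ys) \<bar>?k\<bar> < bi (g ys) \<bar>?l\<bar>"
        using kl abs_L by (intro ord) blast+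
      have ng: "bi (g zs) \<bar>i\<bar> = (if 0 < i then bi (g zs) i else - bi (g zs) i)" if "g zs \<in> S" for zs i
        using that B_odd[of "bi (g zs)" i] by (auto simp: S_B)
      show "cval (bi (\<sigma> \<circ> g xs) i) < cval (bi (\<sigma> \<circ> g xs) j) \<longleftrightarrow>
        cval (bi (\<sigma> \<circ> g ys) i) < cval (bi (\<sigma> \<circ> g ys) j)"
        using o ng[OF x(1)] ng[OF y(1)] pos[OF kl(1) x(1)] pos[OF kl(2) x(1)] pos[OF kl(1) y(1)]
          pos[OF kl(2) y(1)] kl x(1) y(1)
        by (simp add: bx by' cval_less S_B split: if_splits)
    qed (use \<sigma> x(1) y(1) in \<open>auto simp: S_B\<close>)
  qed simp
  finally show ?thesis .
qed

text \<open>The coefficient at \<sigma> is half of the sum in \<open>split_sum_zero\<close> at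
  \<sigma>, plus \<open>s\<close> times half of the one at
  \<open>\<sigma> \<circ> w0 n\<close>.\<close>

lemma split_conv_zero:
  assumes p: "a \<in> L" "a \<in> p" "b \<in> L" "b \<notin> p" and h: "split_fun p h"
  shows "h \<star> prim s = (\<lambda>_. 0)"
proof (rule GA_eqI)
  fix \<sigma> assume \<sigma>: "\<sigma> \<in> B"
  have sum: "(\<Sum>\<tau>\<in>B. h \<tau> * r_elt n L (bi \<sigma> \<circ> \<tau>)) = 0" if \<sigma>: "\<sigma> \<in> B" for \<sigma>
  proof -
    have "(\<Sum>\<tau>\<in>B. h \<tau> * r_elt n L (bi \<sigma> \<circ> \<tau>)) = (\<Sum>\<pi>\<in>B. h (\<sigma> \<circ> \<pi>) * r_elt n L (bi \<sigma> \<circ> (\<sigma> \<circ> \<pi>)))"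
      using sum.reindex_bij_betw[OF bij_lmult[OF \<sigma>], of "\<lambda>\<tau>. h \<tau> * r_elt n L (bi \<sigma> \<circ> \<tau>)"] by simp
    also have "\<dots> = (\<Sum>\<pi>\<in>B. h (\<sigma> \<circ> \<pi>) * r_elt n L \<pi>)"
      using \<sigma> by (intro sum.cong refl) (simp add: comp_def)
    also have "\<dots> = (\<Sum>\<pi>\<in>S. h (\<sigma> \<circ> \<pi>) * r_elt n L \<pi>)"
      using fin by (intro sum.mono_neutral_right) (auto simp: S_B r_elt_eq)
    finally show ?thesis using split_sum_zero[OF p h \<sigma>] by simp
  qed
  have "(h \<star> prim s) \<sigma> = (\<Sum>\<tau>\<in>B. h \<tau> * prim s (bi \<tau> \<circ> \<sigma>))"
    using conv_apply[OF \<sigma>] by simp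
  also have "\<dots> = (\<Sum>\<tau>\<in>B. (h \<tau> * r_elt n L (bi \<sigma> \<circ> \<tau>) +
      of_int s * (h \<tau> * r_elt n L (bi (\<sigma> \<circ> w0 n) \<circ> \<tau>))) / 2)"
    using \<sigma> by (intro sum.cong refl) (simp add: prim_def bi_comp bi_bi bi_w0 comp_assoc algebra_simps add_divide_distrib)
  also have "\<dots> = 0"
    using sum[OF \<sigma>] sum[of "\<sigma> \<circ> w0 n"] \<sigma>
    by (simp add: sum.distrib add_divide_distrib flip: sum_divide_distrib sum_distrib_left)
  finally show "(h \<star> prim s) \<sigma> = 0" .
qed (simp_all add: GA_zero)

text \<open>\<open>bi \<sigma> (u i)\<close> is the position of the letter \<open>u i\<close> in the
  word \<sigma>. These are therefore the shuffles of the blocks into which the word \<open>u\<close>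
  is cut after the positions in \<open>A\<close>, with the signs of \<open>u\<close> kept.\<close>

definition Mset :: "(int \<Rightarrow> int) \<Rightarrow> int set \<Rightarrow> (int \<Rightarrow> int) set" where
  "Mset u A = {\<sigma> \<in> B. bi \<sigma> \<circ> u \<in> S \<and> descents L (bi \<sigma> \<circ> u) \<subseteq> A}"

abbreviation ind :: "(int \<Rightarrow> int) set \<Rightarrow> (int \<Rightarrow> int) \<Rightarrow> complex" where
  "ind X \<equiv> (\<lambda>\<sigma>. of_bool (\<sigma> \<in> X))"

text \<open>A translate of \<open>prim s\<close> expanded in shuffle indicators. In
  \<open>prim_idem\<close> and again in \<open>kernel_span\<close> the term \<open>A = {}\<close> is
  the main one and the others drop out.\<close>

lemma dl_prim:
  assumes "u \<in> B" "v \<in> B"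
  shows "(dl u \<star> prim s) v = (\<Sum>A\<in>Pow E. (-1) ^ card A / of_nat (card A + 1) *
    (ind (Mset u A) v + of_int s * ind (Mset (u \<circ> w0 n) A) v)) / 2"
proof -
  have "(dl u \<star> prim s) v = prim s (bi u \<circ> v)"
    using assms dl_conv by simp
  also have "\<dots> = (r_elt n L (bi v \<circ> u) + of_int s * r_elt n L (bi v \<circ> (u \<circ> w0 n))) / 2"
    using assms w0_comm[of "bi v \<circ> u"] by (simp add: prim_def bi_comp bi_bi comp_assoc)
  also have "\<dots> = (\<Sum>A\<in>Pow E. (-1) ^ card A / of_nat (card A + 1) *
    (ind (Mset u A) v + of_int s * ind (Mset (u \<circ> w0 n) A) v)) / 2"
    using assms unfolding r_elt_def E_alt X_sum_def Mset_def
    by (simp add: sum.distrib sum_distrib_left algebra_simps)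
  finally show ?thesis .
qed

text \<open>An uncut word has no shuffle but itself.\<close>

lemma Mset_empty: "u \<in> B \<Longrightarrow> Mset u {} = {u}"
proof (intro equalityI subsetI)
  fix \<sigma> assume u: "u \<in> B" and "\<sigma> \<in> Mset u {}"
  then have \<sigma>: "\<sigma> \<in> B" "bi \<sigma> \<circ> u = id" using increasing_id by (auto simp: Mset_def)
  then have "bi \<sigma> (u i) = i" for i by (metis comp_apply id_apply)
  then have "u i = \<sigma> i" for i using \<sigma>(1) by (metis bi_apply(1))
  then show "\<sigma> \<in> {u}" by auto
next
  fix \<sigma> assume "u \<in> B" "\<sigma> \<in> {u}"
  moreover have "bi u \<circ> u = id" if "u \<in> B" using l_inv[OF that] by simp
  ultimately show "\<sigma> \<in> Mset u {}" using id_in_S by (auto simp: Mset_def descents_def)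
qed

lemma comp_S_iff: "\<sigma> \<in> B \<Longrightarrow> u \<in> B \<Longrightarrow> bi \<sigma> \<circ> u \<in> S \<longleftrightarrow> (\<forall>i\<in>L. 0 < bi \<sigma> (u i))"
  using S_I[of "bi \<sigma> \<circ> u"] S_L[of "bi \<sigma> \<circ> u"] by force

text \<open>A function that ignores whether \<open>u a\<close> and \<open>u (a + 1)\<close> are in
  order is split: take for \<open>p\<close> the absolute values in the prefix
  \<open>u 1, ..., u a\<close>. All other neighbours in \<open>u\<close> lie on the same side of
  \<open>p\<close>.\<close>

lemma split_prefix:
  assumes u: "u \<in> B" and a: "a \<in> E"
    and h: "\<And>\<sigma> \<tau>. \<sigma> \<in> B \<Longrightarrow> \<tau> \<in> B \<Longrightarrow> (bi \<sigma> \<circ> u \<in> S \<longleftrightarrow> bi \<tau> \<circ> u \<in> S) \<Longrightarrow>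
      (bi \<sigma> \<circ> u \<in> S \<Longrightarrow> \<forall>i\<in>E - {a}. i \<in> descents L (bi \<sigma> \<circ> u) \<longleftrightarrow> i \<in> descents L (bi \<tau> \<circ> u)) \<Longrightarrow> h \<sigma> = h \<tau>"
  shows "h \<star> prim s = (\<lambda>_. 0)"
proof (rule split_conv_zero)
  define p where "p = (\<lambda>i. \<bar>u i\<bar>) ` {1..a}"
  have absu: "\<bar>u i\<bar> \<in> p \<longleftrightarrow> i \<le> a" if "i \<in> L" for i
  proof
    assume "\<bar>u i\<bar> \<in> p"
    then obtain j where j: "j \<in> {1..a}" "\<bar>u i\<bar> = \<bar>u j\<bar>" by (auto simp: p_def)
    then have "u i = u j \<or> u i = u (- j)" using u by (auto simp: B_odd)
    then have "i = j \<or> i = - j" using B_inj[OF u] by blast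
    then show "i \<le> a" using j that by auto
  qed (use that in \<open>auto simp: p_def\<close>)
  have u1: "\<bar>u i\<bar> \<in> L" if "i \<in> L" for i
    using iffD1[OF abs_L, of "u i"] B_ss[OF u, of i] L_ss[OF that] by blast
  show "\<bar>u 1\<bar> \<in> L" "\<bar>u 1\<bar> \<in> p" "\<bar>u (a + 1)\<bar> \<in> L" "\<bar>u (a + 1)\<bar> \<notin> p"
    using u1[of 1] u1[of "a + 1"] absu[of 1] absu[of "a + 1"] a by auto
  show "split_fun p h"
    unfolding split_fun_def
  proof (intro ballI impI)
    fix \<sigma> \<tau> assume st: "\<sigma> \<in> B" "\<tau> \<in> B"
    assume st': "(\<forall>i\<in>ss. 0 < bi \<sigma> i \<longleftrightarrow> 0 < bi \<tau> i) \<and>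
     (\<forall>i\<in>ss. \<forall>j\<in>ss. (\<bar>i\<bar> \<in> p \<longleftrightarrow> \<bar>j\<bar> \<in> p) \<longrightarrow>
        (cval (bi \<sigma> i) < cval (bi \<sigma> j) \<longleftrightarrow> cval (bi \<tau> i) < cval (bi \<tau> j)))"
    have pos: "0 < bi \<sigma> i \<longleftrightarrow> 0 < bi \<tau> i" if "i \<in> ss" for i
      using conjunct1[OF st'] that by (rule bspec)
    have ord: "cval (bi \<sigma> i) < cval (bi \<sigma> j) \<longleftrightarrow> cval (bi \<tau> i) < cval (bi \<tau> j)"
      if "i \<in> ss" "j \<in> ss" "\<bar>i\<bar> \<in> p \<longleftrightarrow> \<bar>j\<bar> \<in> p" for i j
      by (rule conjunct2[OF st', THEN bspec, OF that(1), THEN bspec, OF that(2), THEN mp, OF that(3)])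
    have uss: "u i \<in> ss" if "i \<in> L" for i using that u L_ss by simp
    have S_eq: "bi \<sigma> \<circ> u \<in> S \<longleftrightarrow> bi \<tau> \<circ> u \<in> S"
      unfolding comp_S_iff[OF st(1) u] comp_S_iff[OF st(2) u]
      by (rule ball_cong[OF refl], rule pos, rule uss)
    show "h \<sigma> = h \<tau>"
    proof (rule h[OF st S_eq], intro ballI)
      fix i assume S1: "bi \<sigma> \<circ> u \<in> S" and i: "i \<in> E - {a}"
      then have S2: "bi \<tau> \<circ> u \<in> S" using S_eq by simp
      have iL: "i \<in> L" "i + 1 \<in> L" using i by auto
      have "\<bar>u i\<bar> \<in> p \<longleftrightarrow> \<bar>u (i + 1)\<bar> \<in> p" using absu[OF iL(1)] absu[OF iL(2)] i by auto
      then have "cval (bi \<sigma> (u (i + 1))) < cval (bi \<sigma> (u i)) \<longleftrightarrow> cval (bi \<tau> (u (i + 1))) < cval (bi \<tau> (u i))"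
        using ord uss iL by simp
      moreover have "0 < bi \<sigma> (u i)" "0 < bi \<sigma> (u (i + 1))" "0 < bi \<tau> (u i)" "0 < bi \<tau> (u (i + 1))"
        using S1 S2 iL st u by (auto simp: comp_S_iff)
      ultimately show "i \<in> descents L (bi \<sigma> \<circ> u) \<longleftrightarrow> i \<in> descents L (bi \<tau> \<circ> u)"
        using iL by (simp add: descents_def cval_def)
    qed
  qed
qed

text \<open>At a cut \<open>a\<close> in \<open>A\<close> a descent is allowed but not demanded, so
  membership does not depend on it.\<close>

lemma Mset_kill:
  assumes "u \<in> B" "A \<subseteq> E" "A \<noteq> {}"
  shows "ind (Mset u A) \<star> prim s = (\<lambda>_. 0)"
proof -
  obtain a where a: "a \<in> A" "a \<in> E" using assms by blast
  show ?thesis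
  proof (rule split_prefix[OF assms(1) a(2)])
    fix \<sigma> \<tau> assume st: "\<sigma> \<in> B" "\<tau> \<in> B" "bi \<sigma> \<circ> u \<in> S \<longleftrightarrow> bi \<tau> \<circ> u \<in> S"
      and d: "bi \<sigma> \<circ> u \<in> S \<Longrightarrow> \<forall>i\<in>E - {a}. i \<in> descents L (bi \<sigma> \<circ> u) \<longleftrightarrow> i \<in> descents L (bi \<tau> \<circ> u)"
    have "descents L (bi \<sigma> \<circ> u) \<subseteq> A \<longleftrightarrow> descents L (bi \<tau> \<circ> u) \<subseteq> A" if "bi \<sigma> \<circ> u \<in> S"
      using d[OF that] a(1) descents_E[of "bi \<sigma> \<circ> u"] descents_E[of "bi \<tau> \<circ> u"] by blast
    then show "of_bool (\<sigma> \<in> Mset u A) = of_bool (\<tau> \<in> Mset u A)"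
      using st by (auto simp: Mset_def)
  qed
qed

lemma prim_in_GA: "prim s \<in> GA"
  by (simp add: GA_def prim_def)

text \<open>Translation by \<open>w0 n\<close> exchanges the two halves of \<open>dl_prim\<close>,
  which amounts to the factor \<open>s\<close> because \<open>s * s = 1\<close>.\<close>

lemma w0_prim: "s * s = 1 \<Longrightarrow> u \<in> B \<Longrightarrow> dl (u \<circ> w0 n) \<star> prim s = (\<lambda>g. of_int s * (dl u \<star> prim s) g)"
proof (rule GA_eqI)
  fix v assume s: "s * s = 1" and u: "u \<in> B" and v: "v \<in> B"
  have "(of_int s * of_int s :: complex) = 1" using s by (metis of_int_1 of_int_mult)
  show "(dl (u \<circ> w0 n) \<star> prim s) v = of_int s * (dl u \<star> prim s) v"
  proof -
    have "of_int s * (a * (b + of_int s * c)) = a * (c + of_int s * b)" for a b c :: complex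
    proof -
      have "of_int s * (a * (b + of_int s * c)) = a * ((of_int s * of_int s) * c + of_int s * b)"
        by (simp add: algebra_simps)
      then show ?thesis by (simp only: \<open>of_int s * of_int s = 1\<close> mult_1)
    qed
    then show ?thesis
      unfolding dl_prim[OF comp_in_B[OF u w0_in_B] v] dl_prim[OF u v] w0_w0' times_divide_eq_right sum_distrib_left
      by (simp only:)
  qed
qed (simp_all add: GA_smult)

text \<open>With the left factor expanded in shuffle indicators, all terms with
  \<open>A \<noteq> {}\<close> are annihilated. What remains of it is half of
  \<open>dl id + s dl (w0 n)\<close>, which fixes \<open>prim s\<close>.\<close>

lemma prim_idem:
  assumes s: "s * s = 1"
  shows "prim s \<star> prim s = prim s"
proof -
  let ?c = "\<lambda>A :: int set. (-1) ^ card A / of_nat (card A + 1) / 2 :: complex"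
  have eq: "prim s v = (\<Sum>A\<in>Pow E. ?c A * ind (Mset id A) v + ?c A * of_int s * ind (Mset (w0 n) A) v)"
    if "v \<in> B" for v
  proof -
    have "prim s v = (dl id \<star> prim s) v" using one_conv[OF prim_in_GA, of s] by simp
    also have "\<dots> = (\<Sum>A\<in>Pow E. ?c A * ind (Mset id A) v + ?c A * of_int s * ind (Mset (w0 n) A) v)"
      unfolding dl_prim[OF id_in_B that] sum_divide_distrib id_comp
      by (intro sum.cong refl) (simp add: add_divide_distrib distrib_left mult.assoc)
    finally show ?thesis .
  qed
  have "prim s \<star> prim s = (\<lambda>v. \<Sum>A\<in>Pow E. ?c A * ind (Mset id A) v + ?c A * of_int s * ind (Mset (w0 n) A) v) \<star> prim s"
    by (rule conv_cong) (simp_all add: eq)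
  also have "\<dots> = (\<lambda>v. \<Sum>A\<in>Pow E. ?c A * (ind (Mset id A) \<star> prim s) v +
      ?c A * of_int s * (ind (Mset (w0 n) A) \<star> prim s) v)"
    by (simp only: conv_sum_left conv_add_left conv_smult_left)
  also have "\<dots> = (\<lambda>v. \<Sum>A\<in>{{}}. ?c A * (ind (Mset id A) \<star> prim s) v +
      ?c A * of_int s * (ind (Mset (w0 n) A) \<star> prim s) v)"
    by (rule ext, rule sum.mono_neutral_right) (auto simp: Mset_kill)
  also have "\<dots> = prim s"
  proof -
    have "(of_int s * of_int s :: complex) = 1" using s by (metis of_int_1 of_int_mult)
    then show ?thesis
      using w0_prim[OF s id_in_B] one_conv[OF prim_in_GA, of s]
      by (simp add: Mset_empty flip: mult.assoc)
  qed
  finally show ?thesis .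
qed

text \<open>The identity has no descents, and \<open>dcoef n 0 = 1 / n\<close> is halved. The value
  is the reciprocal of the order \<open>2 n\<close> of either centralizer, as \<open>ind_iso\<close>
  demands.\<close>

lemma prim_one: "prim s id = 1 / of_nat (2 * n)"
proof -
  have "descents L id = {}" by (auto simp: descents_def)
  moreover have "w0 n \<notin> S" using w0_notin_S[OF id_in_S] by simp
  moreover have "dcoef n 0 = 1 / of_nat n"
    using n_pos fact_reduce[of n, where ?'a = complex] by (simp add: dcoef_def)
  ultimately show ?thesis using id_in_S by (simp add: prim_def bi_id r_elt_eq)
qed

text \<open>Replacing the factor at one position by a constant produces a split function, which is
  annihilated; this is why only the differences of the two values survive.\<close>

lemma descent_product_conv:
  assumes u: "u \<in> B"
  shows "(\<lambda>\<sigma>. of_bool (\<sigma> \<in> B \<and> bi \<sigma> \<circ> u \<in> S) * (\<Prod>i\<in>E. f i (i \<in> descents L (bi \<sigma> \<circ> u)))) \<star> prim s =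
    (\<lambda>g. (\<Prod>i\<in>E. f i False - f i True) * (dl u \<star> prim s) g)"
proof -
  define D where "D \<sigma> = descents L (bi \<sigma> \<circ> u)" for \<sigma>
  \<comment> \<open>Descents are confined to \<open>I\<close> and only the factors in
    \<open>I\<close> are kept: \<open>I = {}\<close> singles out \<open>u\<close>, and
    \<open>I = E\<close> is the full product.\<close>
  define h where "h I \<sigma> = (of_bool (\<sigma> \<in> B \<and> bi \<sigma> \<circ> u \<in> S \<and> D \<sigma> \<subseteq> I) * (\<Prod>i\<in>I. f i (i \<in> D \<sigma>)) :: complex)" for I \<sigma>
  have "h I \<star> prim s = (\<lambda>g. (\<Prod>i\<in>I. f i False - f i True) * (dl u \<star> prim s) g)" if "I \<subseteq> E" for I
    using finite_subset[OF that finite_atLeastAtMost_int] that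
  proof (induction I rule: finite_induct)
    case empty
    have "h {} = dl u"
      using Mset_empty[OF u] by (auto simp: h_def Mset_def D_def fun_eq_iff)
    then show ?case by simp
  next
    case (insert j I)
    \<comment> \<open>\<open>k\<close> lacks the factor at \<open>j\<close> but admits a descent
      there, so it does not see that position.\<close>
    define k where "k \<sigma> = (of_bool (\<sigma> \<in> B \<and> bi \<sigma> \<circ> u \<in> S \<and> D \<sigma> \<subseteq> insert j I) * (\<Prod>i\<in>I. f i (i \<in> D \<sigma>)) :: complex)" for \<sigma>
    have "h (insert j I) = (\<lambda>\<sigma>. f j True * k \<sigma> + (f j False - f j True) * h I \<sigma>)"
    proof
      fix \<sigma>
      have "D \<sigma> \<subseteq> I \<longleftrightarrow> D \<sigma> \<subseteq> insert j I \<and> j \<notin> D \<sigma>" using insert.hyps by auto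
      then show "h (insert j I) \<sigma> = f j True * k \<sigma> + (f j False - f j True) * h I \<sigma>"
        using insert.hyps by (auto simp: h_def k_def algebra_simps)
    qed
    moreover have "k \<star> prim s = (\<lambda>_. 0)"
    proof (rule split_prefix[OF u])
      show "j \<in> E" using insert.prems by auto
      fix \<sigma> \<tau> assume st: "\<sigma> \<in> B" "\<tau> \<in> B" "bi \<sigma> \<circ> u \<in> S \<longleftrightarrow> bi \<tau> \<circ> u \<in> S"
        and d: "bi \<sigma> \<circ> u \<in> S \<Longrightarrow> \<forall>i\<in>E - {j}. i \<in> descents L (bi \<sigma> \<circ> u) \<longleftrightarrow> i \<in> descents L (bi \<tau> \<circ> u)"
      show "k \<sigma> = k \<tau>"
      proof (cases "bi \<sigma> \<circ> u \<in> S")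
        case True
        have eq: "i \<in> D \<sigma> \<longleftrightarrow> i \<in> D \<tau>" if "i \<noteq> j" for i
          using d[OF True] that descents_E[of "bi \<sigma> \<circ> u"] descents_E[of "bi \<tau> \<circ> u"]
          unfolding D_def by blast
        then have "D \<sigma> \<subseteq> insert j I \<longleftrightarrow> D \<tau> \<subseteq> insert j I" by blast
        moreover have "(\<Prod>i\<in>I. f i (i \<in> D \<sigma>)) = (\<Prod>i\<in>I. f i (i \<in> D \<tau>))"
        proof (rule prod.cong[OF refl])
          fix i assume "i \<in> I"
          then have "(i \<in> D \<sigma>) = (i \<in> D \<tau>)" using eq[of i] insert.hyps by auto
          then show "f i (i \<in> D \<sigma>) = f i (i \<in> D \<tau>)" by (rule arg_cong)
        qed
        ultimately show ?thesis using st by (simp add: k_def)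
      qed (use st in \<open>simp add: k_def\<close>)
    qed
    ultimately show ?case
      using insert by (simp add: conv_add_left conv_smult_left mult.assoc)
  qed
  note main = this[OF order_refl]
  have "h E = (\<lambda>\<sigma>. of_bool (\<sigma> \<in> B \<and> bi \<sigma> \<circ> u \<in> S) * (\<Prod>i\<in>E. f i (i \<in> descents L (bi \<sigma> \<circ> u))))"
    unfolding h_def D_def by (simp only: descents_E simp_thms)
  then show ?thesis using main by (simp only:)
qed

section \<open>The idempotents of signed partitions with one part\<close>

lemma eps_r_conv: "antip (eps_elt s L \<star> r_elt n L) = prim s"
proof (rule GA_eqI)
  fix w assume w: "w \<in> B"
  have "id \<noteq> w0 n"
    using w0_notin_S[OF id_in_S] id_in_S by auto
  then have "eps_elt s L u = (of_bool (u = id) + of_int s * of_bool (u = w0 n)) / 2" for u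
    by (simp add: eps_elt_def)
  then have "eps_elt s L = (\<lambda>u. 1 / 2 * dl id u + of_int s / 2 * dl (w0 n) u)"
    by (simp add: fun_eq_iff add_divide_distrib)
  then have "(eps_elt s L \<star> r_elt n L) v = 1 / 2 * r_elt n L v + of_int s / 2 * r_elt n L (w0 n \<circ> v)"
    if "v \<in> B" for v
    using that dl_conv[of id v] dl_conv[of "w0 n" v]
    by (simp only: conv_add_left conv_smult_left) (simp add: bi_id bi_w0)
  then show "antip (eps_elt s L \<star> r_elt n L) w = prim s w"
    using w by (simp add: antip_def prim_def add_divide_distrib)
qed (simp_all add: antip_in_GA prim_in_GA)

lemma sort_singleton: "sort xs = [x] \<Longrightarrow> xs = [x]"
  by (metis length_sort length_0_conv length_Suc_conv set_sort empty_set list.simps(15) singleton_insert_inj_eq)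

lemma single_neg: "{p \<in> signed_compositions n. signed_partition_of p = ([], [int n])} = {[- int n]}"
proof (intro equalityI subsetI)
  fix p assume "p \<in> {p \<in> signed_compositions n. signed_partition_of p = ([], [int n])}"
  then have z: "0 \<notin> set p" and f: "rev (sort (filter (\<lambda>a. 0 < a) p)) = []"
    and m: "rev (sort (map abs (filter (\<lambda>a. a < 0) p))) = [int n]"
    by (simp_all add: signed_compositions_def signed_partition_of_def)
  have "filter (\<lambda>a. 0 < a) p = []" using f by (metis length_0_conv length_rev length_sort)
  then have "filter (\<lambda>a. a < 0) p = p" unfolding filter_id_conv filter_empty_conv
    using z by (metis linorder_neqE_linordered_idom)
  moreover have "map abs (filter (\<lambda>a. a < 0) p) = [int n]"
    by (rule sort_singleton) (metis m rev_rev_ident rev_singleton_conv)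
  ultimately show "p \<in> {[- int n]}"
    using z \<open>filter (\<lambda>a. a < 0) p = p\<close> by (auto simp: filter_id_conv)
qed (use n_pos in \<open>auto simp: signed_compositions_def signed_partition_of_def\<close>)

lemma single_pos: "{p \<in> signed_compositions n. signed_partition_of p = ([int n], [])} = {[int n]}"
proof (intro equalityI subsetI)
  fix p assume "p \<in> {p \<in> signed_compositions n. signed_partition_of p = ([int n], [])}"
  then have z: "0 \<notin> set p" and f: "rev (sort (filter (\<lambda>a. 0 < a) p)) = [int n]"
    and m: "rev (sort (map abs (filter (\<lambda>a. a < 0) p))) = []"
    by (simp_all add: signed_compositions_def signed_partition_of_def)
  have "filter (\<lambda>a. a < 0) p = []" using m by (metis length_0_conv length_rev length_sort length_map)
  then have "filter (\<lambda>a. 0 < a) p = p" unfolding filter_id_conv filter_empty_conv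
    using z by (metis linorder_neqE_linordered_idom)
  moreover have "filter (\<lambda>a. 0 < a) p = [int n]"
    by (rule sort_singleton) (metis f rev_rev_ident rev_singleton_conv)
  ultimately show "p \<in> {[int n]}" by auto
qed (use n_pos in \<open>auto simp: signed_compositions_def signed_partition_of_def\<close>)

text \<open>A single part leaves nothing to shuffle: \<open>hat_set\<close> is empty, the identity
  is the only permutation without descents, and the block is all of \<open>L\<close>.\<close>

lemma I_elt_single:
  assumes "s = 1 \<or> s = -1"
  shows "I_elt n [s * int n] = eps_elt s L \<star> r_elt n L"
proof -
  have h: "hat_set [s * int n] = {}" by (auto simp: hat_set_def)
  have b: "block [s * int n] 0 = L" using assms by (auto simp: block_def partial_sum_def)
  have sg: "sgn (s * int n) = s" using assms n_pos by auto
  have "X_sum n L {} = dl id"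
  proof
    fix w show "X_sum n L {} w = of_bool (w = id)"
      using increasing_id[of w] id_in_S by (auto simp: X_sum_def descents_def)
  qed
  then show ?thesis
    using one_conv[of "eps_elt s L \<star> r_elt n L"] conv_one[of "eps_elt s L \<star> r_elt n L"]
    by (simp add: I_elt_def h b sg) (simp add: group_algebra_def)
qed

lemma g_elt_single:
  "g_elt n ([], [int n]) = eps_elt (-1) L \<star> r_elt n L"
  "g_elt n ([int n], []) = eps_elt 1 L \<star> r_elt n L"
  using I_elt_single[of "-1"] I_elt_single[of 1]
  by (simp_all add: g_elt_def single_neg single_pos)

lemma g_iso:
  "rep_isomorphic (hyperoct n) (right_ideal_rep (hyperoct n) (g_elt n ([], [int n]))) (left_ideal_rep (prim (-1)))"
  "rep_isomorphic (hyperoct n) (right_ideal_rep (hyperoct n) (g_elt n ([int n], []))) (left_ideal_rep (prim 1))"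
  using right_ideal_iso[of "eps_elt (-1) L \<star> r_elt n L"] right_ideal_iso[of "eps_elt 1 L \<star> r_elt n L"]
  by (simp_all add: g_elt_single eps_r_conv)

section \<open>The centralizers\<close>

abbreviation c where "c \<equiv> pos_cycle n"
abbreviation \<delta> where "\<delta> \<equiv> neg_cycle n"

lemma c_in_S: "c \<in> S"
  unfolding pos_cycle_def
proof (rule odd_extension_in_S, rule bij_imp_permutes)
  show "bij_betw (\<lambda>i. if 1 \<le> i \<and> i < int n then i + 1 else if i = int n then 1 else i) L L"
    using n_pos by (intro bij_betw_byWitness[of _ "\<lambda>i. if i = 1 then int n else i - 1"]) auto
qed (use n_pos in auto)

lemma c_in_B [simp]: "c \<in> B" by (rule S_B[OF c_in_S])

lemma c_apply: "1 \<le> i \<Longrightarrow> i < int n \<Longrightarrow> c i = i + 1" "c (int n) = 1"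
  using n_pos by (auto simp: pos_cycle_def odd_extension_def)

lemma \<delta>_eq: "\<delta> = c \<circ> w0_on {int n}"
  using n_pos by (auto simp: fun_eq_iff neg_cycle_def pos_cycle_def odd_extension_def w0_on_def)

lemma \<delta>_in_B [simp]: "\<delta> \<in> B"
  unfolding \<delta>_eq using n_pos by (intro comp_in_B w0_on_in_B) auto

lemma \<delta>_apply: "1 \<le> i \<Longrightarrow> i < int n \<Longrightarrow> \<delta> i = i + 1" "\<delta> (int n) = - 1"
  using n_pos by (auto simp: neg_cycle_def odd_extension_def)

lemma generate_comp: "y \<in> Y \<Longrightarrow> h \<in> generate (hyperoct n) Y \<Longrightarrow> y \<circ> h \<in> generate (hyperoct n) Y"
  using generate.eng[OF generate.incl[of y Y "hyperoct n"], of h] by simp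

lemma generate_commute:
  assumes "Y \<subseteq> B" "g \<in> B" "\<And>y. y \<in> Y \<Longrightarrow> g \<circ> y = y \<circ> g" "h \<in> generate (hyperoct n) Y"
  shows "g \<circ> h = h \<circ> g"
  using assms(4)
proof (induction rule: generate.induct)
  case (inv h)
  have h: "h \<in> B" using inv assms by auto
  have "g (bi h i) = bi h (g i)" for i
  proof -
    have "h (g (bi h i)) = g (h (bi h i))" using assms(3)[OF inv] by (metis comp_apply)
    then show ?thesis using h by (metis bi_apply)
  qed
  then show ?case by auto
next
  case (eng h1 h2)
  then show ?case by simp (metis comp_assoc)
qed (use assms in auto)

text \<open>The subgroup generated by \<open>Y\<close> is commutative and transitive on the signed
  letters, and the whole centralizer commutes with it. An element of the centralizer is therefore
  determined by its value at 1, so the two groups coincide and have as many elements as there are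
  letters.\<close>

lemma centralizer_generate:
  assumes Y: "Y \<subseteq> B" "y \<in> Y" "\<And>z w. z \<in> Y \<Longrightarrow> w \<in> Y \<Longrightarrow> z \<circ> w = w \<circ> z"
    and Y': "\<And>g z. g \<in> centralizer (hyperoct n) y \<Longrightarrow> z \<in> Y \<Longrightarrow> g \<circ> z = z \<circ> g"
    and trans: "\<And>i. i \<in> ss \<Longrightarrow> \<exists>h\<in>generate (hyperoct n) Y. h 1 = i"
  shows "centralizer (hyperoct n) y = generate (hyperoct n) Y" "card (generate (hyperoct n) Y) = 2 * n"
proof -
  let ?H = "generate (hyperoct n) Y" and ?Z = "centralizer (hyperoct n) y"
  have HB: "h \<in> B" if "h \<in> ?H" for h using generate_in_carrier[OF Y(1) that] .
  have ZB: "g \<in> B" if "g \<in> ?Z" for g using that by (simp add: centralizer_def)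
  have comm: "g \<circ> h = h \<circ> g" if "g \<in> ?Z" "h \<in> ?H" for g h
    using generate_commute[OF Y(1) ZB[OF that(1)] Y'[OF that(1)] that(2)] .
  have "y \<in> ?Z" using Y by (auto simp: centralizer_def)
  have HZ: "h \<in> ?Z" if "h \<in> ?H" for h
    using comm[OF \<open>y \<in> ?Z\<close> that] HB[OF that] by (simp add: centralizer_def)
  have det: "g = k" if g: "g \<in> ?Z" and k: "k \<in> ?Z" and 1: "g 1 = k 1" for g k
  proof (rule B_eqI)
    fix i assume "i \<in> L"
    then obtain h where h: "h \<in> ?H" "h 1 = i" using trans L_ss by blast
    have "g (h 1) = h (g 1)" "k (h 1) = h (k 1)"
      using comm[OF g h(1)] comm[OF k h(1)] by (metis comp_apply)+
    then show "g i = k i" using 1 h(2) by simp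
  qed (use g k ZB in auto)
  have one: "1 \<in> ss" using n_pos by (simp add: signed_set_iff)
  show "?Z = ?H"
  proof (intro equalityI subsetI)
    fix g assume g: "g \<in> ?Z"
    obtain h where "h \<in> ?H" "h 1 = g 1" using trans[of "g 1"] one ZB[OF g] by auto
    then show "g \<in> ?H" using det[OF g HZ] by metis
  qed (rule HZ)
  have "bij_betw (\<lambda>h. h 1) ?H ss"
    unfolding bij_betw_def
  proof
    show "inj_on (\<lambda>h. h 1) ?H" by (rule inj_onI) (use det HZ in blast)
    show "(\<lambda>h. h 1) ` ?H = ss" using trans one HB by force
  qed
  then have "card ?H = card ss" by (rule bij_betw_same_card)
  also have "\<dots> = 2 * n" by (simp add: signed_set_def)
  finally show "card ?H = 2 * n" .
qed

text \<open>Collects part of the orbit of 1 along a path \<open>x 1, ..., x n\<close> on which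
  \<open>y\<close> takes each letter to the next.\<close>

lemma orbit_walk:
  assumes start: "x 1 \<in> (\<lambda>h. h 1) ` generate (hyperoct n) Y" and y: "y \<in> Y"
    and step: "\<And>i. 1 \<le> i \<Longrightarrow> i < int n \<Longrightarrow> y (x i) = x (i + 1)" and i: "i \<in> L"
  shows "x i \<in> (\<lambda>h. h 1) ` generate (hyperoct n) Y"
proof -
  have closed: "y k \<in> (\<lambda>h. h 1) ` generate (hyperoct n) Y"
    if k: "k \<in> (\<lambda>h. h 1) ` generate (hyperoct n) Y" for k
  proof -
    obtain h where h: "h \<in> generate (hyperoct n) Y" "k = h 1" using k by blast
    show ?thesis by (rule image_eqI[OF _ generate_comp[OF y h(1)]]) (simp add: h(2))
  qed
  have "1 \<le> i" using i by simp
  then show ?thesis using i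
  proof (induction i rule: int_ge_induct)
    case base
    then show ?case using start by simp
  next
    case (step i)
    then show ?case using closed[of "x i"] assms(3)[of i] by simp
  qed
qed

lemma Z_pos_eq: "Z_pos n = generate (hyperoct n) {c, w0 n}" "card (Z_pos n) = 2 * n"
proof -
  let ?O = "(\<lambda>h. h 1) ` generate (hyperoct n) {c, w0 n}"
  have "id \<in> generate (hyperoct n) {c, w0 n}" using generate.one[of "hyperoct n"] by simp
  then have one: "1 \<in> ?O" by (rule rev_image_eqI) simp
  have pos: "i \<in> ?O" if "i \<in> L" for i
    using orbit_walk[of "\<lambda>i. i" "{c, w0 n}" c i] one that c_apply by simp
  have neg: "- i \<in> ?O" if i: "i \<in> L" for i
  proof -
    obtain h where h: "h \<in> generate (hyperoct n) {c, w0 n}" "i = h 1" using pos[OF i] by auto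
    have "(w0 n \<circ> h) 1 = - i" using h L_ss[OF i] by (simp add: w0_apply)
    moreover have "w0 n \<circ> h \<in> generate (hyperoct n) {c, w0 n}" by (rule generate_comp) (use h in auto)
    ultimately show ?thesis by (metis image_eqI)
  qed
  have trans: "\<exists>h\<in>generate (hyperoct n) {c, w0 n}. h 1 = i" if "i \<in> ss" for i
    using that pos[of i] neg[of "- i"] by (cases "0 < i") (auto simp: signed_set_iff)
  have "centralizer (hyperoct n) c = generate (hyperoct n) {c, w0 n}"
    "card (generate (hyperoct n) {c, w0 n}) = 2 * n"
    using trans w0_comm c_in_B w0_in_B
    by (intro centralizer_generate[of "{c, w0 n}" c]; force simp: centralizer_def)+
  then show "Z_pos n = generate (hyperoct n) {c, w0 n}" "card (Z_pos n) = 2 * n"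
    by (simp_all add: Z_pos_def)
qed

text \<open>The path from \<open>x 1 = 1\<close> to \<open>x n\<close> continues to
  \<open>-1\<close> and then through the negatives of the same letters, so the orbit of 1 is
  everything.\<close>

lemma Z_cyclic:
  assumes y: "y \<in> B" and x: "x 1 = 1" "\<And>i. i \<in> L \<Longrightarrow> x i = i \<or> x i = - i"
    and step: "\<And>i. 1 \<le> i \<Longrightarrow> i < int n \<Longrightarrow> y (x i) = x (i + 1)" "y (x (int n)) = - 1"
  shows "centralizer (hyperoct n) y = generate (hyperoct n) {y}" "card (generate (hyperoct n) {y}) = 2 * n"
proof -
  let ?O = "(\<lambda>h. h 1) ` generate (hyperoct n) {y}"
  have "id \<in> generate (hyperoct n) {y}" using generate.one[of "hyperoct n"] by simp
  then have one: "x 1 \<in> ?O" by (rule rev_image_eqI) (simp add: x(1))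
  have pos: "x i \<in> ?O" if "i \<in> L" for i
    using orbit_walk[of x "{y}" y i] one that step(1) by simp
  obtain h where h: "h \<in> generate (hyperoct n) {y}" "x (int n) = h 1" using pos[of "int n"] n_pos by auto
  have "(y \<circ> h) 1 = - x 1" using h(2) step(2) x(1) by simp
  moreover have "y \<circ> h \<in> generate (hyperoct n) {y}" by (rule generate_comp) (use h in auto)
  ultimately have "- x 1 \<in> ?O" by (metis image_eqI)
  then have neg: "- x i \<in> ?O" if "i \<in> L" for i
    using orbit_walk[of "\<lambda>i. - x i" "{y}" y i] that step(1) y by (simp add: B_odd)
  have trans: "\<exists>h\<in>generate (hyperoct n) {y}. h 1 = i" if "i \<in> ss" for i
  proof -
    have "\<bar>i\<bar> \<in> L" using that abs_L by blast
    then have "x \<bar>i\<bar> \<in> ?O" "- x \<bar>i\<bar> \<in> ?O" "i = x \<bar>i\<bar> \<or> i = - x \<bar>i\<bar>"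
      using pos neg x(2)[of "\<bar>i\<bar>"] by (blast, blast, linarith)
    then have "i \<in> ?O" by metis
    then show ?thesis by auto
  qed
  show "centralizer (hyperoct n) y = generate (hyperoct n) {y}"
    "card (generate (hyperoct n) {y}) = 2 * n"
    using trans y by (intro centralizer_generate[of "{y}" y]; force simp: centralizer_def)+
qed

lemma d_in_B [simp]: "d_elt n \<in> B"
  by (simp add: d_elt_def)

lemma Z_neg_eq: "Z_neg n = generate (hyperoct n) {d_elt n}" "card (Z_neg n) = 2 * n"
proof -
  \<comment> \<open>For odd \<open>n\<close> every application of \<open>d_elt n\<close> changes the
    sign, so the orbit of 1 meets \<open>1, -2, 3, ..., n\<close> before it reaches
    \<open>-1\<close>.\<close>
  let ?x = "\<lambda>i :: int. if odd n \<and> even i then - i else i"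
  have "d_elt n (?x i) = ?x (i + 1)" if "1 \<le> i" "i < int n" for i
    using that c_apply(1)[OF that] \<delta>_apply(1)[OF that] B_odd[OF c_in_B, of i]
    by (auto simp: d_elt_def w0_apply signed_set_iff)
  moreover have "d_elt n (?x (int n)) = - 1"
    using n_pos c_apply(2) \<delta>_apply(2) B_odd[OF c_in_B, of "int n"]
    by (auto simp: d_elt_def w0_apply signed_set_iff)
  ultimately have "centralizer (hyperoct n) (d_elt n) = generate (hyperoct n) {d_elt n}"
    "card (generate (hyperoct n) {d_elt n}) = 2 * n"
    by (intro Z_cyclic[of "d_elt n" ?x]; simp)+
  then show "Z_neg n = generate (hyperoct n) {d_elt n}" "card (Z_neg n) = 2 * n"
    by (simp_all add: Z_neg_def)
qed

end

section \<open>Generators of the induced representations\<close>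

lemma omega_power: "m \<noteq> 0 \<Longrightarrow> omega m ^ j = 1 \<longleftrightarrow> m dvd j"
proof -
  assume "m \<noteq> 0"
  moreover have "omega m ^ j = exp (2 * of_real pi * \<i> * of_nat j / of_nat m)"
    by (simp add: omega_def mult.commute flip: exp_of_nat_mult)
  ultimately show ?thesis using complex_root_unity_eq_1[of m j] by simp
qed

lemma omega_half: "m \<noteq> 0 \<Longrightarrow> omega (2 * m) ^ m = -1"
proof -
  assume m: "m \<noteq> 0"
  have "omega (2 * m) ^ m = exp (of_nat m * (2 * of_real pi * \<i> / of_nat (2 * m)))"
    unfolding omega_def by (rule exp_of_nat_mult[symmetric])
  also have "of_nat m * (2 * of_real pi * \<i> / of_nat (2 * m)) = of_real pi * \<i>"
    using m by simp
  finally show ?thesis by (simp add: exp_pi_i)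
qed

lemma omega_nonzero [simp]: "omega m \<noteq> 0"
  by (simp add: omega_def)

context hyperoctahedral
begin

definition maj_weight :: "complex \<Rightarrow> (int \<Rightarrow> int) \<Rightarrow> complex" where
  "maj_weight q k = (\<Prod>i\<in>E. if k (i + 1) < k i then q ^ nat i else 1)"

lemma maj_weight_cong: "(\<And>i. i \<in> E \<Longrightarrow> k (i + 1) < k i \<longleftrightarrow> k' (i + 1) < k' i) \<Longrightarrow> maj_weight q k = maj_weight q k'"
  unfolding maj_weight_def by (rule prod.cong) auto

text \<open>Turning the maximum, at position \<open>m\<close>, into the minimum moves a descent from \<open>m\<close> to \<open>m - 1\<close>.\<close>

lemma maj_weight_rotate:
  assumes q: "q ^ n = 1" and m: "m \<in> L"
    and mx: "\<And>i. i \<in> L \<Longrightarrow> i \<noteq> m \<Longrightarrow> k i < k m" and mn: "\<And>i. i \<in> L \<Longrightarrow> i \<noteq> m \<Longrightarrow> k' m < k' i"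
    and o: "\<And>i j. i \<in> L \<Longrightarrow> j \<in> L \<Longrightarrow> i \<noteq> m \<Longrightarrow> j \<noteq> m \<Longrightarrow> k i < k j \<longleftrightarrow> k' i < k' j"
  shows "maj_weight q k = q * maj_weight q k'"
proof -
  define f where "f i = (if k (i + 1) < k i then q ^ nat i else 1)" for i
  define f' where "f' i = (if k' (i + 1) < k' i then q ^ nat i else 1)" for i
  \<comment> \<open>The factors of \<open>k\<close> and \<open>k'\<close> differ only at
    \<open>m\<close> and \<open>m - 1\<close>: \<open>k\<close> has a descent at \<open>m\<close>
    and none at \<open>m - 1\<close>, and \<open>k'\<close> the other way round.\<close>
  have "f' i * (if i = m then q ^ nat m else 1) = f i * (if i = m - 1 then q ^ nat (m - 1) else 1)"
    if "i \<in> E" for i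
  proof -
    have i: "i \<in> L" "i + 1 \<in> L" using that by auto
    consider "i = m" | "i + 1 = m" | "i \<noteq> m" "i + 1 \<noteq> m" by blast
    then show ?thesis
    proof cases
      case 1
      then show ?thesis using mx[of "i + 1"] mn[of "i + 1"] i by (auto simp: f_def f'_def)
    next
      case 2
      then show ?thesis using mx[of i] mn[of i] i by (auto simp: f_def f'_def)
    next
      case 3
      then show ?thesis using o[of "i + 1" i] i by (auto simp: f_def f'_def)
    qed
  qed
  then have "(\<Prod>i\<in>E. f' i * (if i = m then q ^ nat m else 1)) =
    (\<Prod>i\<in>E. f i * (if i = m - 1 then q ^ nat (m - 1) else 1))"
    by (rule prod.cong[OF refl])
  then have "maj_weight q k' * (if m \<in> E then q ^ nat m else 1) = maj_weight q k * (if m - 1 \<in> E then q ^ nat (m - 1) else 1)"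
    by (simp only: prod.distrib prod.delta finite_atLeastAtMost_int maj_weight_def f_def f'_def)
  \<comment> \<open>At the ends of the word the missing factor is 1 anyway: by
    \<open>q ^ n = 1\<close> for \<open>m = n\<close>, and by \<open>q ^ 0 = 1\<close> for
    \<open>m = 1\<close>.\<close>
  moreover have "(if m \<in> E then q ^ nat m else 1) = q ^ nat m"
  proof (cases "m = int n")
    case False
    then show ?thesis using m by simp
  qed (simp add: q)
  moreover have "(if m - 1 \<in> E then q ^ nat (m - 1) else 1) = q ^ nat (m - 1)"
    using m by (cases "m = 1") auto
  moreover have "q ^ nat m = q ^ nat (m - 1) * q"
    using m by (simp add: nat_diff_distrib flip: power_Suc2)
  moreover have "q \<noteq> 0" using q n_pos by (metis power_0_left one_neq_zero not_one_le_zero)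
  ultimately show ?thesis by (simp add: algebra_simps)
qed

text \<open>Klyachko's element, symmetrised by \<open>w0 n\<close>.\<close>

definition kappa_pos :: "complex \<Rightarrow> int \<Rightarrow> (int \<Rightarrow> int) \<Rightarrow> complex" where
  "kappa_pos q s \<sigma> = of_bool (\<sigma> \<in> B \<and> bi \<sigma> \<circ> id \<in> S) * maj_weight q (bi \<sigma> \<circ> id) +
     of_int s * (of_bool (\<sigma> \<in> B \<and> bi \<sigma> \<circ> w0 n \<in> S) * maj_weight q (bi \<sigma> \<circ> w0 n))"

abbreviation Pq :: "complex \<Rightarrow> complex" where
  "Pq q \<equiv> \<Prod>i\<in>E. 1 - q ^ nat i"

lemma maj_weight_descents: "maj_weight q w = (\<Prod>i\<in>E. if i \<in> descents L w then q ^ nat i else 1)"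
  unfolding maj_weight_def by (rule prod.cong) (auto simp: descents_def)

text \<open>\<open>descent_product_conv\<close> with the values 1 and \<open>q ^ i\<close> yields
  the factors \<open>1 - q ^ i\<close>. The half belonging to \<open>w0 n\<close> contributes the
  same once more, because \<open>s * s = 1\<close>.\<close>

lemma kappa_pos_conv:
  assumes "s * s = 1"
  shows "kappa_pos q s \<star> prim s = (\<lambda>g. 2 * Pq q * prim s g)"
proof -
  have 1: "(of_int s * of_int s :: complex) = 1" using assms by (metis of_int_1 of_int_mult)
  have "kappa_pos q s \<star> prim s = (\<lambda>g. Pq q * (dl id \<star> prim s) g + of_int s * (Pq q * (dl (w0 n) \<star> prim s) g))"
    unfolding kappa_pos_def[abs_def] maj_weight_descents conv_add_left conv_smult_left
      descent_product_conv[OF id_in_B, of "\<lambda>i b. if b then q ^ nat i else 1"]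
      descent_product_conv[OF w0_in_B, of "\<lambda>i b. if b then q ^ nat i else 1"] by simp
  also have "\<dots> = (\<lambda>g. 2 * Pq q * prim s g)"
    using w0_prim[OF assms id_in_B] one_conv[OF prim_in_GA, of s] 1
    by (simp add: fun_eq_iff algebra_simps)
  finally show ?thesis .
qed

lemma bi_c: "bi c 1 = int n" "i \<in> L \<Longrightarrow> i \<noteq> 1 \<Longrightarrow> bi c i = i - 1"
proof -
  show "bi c 1 = int n" using bi_apply(2)[OF c_in_B, of "int n"] c_apply(2) by simp
  assume "i \<in> L" "i \<noteq> 1"
  then show "bi c i = i - 1" using bi_apply(2)[OF c_in_B, of "i - 1"] c_apply(1)[of "i - 1"] by simp
qed

text \<open>Undoing the cycle lowers every letter by one and turns the minimum 1 into the maximum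
  \<open>n\<close>, so \<open>maj_weight_rotate\<close> applies at the position of the letter
  1.\<close>

lemma maj_weight_c:
  assumes q: "q ^ n = 1" and \<pi>: "\<pi> \<in> B"
  shows "of_bool (bi c \<circ> \<pi> \<in> S) * maj_weight q (bi c \<circ> \<pi>) = q * (of_bool (\<pi> \<in> S) * maj_weight q \<pi>)"
proof -
  have iff: "bi c \<circ> \<pi> \<in> S \<longleftrightarrow> \<pi> \<in> S"
  proof
    assume "bi c \<circ> \<pi> \<in> S"
    then have "c \<circ> (bi c \<circ> \<pi>) \<in> S" by (rule S_comp[OF c_in_S])
    moreover have "c \<circ> (bi c \<circ> \<pi>) = \<pi>" by (simp add: fun_eq_iff)
    ultimately show "\<pi> \<in> S" by simp
  qed (use S_comp[OF S_bi[OF c_in_S]] in blast)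
  have "maj_weight q (bi c \<circ> \<pi>) = q * maj_weight q \<pi>" if S: "\<pi> \<in> S"
  proof (rule maj_weight_rotate[OF q, of "bi \<pi> 1"])
    have 1: "\<pi> i \<noteq> 1" if "i \<noteq> bi \<pi> 1" for i using that \<pi> by (metis bi_apply(2))
    note L = S_L[OF S]
    show "bi \<pi> 1 \<in> L" using S_L[OF S_bi[OF S], of 1] n_pos by simp
    fix i assume i: "i \<in> L" "i \<noteq> bi \<pi> 1"
    then have e: "bi c (\<pi> i) = \<pi> i - 1" using bi_c(2)[OF L 1] by blast
    show "(bi c \<circ> \<pi>) i < (bi c \<circ> \<pi>) (bi \<pi> 1)"
      using e \<pi> L[OF i(1)] by (simp add: bi_c(1))
    show "\<pi> (bi \<pi> 1) < \<pi> i" using \<pi> L[OF i(1)] 1[OF i(2)] by auto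
    fix j assume j: "j \<in> L" "j \<noteq> bi \<pi> 1"
    then show "(bi c \<circ> \<pi>) i < (bi c \<circ> \<pi>) j \<longleftrightarrow> \<pi> i < \<pi> j"
      using e bi_c(2)[OF L 1, of j] by simp
  qed
  then show ?thesis by (simp add: iff)
qed

lemma kappa_pos_c: "q ^ n = 1 \<Longrightarrow> \<sigma> \<in> B \<Longrightarrow> kappa_pos q s (\<sigma> \<circ> c) = q * kappa_pos q s \<sigma>"
proof -
  assume q: "q ^ n = 1" and \<sigma>: "\<sigma> \<in> B"
  have "of_bool (bi (\<sigma> \<circ> c) \<circ> u \<in> S) * maj_weight q (bi (\<sigma> \<circ> c) \<circ> u) =
      q * (of_bool (bi \<sigma> \<circ> u \<in> S) * maj_weight q (bi \<sigma> \<circ> u))" if "u \<in> B" for u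
    using maj_weight_c[OF q, of "bi \<sigma> \<circ> u"] \<sigma> that by (simp add: bi_comp comp_assoc)
  from this[of id] this[of "w0 n"] show ?thesis
    using \<sigma> by (simp add: kappa_pos_def distrib_left mult.left_commute)
qed

lemma kappa_pos_w0: "s * s = 1 \<Longrightarrow> \<sigma> \<in> B \<Longrightarrow> kappa_pos q s (\<sigma> \<circ> w0 n) = of_int s * kappa_pos q s \<sigma>"
proof -
  assume s: "s * s = 1" and \<sigma>: "\<sigma> \<in> B"
  have 1: "(of_int s * of_int s :: complex) = 1" using s by (metis of_int_1 of_int_mult)
  have "bi (\<sigma> \<circ> w0 n) \<circ> id = bi \<sigma> \<circ> w0 n" "bi (\<sigma> \<circ> w0 n) \<circ> w0 n = bi \<sigma> \<circ> id"
    using \<sigma> w0_comm[of "bi \<sigma>"] w0_w0'[of "bi \<sigma>"] by (simp_all add: bi_comp bi_w0)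
  then show ?thesis
    using \<sigma> 1 unfolding kappa_pos_def by (simp add: distrib_left flip: mult.assoc)
qed

text \<open>The order \<open>1 < \<dots> < n < - 1 < \<dots> < - n\<close>, in which the negative cycle shifts every letter to its
  successor.\<close>

definition key :: "int \<Rightarrow> int" where
  "key v = (if 0 < v then v else int n - v)"

text \<open>An analogue of Klyachko's element for the negative cycle. The base
  \<open>inverse (z\<^sup>2)\<close> and the weight \<open>z\<close> per negative entry are matched
  so that both ways in which an entry can change its sign under the cycle yield the same eigenvalue
  \<open>inverse z\<close>.\<close>

definition kappa_neg :: "complex \<Rightarrow> (int \<Rightarrow> int) \<Rightarrow> complex" where
  "kappa_neg z \<sigma> = of_bool (\<sigma> \<in> B) * (z ^ card {i \<in> L. bi \<sigma> i < 0} * maj_weight (inverse (z\<^sup>2)) (\<lambda>i. key (bi \<sigma> i)))"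

lemma bi_\<delta>: "bi \<delta> (- 1) = int n" "bi \<delta> 1 = - int n" "i \<in> ss \<Longrightarrow> \<bar>i\<bar> \<noteq> 1 \<Longrightarrow> bi \<delta> i = (if 0 < i then i - 1 else i + 1)"
proof -
  show a: "bi \<delta> (- 1) = int n" using bi_apply(2)[OF \<delta>_in_B, of "int n"] \<delta>_apply(2) by simp
  show "bi \<delta> 1 = - int n" using a B_odd[of "bi \<delta>" 1] by simp
  assume i: "i \<in> ss" "\<bar>i\<bar> \<noteq> 1"
  have pos: "bi \<delta> k = k - 1" if "1 < k" "k \<le> int n" for k
    using bi_apply(2)[OF \<delta>_in_B, of "k - 1"] \<delta>_apply(1)[of "k - 1"] that by simp
  show "bi \<delta> i = (if 0 < i then i - 1 else i + 1)"
  proof (cases "0 < i")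
    case True
    then show ?thesis using pos[of i] i by (auto simp: signed_set_iff)
  next
    case False
    then show ?thesis using pos[of "- i"] i B_odd[of "bi \<delta>" i] by (auto simp: signed_set_iff)
  qed
qed

text \<open>Undoing \<delta> lowers every \<open>key\<close> by one, except that the smallest key
  becomes the largest. If the entry \<open>-1\<close> occurs, it becomes \<open>n\<close>: no
  comparison changes and one negative entry is lost, which gives \<open>inverse z\<close>. If
  instead 1 occurs, it becomes \<open>- n\<close>: one negative entry is gained and the minimum
  turns into the maximum, which gives \<open>z * inverse (z\<^sup>2)\<close>.\<close>

lemma kappa_neg_\<delta>:
  assumes z: "z ^ n = -1" and \<sigma>: "\<sigma> \<in> B"
  shows "kappa_neg z (\<sigma> \<circ> \<delta>) = inverse z * kappa_neg z \<sigma>"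
proof -
  define \<pi> where "\<pi> = bi \<sigma>"
  have \<pi>: "\<pi> \<in> B" using \<sigma> by (simp add: \<pi>_def)
  have bi': "bi (\<sigma> \<circ> \<delta>) i = bi \<delta> (\<pi> i)" for i using \<sigma> by (simp add: bi_comp \<pi>_def)
  define q where "q = inverse (z\<^sup>2)"
  have z0: "z \<noteq> 0" using z n_pos by (metis power_0_left neg_equal_0_iff_equal one_neq_zero not_one_le_zero)
  have q: "q ^ n = 1"
  proof -
    have "(z\<^sup>2) ^ n = (z ^ n)\<^sup>2" by (simp add: mult.commute flip: power_mult)
    then show ?thesis by (simp add: q_def power_inverse z)
  qed
  define m where "m = \<bar>bi \<pi> 1\<bar>"
  have one: "1 \<in> ss" using n_pos by (simp add: signed_set_iff)
  have "bi \<pi> 1 \<in> ss" using one \<pi> by simp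
  then have m: "m \<in> L" unfolding m_def by (rule iffD1[OF abs_L])
  have \<pi>m: "\<bar>\<pi> m\<bar> = 1" using \<pi> by (simp add: m_def B_abs)
  have other: "\<pi> i \<in> ss" "\<bar>\<pi> i\<bar> \<noteq> 1" if "i \<in> L" "i \<noteq> m" for i
  proof -
    show "\<pi> i \<in> ss" using \<pi> L_ss[OF that(1)] by simp
    show "\<bar>\<pi> i\<bar> \<noteq> 1"
    proof
      assume "\<bar>\<pi> i\<bar> = 1"
      then have "\<pi> i = \<pi> m \<or> \<pi> i = \<pi> (- m)" using \<pi>m B_odd[OF \<pi>, of m] by linarith
      then show False using B_inj[OF \<pi>] that m by auto
    qed
  qed
  have sh: "bi \<delta> (\<pi> i) < 0 \<longleftrightarrow> \<pi> i < 0" "key (bi \<delta> (\<pi> i)) = key (\<pi> i) - 1" if "i \<in> L" "i \<noteq> m" for i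
    using bi_\<delta>(3)[OF other[OF that]] other[OF that] by (auto simp: key_def signed_set_iff)
  have finL: "finite {i \<in> L. R i}" for R by (rule finite_subset[of _ L]) auto
  show ?thesis
  proof (cases "\<pi> m < 0")
    case True
    then have v: "\<pi> m = - 1" "bi \<delta> (\<pi> m) = int n" using \<pi>m bi_\<delta>(1) by auto
    have neg: "{i \<in> L. \<pi> i < 0} = insert m {i \<in> L. bi \<delta> (\<pi> i) < 0}"
    proof (rule Set.set_eqI)
      fix i show "i \<in> {i \<in> L. \<pi> i < 0} \<longleftrightarrow> i \<in> insert m {i \<in> L. bi \<delta> (\<pi> i) < 0}"
        using m v sh(1)[of i] by (cases "i = m") auto
    qed
    have "card {i \<in> L. \<pi> i < 0} = Suc (card {i \<in> L. bi \<delta> (\<pi> i) < 0})"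
      unfolding neg using v finL by (intro card_insert_disjoint) auto
    moreover have "key (bi \<delta> (\<pi> i)) = key (\<pi> i) - 1" if "i \<in> L" for i
      using that sh(2)[of i] v n_pos by (cases "i = m") (auto simp: key_def)
    then have "maj_weight q (\<lambda>i. key (bi \<delta> (\<pi> i))) = maj_weight q (\<lambda>i. key (\<pi> i))"
      by (intro maj_weight_cong) auto
    ultimately show ?thesis
      using \<sigma> z0 by (simp add: kappa_neg_def bi' \<pi>_def[symmetric] q_def[symmetric])
  next
    case False
    then have v: "\<pi> m = 1" "bi \<delta> (\<pi> m) = - int n" using \<pi>m bi_\<delta>(2) by auto
    have neg: "{i \<in> L. bi \<delta> (\<pi> i) < 0} = insert m {i \<in> L. \<pi> i < 0}"
    proof (rule Set.set_eqI)
      fix i show "i \<in> {i \<in> L. bi \<delta> (\<pi> i) < 0} \<longleftrightarrow> i \<in> insert m {i \<in> L. \<pi> i < 0}"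
        using m v sh(1)[of i] n_pos by (cases "i = m") auto
    qed
    have "card {i \<in> L. bi \<delta> (\<pi> i) < 0} = Suc (card {i \<in> L. \<pi> i < 0})"
      unfolding neg using v finL by (intro card_insert_disjoint) auto
    moreover have "maj_weight q (\<lambda>i. key (bi \<delta> (\<pi> i))) = q * maj_weight q (\<lambda>i. key (\<pi> i))"
    proof (rule maj_weight_rotate[OF q m])
      fix i assume i: "i \<in> L" "i \<noteq> m"
      show "key (bi \<delta> (\<pi> i)) < key (bi \<delta> (\<pi> m))"
        using sh(2)[OF i] other[OF i] v by (auto simp: key_def signed_set_iff split: if_splits)
      show "key (\<pi> m) < key (\<pi> i)"
        using other[OF i] v n_pos by (auto simp: key_def signed_set_iff)
      fix j assume "j \<in> L" "j \<noteq> m"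
      then show "key (bi \<delta> (\<pi> i)) < key (bi \<delta> (\<pi> j)) \<longleftrightarrow> key (\<pi> i) < key (\<pi> j)"
        using sh(2)[OF i] sh(2)[of j] by simp
    qed
    moreover have "z * q = inverse z" using z0 by (simp add: q_def power2_eq_square)
    ultimately show ?thesis
      using \<sigma> by (simp add: kappa_neg_def bi' \<pi>_def[symmetric] q_def[symmetric] flip: mult.assoc)
  qed
qed

text \<open>The factor at position \<open>i\<close> when \<open>N\<close> is the set of negative
  entries and \<open>b\<close> tells whether the absolute values descend there. At a change of sign
  \<open>key\<close> descends exactly from negative to positive, whatever \<open>b\<close>
  is.\<close>

definition neg_factor :: "complex \<Rightarrow> int set \<Rightarrow> int \<Rightarrow> bool \<Rightarrow> complex" where
  "neg_factor q N i b = (if i \<in> N \<longleftrightarrow> i + 1 \<in> N then if b then q ^ nat i else 1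
     else if i \<in> N then q ^ nat i else 1)"

text \<open>Group elements are sorted by the set \<open>N\<close> of positions where
  \<open>bi \<sigma>\<close> is negative. Each summand has the shape required by
  \<open>descent_product_conv\<close>, with \<open>u = w0_on N\<close>.\<close>

lemma kappa_neg_sum:
  assumes q_def: "q = inverse (z\<^sup>2)"
  shows "kappa_neg z = (\<lambda>\<sigma>. \<Sum>N\<in>Pow L. z ^ card N * (of_bool (\<sigma> \<in> B \<and> bi \<sigma> \<circ> w0_on N \<in> S) *
    (\<Prod>i\<in>E. neg_factor q N i (i \<in> descents L (bi \<sigma> \<circ> w0_on N)))))"
proof
  fix \<sigma>
  show "kappa_neg z \<sigma> = (\<Sum>N\<in>Pow L. z ^ card N * (of_bool (\<sigma> \<in> B \<and> bi \<sigma> \<circ> w0_on N \<in> S) *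
    (\<Prod>i\<in>E. neg_factor q N i (i \<in> descents L (bi \<sigma> \<circ> w0_on N)))))"
  proof (cases "\<sigma> \<in> B")
    case \<sigma>: True
    define \<pi> where "\<pi> = bi \<sigma>"
    have \<pi>: "\<pi> \<in> B" using \<sigma> by (simp add: \<pi>_def)
    define M where "M = {i \<in> L. \<pi> i < 0}"
    have M_L: "M \<subseteq> L" by (auto simp: M_def)
    have nz: "\<pi> i \<noteq> 0" if "i \<in> L" for i
      using \<pi> B_ss[OF \<pi>, of i] L_ss[OF that] by (metis signed_set_iff)
    have app: "(\<pi> \<circ> w0_on N) i = (if i \<in> N then - \<pi> i else \<pi> i)" if "i \<in> L" for N i
      using that \<pi> by (auto simp: w0_on_def B_odd)
    have iff: "\<pi> \<circ> w0_on N \<in> S \<longleftrightarrow> N = M" if N: "N \<subseteq> L" for N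
    proof
      assume S: "\<pi> \<circ> w0_on N \<in> S"
      have "i \<in> N \<longleftrightarrow> i \<in> M" if i: "i \<in> L" for i
        using S_L[OF S i] app[OF i, of N] i by (auto simp: M_def split: if_splits)
      then show "N = M" using N M_L by blast
    next
      assume "N = M"
      then show "\<pi> \<circ> w0_on N \<in> S"
        using app[of _ M] nz \<pi> w0_on_in_B[OF M_L] by (intro S_I) (auto simp: M_def not_less order_le_less)
    qed
    have S: "\<pi> \<circ> w0_on M \<in> S" using iff[OF M_L] by simp
    have fac: "neg_factor q M i (i \<in> descents L (\<pi> \<circ> w0_on M)) = (if key (\<pi> (i + 1)) < key (\<pi> i) then q ^ nat i else 1)"
      if "i \<in> E" for i
    proof -
      have i: "i \<in> L" "i + 1 \<in> L" using that by auto
      have "i \<in> descents L (\<pi> \<circ> w0_on M) \<longleftrightarrow> (\<pi> \<circ> w0_on M) (i + 1) < (\<pi> \<circ> w0_on M) i"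
        using i by (auto simp: descents_def)
      moreover have "\<bar>\<pi> i\<bar> \<le> int n" "\<bar>\<pi> (i + 1)\<bar> \<le> int n"
        using B_ss[OF \<pi>] L_ss i signed_set_iff by blast+
      ultimately show ?thesis
        using app[OF i(1), of M] app[OF i(2), of M] nz[OF i(1)] nz[OF i(2)] i
        by (auto simp: neg_factor_def M_def key_def)
    qed
    have "(\<Sum>N\<in>Pow L. z ^ card N * (of_bool (\<sigma> \<in> B \<and> \<pi> \<circ> w0_on N \<in> S) *
        (\<Prod>i\<in>E. neg_factor q N i (i \<in> descents L (\<pi> \<circ> w0_on N))))) =
      (\<Sum>N\<in>{M}. z ^ card N * (of_bool (\<sigma> \<in> B \<and> \<pi> \<circ> w0_on N \<in> S) *
        (\<Prod>i\<in>E. neg_factor q N i (i \<in> descents L (\<pi> \<circ> w0_on N)))))"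
      using iff M_L by (intro sum.mono_neutral_right) auto
    also have "\<dots> = z ^ card M * maj_weight q (\<lambda>i. key (\<pi> i))"
      using S \<sigma> fac by (simp add: maj_weight_def)
    finally show ?thesis
      using \<sigma> by (simp add: kappa_neg_def \<pi>_def M_def q_def)
  qed (simp add: kappa_neg_def)
qed

text \<open>At a boundary of \<open>N\<close> the factor ignores the descent and the difference
  vanishes, so only the two sets without boundary contribute.\<close>

lemma neg_factor_prod:
  assumes "N \<subseteq> L"
  shows "(\<Prod>i\<in>E. neg_factor q N i False - neg_factor q N i True) = (if N = {} \<or> N = L then Pq q else 0)"
proof (cases "\<forall>i\<in>E. i \<in> N \<longleftrightarrow> i + 1 \<in> N")
  case True
  have "1 \<in> N \<longleftrightarrow> i \<in> N" if "i \<in> L" for i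
  proof -
    have "1 \<le> i" using that by simp
    then show ?thesis using that
    proof (induction i rule: int_ge_induct)
      case (step i)
      then show ?case using True[rule_format, of i] by simp
    qed simp
  qed
  then have "N = {} \<or> N = L" using assms by blast
  moreover have "(\<Prod>i\<in>E. neg_factor q N i False - neg_factor q N i True) = Pq q"
    using True by (intro prod.cong) (auto simp: neg_factor_def)
  ultimately show ?thesis by simp
next
  case False
  then obtain i where i: "i \<in> E" "\<not> (i \<in> N \<longleftrightarrow> i + 1 \<in> N)" by blast
  then have "neg_factor q N i False - neg_factor q N i True = 0" by (auto simp: neg_factor_def)
  then have "(\<Prod>i\<in>E. neg_factor q N i False - neg_factor q N i True) = 0" using i(1) by (intro prod_zero) auto
  moreover have "N \<noteq> {}" "N \<noteq> L" using i by auto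
  ultimately show ?thesis by simp
qed

text \<open>Two sets survive: \<open>{}\<close> gives \<open>prim (-1)\<close>, and \<open>L\<close>
  gives \<open>z ^ n\<close> times its translate by \<open>w0 n\<close>. The latter is
  \<open>prim (-1)\<close> again, since both signs are \<open>-1\<close>.\<close>

lemma kappa_neg_conv:
  assumes z: "z ^ n = -1"
  shows "kappa_neg z \<star> prim (-1) = (\<lambda>g. 2 * Pq (inverse (z\<^sup>2)) * prim (-1) g)"
proof -
  let ?q = "inverse (z\<^sup>2)"
  have id: "w0_on {} = id" by (auto simp: w0_on_def)
  have "kappa_neg z \<star> prim (-1) = (\<lambda>g. \<Sum>N\<in>Pow L. z ^ card N *
      ((\<Prod>i\<in>E. neg_factor ?q N i False - neg_factor ?q N i True) * (dl (w0_on N) \<star> prim (-1)) g))"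
    unfolding kappa_neg_sum[OF refl] conv_sum_left conv_smult_left
    by (rule ext, rule sum.cong) (simp_all add: descent_product_conv w0_on_in_B)
  also have "\<dots> = (\<lambda>g. \<Sum>N\<in>{{}, L}. z ^ card N * (Pq ?q * (dl (w0_on N) \<star> prim (-1)) g))"
  proof
    fix g
    have "(\<Sum>N\<in>Pow L. z ^ card N * ((\<Prod>i\<in>E. neg_factor ?q N i False - neg_factor ?q N i True) * (dl (w0_on N) \<star> prim (-1)) g)) =
      (\<Sum>N\<in>{{}, L}. z ^ card N * ((\<Prod>i\<in>E. neg_factor ?q N i False - neg_factor ?q N i True) * (dl (w0_on N) \<star> prim (-1)) g))"
      by (rule sum.mono_neutral_right) (auto simp: neg_factor_prod)
    also have "\<dots> = (\<Sum>N\<in>{{}, L}. z ^ card N * (Pq ?q * (dl (w0_on N) \<star> prim (-1)) g))"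
      by (rule sum.cong) (auto simp: neg_factor_prod)
    finally show "(\<Sum>N\<in>Pow L. z ^ card N * ((\<Prod>i\<in>E. neg_factor ?q N i False - neg_factor ?q N i True) * (dl (w0_on N) \<star> prim (-1)) g)) =
      (\<Sum>N\<in>{{}, L}. z ^ card N * (Pq ?q * (dl (w0_on N) \<star> prim (-1)) g))" .
  qed
  also have "\<dots> = (\<lambda>g. 2 * Pq ?q * prim (-1) g)"
    using n_pos z w0_prim[of "-1" id] one_conv[OF prim_in_GA, of "-1"] by (auto simp: id)
  finally show ?thesis .
qed

text \<open>The eigenvector \<kappa> serves twice: for the existence of the character and, divided
  by \<open>P\<close>, as the comparison element of \<open>ind_iso\<close>. It is nonzero because
  \<open>P\<close> and \<open>prim s\<close> are.\<close>

lemma ind_iso_prim: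
  assumes Y: "Y \<subseteq> B" and cY: "card (generate (hyperoct n) Y) = 2 * n"
    and \<xi>: "\<And>y. y \<in> Y \<Longrightarrow> \<xi> y \<noteq> 0"
      "\<And>y g. y \<in> Y \<Longrightarrow> g \<in> B \<Longrightarrow> \<kappa> (g \<circ> y) = inverse (\<xi> y) * \<kappa> g"
    and \<kappa>: "\<kappa> \<in> GA" "\<kappa> \<star> prim s = (\<lambda>g. P * prim s g)" "P \<noteq> 0" and s: "s * s = 1"
  shows "rep_isomorphic (hyperoct n) (ind_rep (hyperoct n) (generate (hyperoct n) Y)
    (THE \<rho>. linear_character (hyperoct n) (generate (hyperoct n) Y) \<rho> \<and> (\<forall>y\<in>Y. \<rho> y = \<xi> y)))
    (left_ideal_rep (prim s))"
proof -
  have "\<exists>\<sigma>\<in>B. \<kappa> \<sigma> \<noteq> 0"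
  proof (rule ccontr)
    assume "\<not> (\<exists>\<sigma>\<in>B. \<kappa> \<sigma> \<noteq> 0)"
    then have "\<kappa> = (\<lambda>_. 0)" using \<kappa>(1) by (intro GA_eqI) (auto simp: GA_zero)
    then have "P * prim s id = 0" using \<kappa>(2) by (metis conv_zero_left)
    then show False using \<kappa>(3) n_pos by (simp add: prim_one)
  qed
  then obtain \<sigma> where \<sigma>: "\<sigma> \<in> B" "\<kappa> \<sigma> \<noteq> 0" by blast
  let ?H = "generate (hyperoct n) Y"
  have \<xi>': "\<kappa> (g \<otimes>\<^bsub>hyperoct n\<^esub> y) = inverse (\<xi> y) * \<kappa> g" if "y \<in> Y" "g \<in> B" for y g
    using \<xi>(2)[OF that] by simp
  have lc1: "\<exists>!\<rho>. linear_character (hyperoct n) ?H \<rho> \<and> (\<forall>y\<in>Y. \<rho> y = \<xi> y)"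
    by (rule linear_character_generate(1)[where \<kappa> = \<kappa>, OF Y \<sigma>]) (fact \<xi>(1) \<xi>')+
  define \<rho> where "\<rho> = (THE \<rho>. linear_character (hyperoct n) ?H \<rho> \<and> (\<forall>y\<in>Y. \<rho> y = \<xi> y))"
  have \<rho>: "linear_character (hyperoct n) ?H \<rho>" "\<forall>y\<in>Y. \<rho> y = \<xi> y"
    using theI'[OF lc1] unfolding \<rho>_def by blast+
  have lc2: "\<kappa> (g \<otimes>\<^bsub>hyperoct n\<^esub> h) = inverse (\<rho> h) * \<kappa> g" if "h \<in> ?H" "g \<in> B" for g h
    by (rule linear_character_generate(2)[where \<xi> = \<xi> and \<kappa> = \<kappa>, OF Y \<sigma> _ _ \<rho> that]) (fact \<xi>(1) \<xi>')+
  have "rep_isomorphic (hyperoct n) (ind_rep (hyperoct n) ?H \<rho>) (left_ideal_rep (prim s))"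
  proof (rule ind_iso[where \<kappa> = "\<lambda>g. (1 / P) * \<kappa> g"])
    show "subgroup ?H (hyperoct n)" by (rule generate_is_subgroup[OF Y])
    show "(\<lambda>g. 1 / P * \<kappa> g) \<in> carrier (ind_rep (hyperoct n) ?H \<rho>)"
      using lc2 \<kappa>(1) by (auto simp: ind_rep_def GA_def)
    show "(\<lambda>g. 1 / P * \<kappa> g) \<star> prim s = prim s"
      using \<kappa>(2,3) by (simp only: conv_smult_left) simp
    show "prim s \<star> prim s = prim s" by (rule prim_idem[OF s])
    show "prim s \<one>\<^bsub>hyperoct n\<^esub> = 1 / of_nat (card ?H)" using prim_one cY by simp
  qed (rule \<rho>)
  then show ?thesis unfolding \<rho>_def .
qed

lemma Pq_nonzero: "(\<And>j. 0 < j \<Longrightarrow> j < n \<Longrightarrow> q ^ j \<noteq> 1) \<Longrightarrow> Pq q \<noteq> 0"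
proof -
  assume q: "\<And>j. 0 < j \<Longrightarrow> j < n \<Longrightarrow> q ^ j \<noteq> 1"
  have "1 - q ^ nat i \<noteq> 0" if "i \<in> E" for i using q[of "nat i"] that by (auto simp: nat_less_iff)
  then show ?thesis by (simp add: prod_zero_iff)
qed

lemma kappa_pos_in_GA: "kappa_pos q s \<in> GA" and kappa_neg_in_GA: "kappa_neg z \<in> GA"
  by (simp_all add: GA_def kappa_pos_def kappa_neg_def)

lemma ind_pos_iso:
  "rep_isomorphic (hyperoct n) (ind_rep (hyperoct n) (Z_pos n) (rho_pos n)) (left_ideal_rep (prim 1))"
proof -
  \<comment> \<open>Functions in \<open>ind_rep\<close> transform by the inverse of the character,
    hence the inverse root of unity.\<close>
  let ?q = "inverse (omega n)"
  define \<xi> where "\<xi> y = (if y = c then omega n else 1)" for y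
  have n0: "n \<noteq> 0" using n_pos by simp
  have cw: "w0 n \<noteq> c" using w0_notin_S[OF id_in_S] c_in_S by auto
  have q: "?q ^ j = 1 \<longleftrightarrow> n dvd j" for j
    using omega_power[OF n0, of j] by (simp add: power_inverse)
  have "rho_pos n = (THE \<rho>. linear_character (hyperoct n) (Z_pos n) \<rho> \<and> (\<forall>y\<in>{c, w0 n}. \<rho> y = \<xi> y))"
    using cw by (simp add: rho_pos_def \<xi>_def)
  moreover have "rep_isomorphic (hyperoct n) (ind_rep (hyperoct n) (generate (hyperoct n) {c, w0 n})
    (THE \<rho>. linear_character (hyperoct n) (generate (hyperoct n) {c, w0 n}) \<rho> \<and> (\<forall>y\<in>{c, w0 n}. \<rho> y = \<xi> y)))
    (left_ideal_rep (prim 1))"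
  proof (rule ind_iso_prim[where \<kappa> = "kappa_pos ?q 1" and P = "2 * Pq ?q"])
    show "card (generate (hyperoct n) {c, w0 n}) = 2 * n" using Z_pos_eq by simp
    show "kappa_pos ?q 1 (g \<circ> y) = inverse (\<xi> y) * kappa_pos ?q 1 g" if "y \<in> {c, w0 n}" "g \<in> B" for y g
      using that cw kappa_pos_c[of ?q g 1] kappa_pos_w0[of 1 g ?q] q[of n] by (auto simp: \<xi>_def)
    show "kappa_pos ?q 1 \<star> prim 1 = (\<lambda>g. 2 * Pq ?q * prim 1 g)" by (rule kappa_pos_conv) simp
    have "Pq ?q \<noteq> 0" by (rule Pq_nonzero) (use q in \<open>auto dest: dvd_imp_le\<close>)
    then show "2 * Pq ?q \<noteq> 0" by simp
  qed (auto simp: \<xi>_def kappa_pos_in_GA)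
  ultimately show ?thesis by (simp add: Z_pos_eq(1))
qed

lemma ind_neg_iso:
  "rep_isomorphic (hyperoct n) (ind_rep (hyperoct n) (Z_neg n) (rho_neg n)) (left_ideal_rep (prim (-1)))"
proof -
  let ?z = "omega (2 * n)" and ?d = "d_elt n"
  have n0: "n \<noteq> 0" using n_pos by simp
  have half: "?z ^ n = -1" by (rule omega_half[OF n0])
  have z: "?z ^ j = 1 \<longleftrightarrow> 2 * n dvd j" for j by (rule omega_power) (simp add: n0)
  have z2: "(?z\<^sup>2) ^ j \<noteq> 1" if "0 < j" "j < n" for j
    using z[of "2 * j"] that by (auto simp: power_mult[symmetric] dest: dvd_imp_le)
  have "\<exists>\<kappa> P. \<kappa> \<in> GA \<and> \<kappa> \<star> prim (-1) = (\<lambda>g. P * prim (-1) g) \<and> P \<noteq> 0 \<and>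
    (\<forall>g\<in>B. \<kappa> (g \<circ> ?d) = inverse ?z * \<kappa> g)"
  proof (cases "odd n")
    case True
    \<comment> \<open>Chosen so that \<open>- ?q\<close>, the eigenvalue under
      \<open>c \<circ> w0 n\<close> for \<open>s = -1\<close>, is \<open>inverse ?z\<close>. It is
      an \<open>n\<close>-th root of unity because \<open>n\<close> is odd and
      \<open>?z ^ n = -1\<close>.\<close>
    let ?q = "- inverse ?z"
    have q: "?q ^ n = 1" using half True by (simp add: power_minus_odd power_inverse)
    have "Pq ?q \<noteq> 0"
    proof (rule Pq_nonzero)
      fix j assume j: "0 < j" "j < n"
      show "?q ^ j \<noteq> 1"
      proof
        assume "?q ^ j = 1"
        then have "(?q ^ j)\<^sup>2 = 1" by simp
        then have "inverse ((?z\<^sup>2) ^ j) = 1"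
          by (simp add: power_mult_distrib power_inverse flip: power_mult) (simp add: mult.commute)
        then show False using z2[OF j] by simp
      qed
    qed
    moreover have "kappa_pos ?q (-1) (g \<circ> ?d) = inverse ?z * kappa_pos ?q (-1) g" if g: "g \<in> B" for g
      using kappa_pos_w0[of "-1" "g \<circ> c" ?q] kappa_pos_c[OF q g, of "-1"] g True by (simp add: d_elt_def comp_assoc)
    moreover have "kappa_pos ?q (-1) \<star> prim (-1) = (\<lambda>g. 2 * Pq ?q * prim (-1) g)" by (rule kappa_pos_conv) simp
    ultimately show ?thesis
      by (intro exI[of _ "kappa_pos ?q (-1)"] exI[of _ "2 * Pq ?q"]) (simp add: kappa_pos_in_GA)
  next
    case False
    let ?q = "inverse (?z\<^sup>2)"
    have "Pq ?q \<noteq> 0"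
      by (rule Pq_nonzero) (use z2 in \<open>simp add: power_inverse\<close>)
    then show ?thesis
      using kappa_neg_\<delta>[OF half] kappa_neg_conv[OF half] False
      by (intro exI[of _ "kappa_neg ?z"] exI[of _ "2 * Pq ?q"]) (simp add: kappa_neg_in_GA d_elt_def)
  qed
  then obtain \<kappa> P where \<kappa>: "\<kappa> \<in> GA" "\<kappa> \<star> prim (-1) = (\<lambda>g. P * prim (-1) g)" "P \<noteq> 0"
    "\<And>g. g \<in> B \<Longrightarrow> \<kappa> (g \<circ> ?d) = inverse ?z * \<kappa> g" by blast
  have "rep_isomorphic (hyperoct n) (ind_rep (hyperoct n) (generate (hyperoct n) {?d})
    (THE \<rho>. linear_character (hyperoct n) (generate (hyperoct n) {?d}) \<rho> \<and> (\<forall>y\<in>{?d}. \<rho> y = (\<lambda>_. ?z) y)))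
    (left_ideal_rep (prim (-1)))"
    by (rule ind_iso_prim[OF _ _ _ _ \<kappa>(1-3)]) (use Z_neg_eq \<kappa>(4) in auto)
  then show ?thesis by (simp add: rho_neg_def Z_neg_eq(1))
qed

end

section \<open>Locally constant functions\<close>

lemma lin_span_subrep:
  assumes V: "Module.module complex_ring V" and F: "submodule F complex_ring V" and T: "T \<subseteq> F"
  shows "lin_span (subrep V F) T = lin_span V T"
proof -
  have mF: "Module.module complex_ring (subrep V F)"
    unfolding subrep_def by (rule submodule.submodule_is_module[OF F V])
  have s: "carrier (subrep V F) = F" "\<zero>\<^bsub>subrep V F\<^esub> = \<zero>\<^bsub>V\<^esub>" "x \<oplus>\<^bsub>subrep V F\<^esub> y = x \<oplus>\<^bsub>V\<^esub> y"
    "a \<odot>\<^bsub>subrep V F\<^esub> x = a \<odot>\<^bsub>V\<^esub> x" for x y a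
    by (simp_all add: subrep_def)
  have TV: "T \<subseteq> carrier V" using T submoduleD(1)[OF F] by auto
  show ?thesis
  proof
    have LF: "lin_span V T \<subseteq> F" by (rule lin_span_least[OF F T])
    note L = submoduleD[OF lin_span_submodule[OF V TV]]
    have "submodule (lin_span V T) complex_ring (subrep V F)"
      by (rule complex_submoduleI[OF mF]) (use LF L in \<open>auto simp: s\<close>)
    then show "lin_span (subrep V F) T \<subseteq> lin_span V T"
      by (rule lin_span_least[OF _ lin_span_superset])
    have "T \<subseteq> carrier (subrep V F)" using T by (simp add: s)
    note L' = submoduleD[OF lin_span_submodule[OF mF this]]
    have "submodule (lin_span (subrep V F) T) complex_ring V"
      by (rule complex_submoduleI[OF V]) (use L' submoduleD(1)[OF F] in \<open>auto simp: s\<close>)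
    then show "lin_span V T \<subseteq> lin_span (subrep V F) T"
      by (rule lin_span_least[OF _ lin_span_superset])
  qed
qed

context stable_submodule
begin

lemma quot_lin_span:
  assumes T: "T \<subseteq> carrier V"
  shows "lin_span (quot_rep V U) ((\<lambda>x. U +>\<^bsub>V\<^esub> x) ` T) = (\<lambda>x. U +>\<^bsub>V\<^esub> x) ` lin_span V T"
proof -
  let ?p = "\<lambda>x. U +>\<^bsub>V\<^esub> x"
  have mQ: "Module.module complex_ring (quot_rep V U)"
    using quot_representation by (simp add: representation_def)
  note L = submoduleD[OF lin_span_submodule[OF M.module_axioms T]]
  have TQ: "?p ` T \<subseteq> carrier (quot_rep V U)" using T by (auto simp: quot_carrier)
  note L' = submoduleD[OF lin_span_submodule[OF mQ TQ]]
  show ?thesis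
  proof
    have "submodule (?p ` lin_span V T) complex_ring (quot_rep V U)"
    proof (rule complex_submoduleI[OF mQ])
      show "?p ` lin_span V T \<subseteq> carrier (quot_rep V U)" using L(1) by (auto simp: quot_carrier)
      show "\<zero>\<^bsub>quot_rep V U\<^esub> \<in> ?p ` lin_span V T" using L(2) by (auto simp: quot_zero)
      show "a \<oplus>\<^bsub>quot_rep V U\<^esub> b \<in> ?p ` lin_span V T" if ab: "a \<in> ?p ` lin_span V T" "b \<in> ?p ` lin_span V T" for a b
      proof -
        obtain x y where xy: "x \<in> lin_span V T" "y \<in> lin_span V T" "a = ?p x" "b = ?p y" using ab by blast
        then have "a \<oplus>\<^bsub>quot_rep V U\<^esub> b = ?p (x \<oplus>\<^bsub>V\<^esub> y)"
          using quot_add[OF subsetD[OF L(1) xy(1)] subsetD[OF L(1) xy(2)]] by simp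
        then show ?thesis using L(3)[OF xy(1,2)] by blast
      qed
      show "a \<odot>\<^bsub>quot_rep V U\<^esub> b \<in> ?p ` lin_span V T" if b: "b \<in> ?p ` lin_span V T" for a b
      proof -
        obtain x where x: "x \<in> lin_span V T" "b = ?p x" using b by blast
        then have "a \<odot>\<^bsub>quot_rep V U\<^esub> b = ?p (a \<odot>\<^bsub>V\<^esub> x)"
          using quot_smult[OF subsetD[OF L(1) x(1)]] by simp
        then show ?thesis using L(4)[OF x(1), of a] by blast
      qed
    qed
    then show "lin_span (quot_rep V U) (?p ` T) \<subseteq> ?p ` lin_span V T"
      by (rule lin_span_least) (use lin_span_superset[of T V] in auto)
    define D where "D = {x \<in> carrier V. ?p x \<in> lin_span (quot_rep V U) (?p ` T)}"
    have "submodule D complex_ring V"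
    proof (rule complex_submoduleI[OF M.module_axioms])
      show "\<zero>\<^bsub>V\<^esub> \<in> D" using L'(2) by (auto simp: D_def quot_zero)
      show "x \<oplus>\<^bsub>V\<^esub> y \<in> D" if "x \<in> D" "y \<in> D" for x y
        using L'(3)[of "?p x" "?p y"] that by (auto simp: D_def quot_add)
      show "a \<odot>\<^bsub>V\<^esub> x \<in> D" if "x \<in> D" for a x
        using L'(4)[of "?p x" a] that M.smult_closed[of a x] by (auto simp: D_def quot_smult)
    qed (auto simp: D_def)
    then have "lin_span V T \<subseteq> D"
      by (rule lin_span_least) (use T lin_span_superset[of "?p ` T" "quot_rep V U"] in \<open>auto simp: D_def\<close>)
    then show "?p ` lin_span V T \<subseteq> lin_span (quot_rep V U) (?p ` T)" by (auto simp: D_def)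
  qed
qed

end

context hyperoctahedral
begin

section \<open>Coordinates and the action on points\<close>

abbreviation Z where "Z \<equiv> Zspace n"
abbreviation H where "H \<equiv> H0 n"
abbreviation z1 where "z1 \<equiv> z_one n"
abbreviation z2 where "z2 \<equiv> z_two n"
abbreviation sp where "sp X \<equiv> lin_span (H0 n) X"

lemma Z_nonzero: "x \<in> Z \<Longrightarrow> i \<in> L \<Longrightarrow> x i \<noteq> 0"
  by (auto simp: Zspace_def PiE_iff)

lemma coord_nonzero: "x \<in> Z \<Longrightarrow> i \<in> ss \<Longrightarrow> coord x i \<noteq> 0"
  using Z_nonzero[of x i] Z_nonzero[of x "- i"] by (auto simp: coord_def signed_set_iff)

lemma coord_neg: "x \<in> Z \<Longrightarrow> i \<in> ss \<Longrightarrow> coord x (- i) = - 1 / coord x i"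
  using Z_nonzero[of x i] Z_nonzero[of x "- i"] by (auto simp: coord_def signed_set_iff)

lemma coord_pos_neg: "x \<in> Z \<Longrightarrow> i \<in> ss \<Longrightarrow> 0 < coord x (- i) \<longleftrightarrow> \<not> 0 < coord x i"
  using coord_nonzero[of x i] by (auto simp: coord_neg divide_less_0_iff zero_less_divide_iff not_less)

text \<open>\<open>Zspace\<close> separates \<open>x_i\<close> from \<open>x_j\<close> and
  \<open>-1/x_j\<close> for \<open>i \<noteq> j\<close>. That \<open>x_i\<close> differs from
  \<open>-1/x_i\<close> is automatic, as no real square is \<open>-1\<close>.\<close>

lemma coord_eq_iff:
  assumes x: "x \<in> Z" and i: "i \<in> ss" and j: "j \<in> ss"
  shows "coord x i = coord x j \<longleftrightarrow> i = j"
proof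
  assume eq: "coord x i = coord x j"
  have d: "x k \<noteq> x l" "x k \<noteq> - 1 / x l" if "k \<in> L" "l \<in> L" "k \<noteq> l" for k l
    using x that by (auto simp: Zspace_def)
  have s: "x k \<noteq> - 1 / x k" if "k \<in> L" for k
  proof
    assume "x k = - 1 / x k"
    then have "x k * x k = - 1" using Z_nonzero[OF x that] by (simp add: field_simps)
    then show False using zero_le_square[of "x k"] by linarith
  qed
  consider "0 < i" "0 < j" | "0 < i" "j < 0" | "i < 0" "0 < j" | "i < 0" "j < 0"
    using i j by (force simp: signed_set_iff)
  then show "i = j"
  proof cases
    case 1
    then show ?thesis using eq d(1)[of i j] i j by (auto simp: coord_def signed_set_iff)
  next
    case 2
    then show ?thesis using eq d(2)[of i "- j"] s[of i] i j
      by (cases "i = - j") (auto simp: coord_def signed_set_iff)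
  next
    case 3
    then show ?thesis using eq[symmetric] d(2)[of j "- i"] s[of j] i j
      by (cases "j = - i") (auto simp: coord_def signed_set_iff)
  next
    case 4
    then have "x (- i) = x (- j)"
      using eq Z_nonzero[OF x, of "- i"] Z_nonzero[OF x, of "- j"] i j
      by (auto simp: coord_def signed_set_iff field_simps)
    then show ?thesis using d(1)[of "- i" "- j"] 4 i j by (auto simp: signed_set_iff)
  qed
qed simp

text \<open>The map \<open>t -> -1/t\<close> increases on each half line and exchanges the two half
  lines. The sign factors that appear when an edge is barred come from here.\<close>

lemma coord_less_bar:
  assumes x: "x \<in> Z" and i: "i \<in> ss" and j: "j \<in> ss"
  shows "coord x (- i) < coord x (- j) \<longleftrightarrow>
    (if 0 < coord x i \<longleftrightarrow> 0 < coord x j then coord x i < coord x j else 0 < coord x i)"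
proof -
  have a: "coord x i \<noteq> 0" "coord x j \<noteq> 0" using coord_nonzero x i j by auto
  have key: "- 1 / a < - 1 / b \<longleftrightarrow> (if 0 < a \<longleftrightarrow> 0 < b then a < b else 0 < a)" if "a \<noteq> 0" "b \<noteq> 0" for a b :: real
    using that by (cases "0 < a"; cases "0 < b") (auto simp: divide_simps)
  show ?thesis unfolding coord_neg[OF x i] coord_neg[OF x j] by (rule key[OF a])
qed

lemma coord_point_act:
  assumes x: "x \<in> Z" and w: "w \<in> B" and i: "i \<in> ss"
  shows "coord (point_act n w x) i = coord x (bi w i)"
proof (cases "0 < i")
  case True
  then show ?thesis using i by (simp add: point_act_def coord_def signed_set_iff)
next
  case False
  then have "coord (point_act n w x) i = - 1 / coord x (bi w (- i))"
    using i by (simp add: point_act_def coord_def signed_set_iff)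
  also have "\<dots> = coord x (- bi w (- i))" using w i x coord_neg[of x "bi w (- i)"] B_ss[of "bi w" "- i"]
    by (auto simp: signed_set_iff)
  finally show ?thesis using w by (simp add: B_odd)
qed

lemma coord_pos: "i \<in> L \<Longrightarrow> coord x i = x i"
  by (simp add: coord_def)

lemma ZI:
  assumes "x \<in> extensional L" "\<And>i. i \<in> L \<Longrightarrow> x i \<noteq> 0"
    "\<And>i j. i \<in> L \<Longrightarrow> j \<in> L \<Longrightarrow> i \<noteq> j \<Longrightarrow> x i \<noteq> x j \<and> x i \<noteq> - 1 / x j"
  shows "x \<in> Z"
  using assms by (auto simp: Zspace_def PiE_iff)

lemma point_act_in_Z:
  assumes x: "x \<in> Z" and w: "w \<in> B"
  shows "point_act n w x \<in> Z"
proof (rule ZI)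
  have c: "point_act n w x i = coord x (bi w i)" if "i \<in> L" for i using that by (simp add: point_act_def)
  have b: "bi w i \<in> ss" if "i \<in> L" for i using w L_ss[OF that] by simp
  show "point_act n w x \<in> extensional L" by (simp add: point_act_def)
  show "point_act n w x i \<noteq> 0" if "i \<in> L" for i
    using coord_nonzero[OF x b[OF that]] c[OF that] by simp
  show "point_act n w x i \<noteq> point_act n w x j \<and> point_act n w x i \<noteq> - 1 / point_act n w x j"
    if ij: "i \<in> L" "j \<in> L" "i \<noteq> j" for i j
  proof
    show "point_act n w x i \<noteq> point_act n w x j"
      using coord_eq_iff[OF x b[OF ij(1)] b[OF ij(2)]] c ij w by (auto simp: B_inj)
    have "- bi w j \<in> ss" using b[OF ij(2)] by (simp add: signed_set_iff)
    then have "coord x (bi w i) \<noteq> coord x (- bi w j)"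
      using coord_eq_iff[OF x b[OF ij(1)], of "- bi w j"] ij w B_inj[of "bi w" i "- j"] by (auto simp: B_odd)
    then show "point_act n w x i \<noteq> - 1 / point_act n w x j"
      using coord_neg[OF x b[OF ij(2)]] c ij by simp
  qed
qed

lemma Z_eqI:
  assumes "x \<in> Z" "y \<in> Z" "\<And>i. i \<in> L \<Longrightarrow> coord x i = coord y i"
  shows "x = y"
proof (rule extensionalityI)
  show "x \<in> extensional L" "y \<in> extensional L" using assms by (auto simp: Zspace_def PiE_def)
qed (use assms in \<open>simp add: coord_pos\<close>)

lemma point_act_comp:
  assumes x: "x \<in> Z" and u: "u \<in> B" and v: "v \<in> B"
  shows "point_act n (u \<circ> v) x = point_act n u (point_act n v x)"
proof (rule Z_eqI)
  fix i assume "i \<in> L"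
  then have "i \<in> ss" by (rule L_ss)
  then show "coord (point_act n (u \<circ> v) x) i = coord (point_act n u (point_act n v x)) i"
    using assms by (simp add: coord_point_act point_act_in_Z bi_comp)
qed (use assms in \<open>auto intro: point_act_in_Z\<close>)

lemma point_act_id: "x \<in> Z \<Longrightarrow> point_act n id x = x"
  by (rule Z_eqI) (auto simp: point_act_in_Z coord_point_act L_ss bi_id)

lemma topspace_Ztop: "topspace (Ztop n) = Z"
  by (auto simp: Ztop_def Zspace_def topspace_product_topology PiE_def)

lemma continuous_coord:
  assumes i: "i \<in> ss"
  shows "continuous_map (Ztop n) euclideanreal (\<lambda>x. coord x i)"
proof -
  have p: "continuous_map (Ztop n) euclideanreal (\<lambda>x. x k)" if "k \<in> L" for k
    unfolding Ztop_def using that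
    by (intro continuous_map_from_subtopology continuous_map_product_projection)
  show ?thesis
  proof (cases "0 < i")
    case True
    then show ?thesis using p[of i] i by (simp add: coord_def signed_set_iff)
  next
    case False
    then have k: "- i \<in> L" using i by (auto simp: signed_set_iff)
    have "continuous_map (Ztop n) euclideanreal (\<lambda>x. - 1 / x (- i))"
      by (intro continuous_map_real_divide p[OF k] continuous_map_const[THEN iffD2])
        (use Z_nonzero k in \<open>auto simp: topspace_Ztop\<close>)
    then show ?thesis using False by (simp add: coord_def)
  qed
qed

lemma open_less:
  assumes f: "continuous_map (Ztop n) euclideanreal f" and g: "continuous_map (Ztop n) euclideanreal g"
  shows "openin (Ztop n) {x \<in> Z. f x < g x}"
proof -
  have "continuous_map (Ztop n) euclideanreal (\<lambda>x. g x - f x)"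
    by (intro continuous_map_diff f g)
  then have "openin (Ztop n) {x \<in> topspace (Ztop n). g x - f x \<in> {0<..}}"
    by (rule openin_continuous_map_preimage) simp
  then show ?thesis by (simp add: topspace_Ztop)
qed

section \<open>The module of locally constant functions and its generators\<close>

lemma H_simps [simp]:
  "\<zero>\<^bsub>H0 n\<^esub> = (\<lambda>x\<in>Z. 0)" "f \<oplus>\<^bsub>H0 n\<^esub> g = (\<lambda>x\<in>Z. f x + g x)" "a \<odot>\<^bsub>H0 n\<^esub> f = (\<lambda>x\<in>Z. a * f x)"
  "act (H0 n) w f = (\<lambda>x\<in>Z. f (point_act n (bi w) x))"
  by (simp_all add: H0_def)

lemma H_iff: "f \<in> carrier H \<longleftrightarrow> f \<in> extensional Z \<and>
  (\<forall>x\<in>Z. \<exists>U. openin (Ztop n) U \<and> x \<in> U \<and> (\<forall>y\<in>U. f y = f x))"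
  by (simp add: H0_def)

lemma H_combine:
  assumes f: "f \<in> carrier H" and g: "g \<in> carrier H"
  shows "(\<lambda>x\<in>Z. F (f x) (g x)) \<in> carrier H"
  unfolding H_iff
proof (intro conjI ballI)
  fix x assume x: "x \<in> Z"
  obtain U U' where U: "openin (Ztop n) U" "x \<in> U" "\<forall>y\<in>U. f y = f x"
    and U': "openin (Ztop n) U'" "x \<in> U'" "\<forall>y\<in>U'. g y = g x"
    using f g x unfolding H_iff by meson
  have "(\<lambda>x\<in>Z. F (f x) (g x)) y = (\<lambda>x\<in>Z. F (f x) (g x)) x" if "y \<in> U \<inter> U'" for y
  proof -
    have "y \<in> Z" using openin_subset[OF U(1)] that by (auto simp: topspace_Ztop)
    moreover have "f y = f x" "g y = g x" using U(3) U'(3) that by auto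
    ultimately show ?thesis using x by simp
  qed
  then show "\<exists>U. openin (Ztop n) U \<and> x \<in> U \<and> (\<forall>y\<in>U. (\<lambda>x\<in>Z. F (f x) (g x)) y = (\<lambda>x\<in>Z. F (f x) (g x)) x)"
    using openin_Int[OF U(1) U'(1)] U(2) U'(2) by blast
qed simp

lemma H_const: "(\<lambda>x\<in>Z. a) \<in> carrier H"
  unfolding H_iff
proof (intro conjI ballI)
  fix x assume x: "x \<in> Z"
  have "openin (Ztop n) Z" using openin_topspace[of "Ztop n"] by (simp add: topspace_Ztop)
  then show "\<exists>U. openin (Ztop n) U \<and> x \<in> U \<and> (\<forall>y\<in>U. (\<lambda>x\<in>Z. a) y = (\<lambda>x\<in>Z. a) x)"
    using x by (intro exI[of _ Z]) auto
qed simp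

lemma H_of_bool:
  assumes "openin (Ztop n) {x \<in> Z. Q x}" "openin (Ztop n) {x \<in> Z. \<not> Q x}"
  shows "(\<lambda>x\<in>Z. of_bool (Q x)) \<in> carrier H"
  unfolding H_iff
proof (intro conjI ballI)
  fix x assume x: "x \<in> Z"
  show "\<exists>U. openin (Ztop n) U \<and> x \<in> U \<and> (\<forall>y\<in>U. (\<lambda>x\<in>Z. of_bool (Q x)) y = (\<lambda>x\<in>Z. of_bool (Q x)) x)"
    using assms x by (intro exI[of _ "{y \<in> Z. Q y \<longleftrightarrow> Q x}"]) (cases "Q x"; simp)
qed simp

lemma H_ext: "f \<in> carrier H \<Longrightarrow> x \<notin> Z \<Longrightarrow> f x = undefined"
  by (auto simp: H_iff extensional_def)

lemma module_H: "Module.module complex_ring H"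
proof (rule complex_moduleI)
  have eq: "f = g" if "f \<in> carrier H" "g \<in> carrier H" "\<And>x. x \<in> Z \<Longrightarrow> f x = g x" for f g
    using that H_ext by (metis ext)
  show "f \<oplus>\<^bsub>H\<^esub> g \<in> carrier H" if "f \<in> carrier H" "g \<in> carrier H" for f g
    using H_combine[OF that, of "(+)"] by simp
  show "a \<odot>\<^bsub>H\<^esub> f \<in> carrier H" if "f \<in> carrier H" for a f
    using H_combine[OF that that, of "\<lambda>x _. a * x"] by simp
  show "\<zero>\<^bsub>H\<^esub> \<in> carrier H" by (simp add: H_const)
  show "\<zero>\<^bsub>H\<^esub> \<oplus>\<^bsub>H\<^esub> f = f" if "f \<in> carrier H" for f
    using that H_ext[OF that] by auto
  show "1 \<odot>\<^bsub>H\<^esub> f = f" if "f \<in> carrier H" for f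
    using that H_ext[OF that] by auto
qed (auto simp: algebra_simps)

abbreviation gens where "gens \<equiv> gens_one n \<union> gens_two n"

lemma z1_apply: "x \<in> Z \<Longrightarrow> z1 i x = of_bool (0 < coord x i)"
  and z2_apply: "x \<in> Z \<Longrightarrow> z2 i j x = of_bool (coord x i < coord x j)"
  by (simp_all add: z_one_def z_two_def)

lemma z1_in_H: "i \<in> ss \<Longrightarrow> z1 i \<in> carrier H"
proof -
  assume i: "i \<in> ss"
  have "{x \<in> Z. \<not> 0 < coord x i} = {x \<in> Z. coord x i < 0}" using coord_nonzero i by force
  then show ?thesis
    using i unfolding z_one_def by (intro H_of_bool) (auto intro!: open_less continuous_coord)
qed

lemma z2_in_H: "i \<in> ss \<Longrightarrow> j \<in> ss \<Longrightarrow> i \<noteq> j \<Longrightarrow> z2 i j \<in> carrier H"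
proof -
  assume ij: "i \<in> ss" "j \<in> ss" "i \<noteq> j"
  have "{x \<in> Z. \<not> coord x i < coord x j} = {x \<in> Z. coord x j < coord x i}"
    using coord_eq_iff ij by force
  then show ?thesis
    using ij unfolding z_two_def by (intro H_of_bool) (auto intro!: open_less continuous_coord)
qed

lemma gens_in_H: "gens \<subseteq> carrier H"
  using z1_in_H z2_in_H by (auto simp: gens_one_def gens_two_def)

lemma prod_fun_apply: "x \<in> Z \<Longrightarrow> prod_fun n fs x = (\<Prod>f\<leftarrow>fs. f x)"
  by (simp add: prod_fun_def)

lemma prod_fun_in_H: "set fs \<subseteq> gens \<Longrightarrow> prod_fun n fs \<in> carrier H"
proof (induction fs)
  case Nil
  then show ?case
    unfolding prod_fun_def using H_const[of 1] by (simp only: list.map prod_list.Nil)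
next
  case (Cons f fs)
  then have "(\<lambda>x\<in>Z. f x * prod_fun n fs x) \<in> carrier H"
    using gens_in_H by (intro H_combine) auto
  moreover have "(\<lambda>x\<in>Z. f x * prod_fun n fs x) = prod_fun n (f # fs)"
    by (auto simp: prod_fun_def)
  ultimately show ?case by simp
qed

lemma act_z1: "w \<in> B \<Longrightarrow> i \<in> ss \<Longrightarrow> act H w (z1 i) = z1 (w i)"
  and act_z2: "w \<in> B \<Longrightarrow> i \<in> ss \<Longrightarrow> j \<in> ss \<Longrightarrow> act H w (z2 i j) = z2 (w i) (w j)"
  by (auto simp: z_one_def z_two_def point_act_in_Z coord_point_act bi_bi)

lemma act_gens:
  assumes "w \<in> B"
  shows "f \<in> gens_one n \<Longrightarrow> act H w f \<in> gens_one n" "f \<in> gens_two n \<Longrightarrow> act H w f \<in> gens_two n"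
proof -
  assume "f \<in> gens_one n"
  then obtain i where "i \<in> ss" "f = z1 i" by (auto simp: gens_one_def)
  then have "act H w f = z1 (w i)" "w i \<in> ss" using act_z1[OF assms] assms by (simp_all del: H_simps)
  then show "act H w f \<in> gens_one n" unfolding gens_one_def by blast
next
  assume "f \<in> gens_two n"
  then obtain i j where "i \<in> ss" "j \<in> ss" "i \<noteq> j" "f = z2 i j" by (auto simp: gens_two_def)
  then have "act H w f = z2 (w i) (w j)" "w i \<in> ss" "w j \<in> ss" "w i \<noteq> w j"
    using act_z2[OF assms] assms by (simp_all add: B_inj del: H_simps)
  then show "act H w f \<in> gens_two n" unfolding gens_two_def by blast
qed

lemma act_prod_fun: "w \<in> B \<Longrightarrow> act H w (prod_fun n fs) = prod_fun n (map (act H w) fs)"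
  by (auto simp: prod_fun_def point_act_in_Z comp_def)

section \<open>The filtration and the bigraded pieces\<close>

definition top_prods :: "nat \<Rightarrow> nat \<Rightarrow> ((int \<Rightarrow> real) \<Rightarrow> complex) set" where
  "top_prods k l = {prod_fun n fs | fs. set fs \<subseteq> gens \<and> length fs = k \<and>
     l \<le> length (filter (\<lambda>f. f \<in> gens_one n) fs)}"

definition low_prods :: "int \<Rightarrow> ((int \<Rightarrow> real) \<Rightarrow> complex) set" where
  "low_prods k = {prod_fun n fs | fs. set fs \<subseteq> gens \<and> int (length fs) \<le> k}"

lemma Fil_eq: "Fil n k = sp (low_prods k)"
  by (simp add: Fil_def low_prods_def)

lemma prods_in_H: "top_prods k l \<subseteq> carrier H" "low_prods m \<subseteq> carrier H"
  using prod_fun_in_H by (auto simp: top_prods_def low_prods_def)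

lemma top_low: "top_prods k l \<subseteq> low_prods (int k)" "low_prods (int k - 1) \<subseteq> low_prods (int k)"
  "top_prods k (l + 1) \<subseteq> top_prods k l"
  by (force simp: top_prods_def low_prods_def)+

lemma sp_submodule: "X \<subseteq> carrier H \<Longrightarrow> submodule (sp X) complex_ring H"
  by (rule lin_span_submodule[OF module_H])

lemma sp_induct [consumes 2, case_names zero gen add smult]:
  assumes X: "X \<subseteq> carrier H" and f: "f \<in> sp X"
    and z: "R (\<lambda>x\<in>Z. 0)" and gen: "\<And>f. f \<in> X \<Longrightarrow> R f"
    and a: "\<And>f g. f \<in> sp X \<Longrightarrow> g \<in> sp X \<Longrightarrow> R f \<Longrightarrow> R g \<Longrightarrow> R (\<lambda>x\<in>Z. f x + g x)"
    and s: "\<And>a f. f \<in> sp X \<Longrightarrow> R f \<Longrightarrow> R (\<lambda>x\<in>Z. a * f x)"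
  shows "R f"
proof -
  note D = submoduleD[OF sp_submodule[OF X]]
  have "submodule {f \<in> sp X. R f} complex_ring H"
    using D z a s by (intro complex_submoduleI[OF module_H]) auto
  then have "sp X \<subseteq> {f \<in> sp X. R f}"
    by (rule lin_span_least) (use gen lin_span_superset[of X H] in auto)
  then show ?thesis using f by blast
qed

lemma sp_stable:
  assumes X: "X \<subseteq> carrier H" and st: "\<And>f. f \<in> X \<Longrightarrow> act H w f \<in> X" and w: "w \<in> B" and f: "f \<in> sp X"
  shows "act H w f \<in> sp X"
  using X f
proof (induction rule: sp_induct)
  note D = submoduleD[OF sp_submodule[OF X]]
  case zero
  have "act H w (\<lambda>x\<in>Z. 0) = \<zero>\<^bsub>H\<^esub>" using w by (auto simp: point_act_in_Z)
  then show ?case using D(2) by (simp only:)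
next
  case (gen f)
  then show ?case using st lin_span_superset[of X H] by blast
next
  note D = submoduleD[OF sp_submodule[OF X]]
  case (add f g)
  have "act H w (\<lambda>x\<in>Z. f x + g x) = act H w f \<oplus>\<^bsub>H\<^esub> act H w g" using w by (auto simp: point_act_in_Z)
  then show ?case using D(3)[OF add(3,4)] by (simp only:)
next
  note D = submoduleD[OF sp_submodule[OF X]]
  case (smult a f)
  have "act H w (\<lambda>x\<in>Z. a * f x) = a \<odot>\<^bsub>H\<^esub> act H w f" using w by (auto simp: point_act_in_Z)
  then show ?case using D(4)[OF smult(2)] by (simp only:)
qed

lemma prods_stable:
  assumes w: "w \<in> B"
  shows "f \<in> top_prods k l \<Longrightarrow> act H w f \<in> top_prods k l" "f \<in> low_prods m \<Longrightarrow> act H w f \<in> low_prods m"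
proof -
  have g: "set (map (act H w) fs) \<subseteq> gens" if "set fs \<subseteq> gens" for fs
    using that act_gens[OF w] by (auto simp del: H_simps)
  have len: "length (filter (\<lambda>f. f \<in> gens_one n) fs) \<le> length (filter (\<lambda>f. f \<in> gens_one n) (map (act H w) fs))" for fs
    using act_gens(1)[OF w] by (induction fs) (auto simp del: H_simps)
  show "act H w f \<in> top_prods k l" if f: "f \<in> top_prods k l"
  proof -
    obtain fs where fs: "f = prod_fun n fs" "set fs \<subseteq> gens" "length fs = k"
      "l \<le> length (filter (\<lambda>f. f \<in> gens_one n) fs)" using f by (auto simp: top_prods_def)
    then show ?thesis
      unfolding top_prods_def fs(1) act_prod_fun[OF w] using g[OF fs(2)] len[of fs]
      by (intro CollectI exI[of _ "map (act H w) fs"]) (simp del: H_simps)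
  qed
  show "act H w f \<in> low_prods m" if f: "f \<in> low_prods m"
  proof -
    obtain fs where fs: "f = prod_fun n fs" "set fs \<subseteq> gens" "int (length fs) \<le> m"
      using f by (auto simp: low_prods_def)
    then show ?thesis
      unfolding low_prods_def fs(1) act_prod_fun[OF w] using g[OF fs(2)]
      by (intro CollectI exI[of _ "map (act H w) fs"]) (simp del: H_simps)
  qed
qed

lemma Fil_stable: "g \<in> B \<Longrightarrow> f \<in> Fil n k \<Longrightarrow> act H g f \<in> Fil n k"
  unfolding Fil_eq by (rule sp_stable[OF prods_in_H(2) prods_stable(2)])

lemma representation_Fil: "representation (hyperoct n) (subrep H (Fil n k))"
proof (rule representationI)
  have sub: "submodule (Fil n k) complex_ring H" unfolding Fil_eq by (rule sp_submodule[OF prods_in_H(2)])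
  have ext: "f x = undefined" if "f \<in> Fil n k" "x \<notin> Z" for f x
    using submoduleD(1)[OF sub] H_ext that by blast
  show "Group.group (hyperoct n)" by (rule group_axioms)
  show "Module.module complex_ring (subrep H (Fil n k))"
    unfolding subrep_def by (rule submodule.submodule_is_module[OF sub module_H])
  have s: "carrier (subrep H (Fil n k)) = Fil n k" "act (subrep H (Fil n k)) = act H"
    "x \<oplus>\<^bsub>subrep H (Fil n k)\<^esub> y = x \<oplus>\<^bsub>H\<^esub> y" "a \<odot>\<^bsub>subrep H (Fil n k)\<^esub> x = a \<odot>\<^bsub>H\<^esub> x" for x y a
    by (simp_all add: subrep_def)
  show "act (subrep H (Fil n k)) g f \<in> carrier (subrep H (Fil n k))"
    if "g \<in> B" "f \<in> carrier (subrep H (Fil n k))" for g f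
    using Fil_stable[OF that(1), of f] that(2) by (simp only: s)
  show "act (subrep H (Fil n k)) \<one>\<^bsub>hyperoct n\<^esub> f = f" if "f \<in> carrier (subrep H (Fil n k))" for f
  proof
    fix x show "act (subrep H (Fil n k)) \<one>\<^bsub>hyperoct n\<^esub> f x = f x"
      using that ext[of f x] by (cases "x \<in> Z") (simp_all add: s bi_id point_act_id)
  qed
  show "act (subrep H (Fil n k)) (g \<otimes>\<^bsub>hyperoct n\<^esub> h) f = act (subrep H (Fil n k)) g (act (subrep H (Fil n k)) h f)"
    if "g \<in> B" "h \<in> B" "f \<in> carrier (subrep H (Fil n k))" for g h f
  proof
    fix x show "act (subrep H (Fil n k)) (g \<otimes>\<^bsub>hyperoct n\<^esub> h) f x =
      act (subrep H (Fil n k)) g (act (subrep H (Fil n k)) h f) x"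
      using that by (cases "x \<in> Z") (simp_all add: s bi_comp point_act_comp point_act_in_Z)
  qed
qed (auto simp: subrep_def point_act_in_Z)

text \<open>Reduces the piece, a quotient inside a quotient, to plain functions: \<phi> lives on
  \<open>Fil n k\<close>, is onto already from the span of \<open>top_prods k l\<close>, and has its
  kernel there inside the span of the generators of \<open>F_{k-1}\<close> and
  \<open>P_{k,l+1}\<close>. No cosets appear in the conditions left to check.\<close>

lemma G_piece_iso:
  fixes \<phi> :: "((int \<Rightarrow> real) \<Rightarrow> complex) \<Rightarrow> 'w"
  assumes W: "representation (hyperoct n) W"
    and closed: "\<And>f. f \<in> Fil n (int k) \<Longrightarrow> \<phi> f \<in> carrier W"
    and add: "\<And>f g. f \<in> Fil n (int k) \<Longrightarrow> g \<in> Fil n (int k) \<Longrightarrow> \<phi> (\<lambda>x\<in>Z. f x + g x) = \<phi> f \<oplus>\<^bsub>W\<^esub> \<phi> g"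
    and smult: "\<And>a f. f \<in> Fil n (int k) \<Longrightarrow> \<phi> (\<lambda>x\<in>Z. a * f x) = a \<odot>\<^bsub>W\<^esub> \<phi> f"
    and act: "\<And>g f. g \<in> B \<Longrightarrow> f \<in> Fil n (int k) \<Longrightarrow> \<phi> (act H g f) = act W g (\<phi> f)"
    and ker1: "\<And>f. f \<in> low_prods (int k - 1) \<union> top_prods k (l + 1) \<Longrightarrow> \<phi> f = \<zero>\<^bsub>W\<^esub>"
    and surj: "carrier W \<subseteq> \<phi> ` sp (top_prods k l)"
    and ker2: "\<And>f. f \<in> sp (top_prods k l) \<Longrightarrow> \<phi> f = \<zero>\<^bsub>W\<^esub> \<Longrightarrow> f \<in> sp (low_prods (int k - 1) \<union> top_prods k (l + 1))"
  shows "rep_isomorphic (hyperoct n) (G_piece n k l) W"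
proof -
  let ?F = "Fil n (int k)" and ?U = "Fil n (int k - 1)"
  define V where "V = subrep H ?F"
  have subF: "submodule ?F complex_ring H" and subU: "submodule ?U complex_ring H"
    unfolding Fil_eq by (rule sp_submodule[OF prods_in_H(2)])+
  have s: "carrier V = ?F" "\<zero>\<^bsub>V\<^esub> = \<zero>\<^bsub>H\<^esub>" "x \<oplus>\<^bsub>V\<^esub> y = x \<oplus>\<^bsub>H\<^esub> y"
    "a \<odot>\<^bsub>V\<^esub> x = a \<odot>\<^bsub>H\<^esub> x" "act V = act H" for x y a
    by (simp_all add: V_def subrep_def)
  have UF: "?U \<subseteq> ?F" unfolding Fil_eq by (rule lin_span_mono[OF top_low(2)])
  have repV: "representation (hyperoct n) V" unfolding V_def by (rule representation_Fil)
  have mV: "Module.module complex_ring V" using repV by (simp add: representation_def)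
  interpret Q: stable_submodule "hyperoct n" V ?U
  proof (rule stable_submodule.intro)
    show "representation (hyperoct n) V" by (rule repV)
    show "submodule ?U complex_ring V"
      by (rule complex_submoduleI[OF mV]) (use UF submoduleD[OF subU] in \<open>auto simp: s\<close>)
    show "act V g u \<in> ?U" if "g \<in> B" "u \<in> ?U" for g u
      using Fil_stable[OF that] unfolding s .
  qed
  interpret W: Module.module complex_ring W using W by (simp add: representation_def)
  define Q where "Q = quot_rep V ?U"
  have grQ: "gr n k = Q" by (simp add: gr_def Q_def V_def)
  have repQ: "representation (hyperoct n) Q" unfolding Q_def by (rule Q.quot_representation)
  have mQ: "Module.module complex_ring Q" using repQ by (simp add: representation_def)
  let ?p = "\<lambda>f. ?U +>\<^bsub>V\<^esub> f"
  have cos: "?U +>\<^bsub>H\<^esub> f = ?p f" for f unfolding a_r_coset_def' s ..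
  have \<phi>z: "\<phi> \<zero>\<^bsub>H\<^esub> = \<zero>\<^bsub>W\<^esub>"
    using smult[of "\<zero>\<^bsub>H\<^esub>" 0] submoduleD(2)[OF subF] closed[of "\<zero>\<^bsub>H\<^esub>"] W.smult_l_null[simplified] by (simp cong: restrict_cong)
  have ker: "\<phi> f = \<zero>\<^bsub>W\<^esub>" if X: "X \<subseteq> low_prods (int k - 1) \<union> top_prods k (l + 1)" and f: "f \<in> sp X" for X f
  proof -
    have XF: "sp X \<subseteq> ?F"
      unfolding Fil_eq by (rule lin_span_mono) (use X top_low in blast)
    have "X \<subseteq> carrier H" using X prods_in_H by blast
    from this f show ?thesis
    proof (induction rule: sp_induct)
      case zero
      then show ?case using \<phi>z by (simp only: H_simps)
    next
      case (gen f)
      then show ?case using X ker1 by blast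
    next
      case (add f g)
      then have "f \<in> ?F" "g \<in> ?F" using XF by blast+
      then show ?case unfolding assms(3)[OF \<open>f \<in> ?F\<close> \<open>g \<in> ?F\<close>] by (simp add: add)
    next
      case (smult a f)
      then have "f \<in> ?F" using XF by blast
      then show ?case unfolding assms(4)[OF \<open>f \<in> ?F\<close>] using W.smult_r_null[of a] by (simp add: smult)
    qed
  qed
  have kerU: "\<phi> u = \<zero>\<^bsub>W\<^esub>" if "u \<in> ?U" for u
    by (rule ker[of "low_prods (int k - 1)"]) (use that in \<open>auto simp: Fil_eq\<close>)
  define \<psi> where "\<psi> X = \<phi> (SOME x. x \<in> X)" for X
  have \<psi>: "\<psi> (?p f) = \<phi> f" if f: "f \<in> ?F" for f
  proof -
    have "f \<in> ?p f" by (rule Q.a_rcos_self) (simp only: s f)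
    then have "(SOME y. y \<in> ?p f) \<in> ?p f" by (rule someI[where P = "\<lambda>y. y \<in> ?p f"])
    then obtain u where u: "u \<in> ?U" "(SOME y. y \<in> ?p f) = u \<oplus>\<^bsub>V\<^esub> f"
      unfolding Q.rcoset_eq by blast
    have "\<phi> (u \<oplus>\<^bsub>V\<^esub> f) = \<phi> u \<oplus>\<^bsub>W\<^esub> \<phi> f"
      unfolding s H_simps by (rule add) (use u UF f in auto)
    then show ?thesis
      unfolding \<psi>_def u(2) using kerU[OF u(1)] closed[OF f] by (simp only: W.M.l_zero)
  qed
  have spF: "sp (top_prods k m) \<subseteq> ?F" for m
    unfolding Fil_eq by (rule lin_span_mono[OF top_low(1)])
  have topF: "top_prods k m \<subseteq> ?F" for m
    using spF[of m] lin_span_superset[of "top_prods k m" H] by blast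
  have P0: "P_span n k m = lin_span Q (?p ` top_prods k m)" for m
    unfolding P_span_def grQ cos top_prods_def by (rule arg_cong[of _ _ "lin_span Q"]) blast
  have P: "P_span n k m = ?p ` sp (top_prods k m)" for m
  proof -
    have "P_span n k m = lin_span Q (?p ` top_prods k m)" by (rule P0)
    also have "\<dots> = ?p ` lin_span V (top_prods k m)"
      unfolding Q_def using topF by (intro Q.quot_lin_span) (simp add: s)
    also have "lin_span V (top_prods k m) = sp (top_prods k m)"
      unfolding V_def by (rule lin_span_subrep[OF module_H subF topF])
    finally show ?thesis .
  qed
  have subP: "submodule (P_span n k m) complex_ring Q" for m
  proof -
    have "?p ` top_prods k m \<subseteq> carrier Q" using topF[of m] by (auto simp: Q_def Q.quot_carrier s)
    then show ?thesis unfolding P0 by (rule lin_span_submodule[OF mQ])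
  qed
  have stP: "act Q g X \<in> P_span n k m" if g: "g \<in> B" and X: "X \<in> P_span n k m" for g X m
  proof -
    obtain f where f: "f \<in> sp (top_prods k m)" "X = ?p f" using X unfolding P by blast
    then have "act Q g X = ?p (act H g f)"
      using Q.quot_act[OF g, of f] spF[of m] by (auto simp: Q_def s simp del: H_simps)
    moreover have "act H g f \<in> sp (top_prods k m)"
      by (rule sp_stable[OF prods_in_H(1) prods_stable(1)[OF g] g f(1)])
    ultimately show ?thesis unfolding P by blast
  qed
  define V2 where "V2 = subrep Q (P_span n k l)"
  have s2: "carrier V2 = P_span n k l" "\<zero>\<^bsub>V2\<^esub> = \<zero>\<^bsub>Q\<^esub>" "x \<oplus>\<^bsub>V2\<^esub> y = x \<oplus>\<^bsub>Q\<^esub> y"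
    "a \<odot>\<^bsub>V2\<^esub> x = a \<odot>\<^bsub>Q\<^esub> x" "act V2 = act Q" for x y a
    by (simp_all add: V2_def subrep_def)
  have repV2: "representation (hyperoct n) V2"
    unfolding V2_def by (rule representation_subrep[OF repQ subP stP])
  have mV2: "Module.module complex_ring V2" using repV2 by (simp add: representation_def)
  interpret Q2: stable_submodule "hyperoct n" V2 "P_span n k (l + 1)"
  proof (rule stable_submodule.intro)
    show "representation (hyperoct n) V2" by (rule repV2)
    show "submodule (P_span n k (l + 1)) complex_ring V2"
    proof (rule complex_submoduleI[OF mV2])
      show "P_span n k (l + 1) \<subseteq> carrier V2"
        unfolding s2 P by (rule image_mono[OF lin_span_mono[OF top_low(3)]])
    qed (use submoduleD[OF subP[of "l + 1"]] in \<open>auto simp: s2\<close>)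
    show "act V2 g u \<in> P_span n k (l + 1)" if "g \<in> B" "u \<in> P_span n k (l + 1)" for g u
      using stP[OF that] by (simp add: s2)
  qed
  have q: "\<zero>\<^bsub>Q\<^esub> = ?p \<zero>\<^bsub>H\<^esub>" "f \<in> ?F \<Longrightarrow> g \<in> ?F \<Longrightarrow> ?p f \<oplus>\<^bsub>Q\<^esub> ?p g = ?p (f \<oplus>\<^bsub>H\<^esub> g)"
    "f \<in> ?F \<Longrightarrow> a \<odot>\<^bsub>Q\<^esub> ?p f = ?p (a \<odot>\<^bsub>H\<^esub> f)" "f \<in> ?F \<Longrightarrow> h \<in> B \<Longrightarrow> act Q h (?p f) = ?p (act H h f)" for f g a h
    using Q.quot_zero Q.quot_add[of f g] Q.quot_smult[of f a] Q.quot_act[of h f] unfolding Q_def s by auto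
  note DF = submoduleD[OF subF]
  have "rep_isomorphic (hyperoct n) (quot_rep V2 (P_span n k (l + 1))) W"
  proof (rule Q2.quot_iso[OF W])
    have "\<psi> ` carrier V2 = \<phi> ` sp (top_prods k l)"
      unfolding s2 P image_image using \<psi> spF[of l] by (intro image_cong) auto
    also have "\<dots> = carrier W" using surj closed spF[of l] by blast
    finally show "\<psi> ` carrier V2 = carrier W" .
    show "\<psi> \<zero>\<^bsub>V2\<^esub> = \<zero>\<^bsub>W\<^esub>"
      using \<psi>[OF DF(2)] \<phi>z by (simp only: s2 q)
    show "\<psi> (X \<oplus>\<^bsub>V2\<^esub> Y) = \<psi> X \<oplus>\<^bsub>W\<^esub> \<psi> Y" if XY: "X \<in> carrier V2" "Y \<in> carrier V2" for X Y
    proof -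
      obtain f g where fg: "f \<in> ?F" "g \<in> ?F" "X = ?p f" "Y = ?p g"
        using XY spF[of l] unfolding s2 P by blast
      then show ?thesis using \<psi>[OF DF(3)[OF fg(1,2)]] add[OF fg(1,2)] by (simp only: s2 q \<psi>) simp
    qed
    show "\<psi> (a \<odot>\<^bsub>V2\<^esub> X) = a \<odot>\<^bsub>W\<^esub> \<psi> X" if X: "X \<in> carrier V2" for a X
    proof -
      obtain f where f: "f \<in> ?F" "X = ?p f" using X spF[of l] unfolding s2 P by blast
      then show ?thesis using \<psi>[OF DF(4)[OF f(1)]] smult[OF f(1)] by (simp only: s2 q \<psi>) simp
    qed
    show "\<psi> (act V2 g X) = act W g (\<psi> X)" if g: "g \<in> B" and X: "X \<in> carrier V2" for g X
    proof -
      obtain f where f: "f \<in> ?F" "X = ?p f" using X spF[of l] unfolding s2 P by blast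
      have "act H g f \<in> ?F" using Q.act_closed[OF g, of f] f(1) by (simp only: s)
      then show ?thesis using \<psi> act[OF g f(1)] f g by (simp only: s2 q)
    qed
    show "\<psi> X = \<zero>\<^bsub>W\<^esub> \<longleftrightarrow> X \<in> P_span n k (l + 1)" if X: "X \<in> carrier V2" for X
    proof
      obtain f where f: "f \<in> sp (top_prods k l)" "X = ?p f" using X unfolding s2 P by blast
      then have fF: "f \<in> ?F" using spF by blast
      assume "\<psi> X = \<zero>\<^bsub>W\<^esub>"
      then have "f \<in> sp (low_prods (int k - 1) \<union> top_prods k (l + 1))"
        using ker2[OF f(1)] \<psi>[OF fF] f(2) by simp
      \<comment> \<open>The functions of \<open>Fil n k\<close> whose class lies in
        \<open>P_span n k (l + 1)\<close>. Generators of both kinds belong to it, those of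
        \<open>F_{k-1}\<close> because their class is zero.\<close>
      moreover define D where "D = {f \<in> ?F. ?p f \<in> P_span n k (l + 1)}"
      note DP = submoduleD[OF subP[of "l + 1"]]
      have "submodule D complex_ring H"
      proof (rule complex_submoduleI[OF module_H])
        show "D \<subseteq> carrier H" using DF(1) by (auto simp: D_def)
        show "\<zero>\<^bsub>H\<^esub> \<in> D" using DF(2) DP(2) unfolding D_def q by simp
        show "f \<oplus>\<^bsub>H\<^esub> g \<in> D" if "f \<in> D" "g \<in> D" for f g
        proof -
          have fg: "f \<in> ?F" "g \<in> ?F" using that unfolding D_def by blast+
          have "?p f \<oplus>\<^bsub>Q\<^esub> ?p g \<in> P_span n k (l + 1)" by (rule DP(3)) (use that D_def in blast)+
          then show ?thesis using DF(3)[OF fg] unfolding q(2)[OF fg] D_def by blast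
        qed
        show "a \<odot>\<^bsub>H\<^esub> f \<in> D" if "f \<in> D" for a f
        proof -
          have f: "f \<in> ?F" using that unfolding D_def by blast
          have "a \<odot>\<^bsub>Q\<^esub> ?p f \<in> P_span n k (l + 1)" by (rule DP(4)) (use that D_def in blast)
          then show ?thesis using DF(4)[OF f] unfolding q(3)[OF f] D_def by blast
        qed
      qed
      then have "sp (low_prods (int k - 1) \<union> top_prods k (l + 1)) \<subseteq> D"
      proof (rule lin_span_least, intro Un_least subsetI)
        fix f assume f: "f \<in> low_prods (int k - 1)"
        then have fU: "f \<in> ?U" unfolding Fil_eq by (rule subsetD[OF lin_span_superset])
        then have fV: "f \<in> carrier V" using UF unfolding s by blast
        have "?p f = ?p \<zero>\<^bsub>V\<^esub>"
          by (rule Q.coset_eqI[OF fU Q.M.zero_closed Q.M.r_zero[OF fV, symmetric]])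
        then have "?p f \<in> P_span n k (l + 1)" using DP(2) by (simp only: q s)
        then show "f \<in> D" using fV unfolding D_def s by blast
      next
        fix f assume f: "f \<in> top_prods k (l + 1)"
        then have "?p f \<in> P_span n k (l + 1)"
          unfolding P by (intro imageI subsetD[OF lin_span_superset])
        then show "f \<in> D" using subsetD[OF topF f] unfolding D_def by blast
      qed
      ultimately show "X \<in> P_span n k (l + 1)" using f(2) unfolding D_def by blast
    next
      assume "X \<in> P_span n k (l + 1)"
      then obtain f where f: "f \<in> sp (top_prods k (l + 1))" "X = ?p f" unfolding P by blast
      then have "f \<in> ?F" using spF by blast
      moreover have "\<phi> f = \<zero>\<^bsub>W\<^esub>" by (rule ker[OF _ f(1)]) blast
      ultimately show "\<psi> X = \<zero>\<^bsub>W\<^esub>" using \<psi> f(2) by simp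
    qed
  qed
  then show ?thesis by (simp add: G_piece_def grQ V2_def)
qed

end

text \<open>The colours are the connected components of the graph. An edge that closes a cycle is redundant for
  them; if there is none, flipping signs on whole components makes all edges compatible.\<close>

lemma edge_colouring:
  fixes es :: "(int \<times> int) list" and V :: "int set"
  assumes V: "finite V" and es: "\<And>i j. (i, j) \<in> set es \<Longrightarrow> \<bar>i\<bar> \<in> V \<and> \<bar>j\<bar> \<in> V \<and> i \<noteq> 0 \<and> j \<noteq> 0"
  shows "\<exists>(col :: int \<Rightarrow> int) J. J \<subseteq> V \<and> (\<forall>(i, j)\<in>set es. col \<bar>i\<bar> = col \<bar>j\<bar>) \<and>
    (card V < card (col ` V) + length es \<or>
     card V \<le> card (col ` V) + length es \<and> (\<forall>(i, j)\<in>set es. 0 < w0_on J i \<longleftrightarrow> 0 < w0_on J j))"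
  using es
proof (induction es)
  case Nil
  have "card ((\<lambda>i. i) ` V) = card V" by simp
  then show ?case by (intro exI[of _ "\<lambda>i. i"] exI[of _ "{}"]) simp
next
  case (Cons e es)
  obtain i j where e: "e = (i, j)" by (cases e)
  have ij: "\<bar>i\<bar> \<in> V" "\<bar>j\<bar> \<in> V" "i \<noteq> 0" "j \<noteq> 0" using Cons.prems[of i j] e by auto
  have "\<bar>i\<bar> \<in> V \<and> \<bar>j\<bar> \<in> V \<and> i \<noteq> 0 \<and> j \<noteq> 0" if "(i, j) \<in> set es" for i j
    using Cons.prems[of i j] that by simp
  from Cons.IH[OF this] obtain col :: "int \<Rightarrow> int" and J where J: "J \<subseteq> V"
    and col0: "\<forall>(i, j)\<in>set es. col \<bar>i\<bar> = col \<bar>j\<bar>" and alt: "card V < card (col ` V) + length es \<or>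
     card V \<le> card (col ` V) + length es \<and> (\<forall>(i, j)\<in>set es. 0 < w0_on J i \<longleftrightarrow> 0 < w0_on J j)"
    by blast
  have col: "col \<bar>a\<bar> = col \<bar>b\<bar>" if "(a, b) \<in> set es" for a b using bspec[OF col0 that] by simp
  show ?case
  proof (cases "col \<bar>i\<bar> = col \<bar>j\<bar>")
    \<comment> \<open>The edge closes a cycle: colours stay the same while the number of edges
      grows, so the strict alternative holds from now on.\<close>
    case True
    then show ?thesis using J col alt by (intro exI[of _ col] exI[of _ J]) (auto simp: e)
  next
    case False
    define col' where "col' v = (if col v = col \<bar>j\<bar> then col \<bar>i\<bar> else col v)" for v
    define C where "C = {v \<in> V. col v = col \<bar>j\<bar>}"
    \<comment> \<open>If the signs at the two ends disagree, the whole component \<open>C\<close> of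
      \<open>j\<close> is flipped; edges inside \<open>C\<close> stay compatible.\<close>
    define J' where "J' = (if 0 < w0_on J i \<longleftrightarrow> 0 < w0_on J j then J else (J - C) \<union> (C - J))"
    have "col ` V \<subseteq> insert (col \<bar>j\<bar>) (col' ` V)" by (auto simp: col'_def)
    then have "card (col ` V) \<le> card (insert (col \<bar>j\<bar>) (col' ` V))" using V by (intro card_mono) auto
    also have "\<dots> \<le> card (col' ` V) + 1" by (simp add: card_insert_le_m1 card_insert_if V)
    finally have card: "card (col ` V) \<le> card (col' ` V) + 1" .
    have w: "0 < w0_on J' a \<longleftrightarrow> (if \<not> (0 < w0_on J i \<longleftrightarrow> 0 < w0_on J j) \<and> \<bar>a\<bar> \<in> C then \<not> 0 < w0_on J a else 0 < w0_on J a)"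
      if "a \<noteq> 0" for a
      using that by (auto simp: J'_def w0_on_def)
    have "0 < w0_on J' a \<longleftrightarrow> 0 < w0_on J' b" if ab: "(a, b) \<in> set es" "0 < w0_on J a \<longleftrightarrow> 0 < w0_on J b" for a b
    proof -
      have "\<bar>a\<bar> \<in> C \<longleftrightarrow> \<bar>b\<bar> \<in> C" using col[OF ab(1)] Cons.prems[of a b] ab(1) by (auto simp: C_def)
      then show ?thesis using w[of a] w[of b] ab Cons.prems[of a b] by simp
    qed
    moreover have "0 < w0_on J' i \<longleftrightarrow> 0 < w0_on J' j"
      using w[of i] w[of j] ij False by (auto simp: C_def)
    moreover have "J' \<subseteq> V" using J by (auto simp: J'_def C_def)
    moreover have "col' \<bar>a\<bar> = col' \<bar>b\<bar>" if "(a, b) \<in> set (e # es)" for a b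
      using that col[of a b] False by (auto simp: col'_def e)
    ultimately show ?thesis
      using alt card by (intro exI[of _ col'] exI[of _ J']) (auto simp: e)
  qed
qed

context hyperoctahedral
begin

section \<open>Evaluation at one point of each component\<close>

definition pt :: "(int \<Rightarrow> int) \<Rightarrow> int \<Rightarrow> real" where
  "pt w = point_act n w (\<lambda>i\<in>L. real_of_int i)"

lemma base_in_Z: "(\<lambda>i\<in>L. real_of_int i) \<in> Z"
proof (rule ZI)
  fix i j assume ij: "i \<in> L" "j \<in> L" "i \<noteq> j"
  have "- 1 / real_of_int j < 0" "0 < real_of_int i" using ij by auto
  then have "real_of_int i \<noteq> - 1 / real_of_int j" by linarith
  then show "(\<lambda>i\<in>L. real_of_int i) i \<noteq> (\<lambda>i\<in>L. real_of_int i) j \<and>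
    (\<lambda>i\<in>L. real_of_int i) i \<noteq> - 1 / (\<lambda>i\<in>L. real_of_int i) j" using ij by simp
qed auto

lemma pt_in_Z: "w \<in> B \<Longrightarrow> pt w \<in> Z"
  unfolding pt_def by (rule point_act_in_Z[OF base_in_Z])

lemma coord_pt:
  assumes "w \<in> B" "i \<in> ss"
  shows "coord (pt w) i = cval (bi w i)"
proof -
  have "coord (\<lambda>i\<in>L. real_of_int i) k = cval k" if "k \<in> ss" for k
    using that by (auto simp: coord_def cval_def signed_set_iff)
  then show ?thesis using assms by (simp add: pt_def coord_point_act base_in_Z)
qed

lemma pt_comp: "u \<in> B \<Longrightarrow> v \<in> B \<Longrightarrow> point_act n u (pt v) = pt (u \<circ> v)"
  by (simp add: pt_def point_act_comp base_in_Z)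

definition ev :: "((int \<Rightarrow> real) \<Rightarrow> complex) \<Rightarrow> (int \<Rightarrow> int) \<Rightarrow> complex" where
  "ev f w = (if w \<in> B then f (pt w) else 0)"

lemma ev_in_GA: "ev f \<in> GA"
  by (simp add: GA_def ev_def)

lemma ev_add: "ev (\<lambda>x\<in>Z. f x + g x) = (\<lambda>w. ev f w + ev g w)"
  and ev_smult: "ev (\<lambda>x\<in>Z. a * f x) = (\<lambda>w. a * ev f w)"
  by (auto simp: ev_def pt_in_Z)

lemma ev_act: "g \<in> B \<Longrightarrow> ev (act H g f) = dl g \<star> ev f"
proof (rule GA_eqI)
  fix w assume "g \<in> B" "w \<in> B"
  then show "ev (act H g f) w = (dl g \<star> ev f) w"
    using dl_conv[of g w "ev f"] by (simp add: ev_def pt_in_Z pt_comp)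
qed (simp_all add: ev_in_GA)

definition phi :: "int \<Rightarrow> ((int \<Rightarrow> real) \<Rightarrow> complex) \<Rightarrow> (int \<Rightarrow> int) \<Rightarrow> complex" where
  "phi s f = ev f \<star> prim s"

lemma phi_add: "phi s (\<lambda>x\<in>Z. f x + g x) = (\<lambda>w. phi s f w + phi s g w)"
  and phi_smult: "phi s (\<lambda>x\<in>Z. a * f x) = (\<lambda>w. a * phi s f w)"
  and phi_act: "h \<in> B \<Longrightarrow> phi s (act H h f) = dl h \<star> phi s f"
  and phi_sum: "phi s (\<lambda>x\<in>Z. \<Sum>i\<in>I. a' i * F i x) = (\<lambda>w. \<Sum>i\<in>I. a' i * phi s (F i) w)"
proof -
  show "phi s (\<lambda>x\<in>Z. f x + g x) = (\<lambda>w. phi s f w + phi s g w)"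
    unfolding phi_def ev_add by (rule conv_add_left)
  show "phi s (\<lambda>x\<in>Z. a * f x) = (\<lambda>w. a * phi s f w)"
    unfolding phi_def ev_smult by (rule conv_smult_left)
  show "phi s (act H h f) = dl h \<star> phi s f" if "h \<in> B"
    unfolding phi_def ev_act[OF that] by (rule conv_assoc)
  have "ev (\<lambda>x\<in>Z. \<Sum>i\<in>I. a' i * F i x) = (\<lambda>w. \<Sum>i\<in>I. a' i * ev (F i) w)"
    by (auto simp: ev_def pt_in_Z)
  then show "phi s (\<lambda>x\<in>Z. \<Sum>i\<in>I. a' i * F i x) = (\<lambda>w. \<Sum>i\<in>I. a' i * phi s (F i) w)"
    by (simp only: phi_def conv_sum_left conv_smult_left)
qed

lemma sp_add: "X \<subseteq> carrier H \<Longrightarrow> f \<in> sp X \<Longrightarrow> g \<in> sp X \<Longrightarrow> (\<lambda>x\<in>Z. f x + g x) \<in> sp X"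
  using submoduleD(3)[OF sp_submodule] unfolding H_simps .

lemma sp_smult: "X \<subseteq> carrier H \<Longrightarrow> f \<in> sp X \<Longrightarrow> (\<lambda>x\<in>Z. a * f x) \<in> sp X"
  using submoduleD(4)[OF sp_submodule] unfolding H_simps .

lemma sp_zero: "X \<subseteq> carrier H \<Longrightarrow> (\<lambda>x\<in>Z. 0) \<in> sp X"
  using submoduleD(2)[OF sp_submodule] unfolding H_simps .

lemma sp_gen: "f \<in> X \<Longrightarrow> f \<in> sp X"
  by (rule subsetD[OF lin_span_superset])

lemma sp_diff:
  assumes X: "X \<subseteq> carrier H" and f: "f \<in> sp X" and g: "g \<in> sp X"
  shows "(\<lambda>x\<in>Z. f x - g x) \<in> sp X"
proof -
  have "(\<lambda>x\<in>Z. f x + (\<lambda>x\<in>Z. (-1) * g x) x) \<in> sp X" by (intro sp_add sp_smult X f g)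
  moreover have "(\<lambda>x\<in>Z. f x + (\<lambda>x\<in>Z. (-1) * g x) x) = (\<lambda>x\<in>Z. f x - g x)" by auto
  ultimately show ?thesis by metis
qed

lemma sp_sum:
  assumes X: "X \<subseteq> carrier H" and I: "finite I" and F: "\<And>i. i \<in> I \<Longrightarrow> F i \<in> sp X"
  shows "(\<lambda>x\<in>Z. \<Sum>i\<in>I. a i * F i x) \<in> sp X"
  using I F
proof (induction I rule: finite_induct)
  case empty
  then show ?case using sp_zero[OF X] by (simp only: sum.empty)
next
  case (insert j I)
  have "(\<lambda>x\<in>Z. (\<lambda>x\<in>Z. a j * F j x) x + (\<lambda>x\<in>Z. \<Sum>i\<in>I. a i * F i x) x) \<in> sp X"
    using insert by (intro sp_add sp_smult X) auto
  moreover have "(\<lambda>x\<in>Z. (\<lambda>x\<in>Z. a j * F j x) x + (\<lambda>x\<in>Z. \<Sum>i\<in>I. a i * F i x) x) = (\<lambda>x\<in>Z. \<Sum>i\<in>insert j I. a i * F i x)"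
    using insert by auto
  ultimately show ?case by metis
qed

lemma H_eqI: "f \<in> carrier H \<Longrightarrow> g \<in> carrier H \<Longrightarrow> (\<And>x. x \<in> Z \<Longrightarrow> f x = g x) \<Longrightarrow> f = g"
  using H_ext by (metis ext)

lemma sp_H: "X \<subseteq> carrier H \<Longrightarrow> f \<in> sp X \<Longrightarrow> f \<in> carrier H"
  using submoduleD(1)[OF sp_submodule] by blast

lemma sp_eq:
  assumes X: "X \<subseteq> carrier H" and g: "(\<lambda>x\<in>Z. g x) \<in> sp X" and f: "f \<in> carrier H" and eq: "\<And>x. x \<in> Z \<Longrightarrow> f x = g x"
  shows "f \<in> sp X"
proof -
  have "f = (\<lambda>x\<in>Z. g x)" by (rule H_eqI[OF f sp_H[OF X g]]) (simp add: eq)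
  then show ?thesis using g by simp
qed

lemma phi_zero_sp:
  assumes X: "X \<subseteq> carrier H" and "\<And>f. f \<in> X \<Longrightarrow> phi s f = (\<lambda>_. 0)" and f: "f \<in> sp X"
  shows "phi s f = (\<lambda>_. 0)"
  using X f
proof (induction rule: sp_induct)
  case zero
  have "ev (\<lambda>x\<in>Z. 0) = (\<lambda>_. 0)" by (auto simp: ev_def pt_in_Z)
  then show ?case unfolding phi_def by (simp only: conv_zero_left)
next
  case (gen f)
  then show ?case by (rule assms(2))
next
  case (add f g)
  then show ?case unfolding phi_add by simp
next
  case (smult a f)
  then show ?case unfolding phi_smult by simp
qed

text \<open>Flipping the letters in \<open>J\<close> makes all coordinates positive, and \<tau>
  sorts them. Comparisons that involve barred letters then reduce to those between positive numbers
  and their negative reciprocals, in the same way at \<open>x\<close> and at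
  \<open>pt w\<close>.\<close>

lemma component_exists:
  assumes x: "x \<in> Z"
  shows "\<exists>w\<in>B. (\<forall>i\<in>ss. 0 < coord x i \<longleftrightarrow> 0 < coord (pt w) i) \<and>
    (\<forall>i\<in>ss. \<forall>j\<in>ss. coord x i < coord x j \<longleftrightarrow> coord (pt w) i < coord (pt w) j)"
proof -
  define J where "J = {i \<in> L. coord x i < 0}"
  define s where "s = w0_on J"
  have s: "s \<in> B" unfolding s_def by (rule w0_on_in_B) (auto simp: J_def)
  have ssi: "s (s i) = i" for i by (simp add: s_def w0_on_def)
  define y where "y i = coord x (s i)" for i
  have ypos: "0 < y i" if "i \<in> L" for i
    using that coord_nonzero[OF x L_ss[OF that]] coord_pos_neg[OF x L_ss[OF that]]
    by (auto simp: y_def s_def w0_on_def J_def not_less order_le_less)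
  have "inj_on y L"
    using coord_eq_iff[OF x] s L_ss by (auto simp: inj_on_def y_def B_inj)
  then obtain \<tau> where \<tau>: "\<tau> \<in> S" "\<And>i j. i \<in> L \<Longrightarrow> j \<in> L \<Longrightarrow> bi \<tau> i < bi \<tau> j \<longleftrightarrow> y i < y j"
    by (rule sorting_exists) blast
  define w where "w = s \<circ> \<tau>"
  have w: "w \<in> B" using s \<tau>(1) by (simp add: w_def S_B)
  have "bi s = s" using inv_equality[of s s] s ssi by (simp add: comp_def id_def)
  then have bw: "bi w i = bi \<tau> (s i)" for i using s \<tau>(1) by (simp add: w_def bi_comp S_B)
  have p: "bi \<tau> i \<in> L" if "i \<in> L" for i using S_L[OF S_bi[OF \<tau>(1)] that] .
  have q1: "coord x (s i) = y i" "coord (pt w) (s i) = real_of_int (bi \<tau> i)" if "i \<in> L" for i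
    using that p[OF that] w s L_ss[OF that] by (simp_all add: y_def coord_pt bw ssi cval_def)
  have q2: "coord x (s (- i)) = - 1 / y i" "coord (pt w) (s (- i)) = - 1 / real_of_int (bi \<tau> i)" if "i \<in> L" for i
    using q1[OF that] coord_neg[of _ "s i"] x w s L_ss[OF that] by (simp_all add: B_odd pt_in_Z)
  have rec: "- 1 / a < - 1 / b \<longleftrightarrow> a < b" "- 1 / a < b" "\<not> b < - 1 / a" "\<not> 0 < - 1 / a" if "0 < a" "0 < b" for a b :: real
  proof -
    have "- 1 / a < 0" using that by simp
    then show "- 1 / a < b" "\<not> b < - 1 / a" "\<not> 0 < - 1 / a" using that by linarith+
    show "- 1 / a < - 1 / b \<longleftrightarrow> a < b" using that by (simp add: field_simps)
  qed
  have cases: "\<exists>k\<in>L. i = s k \<or> i = s (- k)" if "i \<in> ss" for i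
  proof -
    have "s i \<in> ss" using that s by simp
    then have "\<bar>s i\<bar> \<in> L" by (rule iffD1[OF abs_L])
    moreover have "i = s \<bar>s i\<bar> \<or> i = s (- \<bar>s i\<bar>)" using ssi[of i] by (cases "0 \<le> s i") auto
    ultimately show ?thesis by blast
  qed
  have "0 < coord x i \<longleftrightarrow> 0 < coord (pt w) i" if "i \<in> ss" for i
  proof -
    obtain k where k: "k \<in> L" "i = s k \<or> i = s (- k)" using cases[OF \<open>i \<in> ss\<close>] by blast
    then show ?thesis using q1[OF k(1)] q2[OF k(1)] ypos[OF k(1)] p[OF k(1)] by auto
  qed
  moreover have "coord x i < coord x j \<longleftrightarrow> coord (pt w) i < coord (pt w) j" if "i \<in> ss" "j \<in> ss" for i j
  proof -
    obtain k where k: "k \<in> L" "i = s k \<or> i = s (- k)" using cases[OF \<open>i \<in> ss\<close>] by blast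
    obtain l where l: "l \<in> L" "j = s l \<or> j = s (- l)" using cases[OF \<open>j \<in> ss\<close>] by blast
    have P: "0 < y k" "0 < y l" "0 < real_of_int (bi \<tau> k)" "0 < real_of_int (bi \<tau> l)"
      using ypos k l p[OF k(1)] p[OF l(1)] by auto
    have o: "real_of_int (bi \<tau> k) < real_of_int (bi \<tau> l) \<longleftrightarrow> y k < y l" using \<tau>(2)[OF k(1) l(1)] by simp
    show ?thesis
      using k(2) l(2) o rec[OF P(1,2)] rec[OF P(3,4)] rec[OF P(2,1)] rec[OF P(4,3)]
      by (elim disjE) (simp_all only: q1[OF k(1)] q2[OF k(1)] q1[OF l(1)] q2[OF l(1)])
  qed
  ultimately show ?thesis using w by blast
qed

text \<open>\<open>z2 i (- i)\<close> is the same function as \<open>z1 (- i)\<close>, so generators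
  outside \<open>gens_one n\<close> are edges between letters of different absolute value.\<close>

lemma gens_cases:
  assumes "f \<in> gens"
  shows "(\<exists>i\<in>ss. f = z1 i) \<or> (\<exists>i\<in>ss. \<exists>j\<in>ss. \<bar>i\<bar> \<noteq> \<bar>j\<bar> \<and> f = z2 i j)"
proof (cases "f \<in> gens_one n")
  case True
  then show ?thesis by (auto simp: gens_one_def)
next
  case False
  then obtain i j where ij: "i \<in> ss" "j \<in> ss" "i \<noteq> j" "f = z2 i j" using assms by (auto simp: gens_two_def)
  show ?thesis
  proof (cases "\<bar>i\<bar> = \<bar>j\<bar>")
    case True
    then have j: "j = - i" using ij(3) by linarith
    have "coord x i < coord x (- i) \<longleftrightarrow> 0 < coord x (- i)" if "x \<in> Z" for x
    proof (cases "0 < coord x i")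
      case True
      then have "- 1 / coord x i < 0" by simp
      then show ?thesis using True unfolding coord_neg[OF that ij(1)] by linarith
    next
      case False
      then have "coord x i < 0" using coord_nonzero[OF that ij(1)] by simp
      moreover from this have "0 < - 1 / coord x i" by (simp add: divide_neg_neg)
      ultimately show ?thesis unfolding coord_neg[OF that ij(1)] by linarith
    qed
    then have "f = z1 (- i)" unfolding ij(4) j by (auto simp: z_one_def z_two_def)
    moreover have "- i \<in> ss" using ij(1) by (simp add: signed_set_iff)
    ultimately show ?thesis by blast
  qed (use ij in blast)
qed

lemma not_one_cases:
  assumes "f \<in> gens" "f \<notin> gens_one n"
  shows "\<exists>e. fst e \<in> ss \<and> snd e \<in> ss \<and> \<bar>fst e\<bar> \<noteq> \<bar>snd e\<bar> \<and> f = z2 (fst e) (snd e)"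
proof -
  have "\<not> (\<exists>i\<in>ss. f = z1 i)" using assms(2) by (auto simp: gens_one_def)
  then obtain i j where "i \<in> ss" "j \<in> ss" "\<bar>i\<bar> \<noteq> \<bar>j\<bar>" "f = z2 i j" using gens_cases[OF assms(1)] by blast
  then show ?thesis by (intro exI[of _ "(i, j)"]) simp
qed

lemma z1_gens: "i \<in> ss \<Longrightarrow> z1 i \<in> gens_one n"
  by (auto simp: gens_one_def)

lemma z2_gens: "i \<in> ss \<Longrightarrow> j \<in> ss \<Longrightarrow> i \<noteq> j \<Longrightarrow> z2 i j \<in> gens"
  by (auto simp: gens_two_def)

text \<open>No edge joins \<open>p\<close> to its complement, so the product sees only signs and
  comparisons within the two sides.\<close>

lemma split_prod:
  assumes p: "a \<in> L" "a \<in> p" "b \<in> L" "b \<notin> p" and fs: "set fs \<subseteq> gens"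
    and cr: "\<And>f. f \<in> set fs \<Longrightarrow> f \<in> gens_one n \<or> (\<exists>i\<in>ss. \<exists>j\<in>ss. f = z2 i j \<and> (\<bar>i\<bar> \<in> p \<longleftrightarrow> \<bar>j\<bar> \<in> p))"
  shows "phi s (prod_fun n fs) = (\<lambda>_. 0)"
  unfolding phi_def
proof (rule split_conv_zero[OF p])
  show "split_fun p (ev (prod_fun n fs))"
    unfolding split_fun_def
  proof (intro ballI impI)
    fix \<sigma> \<tau> assume st: "\<sigma> \<in> B" "\<tau> \<in> B"
    assume *: "(\<forall>i\<in>ss. 0 < bi \<sigma> i \<longleftrightarrow> 0 < bi \<tau> i) \<and>
     (\<forall>i\<in>ss. \<forall>j\<in>ss. (\<bar>i\<bar> \<in> p \<longleftrightarrow> \<bar>j\<bar> \<in> p) \<longrightarrow>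
        (cval (bi \<sigma> i) < cval (bi \<sigma> j) \<longleftrightarrow> cval (bi \<tau> i) < cval (bi \<tau> j)))"
    have "f (pt \<sigma>) = f (pt \<tau>)" if f: "f \<in> set fs" for f
      using cr[OF f]
    proof
      assume "f \<in> gens_one n"
      then obtain i where i: "i \<in> ss" "f = z1 i" by (auto simp: gens_one_def)
      have "0 < bi \<sigma> i \<longleftrightarrow> 0 < bi \<tau> i" using conjunct1[OF *] i(1) by (rule bspec)
      then show ?thesis
        using i st by (simp add: z1_apply pt_in_Z coord_pt cval_pos)
    next
      assume "\<exists>i\<in>ss. \<exists>j\<in>ss. f = z2 i j \<and> (\<bar>i\<bar> \<in> p \<longleftrightarrow> \<bar>j\<bar> \<in> p)"
      then obtain i j where ij: "i \<in> ss" "j \<in> ss" "f = z2 i j" "\<bar>i\<bar> \<in> p \<longleftrightarrow> \<bar>j\<bar> \<in> p" by blast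
      have "cval (bi \<sigma> i) < cval (bi \<sigma> j) \<longleftrightarrow> cval (bi \<tau> i) < cval (bi \<tau> j)"
        by (rule conjunct2[OF *, THEN bspec, OF ij(1), THEN bspec, OF ij(2), THEN mp, OF ij(4)])
      then show ?thesis using ij st by (simp add: z2_apply pt_in_Z coord_pt)
    qed
    then have "map (\<lambda>f. f (pt \<sigma>)) fs = map (\<lambda>f. f (pt \<tau>)) fs" by (intro map_cong) auto
    then have "(\<Prod>f\<leftarrow>fs. f (pt \<sigma>)) = (\<Prod>f\<leftarrow>fs. f (pt \<tau>))" by (rule arg_cong)
    then show "ev (prod_fun n fs) \<sigma> = ev (prod_fun n fs) \<tau>"
      using st by (simp add: ev_def prod_fun_apply pt_in_Z)
  qed
qed

lemma edges_of:
  assumes "set fs \<subseteq> gens"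
  shows "\<exists>es. length es = length (filter (\<lambda>f. f \<notin> gens_one n) fs) \<and>
    filter (\<lambda>f. f \<notin> gens_one n) fs = map (\<lambda>e. z2 (fst e) (snd e)) es \<and>
    (\<forall>e\<in>set es. fst e \<in> ss \<and> snd e \<in> ss \<and> \<bar>fst e\<bar> \<noteq> \<bar>snd e\<bar>)"
proof -
  have "\<forall>f\<in>set (filter (\<lambda>f. f \<notin> gens_one n) fs). \<exists>e. fst e \<in> ss \<and> snd e \<in> ss \<and> \<bar>fst e\<bar> \<noteq> \<bar>snd e\<bar> \<and> f = z2 (fst e) (snd e)"
    using not_one_cases assms by auto
  then obtain E' where E': "\<forall>f\<in>set (filter (\<lambda>f. f \<notin> gens_one n) fs).
    fst (E' f) \<in> ss \<and> snd (E' f) \<in> ss \<and> \<bar>fst (E' f)\<bar> \<noteq> \<bar>snd (E' f)\<bar> \<and> f = z2 (fst (E' f)) (snd (E' f))"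
    by (rule bchoice[THEN exE])
  let ?es = "map E' (filter (\<lambda>f. f \<notin> gens_one n) fs)"
  have "map (\<lambda>e. z2 (fst e) (snd e)) ?es = filter (\<lambda>f. f \<notin> gens_one n) fs"
    unfolding map_map comp_def by (rule map_idI) (use E' in auto)
  moreover have "\<forall>e\<in>set ?es. fst e \<in> ss \<and> snd e \<in> ss \<and> \<bar>fst e\<bar> \<noteq> \<bar>snd e\<bar>" using E' by auto
  ultimately show ?thesis by (intro exI[of _ ?es]) simp
qed

lemma two_colours:
  assumes "1 < card (col ` L)"
  obtains a b where "a \<in> L" "b \<in> L" "col a \<noteq> col b"
proof -
  have "\<exists>a\<in>L. \<exists>b\<in>L. col a \<noteq> col b"
  proof (rule ccontr)
    assume *: "\<not> (\<exists>a\<in>L. \<exists>b\<in>L. col a \<noteq> col b)"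
    have "1 \<in> L" using n_pos by simp
    then have "col x = col 1" if "x \<in> L" for x using * that by blast
    then have "col ` L \<subseteq> {col 1}" by blast
    then have "card (col ` L) \<le> card {col 1}" by (intro card_mono) auto
    then show False using assms by simp
  qed
  then obtain a b where "a \<in> L" "b \<in> L" "col a \<noteq> col b" by blast
  then show ?thesis by (rule that)
qed

lemma colouring_edges:
  assumes "\<forall>e\<in>set es. fst e \<in> ss \<and> snd e \<in> ss"
  obtains col :: "int \<Rightarrow> int" and J where "J \<subseteq> L" "\<forall>e\<in>set es. col \<bar>fst e\<bar> = col \<bar>snd e\<bar>"
    "n < card (col ` L) + length es \<or> n \<le> card (col ` L) + length es \<and>
      (\<forall>e\<in>set es. 0 < w0_on J (fst e) \<longleftrightarrow> 0 < w0_on J (snd e))"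
proof -
  have "\<bar>i\<bar> \<in> L \<and> \<bar>j\<bar> \<in> L \<and> i \<noteq> 0 \<and> j \<noteq> 0" if "(i, j) \<in> set es" for i j
    using bspec[OF assms that] by (auto simp: signed_set_iff)
  from edge_colouring[OF finite_atLeastAtMost_int this] obtain col :: "int \<Rightarrow> int" and J where
    "J \<subseteq> L" "\<forall>(i, j)\<in>set es. col \<bar>i\<bar> = col \<bar>j\<bar>"
    "card L < card (col ` L) + length es \<or> card L \<le> card (col ` L) + length es \<and>
      (\<forall>(i, j)\<in>set es. 0 < w0_on J i \<longleftrightarrow> 0 < w0_on J j)" by blast
  then show ?thesis using that[of J col] by (simp add: case_prod_beta)
qed

text \<open>A graph on \<open>n\<close> vertices with at most \<open>n - 2\<close> edges is
  disconnected, and a colour class serves as \<open>p\<close>.\<close>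

lemma few_edges_zero:
  assumes fs: "set fs \<subseteq> gens" and few: "length (filter (\<lambda>f. f \<notin> gens_one n) fs) + 2 \<le> n"
  shows "phi s (prod_fun n fs) = (\<lambda>_. 0)"
proof -
  obtain es where es: "length es = length (filter (\<lambda>f. f \<notin> gens_one n) fs)"
    "filter (\<lambda>f. f \<notin> gens_one n) fs = map (\<lambda>e. z2 (fst e) (snd e)) es"
    "\<forall>e\<in>set es. fst e \<in> ss \<and> snd e \<in> ss \<and> \<bar>fst e\<bar> \<noteq> \<bar>snd e\<bar>" using edges_of[OF fs] by blast
  have "\<forall>e\<in>set es. fst e \<in> ss \<and> snd e \<in> ss" using es(3) by blast
  then obtain col :: "int \<Rightarrow> int" and J where col: "\<forall>e\<in>set es. col \<bar>fst e\<bar> = col \<bar>snd e\<bar>"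
    and "n < card (col ` L) + length es \<or> n \<le> card (col ` L) + length es \<and>
      (\<forall>e\<in>set es. 0 < w0_on J (fst e) \<longleftrightarrow> 0 < w0_on J (snd e))"
    by (rule colouring_edges)
  then have c: "n \<le> card (col ` L) + length es" by linarith
  have "1 < card (col ` L)" using c few es(1) by simp
  then obtain a b where ab: "a \<in> L" "b \<in> L" "col a \<noteq> col b" by (rule two_colours)
  show ?thesis
  proof (rule split_prod[OF ab(1) _ ab(2) _ fs, where p = "{v. col v = col a}"])
    fix f assume f: "f \<in> set fs"
    show "f \<in> gens_one n \<or> (\<exists>i\<in>ss. \<exists>j\<in>ss. f = z2 i j \<and> (\<bar>i\<bar> \<in> {v. col v = col a} \<longleftrightarrow> \<bar>j\<bar> \<in> {v. col v = col a}))"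
    proof (cases "f \<in> gens_one n")
      case False
      then have "f \<in> set (filter (\<lambda>f. f \<notin> gens_one n) fs)" using f by simp
      then obtain e where e: "e \<in> set es" "f = z2 (fst e) (snd e)" unfolding es(2) by auto
      then have "fst e \<in> ss" "snd e \<in> ss" "col \<bar>fst e\<bar> = col \<bar>snd e\<bar>" using es(3) col by auto
      then show ?thesis using e(2) by (intro disjI2 bexI[of _ "fst e"] bexI[of _ "snd e"]) simp_all
    qed simp
  qed (use ab in auto)
qed

end

section \<open>Chains\<close>

lemma prod_list_of_bool: "(\<Prod>i\<leftarrow>xs. of_bool (P i)) = (of_bool (\<forall>i\<in>set xs. P i) :: complex)"
  by (induction xs) auto

lemma prod_list_filter_split:
  "(\<Prod>f\<leftarrow>fs. g f) = (\<Prod>f\<leftarrow>filter P fs. g f) * (\<Prod>f\<leftarrow>filter (\<lambda>f. \<not> P f) fs. (g f :: complex))"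
  by (induction fs) auto

context hyperoctahedral
begin

text \<open>The word \<open>u\<close> is cut into blocks after the positions in \<open>A\<close>: \<open>cut_chain\<close> demands that each block be
  increasing, \<open>pos_chain\<close> that it also be positive.\<close>

definition links :: "int set \<Rightarrow> (int \<Rightarrow> int) \<Rightarrow> ((int \<Rightarrow> real) \<Rightarrow> complex) list" where
  "links A u = map (\<lambda>i. z2 (u i) (u (i + 1))) (filter (\<lambda>i. i \<notin> A) [1..int n - 1])"

definition cut_chain :: "int set \<Rightarrow> (int \<Rightarrow> int) \<Rightarrow> (int \<Rightarrow> real) \<Rightarrow> complex" where
  "cut_chain A u = prod_fun n (links A u)"

definition pos_chain :: "int set \<Rightarrow> (int \<Rightarrow> int) \<Rightarrow> (int \<Rightarrow> real) \<Rightarrow> complex" where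
  "pos_chain A u = prod_fun n ((z1 (u 1) # map (\<lambda>i. z1 (u (i + 1))) (filter (\<lambda>i. i \<in> A) [1..int n - 1])) @ links A u)"

text \<open>The part of \<open>chain u\<close> where the sign changes from negative to positive
  after position \<open>j\<close>. The two sign factors imply the link at \<open>j\<close>, which is
  therefore omitted and leaves only \<open>n - 2\<close> links.\<close>

definition sign_change :: "int \<Rightarrow> (int \<Rightarrow> int) \<Rightarrow> (int \<Rightarrow> real) \<Rightarrow> complex" where
  "sign_change j u = prod_fun n ([z1 (- u j), z1 (u (j + 1))] @ links {j} u)"

abbreviation chain where "chain \<equiv> cut_chain {}"

lemma links_prod: "x \<in> Z \<Longrightarrow> (\<Prod>f\<leftarrow>links A u. f x) = of_bool (\<forall>i\<in>E - A. coord x (u i) < coord x (u (i + 1)))"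
  unfolding links_def map_map comp_def by (simp only: z2_apply prod_list_of_bool) auto

lemma cut_chain_apply: "x \<in> Z \<Longrightarrow> cut_chain A u x = of_bool (\<forall>i\<in>E - A. coord x (u i) < coord x (u (i + 1)))"
  unfolding cut_chain_def by (simp only: prod_fun_apply links_prod)

lemma pos_chain_apply: "x \<in> Z \<Longrightarrow> pos_chain A u x = of_bool (0 < coord x (u 1) \<and>
  (\<forall>i\<in>E \<inter> A. 0 < coord x (u (i + 1))) \<and> (\<forall>i\<in>E - A. coord x (u i) < coord x (u (i + 1))))"
proof -
  assume x: "x \<in> Z"
  have "(\<Prod>f\<leftarrow>map (\<lambda>i. z1 (u (i + 1))) (filter (\<lambda>i. i \<in> A) [1..int n - 1]). f x) =
    of_bool (\<forall>i\<in>E \<inter> A. 0 < coord x (u (i + 1)))"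
    unfolding map_map comp_def by (simp only: z1_apply[OF x] prod_list_of_bool) auto
  then show ?thesis
    unfolding pos_chain_def prod_fun_apply[OF x] map_append prod_list.append links_prod[OF x]
    by (simp add: z1_apply[OF x])
qed

lemma sign_change_apply: "x \<in> Z \<Longrightarrow> sign_change j u x = of_bool (0 < coord x (- u j) \<and> 0 < coord x (u (j + 1)) \<and>
  (\<forall>i\<in>E - {j}. coord x (u i) < coord x (u (i + 1))))"
  unfolding sign_change_def by (simp add: prod_fun_apply links_prod z1_apply)

lemma u_ss: "u \<in> B \<Longrightarrow> i \<in> L \<Longrightarrow> u i \<in> ss"
  using L_ss by simp

lemma E_L: "i \<in> E \<Longrightarrow> i \<in> L" "i \<in> E \<Longrightarrow> i + 1 \<in> L"
  by auto

lemma one_L: "1 \<in> L"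
  using n_pos by simp

lemma links_gens: "u \<in> B \<Longrightarrow> set (links A u) \<subseteq> gens"
proof
  fix f assume u: "u \<in> B" and "f \<in> set (links A u)"
  then obtain i where i: "i \<in> E" "f = z2 (u i) (u (i + 1))" by (auto simp: links_def)
  then show "f \<in> gens"
    using z2_gens[OF u_ss[OF u E_L(1)] u_ss[OF u E_L(2)], of i i] u by (simp add: B_inj)
qed

lemma links_length: "length (links A u) = card (E - A)"
proof -
  have "length (links A u) = card (set (filter (\<lambda>i. i \<notin> A) [1..int n - 1]))"
    unfolding links_def length_map by (rule distinct_card[symmetric]) simp
  also have "set (filter (\<lambda>i. i \<notin> A) [1..int n - 1]) = E - A" by auto
  finally show ?thesis .
qed

lemma card_E: "card E = n - 1"
  by simp

lemma filter_prefix_length: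
  assumes "\<forall>x\<in>set xs. P x"
  shows "length xs \<le> length (filter P (xs @ ys))" "length (filter (\<lambda>x. \<not> P x) (xs @ ys)) \<le> length ys"
  using assms by (induction xs) auto

lemma cut_chain_in_H: "u \<in> B \<Longrightarrow> cut_chain A u \<in> carrier H"
  unfolding cut_chain_def by (rule prod_fun_in_H[OF links_gens])

lemma top_prodsI: "set fs \<subseteq> gens \<Longrightarrow> length fs = k \<Longrightarrow> l \<le> length (filter (\<lambda>f. f \<in> gens_one n) fs) \<Longrightarrow>
  prod_fun n fs \<in> top_prods k l"
  unfolding top_prods_def by blast

lemma low_prodsI: "set fs \<subseteq> gens \<Longrightarrow> int (length fs) \<le> k \<Longrightarrow> prod_fun n fs \<in> low_prods k"
  unfolding low_prods_def by blast

lemma chain_top: "u \<in> B \<Longrightarrow> chain u \<in> top_prods (n - 1) 0"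
  unfolding cut_chain_def by (rule top_prodsI[OF links_gens]) (simp_all add: links_length)

lemma card_diff_less: "A \<subseteq> E \<Longrightarrow> A \<noteq> {} \<Longrightarrow> card (E - A) + 1 \<le> n - 1"
proof -
  assume A: "A \<subseteq> E" "A \<noteq> {}"
  then have "finite A" using finite_subset by blast
  then have "1 \<le> card A" using A(2) by (simp add: Suc_le_eq card_gt_0_iff)
  moreover have "card (E - A) = card E - card A" by (rule card_Diff_subset[OF \<open>finite A\<close> A(1)])
  moreover have "card A \<le> card E" by (rule card_mono[OF finite_atLeastAtMost_int A(1)])
  ultimately show ?thesis using card_E by linarith
qed

lemma cut_chain_low: "u \<in> B \<Longrightarrow> A \<subseteq> E \<Longrightarrow> A \<noteq> {} \<Longrightarrow> cut_chain A u \<in> low_prods (int (n - 1) - 1)"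
  unfolding cut_chain_def using card_diff_less[of A] by (intro low_prodsI[OF links_gens]) (simp_all add: links_length)

text \<open>Each cut trades a link for a sign factor, so there are \<open>n\<close> factors for
  every \<open>A\<close>.\<close>

lemma pos_chain_top:
  assumes u: "u \<in> B" and A: "A \<subseteq> E"
  shows "pos_chain A u \<in> top_prods n (1 + card A)"
proof -
  let ?xs = "z1 (u 1) # map (\<lambda>i. z1 (u (i + 1))) (filter (\<lambda>i. i \<in> A) [1..int n - 1])"
  have one: "\<forall>f\<in>set ?xs. f \<in> gens_one n"
    using z1_gens[OF u_ss[OF u]] one_L E_L(2) by auto
  have "length (filter (\<lambda>i. i \<in> A) [1..int n - 1]) = card (set (filter (\<lambda>i. i \<in> A) [1..int n - 1]))"
    by (rule distinct_card[symmetric]) simp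
  also have "set (filter (\<lambda>i. i \<in> A) [1..int n - 1]) = A" using A by auto
  finally have len: "length ?xs = 1 + card A" by simp
  have fA: "finite A" using A finite_subset by blast
  show ?thesis
    unfolding pos_chain_def
  proof (rule top_prodsI)
    show "set (?xs @ links A u) \<subseteq> gens" using one links_gens[OF u, of A] unfolding set_append by blast
    have "card A \<le> card E" using A by (intro card_mono) auto
    then show "length (?xs @ links A u) = n"
      using n_pos card_Diff_subset[OF fA A] unfolding length_append len links_length by simp
    show "1 + card A \<le> length (filter (\<lambda>f. f \<in> gens_one n) (?xs @ links A u))"
      using filter_prefix_length(1)[OF one, of "links A u"] len by linarith
  qed
qed

lemma top_prods_mono: "l \<le> l' \<Longrightarrow> top_prods k l' \<subseteq> top_prods k l"
  unfolding top_prods_def by force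

text \<open>There are two sign factors and \<open>n - 2\<close> links: one sign more than the second
  grading retains, and too few links to connect all letters.\<close>

lemma sign_change_facts:
  assumes u: "u \<in> B" and j: "j \<in> E"
  shows "sign_change j u \<in> top_prods n 2" "phi s (sign_change j u) = (\<lambda>_. 0)"
proof -
  let ?xs = "[z1 (- u j), z1 (u (j + 1))]"
  have "- u j \<in> ss" using u_ss[OF u E_L(1)[OF j]] by (simp add: signed_set_iff)
  then have one: "\<forall>f\<in>set ?xs. f \<in> gens_one n"
    using z1_gens[of "- u j"] z1_gens[OF u_ss[OF u E_L(2)[OF j]]] by auto
  have g: "set (?xs @ links {j} u) \<subseteq> gens" using one links_gens[OF u, of "{j}"] unfolding set_append by blast
  have len: "length (links {j} u) + 2 = n"
    using j card_Diff_singleton[OF j] unfolding links_length by auto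
  show "sign_change j u \<in> top_prods n 2"
    unfolding sign_change_def using g len filter_prefix_length(1)[OF one, of "links {j} u"]
    by (intro top_prodsI) simp_all
  show "phi s (sign_change j u) = (\<lambda>_. 0)"
    unfolding sign_change_def using filter_prefix_length(2)[OF one, of "links {j} u"] len
    by (intro few_edges_zero[OF g]) linarith
qed

lemma chain_less:
  assumes "\<forall>i\<in>E. y i < (y (i + 1) :: real)" "i \<in> L" "j \<in> L" "i < j"
  shows "y i < y j"
proof -
  have "i + 1 \<le> j" using assms by simp
  then show ?thesis using assms(3)
  proof (induction j rule: int_ge_induct)
    case base
    then show ?case using assms(1,2) by auto
  next
    case (step j)
    then have "y i < y j" "y j < y (j + 1)" using assms(1,2) by auto
    then show ?case by (rule less_trans)
  qed
qed

text \<open>An increasing sequence of nonzero numbers is positive, negative, or changes sign at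
  exactly one place. The negative case is the positive chain of \<open>u \<circ> w0 n\<close>, as
  \<open>t -> -1/t\<close> preserves the order of negative numbers. The identity yields the factor
  \<open>1 + s\<close> of \<open>phi_chain\<close>, and in the piece with \<open>k = n\<close> and
  \<open>l = 1\<close> the relation that \<open>pos_chain {} u\<close> and
  \<open>pos_chain {} (u \<circ> w0 n)\<close> are opposite.\<close>

lemma chain_decompose:
  assumes x: "x \<in> Z" and u: "u \<in> B"
  shows "chain u x = pos_chain {} u x + pos_chain {} (u \<circ> w0 n) x + (\<Sum>j\<in>E. sign_change j u x)"
proof -
  define y where "y i = coord x (u i)" for i
  have nz: "y i \<noteq> 0" if "i \<in> L" for i using coord_nonzero[OF x u_ss[OF u that]] by (simp add: y_def)
  have bar: "coord x ((u \<circ> w0 n) i) = coord x (- u i)" if "i \<in> L" for i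
    using w0_neg[OF u L_ss[OF that]] by simp
  have bpos: "0 < coord x (- u i) \<longleftrightarrow> y i < 0" if "i \<in> L" for i
    using coord_pos_neg[OF x u_ss[OF u that]] nz[OF that] by (auto simp: y_def)
  have bless: "coord x (- u i) < coord x (- u (i + 1)) \<longleftrightarrow>
      (if 0 < y i \<longleftrightarrow> 0 < y (i + 1) then y i < y (i + 1) else 0 < y i)" if "i \<in> E" for i
    using coord_less_bar[OF x u_ss[OF u E_L(1)[OF that]] u_ss[OF u E_L(2)[OF that]]] by (simp add: y_def)
  let ?c = "\<forall>i\<in>E. y i < y (i + 1)"
  have ch: "chain u x = of_bool ?c" unfolding cut_chain_apply[OF x] y_def by simp
  have d1: "pos_chain {} u x = of_bool (?c \<and> 0 < y 1)" unfolding pos_chain_apply[OF x] y_def by auto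
  have d2: "pos_chain {} (u \<circ> w0 n) x = of_bool (?c \<and> y (int n) < 0)"
  proof -
    have "pos_chain {} (u \<circ> w0 n) x = of_bool (0 < coord x (- u 1) \<and> (\<forall>i\<in>E. coord x (- u i) < coord x (- u (i + 1))))"
      unfolding pos_chain_apply[OF x] using bar one_L E_L by (intro arg_cong[of _ _ of_bool]) auto
    also have "0 < coord x (- u 1) \<and> (\<forall>i\<in>E. coord x (- u i) < coord x (- u (i + 1))) \<longleftrightarrow> ?c \<and> y (int n) < 0"
    proof
      assume a: "0 < coord x (- u 1) \<and> (\<forall>i\<in>E. coord x (- u i) < coord x (- u (i + 1)))"
      have neg: "y i < 0" if "i \<in> L" for i
      proof -
        have "0 < coord x (- u i)"
          using a chain_less[of "\<lambda>i. coord x (- u i)" 1 i] one_L that by (cases "i = 1") force+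
        then show ?thesis using bpos[OF that] by simp
      qed
      have "y i < y (i + 1)" if "i \<in> E" for i
        using bless[OF that] a that neg[OF E_L(1)[OF that]] neg[OF E_L(2)[OF that]] by auto
      then show "?c \<and> y (int n) < 0" using neg[of "int n"] n_pos by auto
    next
      assume a: "?c \<and> y (int n) < 0"
      have neg: "y i < 0" if "i \<in> L" for i
        using a chain_less[of y i "int n"] that n_pos by (cases "i = int n") force+
      have "coord x (- u i) < coord x (- u (i + 1))" if "i \<in> E" for i
        using bless[OF that] bspec[OF conjunct1[OF a] that] neg[OF E_L(1)[OF that]] neg[OF E_L(2)[OF that]] by simp
      then show "0 < coord x (- u 1) \<and> (\<forall>i\<in>E. coord x (- u i) < coord x (- u (i + 1)))"
        using bpos[OF one_L] neg[OF one_L] by blast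
    qed
    finally show ?thesis .
  qed
  have m: "sign_change j u x = of_bool (?c \<and> y j < 0 \<and> 0 < y (j + 1))" if j: "j \<in> E" for j
  proof -
    have "0 < coord x (- u j) \<and> 0 < coord x (u (j + 1)) \<and> (\<forall>i\<in>E - {j}. coord x (u i) < coord x (u (i + 1))) \<longleftrightarrow>
      ?c \<and> y j < 0 \<and> 0 < y (j + 1)"
      unfolding bpos[OF E_L(1)[OF j]] y_def[symmetric] using j by (metis Diff_iff less_trans singletonD)
    then show ?thesis unfolding sign_change_apply[OF x] by (simp only:)
  qed
  show ?thesis
  proof (cases ?c)
    case c: True
    have mono: "y i < y j" if "i \<in> L" "j \<in> L" "i < j" for i j using chain_less[OF c that] .
    consider "0 < y 1" | "y (int n) < 0" | j where "j \<in> E" "y j < 0" "0 < y (j + 1)"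
    proof -
      have "(\<forall>i\<in>E. \<not> (y i < 0 \<and> 0 < y (i + 1))) \<Longrightarrow> y 1 < 0 \<Longrightarrow> i \<in> L \<Longrightarrow> y i < 0" for i
      proof -
        assume a: "\<forall>i\<in>E. \<not> (y i < 0 \<and> 0 < y (i + 1))" "y 1 < 0" "i \<in> L"
        have "1 \<le> i" using a(3) by simp
        then show "y i < 0" using a(3)
        proof (induction i rule: int_ge_induct)
          case base
          then show ?case using a by simp
        next
          case (step i)
          then have "y i < 0" "i \<in> E" "i + 1 \<in> L" by auto
          then show ?case using a(1) nz[of "i + 1"] by (metis linorder_less_linear)
        qed
      qed
      then have "0 < y 1 \<or> y (int n) < 0 \<or> (\<exists>j\<in>E. y j < 0 \<and> 0 < y (j + 1))"
        using nz[OF one_L] n_pos by (metis atLeastAtMost_iff linorder_less_linear of_nat_1 of_nat_le_iff order_refl)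
      then show thesis using that by blast
    qed
    then show ?thesis
    proof cases
      case 1
      have pos: "0 < y i" if "i \<in> L" for i
        using mono[OF one_L that] 1 that by (cases "i = 1") force+
      have "(\<Sum>j\<in>E. sign_change j u x) = 0"
      proof (rule sum.neutral, rule ballI)
        fix j assume j: "j \<in> E"
        then show "sign_change j u x = 0" using m[OF j] pos[OF E_L(1)[OF j]] by simp
      qed
      moreover have "\<not> y (int n) < 0" using pos[of "int n"] n_pos by simp
      ultimately show ?thesis unfolding ch d1 d2 using c 1 by simp
    next
      case 2
      have neg: "y i < 0" if "i \<in> L" for i
        using mono[OF that, of "int n"] 2 that n_pos by (cases "i = int n") force+
      have "(\<Sum>j\<in>E. sign_change j u x) = 0"
      proof (rule sum.neutral, rule ballI)
        fix j assume j: "j \<in> E"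
        then show "sign_change j u x = 0" using m[OF j] neg[OF E_L(2)[OF j]] by simp
      qed
      moreover have "\<not> 0 < y 1" using neg[OF one_L] by simp
      ultimately show ?thesis unfolding ch d1 d2 using c 2 by simp
    next
      case (3 j)
      have "sign_change k u x = of_bool (k = j)" if k: "k \<in> E" for k
      proof -
        have "y k < 0 \<and> 0 < y (k + 1) \<longleftrightarrow> k = j"
        proof
          assume a: "y k < 0 \<and> 0 < y (k + 1)"
          show "k = j"
          proof (rule ccontr)
            assume "k \<noteq> j"
            then consider "k + 1 \<le> j" | "j + 1 \<le> k" by linarith
            then show False
            proof cases
              case 1
              then have "y (k + 1) \<le> y j" using mono[OF E_L(2)[OF k] E_L(1)[OF 3(1)]] by (cases "k + 1 = j") auto
              then show False using a 3 by simp
            next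
              case 2
              then have "y (j + 1) \<le> y k" using mono[OF E_L(2)[OF 3(1)] E_L(1)[OF k]] by (cases "j + 1 = k") auto
              then show False using a 3 by simp
            qed
          qed
        qed (use 3 in simp)
        then show ?thesis unfolding m[OF k] using c by simp
      qed
      then have "(\<Sum>k\<in>E. sign_change k u x) = (\<Sum>k\<in>E. of_bool (k = j))" by (rule sum.cong[OF refl])
      also have "\<dots> = 1" using 3(1) by (simp add: of_bool_def)
      finally have "(\<Sum>k\<in>E. sign_change k u x) = 1" .
      moreover have "\<not> 0 < y 1"
        using mono[OF one_L E_L(1)[OF 3(1)]] 3(1,2) by (cases "j = 1") force+
      moreover have "\<not> y (int n) < 0"
        using mono[OF E_L(2)[OF 3(1)], of "int n"] 3(1,3) n_pos by (cases "j + 1 = int n") force+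
      ultimately show ?thesis unfolding ch d1 d2 using c by simp
    qed
  next
    case False
    then have "(\<Sum>j\<in>E. sign_change j u x) = 0" using m by (intro sum.neutral) simp
    then show ?thesis unfolding ch d1 d2 using False by simp
  qed
qed

text \<open>That the letters of \<open>u\<close> have positive and increasing coordinates at
  \<open>pt w\<close> means \<open>w \<in> Mset u {}\<close>, that is, \<open>w = u\<close>.\<close>

lemma ev_pos_chain:
  assumes u: "u \<in> B"
  shows "ev (pos_chain {} u) = dl u"
proof (rule GA_eqI)
  fix w assume w: "w \<in> B"
  have c: "coord (pt w) (u i) = cval (bi w (u i))" "bi w (u i) \<in> ss" if "i \<in> L" for i
    using coord_pt[OF w u_ss[OF u that]] u_ss[OF u that] w by auto
  have "0 < coord (pt w) (u 1) \<and> (\<forall>i\<in>E. coord (pt w) (u i) < coord (pt w) (u (i + 1))) \<longleftrightarrow> w = u"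
  proof
    assume a: "0 < coord (pt w) (u 1) \<and> (\<forall>i\<in>E. coord (pt w) (u i) < coord (pt w) (u (i + 1)))"
    have pos: "0 < bi w (u i)" if "i \<in> L" for i
    proof -
      have "0 < coord (pt w) (u i)"
        using a chain_less[of "\<lambda>i. coord (pt w) (u i)" 1 i] one_L that by (cases "i = 1") force+
      then show ?thesis using c[OF that] cval_pos by simp
    qed
    have S: "bi w \<circ> u \<in> S" using pos w u by (simp add: comp_S_iff)
    moreover have "descents L (bi w \<circ> u) = {}"
    proof -
      have "bi w (u i) < bi w (u (i + 1))" if "i \<in> E" for i
        using bspec[OF conjunct2[OF a] that] pos[OF E_L(1)[OF that]] pos[OF E_L(2)[OF that]]
        unfolding c(1)[OF E_L(1)[OF that]] c(1)[OF E_L(2)[OF that]] cval_def by simp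
      then show ?thesis using descents_E[of "bi w \<circ> u"] by (force simp: descents_def)
    qed
    ultimately have "w \<in> Mset u {}" using w by (simp add: Mset_def)
    then show "w = u" using Mset_empty[OF u] by simp
  next
    assume "w = u"
    then show "0 < coord (pt w) (u 1) \<and> (\<forall>i\<in>E. coord (pt w) (u i) < coord (pt w) (u (i + 1)))"
      using c(1)[OF one_L] c(1)[OF E_L(1)] c(1)[OF E_L(2)] u by (auto simp: cval_def)
  qed
  then show "ev (pos_chain {} u) w = of_bool (w = u)"
    using w by (simp add: ev_def pos_chain_apply pt_in_Z)
qed (simp_all add: ev_in_GA dl_in_GA u)

text \<open>The components of \<open>u\<close> and \<open>u \<circ> w0 n\<close> contribute 1 and
  \<open>s\<close>, the sign changes nothing. So chains generate the image for \<open>s = 1\<close>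
  and vanish for \<open>s = -1\<close>.\<close>

lemma phi_chain:
  assumes u: "u \<in> B" and s: "s * s = 1"
  shows "phi s (chain u) = (\<lambda>g. (1 + of_int s) * (dl u \<star> prim s) g)"
proof -
  have ub: "u \<circ> w0 n \<in> B" using u by simp
  have "ev (chain u) = (\<lambda>w. (dl u w + dl (u \<circ> w0 n) w) + (\<Sum>j\<in>E. ev (sign_change j u) w))"
  proof (rule GA_eqI)
    fix w assume w: "w \<in> B"
    show "ev (chain u) w = (dl u w + dl (u \<circ> w0 n) w) + (\<Sum>j\<in>E. ev (sign_change j u) w)"
      using chain_decompose[OF pt_in_Z[OF w] u] fun_cong[OF ev_pos_chain[OF u], of w] fun_cong[OF ev_pos_chain[OF ub], of w] w
      by (simp add: ev_def)
  qed (use u ub in \<open>auto simp: ev_in_GA GA_def ev_def\<close>)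
  then have "phi s (chain u) = (\<lambda>g. ((dl u \<star> prim s) g + (dl (u \<circ> w0 n) \<star> prim s) g) + (\<Sum>j\<in>E. phi s (sign_change j u) g))"
    unfolding phi_def by (simp only: conv_add_left conv_sum_left)
  also have "\<dots> = (\<lambda>g. (1 + of_int s) * (dl u \<star> prim s) g)"
    using sign_change_facts(2)[OF u] by (simp add: w0_prim[OF s u] distrib_right)
  finally show ?thesis .
qed

text \<open>Among the words with the signs of \<open>u\<close> exactly one lists its letters by
  increasing coordinate at \<open>x\<close>; \<tau> is the permutation that sorts \<open>u\<close>
  into it.\<close>

lemma sort_at:
  assumes x: "x \<in> Z" and u: "u \<in> B"
  obtains \<tau> where "\<tau> \<in> S" "\<And>i j. i \<in> L \<Longrightarrow> j \<in> L \<Longrightarrow> bi \<tau> i < bi \<tau> j \<longleftrightarrow> coord x (u i) < coord x (u j)"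
    "\<And>\<sigma>. \<sigma> \<in> B \<Longrightarrow> bi \<sigma> \<circ> u \<in> S \<Longrightarrow> chain \<sigma> x = of_bool (\<sigma> = u \<circ> \<tau>)"
proof -
  have "inj_on (\<lambda>i. coord x (u i)) L"
    using coord_eq_iff[OF x u_ss[OF u] u_ss[OF u]] u by (auto simp: inj_on_def B_inj)
  then obtain \<tau> where \<tau>: "\<tau> \<in> S" "\<And>i j. i \<in> L \<Longrightarrow> j \<in> L \<Longrightarrow> bi \<tau> i < bi \<tau> j \<longleftrightarrow> coord x (u i) < coord x (u j)"
    by (rule sorting_exists) blast
  have "chain \<sigma> x = of_bool (\<sigma> = u \<circ> \<tau>)" if \<sigma>: "\<sigma> \<in> B" and S: "bi \<sigma> \<circ> u \<in> S" for \<sigma>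
  proof -
    define \<pi> where "\<pi> = bi u \<circ> \<sigma>"
    have "\<pi> = bi (bi \<sigma> \<circ> u)" using \<sigma> u by (simp add: \<pi>_def bi_comp bi_bi)
    then have \<pi>: "\<pi> \<in> S" using S_bi[OF S] by simp
    have \<sigma>i: "\<sigma> i = u (\<pi> i)" for i using u by (simp add: \<pi>_def)
    have "chain \<sigma> x = of_bool (\<forall>i\<in>E. bi \<tau> (\<pi> i) < bi \<tau> (\<pi> (i + 1)))"
      unfolding cut_chain_apply[OF x] \<sigma>i using \<tau>(2)[OF S_L[OF \<pi> E_L(1)] S_L[OF \<pi> E_L(2)]]
      by (intro arg_cong[of _ _ of_bool]) auto
    also have "(\<forall>i\<in>E. bi \<tau> (\<pi> i) < bi \<tau> (\<pi> (i + 1))) \<longleftrightarrow> \<sigma> = u \<circ> \<tau>"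
    proof
      assume "\<forall>i\<in>E. bi \<tau> (\<pi> i) < bi \<tau> (\<pi> (i + 1))"
      then have "descents L (bi \<tau> \<circ> \<pi>) = {}"
        using descents_E[of "bi \<tau> \<circ> \<pi>"] by (force simp: descents_def)
      then have "bi \<tau> \<circ> \<pi> = id" by (rule increasing_id[OF S_comp[OF S_bi[OF \<tau>(1)] \<pi>]])
      then have "bi \<tau> (\<pi> i) = i" for i by (metis comp_apply id_apply)
      then have "\<pi> i = \<tau> i" for i using S_B[OF \<tau>(1)] by (metis bi_apply(1))
      then show "\<sigma> = u \<circ> \<tau>" using \<sigma>i by auto
    next
      assume "\<sigma> = u \<circ> \<tau>"
      then have "\<pi> = \<tau>" using u by (auto simp: \<pi>_def fun_eq_iff)
      then show "\<forall>i\<in>E. bi \<tau> (\<pi> i) < bi \<tau> (\<pi> (i + 1))" using S_B[OF \<tau>(1)] by simp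
    qed
    finally show ?thesis .
  qed
  then show ?thesis using \<tau> by (rule that[rotated 2])
qed

text \<open>At \<open>x\<close> only one word with the signs of \<open>u\<close> is increasing, and
  it is a shuffle of the blocks exactly when every block is increasing. So a sum of chains over
  shuffles becomes a product over blocks. For positive chains the least coordinate must be positive,
  equivalently the first coordinate of each block.\<close>

lemma Mset_sums:
  assumes x: "x \<in> Z" and u: "u \<in> B" and A: "A \<subseteq> E"
  shows "(\<Sum>v\<in>B. ind (Mset u A) v * chain v x) = cut_chain A u x"
    and "(\<Sum>v\<in>B. ind (Mset u A) v * pos_chain {} v x) = pos_chain A u x"
proof -
  obtain \<tau> where \<tau>: "\<tau> \<in> S" and ord: "\<And>i j. i \<in> L \<Longrightarrow> j \<in> L \<Longrightarrow> bi \<tau> i < bi \<tau> j \<longleftrightarrow> coord x (u i) < coord x (u j)"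
    and ch: "\<And>\<sigma>. \<sigma> \<in> B \<Longrightarrow> bi \<sigma> \<circ> u \<in> S \<Longrightarrow> chain \<sigma> x = of_bool (\<sigma> = u \<circ> \<tau>)"
    by (rule sort_at[OF x u]) blast
  have \<tau>B: "\<tau> \<in> B" by (rule S_B[OF \<tau>])
  have ut: "u \<circ> \<tau> \<in> B" using u \<tau>B by simp
  have bu: "bi (u \<circ> \<tau>) \<circ> u = bi \<tau>" using u \<tau>B by (simp add: bi_comp fun_eq_iff)
  have mem: "u \<circ> \<tau> \<in> Mset u A \<longleftrightarrow> (\<forall>i\<in>E - A. coord x (u i) < coord x (u (i + 1)))"
  proof -
    have "i \<in> descents L (bi \<tau>) \<longleftrightarrow> \<not> coord x (u i) < coord x (u (i + 1))" if i: "i \<in> E" for i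
    proof -
      have "i \<in> descents L (bi \<tau>) \<longleftrightarrow> coord x (u (i + 1)) < coord x (u i)"
        using ord[OF E_L(2)[OF i] E_L(1)[OF i]] E_L[OF i] by (simp add: descents_def del: atLeastAtMost_iff)
      moreover have "coord x (u (i + 1)) \<noteq> coord x (u i)"
        using coord_eq_iff[OF x u_ss[OF u E_L(2)[OF i]] u_ss[OF u E_L(1)[OF i]]] u by (simp add: B_inj)
      ultimately show ?thesis by auto
    qed
    then have "descents L (bi \<tau>) \<subseteq> A \<longleftrightarrow> (\<forall>i\<in>E - A. coord x (u i) < coord x (u (i + 1)))"
      using descents_E[of "bi \<tau>"] by blast
    then show ?thesis using ut S_bi[OF \<tau>] by (simp add: Mset_def bu)
  qed
  have val: "ind (Mset u A) v * chain v x = (if v = u \<circ> \<tau> then ind (Mset u A) v else 0)" if "v \<in> B" for v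
    using ch[OF that] by (auto simp: Mset_def)
  have "(\<Sum>v\<in>B. ind (Mset u A) v * chain v x) = (\<Sum>v\<in>B. if v = u \<circ> \<tau> then ind (Mset u A) v else 0)"
    by (rule sum.cong[OF refl val])
  also have "\<dots> = ind (Mset u A) (u \<circ> \<tau>)" using ut fin by (simp add: sum.delta)
  finally show "(\<Sum>v\<in>B. ind (Mset u A) v * chain v x) = cut_chain A u x"
    by (simp only: mem cut_chain_apply[OF x])
  have dv: "pos_chain {} v x = of_bool (0 < coord x (v 1)) * chain v x" for v
    unfolding pos_chain_apply[OF x] cut_chain_apply[OF x] by auto
  have min: "0 < coord x (u (\<tau> 1)) \<longleftrightarrow> (\<forall>i\<in>L. 0 < coord x (u i))"
  proof
    assume a: "0 < coord x (u (\<tau> 1))"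
    show "\<forall>i\<in>L. 0 < coord x (u i)"
    proof
      fix i assume i: "i \<in> L"
      have "\<not> bi \<tau> i < bi \<tau> (\<tau> 1)" using S_L[OF S_bi[OF \<tau>] i] \<tau>B by simp
      then have "\<not> coord x (u i) < coord x (u (\<tau> 1))" using ord[OF i S_L[OF \<tau> one_L]] by simp
      then show "0 < coord x (u i)" using a by linarith
    qed
  qed (use S_L[OF \<tau> one_L] in blast)
  have "(\<Sum>v\<in>B. ind (Mset u A) v * pos_chain {} v x) =
    (\<Sum>v\<in>B. if v = u \<circ> \<tau> then ind (Mset u A) v * of_bool (0 < coord x (v 1)) else 0)"
    by (rule sum.cong[OF refl]) (use ch in \<open>auto simp: dv Mset_def\<close>)
  also have "\<dots> = ind (Mset u A) (u \<circ> \<tau>) * of_bool (0 < coord x ((u \<circ> \<tau>) 1))"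
    using ut fin by (simp add: sum.delta)
  also have "\<dots> = of_bool ((\<forall>i\<in>E - A. coord x (u i) < coord x (u (i + 1))) \<and> (\<forall>i\<in>L. 0 < coord x (u i)))"
    by (simp only: mem comp_apply min of_bool_conj)
  also have "(\<forall>i\<in>E - A. coord x (u i) < coord x (u (i + 1))) \<and> (\<forall>i\<in>L. 0 < coord x (u i)) \<longleftrightarrow>
    0 < coord x (u 1) \<and> (\<forall>i\<in>E \<inter> A. 0 < coord x (u (i + 1))) \<and> (\<forall>i\<in>E - A. coord x (u i) < coord x (u (i + 1)))"
  proof
    assume "(\<forall>i\<in>E - A. coord x (u i) < coord x (u (i + 1))) \<and> (\<forall>i\<in>L. 0 < coord x (u i))"
    then show "0 < coord x (u 1) \<and> (\<forall>i\<in>E \<inter> A. 0 < coord x (u (i + 1))) \<and> (\<forall>i\<in>E - A. coord x (u i) < coord x (u (i + 1)))"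
      using one_L E_L(2) by blast
  next
    assume a: "0 < coord x (u 1) \<and> (\<forall>i\<in>E \<inter> A. 0 < coord x (u (i + 1))) \<and> (\<forall>i\<in>E - A. coord x (u i) < coord x (u (i + 1)))"
    have "0 < coord x (u i)" if "i \<in> L" for i
    proof -
      have "1 \<le> i" using that by simp
      then show ?thesis using that
      proof (induction i rule: int_ge_induct)
        case base
        then show ?case using a by simp
      next
        case (step i)
        then have "0 < coord x (u i)" "i \<in> E" by auto
        then show ?case using a by (cases "i \<in> A") (auto intro: less_trans)
      qed
    qed
    then show "(\<forall>i\<in>E - A. coord x (u i) < coord x (u (i + 1))) \<and> (\<forall>i\<in>L. 0 < coord x (u i))" using a by blast
  qed
  finally show "(\<Sum>v\<in>B. ind (Mset u A) v * pos_chain {} v x) = pos_chain A u x"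
    by (simp only: pos_chain_apply[OF x])
qed

section \<open>Barring edges modulo products with a sign factor\<close>

definition edge_fun :: "int \<times> int \<Rightarrow> (int \<Rightarrow> real) \<Rightarrow> complex" where
  "edge_fun e = z2 (fst e) (snd e)"

definition bar :: "int \<times> int \<Rightarrow> int \<times> int" where
  "bar e = (- fst e, - snd e)"

definition edge :: "int \<times> int \<Rightarrow> bool" where
  "edge e \<longleftrightarrow> fst e \<in> ss \<and> snd e \<in> ss \<and> \<bar>fst e\<bar> \<noteq> \<bar>snd e\<bar>"

text \<open>Generators of what is divided out in the piece with \<open>k = n - 1\<close> and
  \<open>l = 0\<close>.\<close>

definition residual :: "((int \<Rightarrow> real) \<Rightarrow> complex) set" where
  "residual = low_prods (int (n - 1) - 1) \<union> top_prods (n - 1) 1"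

lemma residual_in_H: "residual \<subseteq> carrier H"
  unfolding residual_def using prods_in_H by blast

lemma neg_ss: "i \<in> ss \<Longrightarrow> - i \<in> ss"
  by (simp add: signed_set_iff)

lemma edge_gens: "edge e \<Longrightarrow> edge_fun e \<in> gens"
  unfolding edge_def edge_fun_def by (rule z2_gens) auto

lemma edge_bar: "edge e \<Longrightarrow> edge (bar e)"
  by (simp add: edge_def bar_def neg_ss)

lemma edges_gens: "(\<And>e. e \<in> set es \<Longrightarrow> edge e) \<Longrightarrow> set (map edge_fun es) \<subseteq> gens"
  using edge_gens by auto

text \<open>By \<open>coord_less_bar\<close> the edge and its barred copy agree at coordinates of
  equal sign and are complementary at opposite signs; the difference of the sign functions is
  exactly this defect.\<close>

lemma z2_flip:
  assumes x: "x \<in> Z" and e: "edge e"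
  shows "edge_fun e x = edge_fun (bar e) x + z1 (- fst e) x - z1 (- snd e) x"
proof -
  have e': "fst e \<in> ss" "snd e \<in> ss" using e by (auto simp: edge_def)
  show ?thesis
    unfolding edge_fun_def bar_def fst_conv snd_conv z2_apply[OF x] z1_apply[OF x]
      coord_less_bar[OF x e'] coord_pos_neg[OF x e'(1)] coord_pos_neg[OF x e'(2)]
    using coord_nonzero[OF x e'(1)] coord_nonzero[OF x e'(2)] by (auto simp: not_less)
qed

lemma residual_one:
  assumes "set fs \<subseteq> gens" "length fs = n - 1" "f \<in> set fs" "f \<in> gens_one n"
  shows "prod_fun n fs \<in> sp residual"
proof (rule sp_gen)
  have "filter (\<lambda>f. f \<in> gens_one n) fs \<noteq> []" using assms(3,4) by (auto simp: filter_empty_conv)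
  then have "1 \<le> length (filter (\<lambda>f. f \<in> gens_one n) fs)" by (cases "filter (\<lambda>f. f \<in> gens_one n) fs") auto
  then show "prod_fun n fs \<in> residual" unfolding residual_def using top_prodsI[OF assms(1,2)] by blast
qed

lemma residual_short:
  assumes "set fs \<subseteq> gens" "length fs + 2 \<le> n"
  shows "prod_fun n fs \<in> sp residual"
proof (rule sp_gen)
  have "int (length fs) \<le> int (n - 1) - 1" using assms(2) by linarith
  then show "prod_fun n fs \<in> residual" unfolding residual_def using low_prodsI[OF assms(1)] by blast
qed

text \<open>Edges are treated one at a time, with \<open>fs\<close> holding those already done. The
  correction from \<open>z2_flip\<close> replaces an edge by a sign factor, so there are still
  \<open>n - 1\<close> factors and the result is residual.\<close>

lemma flip_edges:
  assumes "set fs \<subseteq> gens" "\<And>e. e \<in> set es \<Longrightarrow> edge e" "length fs + length es = n - 1"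
  shows "(\<lambda>x\<in>Z. prod_fun n (fs @ map edge_fun es) x -
    prod_fun n (fs @ map (\<lambda>e. edge_fun (if fl e then bar e else e)) es) x) \<in> sp residual"
  using assms
proof (induction es arbitrary: fs)
  case Nil
  have "(\<lambda>x\<in>Z. prod_fun n (fs @ map edge_fun []) x - prod_fun n (fs @ map (\<lambda>e. edge_fun (if fl e then bar e else e)) []) x)
    = (\<lambda>x\<in>Z. 0)" by simp
  then show ?case using sp_zero[OF residual_in_H] by (simp only:)
next
  case (Cons e es)
  let ?f = "\<lambda>e. edge_fun (if fl e then bar e else e)"
  have e: "edge e" and es: "\<And>e. e \<in> set es \<Longrightarrow> edge e" using Cons.prems(2) by auto
  have fe: "?f e \<in> gens" using e edge_gens edge_bar by (cases "fl e") auto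
  have IH: "(\<lambda>x\<in>Z. prod_fun n ((fs @ [?f e]) @ map edge_fun es) x - prod_fun n ((fs @ [?f e]) @ map ?f es) x) \<in> sp residual"
    by (rule Cons.IH) (use Cons.prems fe es in auto)
  have ss: "- fst e \<in> ss" "- snd e \<in> ss" using e by (auto simp: edge_def neg_ss)
  have one: "prod_fun n (z1 i # fs @ map edge_fun es) \<in> sp residual" if i: "i \<in> ss" for i
  proof (rule residual_one)
    show "set (z1 i # fs @ map edge_fun es) \<subseteq> gens"
      using z1_gens[OF i] Cons.prems(1) edges_gens[OF es] by auto
    show "length (z1 i # fs @ map edge_fun es) = n - 1" using Cons.prems(3) by simp
  qed (use z1_gens[OF i] in auto)
  \<comment> \<open>\<open>c\<close> switches the correction on exactly when \<open>e\<close> is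
    flipped, so one formula covers both cases.\<close>
  define c :: complex where "c = of_bool (fl e)"
  have "(\<lambda>x\<in>Z. (\<lambda>x\<in>Z. prod_fun n ((fs @ [?f e]) @ map edge_fun es) x - prod_fun n ((fs @ [?f e]) @ map ?f es) x) x +
    (\<lambda>x\<in>Z. c * (\<lambda>x\<in>Z. prod_fun n (z1 (- fst e) # fs @ map edge_fun es) x - prod_fun n (z1 (- snd e) # fs @ map edge_fun es) x) x) x) \<in> sp residual"
    by (intro sp_add[OF residual_in_H] sp_smult[OF residual_in_H] sp_diff[OF residual_in_H] one ss IH)
  moreover have "(\<lambda>x\<in>Z. (\<lambda>x\<in>Z. prod_fun n ((fs @ [?f e]) @ map edge_fun es) x - prod_fun n ((fs @ [?f e]) @ map ?f es) x) x +
    (\<lambda>x\<in>Z. c * (\<lambda>x\<in>Z. prod_fun n (z1 (- fst e) # fs @ map edge_fun es) x - prod_fun n (z1 (- snd e) # fs @ map edge_fun es) x) x) x) =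
    (\<lambda>x\<in>Z. prod_fun n (fs @ map edge_fun (e # es)) x - prod_fun n (fs @ map ?f (e # es)) x)" (is "?l = ?r")
  proof (rule restrict_ext)
    fix x assume x: "x \<in> Z"
    have fl: "edge_fun e x = ?f e x + c * (z1 (- fst e) x - z1 (- snd e) x)"
      using z2_flip[OF x e] by (simp add: c_def)
    show "(\<lambda>x\<in>Z. prod_fun n ((fs @ [?f e]) @ map edge_fun es) x - prod_fun n ((fs @ [?f e]) @ map ?f es) x) x +
      (\<lambda>x\<in>Z. c * (\<lambda>x\<in>Z. prod_fun n (z1 (- fst e) # fs @ map edge_fun es) x - prod_fun n (z1 (- snd e) # fs @ map edge_fun es) x) x) x =
      prod_fun n (fs @ map edge_fun (e # es)) x - prod_fun n (fs @ map ?f (e # es)) x"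
      unfolding restrict_apply'[OF x] prod_fun_apply[OF x] list.map map_append prod_list.append prod_list.Cons fl
      by (simp add: algebra_simps)
  qed
  ultimately show ?case by metis
qed

text \<open>Barring every link of \<open>u\<close> gives the links of
  \<open>u \<circ> w0 n\<close>.\<close>

lemma chain_flip:
  assumes u: "u \<in> B"
  shows "(\<lambda>x\<in>Z. chain u x - chain (u \<circ> w0 n) x) \<in> sp residual"
proof -
  define es where "es = map (\<lambda>i. (u i, u (i + 1))) [1..int n - 1]"
  have "edge e" if e: "e \<in> set es" for e
  proof -
    obtain i where i: "i \<in> E" "e = (u i, u (i + 1))" using e by (auto simp: es_def)
    have "\<bar>u i\<bar> \<noteq> \<bar>u (i + 1)\<bar>"
    proof
      assume "\<bar>u i\<bar> = \<bar>u (i + 1)\<bar>"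
      then have "u i = u (i + 1) \<or> u i = u (- (i + 1))" using B_odd[OF u, of "i + 1"] by linarith
      then show False using i(1) by (auto simp: B_inj[OF u])
    qed
    then show ?thesis using u_ss[OF u E_L(1)[OF i(1)]] u_ss[OF u E_L(2)[OF i(1)]] by (simp add: edge_def i(2))
  qed
  moreover have "length es = n - 1" by (simp add: es_def)
  ultimately have "(\<lambda>x\<in>Z. prod_fun n ([] @ map edge_fun es) x - prod_fun n ([] @ map (\<lambda>e. edge_fun (if True then bar e else e)) es) x) \<in> sp residual"
    by (intro flip_edges) auto
  moreover have "prod_fun n ([] @ map edge_fun es) = chain u" by (simp add: cut_chain_def links_def es_def edge_fun_def comp_def)
  moreover have "prod_fun n ([] @ map (\<lambda>e. edge_fun (if True then bar e else e)) es) = chain (u \<circ> w0 n)"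
  proof -
    have "map (\<lambda>e. edge_fun (if True then bar e else e)) es = links {} (u \<circ> w0 n)"
      unfolding es_def links_def map_map
    proof (rule map_cong)
      fix i assume "i \<in> set (filter (\<lambda>i. i \<notin> {}) [1..int n - 1])"
      then have "i \<in> E" by simp
      then show "((\<lambda>e. edge_fun (if True then bar e else e)) \<circ> (\<lambda>i. (u i, u (i + 1)))) i = z2 ((u \<circ> w0 n) i) ((u \<circ> w0 n) (i + 1))"
        using w0_neg[OF u L_ss[OF E_L(1)]] w0_neg[OF u L_ss[OF E_L(2)]] by (simp add: edge_fun_def bar_def del: comp_apply) simp
    qed simp
    then show ?thesis unfolding cut_chain_def by simp
  qed
  ultimately show ?thesis by metis
qed

section \<open>Products of fewer than \<open>n\<close> generators\<close>

text \<open>For a set \<open>C\<close> of letters, a point selects the positive coordinate from each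
  pair \<open>x_i\<close>, \<open>-1/x_i\<close>. The word of \<open>words C\<close> that is
  \<open>sorted_at\<close> this point lists the selected letters in increasing order.\<close>

definition sorted_at :: "int list \<Rightarrow> (int \<Rightarrow> real) \<Rightarrow> bool" where
  "sorted_at vs x \<longleftrightarrow> (\<forall>k\<in>set vs. 0 < coord x k) \<and> sorted_wrt (\<lambda>i j. coord x i < coord x j) vs"

definition words :: "int set \<Rightarrow> int list set" where
  "words C = {vs. set vs \<subseteq> ss \<and> distinct vs \<and> abs ` set vs = C \<and> length vs = card C}"

lemma finite_words: "finite (words C)"
proof -
  have "words C \<subseteq> {vs. set vs \<subseteq> ss \<and> length vs = card C}" by (auto simp: words_def)
  moreover have "finite {vs. set vs \<subseteq> ss \<and> length vs = card C}"
    by (rule finite_lists_length_eq) (simp add: signed_set_def)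
  ultimately show ?thesis by (rule finite_subset)
qed

lemma sorted_at_set:
  assumes x: "x \<in> Z" and vs: "vs \<in> words C" "sorted_at vs x" and i: "i \<in> ss" "\<bar>i\<bar> \<in> C"
  shows "i \<in> set vs \<longleftrightarrow> 0 < coord x i"
proof
  assume "i \<in> set vs" then show "0 < coord x i" using vs(2) by (simp add: sorted_at_def)
next
  assume pos: "0 < coord x i"
  obtain k where k: "k \<in> set vs" "\<bar>k\<bar> = \<bar>i\<bar>" using vs(1) i(2) by (auto simp: words_def)
  then consider "k = i" | "k = - i" by linarith
  then show "i \<in> set vs"
  proof cases
    case 2
    then have "0 < coord x (- i)" using k(1) vs(2) by (simp add: sorted_at_def)
    then show ?thesis using coord_pos_neg[OF x i(1)] pos by simp
  qed (use k in simp)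
qed

text \<open>The word fixes every comparison inside \<open>C\<close>: between positive coordinates
  directly, between negative ones after barring both letters, and opposite signs decide by
  themselves.\<close>

lemma sorted_at_less:
  assumes x: "x \<in> Z" and y: "y \<in> Z" and vs: "vs \<in> words C" "sorted_at vs x" "sorted_at vs y"
    and i: "i \<in> ss" "\<bar>i\<bar> \<in> C" and j: "j \<in> ss" "\<bar>j\<bar> \<in> C"
  shows "coord x i < coord x j \<longleftrightarrow> coord y i < coord y j"
proof -
  have st: "sorted_wrt (\<lambda>i j. coord x i < coord x j) vs" "sorted_wrt (\<lambda>i j. coord y i < coord y j) vs"
    using vs by (auto simp: sorted_at_def)
  have key: "coord x a < coord x b \<longleftrightarrow> coord y a < coord y b" if "a \<in> set vs" "b \<in> set vs" for a b
    using sorted_wrt_key_eq[OF st that] .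
  note mem = sorted_at_set[OF x vs(1,2)] sorted_at_set[OF y vs(1,3)]
  have nz: "coord x i \<noteq> 0" "coord x j \<noteq> 0" "coord y i \<noteq> 0" "coord y j \<noteq> 0"
    using coord_nonzero x y i(1) j(1) by auto
  have pi: "0 < coord x i \<longleftrightarrow> 0 < coord y i" and pj: "0 < coord x j \<longleftrightarrow> 0 < coord y j"
    using mem[OF i] mem[OF j] by auto
  show ?thesis
  proof (cases "0 < coord x i \<longleftrightarrow> 0 < coord x j")
    case False
    then show ?thesis using pi pj nz by linarith
  next
    case same: True
    show ?thesis
    proof (cases "0 < coord x i")
      case True
      then have "i \<in> set vs" "j \<in> set vs" using mem(1)[OF i] mem(1)[OF j] same by auto
      then show ?thesis by (rule key)
    next
      case False
      have i': "- i \<in> ss" "\<bar>- i\<bar> \<in> C" "- j \<in> ss" "\<bar>- j\<bar> \<in> C" using i j by (auto simp: neg_ss)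
      have "0 < coord x (- i)" "0 < coord x (- j)" using False same coord_pos_neg[OF x i(1)] coord_pos_neg[OF x j(1)] by auto
      then have "- i \<in> set vs" "- j \<in> set vs" using mem(1)[OF i'(1,2)] mem(1)[OF i'(3,4)] by auto
      then have "coord x (- i) < coord x (- j) \<longleftrightarrow> coord y (- i) < coord y (- j)" by (rule key)
      then show ?thesis
        unfolding coord_less_bar[OF x i(1) j(1)] coord_less_bar[OF y i(1) j(1)] using same pi pj by simp
    qed
  qed
qed

lemma sorted_at_unique:
  assumes x: "x \<in> Z" and v: "v \<in> words C" "sorted_at v x" and w: "w \<in> words C" "sorted_at w x"
  shows "v = w"
proof -
  have "set v = {k \<in> ss. \<bar>k\<bar> \<in> C \<and> 0 < coord x k}" if v: "v \<in> words C" "sorted_at v x" for v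
  proof -
    have "k \<in> ss \<and> \<bar>k\<bar> \<in> C" if "k \<in> set v" for k using v(1) that by (auto simp: words_def)
    then show ?thesis using sorted_at_set[OF x v] by blast
  qed
  from this[OF v] this[OF w] have eq: "set v = set w" by simp
  have "sorted_wrt (<) (map (coord x) v)" "sorted_wrt (<) (map (coord x) w)"
    using v w by (simp_all add: sorted_at_def sorted_wrt_map)
  then have "map (coord x) v = map (coord x) w" using eq by (intro strict_sorted_equal) auto
  moreover have "inj_on (coord x) (set v \<union> set w)"
    using v(1) w(1) coord_eq_iff[OF x] by (auto simp: inj_on_def words_def subset_iff)
  ultimately show ?thesis by (rule map_inj_on)
qed

lemma sorted_at_exists:
  assumes x: "x \<in> Z" and C: "C \<subseteq> L"
  shows "\<exists>vs\<in>words C. sorted_at vs x"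
proof -
  define D where "D = {k \<in> ss. \<bar>k\<bar> \<in> C \<and> 0 < coord x k}"
  have fin: "finite D" unfolding D_def by (rule finite_subset[of _ ss]) (auto simp: signed_set_def)
  have inj: "inj_on (coord x) D" using coord_eq_iff[OF x] by (auto simp: inj_on_def D_def)
  define vs where "vs = sort_key (coord x) (sorted_list_of_set D)"
  have vs: "set vs = D" "distinct vs" using fin by (auto simp: vs_def)
  have inja: "inj_on abs D"
  proof (rule inj_onI)
    fix a b assume ab: "a \<in> D" "b \<in> D" "\<bar>a\<bar> = \<bar>b\<bar>"
    have "b \<noteq> - a" using ab coord_pos_neg[OF x, of a] by (auto simp: D_def)
    then show "a = b" using ab(3) by linarith
  qed
  have img: "abs ` D = C"
  proof
    show "C \<subseteq> abs ` D"
    proof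
      fix c assume c: "c \<in> C"
      then have cL: "c \<in> L" "c \<in> ss" using C L_ss by auto
      have abs: "\<bar>c\<bar> = c" "\<bar>- c\<bar> = c" using cL(1) by auto
      show "c \<in> abs ` D"
      proof (cases "0 < coord x c")
        case True
        then have "c \<in> D" using c cL(2) abs by (simp add: D_def)
        then show ?thesis using abs by force
      next
        case False
        then have "- c \<in> D" using c cL(2) abs coord_pos_neg[OF x cL(2)] by (simp add: D_def neg_ss)
        then show ?thesis using abs by force
      qed
    qed
  qed (auto simp: D_def)
  have "length vs = card C" using card_image[OF inja] distinct_card[OF vs(2)] by (simp add: img vs(1))
  then have "vs \<in> words C" using vs img by (auto simp: words_def D_def)
  moreover have "sorted_wrt (<) (map (coord x) vs)"
  proof -
    have "sorted (map (coord x) vs)" by (simp add: vs_def)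
    moreover have "distinct (map (coord x) vs)" using vs inj by (simp add: distinct_map)
    ultimately show ?thesis by (simp add: strict_sorted_iff)
  qed
  then have "sorted_at vs x" using vs(1) by (auto simp: sorted_at_def sorted_wrt_map D_def)
  ultimately show ?thesis by blast
qed

text \<open>Their product is the indicator of \<open>sorted_at vs\<close>, since positivity of the
  first letter passes along the links. It has as many factors as letters, one of them a sign
  factor.\<close>

definition block_factors :: "int list \<Rightarrow> ((int \<Rightarrow> real) \<Rightarrow> complex) list" where
  "block_factors vs = z1 (hd vs) # map (\<lambda>(i, j). z2 i j) (zip vs (tl vs))"

lemma block_factors_prod:
  assumes x: "x \<in> Z"
  shows "vs \<noteq> [] \<Longrightarrow> (\<Prod>f\<leftarrow>block_factors vs. f x) = of_bool (sorted_at vs x)"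
proof (induction vs rule: induct_list012)
  case (2 a)
  then show ?case by (simp add: block_factors_def sorted_at_def z1_apply[OF x])
next
  case (3 a b vs)
  have "(\<Prod>f\<leftarrow>block_factors (b # vs). f x) = of_bool (sorted_at (b # vs) x)" by (rule 3) simp
  then have "z1 b x * (\<Prod>f\<leftarrow>map (\<lambda>(i, j). z2 i j) (zip (b # vs) vs). f x) = of_bool (sorted_at (b # vs) x)"
    by (simp add: block_factors_def)
  moreover have "(\<Prod>f\<leftarrow>block_factors (a # b # vs). f x) = z1 a x * z2 a b x * (\<Prod>f\<leftarrow>map (\<lambda>(i, j). z2 i j) (zip (b # vs) vs). f x)"
    by (simp add: block_factors_def)
  moreover have "z1 a x * z2 a b x = z1 a x * z2 a b x * z1 b x"
    by (auto simp: z1_apply[OF x] z2_apply[OF x])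
  ultimately have "(\<Prod>f\<leftarrow>block_factors (a # b # vs). f x) = z1 a x * z2 a b x * of_bool (sorted_at (b # vs) x)"
    by (metis mult.assoc)
  also have "\<dots> = of_bool (sorted_at (a # b # vs) x)"
    unfolding sorted_at_def by (auto simp: z1_apply[OF x] z2_apply[OF x] intro: less_trans)
  finally show ?case .
qed simp

lemma block_factors_gens:
  assumes vs: "vs \<in> words C" "vs \<noteq> []"
  shows "set (block_factors vs) \<subseteq> gens" "z1 (hd vs) \<in> gens_one n" "length (block_factors vs) = card C"
proof -
  have s: "set vs \<subseteq> ss" "distinct vs" "length vs = card C" using vs(1) by (auto simp: words_def)
  show h: "z1 (hd vs) \<in> gens_one n" using s vs(2) by (intro z1_gens) auto
  show "length (block_factors vs) = card C" using s(3) vs(2) by (cases vs) (auto simp: block_factors_def)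
  have "z2 i j \<in> gens" if ij: "(i, j) \<in> set (zip vs (tl vs))" for i j
  proof -
    have "i \<in> set vs" "j \<in> set vs" using set_zip_leftD[OF ij] set_zip_rightD[OF ij] by (auto dest: list.set_sel(2)[OF vs(2)])
    moreover have "i \<noteq> j"
    proof -
      obtain k where k: "k < length vs" "k < length (tl vs)" "i = vs ! k" "j = tl vs ! k" using ij by (auto simp: in_set_zip)
      then have "j = vs ! Suc k" "Suc k < length vs" by (auto simp: nth_tl)
      then show ?thesis using k s(2) by (simp add: nth_eq_iff_index_eq)
    qed
    ultimately show ?thesis using s(1) by (intro z2_gens) auto
  qed
  then show "set (block_factors vs) \<subseteq> gens" using h by (auto simp: block_factors_def)
qed

text \<open>The edges inside \<open>C\<close> depend only on the word at \<open>C\<close>, so their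
  product is a combination of the products of \<open>block_factors\<close>, which have
  \<open>card C\<close> factors. With at least that many edges to begin with, no product becomes
  longer, and each gains a sign factor; hence everything is residual.\<close>

lemma split_span:
  assumes C: "C \<subseteq> L" "C \<noteq> {}"
    and es: "\<And>e. e \<in> set es1 \<union> set es2 \<Longrightarrow> edge e" "\<And>e. e \<in> set es1 \<Longrightarrow> \<bar>fst e\<bar> \<in> C \<and> \<bar>snd e\<bar> \<in> C"
    and len: "card C \<le> length es1" "length es1 + length es2 = n - 1"
  shows "prod_fun n (map edge_fun es1 @ map edge_fun es2) \<in> sp residual"
proof (rule sp_eq[OF residual_in_H])
  \<comment> \<open>Any point with the word \<open>vs\<close> may be chosen, by
    \<open>sorted_at_less\<close>.\<close>
  define g where "g vs = prod_fun n (map edge_fun es1) (SOME y. y \<in> Z \<and> sorted_at vs y)" for vs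
  have ne: "vs \<noteq> []" if "vs \<in> words C" for vs using that C(2) by (auto simp: words_def)
  have fC: "finite C" using C(1) by (rule finite_subset) simp
  have es2: "set (map edge_fun es2) \<subseteq> gens" by (rule edges_gens) (use es(1) in blast)
  have mem: "prod_fun n (block_factors vs @ map edge_fun es2) \<in> sp residual" if vs: "vs \<in> words C" for vs
  proof -
    note b = block_factors_gens[OF vs ne[OF vs]]
    have g: "set (block_factors vs @ map edge_fun es2) \<subseteq> gens" using b(1) es2 by (simp only: set_append Un_subset_iff)
    show ?thesis
    proof (cases "card C = length es1")
      case True
      show ?thesis by (rule residual_one[OF g _ _ b(2)]) (use True len b(3) in \<open>simp_all add: block_factors_def\<close>)
    next
      case False
      then show ?thesis using len b(3) by (intro residual_short[OF g]) simp
    qed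
  qed
  show "(\<lambda>x\<in>Z. \<Sum>vs\<in>words C. g vs * prod_fun n (block_factors vs @ map edge_fun es2) x) \<in> sp residual"
    by (rule sp_sum[OF residual_in_H finite_words mem])
  show "prod_fun n (map edge_fun es1 @ map edge_fun es2) \<in> carrier H"
    unfolding map_append[symmetric] by (rule prod_fun_in_H[OF edges_gens]) (use es(1) in auto)
  fix x assume x: "x \<in> Z"
  obtain vs where vs: "vs \<in> words C" "sorted_at vs x" using sorted_at_exists[OF x C(1)] by blast
  have gv: "g vs = prod_fun n (map edge_fun es1) x"
  proof -
    define y where "y = (SOME y. y \<in> Z \<and> sorted_at vs y)"
    have y: "y \<in> Z \<and> sorted_at vs y" unfolding y_def by (rule someI[of _ x]) (use x vs in blast)
    have "edge_fun e y = edge_fun e x" if e: "e \<in> set es1" for e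
    proof -
      have "edge e" "\<bar>fst e\<bar> \<in> C" "\<bar>snd e\<bar> \<in> C" using es e by auto
      then have "coord y (fst e) < coord y (snd e) \<longleftrightarrow> coord x (fst e) < coord x (snd e)"
        using y x vs by (intro sorted_at_less[of _ _ vs C]) (auto simp: edge_def)
      then show ?thesis using x y by (simp add: edge_fun_def z2_apply)
    qed
    then have "map (\<lambda>e. edge_fun e y) es1 = map (\<lambda>e. edge_fun e x) es1" by simp
    then have "(\<Prod>e\<leftarrow>es1. edge_fun e y) = (\<Prod>e\<leftarrow>es1. edge_fun e x)" by (rule arg_cong)
    then show ?thesis unfolding g_def y_def[symmetric] using x y by (simp add: prod_fun_apply comp_def)
  qed
  have "(\<Sum>ws\<in>words C. g ws * prod_fun n (block_factors ws @ map edge_fun es2) x) =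
    (\<Sum>ws\<in>words C. if ws = vs then g vs * (\<Prod>f\<leftarrow>map edge_fun es2. f x) else 0)"
  proof (rule sum.cong[OF refl])
    fix ws assume ws: "ws \<in> words C"
    have "sorted_at ws x \<longleftrightarrow> ws = vs" using sorted_at_unique[OF x ws _ vs] vs by blast
    then show "g ws * prod_fun n (block_factors ws @ map edge_fun es2) x = (if ws = vs then g vs * (\<Prod>f\<leftarrow>map edge_fun es2. f x) else 0)"
      unfolding prod_fun_apply[OF x] map_append prod_list.append block_factors_prod[OF x ne[OF ws]] by simp
  qed
  also have "\<dots> = g vs * (\<Prod>f\<leftarrow>map edge_fun es2. f x)" using vs(1) finite_words by simp
  finally show "prod_fun n (map edge_fun es1 @ map edge_fun es2) x = (\<Sum>ws\<in>words C. g ws * prod_fun n (block_factors ws @ map edge_fun es2) x)"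
    unfolding gv prod_fun_apply[OF x] map_append prod_list.append by simp
qed

text \<open>All edges join letters \<open>s i\<close> with \<open>i\<close> in \<open>L\<close>, one
  from each barred pair. Their product is the sum of the chains over the total orders of these
  letters that satisfy all edges, its linear extensions.\<close>

lemma normalized_span:
  assumes J: "J \<subseteq> L" and es: "\<And>e. e \<in> set es \<Longrightarrow> edge e \<and> 0 < w0_on J (fst e) \<and> 0 < w0_on J (snd e)"
  shows "prod_fun n (map edge_fun es) \<in> sp (chain ` B)"
proof -
  define s where "s = w0_on J"
  have s: "s \<in> B" unfolding s_def by (rule w0_on_in_B[OF J])
  have ssi: "s (s i) = i" for i by (simp add: s_def w0_on_def)
  have bs: "bi s = s" using inv_equality[of s s] s ssi by (simp add: comp_def id_def)
  have sL: "s (fst e) \<in> L \<and> s (snd e) \<in> L" if "e \<in> set es" for e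
  proof -
    have "fst e \<in> ss" "snd e \<in> ss" using es[OF that] by (auto simp: edge_def)
    then have "s (fst e) \<in> ss" "s (snd e) \<in> ss" using s by auto
    then show ?thesis using es[OF that] by (simp add: signed_set_iff s_def)
  qed
  have X: "chain ` B \<subseteq> carrier H" using cut_chain_in_H by blast
  have finS: "finite S" by (rule finite_subset[OF _ fin]) (use S_B in blast)
  show ?thesis
  proof (rule sp_eq[OF X])
    show "(\<lambda>x\<in>Z. \<Sum>\<tau>\<in>S. of_bool (\<forall>e\<in>set es. bi \<tau> (s (fst e)) < bi \<tau> (s (snd e))) * chain (s \<circ> \<tau>) x) \<in> sp (chain ` B)"
      by (rule sp_sum[OF X finS]) (rule sp_gen, rule imageI, rule comp_in_B[OF s S_B])
    show "prod_fun n (map edge_fun es) \<in> carrier H" by (rule prod_fun_in_H[OF edges_gens]) (use es in blast)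
    fix x assume x: "x \<in> Z"
    obtain \<tau> where \<tau>: "\<tau> \<in> S" and ord: "\<And>i j. i \<in> L \<Longrightarrow> j \<in> L \<Longrightarrow> bi \<tau> i < bi \<tau> j \<longleftrightarrow> coord x (s i) < coord x (s j)"
      and ch: "\<And>\<sigma>. \<sigma> \<in> B \<Longrightarrow> bi \<sigma> \<circ> s \<in> S \<Longrightarrow> chain \<sigma> x = of_bool (\<sigma> = s \<circ> \<tau>)"
      by (rule sort_at[OF x s]) blast
    have chs: "chain (s \<circ> \<rho>) x = of_bool (\<rho> = \<tau>)" if \<rho>: "\<rho> \<in> S" for \<rho>
    proof -
      have "bi (s \<circ> \<rho>) \<circ> s = bi \<rho>" using s S_B[OF \<rho>] by (simp add: bi_comp fun_eq_iff)
      then have "bi (s \<circ> \<rho>) \<circ> s \<in> S" using S_bi[OF \<rho>] by simp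
      then have "chain (s \<circ> \<rho>) x = of_bool (s \<circ> \<rho> = s \<circ> \<tau>)" by (rule ch[OF comp_in_B[OF s S_B[OF \<rho>]]])
      also have "s \<circ> \<rho> = s \<circ> \<tau> \<longleftrightarrow> \<rho> = \<tau>" by (auto simp: fun_eq_iff B_inj[OF s])
      finally show ?thesis .
    qed
    have "(\<Sum>\<rho>\<in>S. of_bool (\<forall>e\<in>set es. bi \<rho> (s (fst e)) < bi \<rho> (s (snd e))) * chain (s \<circ> \<rho>) x) =
      (\<Sum>\<rho>\<in>S. if \<rho> = \<tau> then of_bool (\<forall>e\<in>set es. bi \<tau> (s (fst e)) < bi \<tau> (s (snd e))) else 0)"
      by (rule sum.cong[OF refl]) (simp add: chs)
    also have "\<dots> = of_bool (\<forall>e\<in>set es. bi \<tau> (s (fst e)) < bi \<tau> (s (snd e)))" using \<tau> finS by simp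
    also have "\<dots> = of_bool (\<forall>e\<in>set es. coord x (fst e) < coord x (snd e))"
      using sL ord ssi by (intro arg_cong[of _ _ of_bool] ball_cong[OF refl]) metis
    also have "\<dots> = prod_fun n (map edge_fun es) x"
      unfolding prod_fun_apply[OF x] map_map comp_def edge_fun_def z2_apply[OF x] prod_list_of_bool by simp
    finally show "prod_fun n (map edge_fun es) x = (\<Sum>\<tau>\<in>S. of_bool (\<forall>e\<in>set es. bi \<tau> (s (fst e)) < bi \<tau> (s (snd e))) * chain (s \<circ> \<tau>) x)"
      by simp
  qed
qed

lemma residual_chain_in_H: "residual \<union> chain ` B \<subseteq> carrier H"
  using residual_in_H cut_chain_in_H by blast

text \<open>If there are several colours, \<open>C\<close> is one colour class, and \<open>C\<close>
  or its complement contains at least as many edges as letters, so \<open>split_span\<close>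
  applies. Otherwise the edges can be made to join letters of a consistent choice of signs by
  barring some of them, which costs residual terms only, and the outcome is a sum of chains.\<close>

lemma edges_span:
  assumes es: "\<And>e. e \<in> set es \<Longrightarrow> edge e" and len: "length es = n - 1"
  shows "prod_fun n (map edge_fun es) \<in> sp (residual \<union> chain ` B)"
proof -
  have mono: "f \<in> sp (residual \<union> chain ` B)" if "f \<in> sp residual \<or> f \<in> sp (chain ` B)" for f
    using that lin_span_mono[of residual "residual \<union> chain ` B" H] lin_span_mono[of "chain ` B" "residual \<union> chain ` B" H] by blast
  have "\<forall>e\<in>set es. fst e \<in> ss \<and> snd e \<in> ss" using es by (simp add: edge_def)
  then obtain col :: "int \<Rightarrow> int" and J where J: "J \<subseteq> L" and col: "\<forall>e\<in>set es. col \<bar>fst e\<bar> = col \<bar>snd e\<bar>"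
    and alt: "n < card (col ` L) + length es \<or> n \<le> card (col ` L) + length es \<and>
      (\<forall>e\<in>set es. 0 < w0_on J (fst e) \<longleftrightarrow> 0 < w0_on J (snd e))"
    by (rule colouring_edges) blast
  from alt show ?thesis
  proof
    assume "n < card (col ` L) + length es"
    then have "1 < card (col ` L)" using len n_pos by linarith
    then obtain a b where ab: "a \<in> L" "b \<in> L" "col a \<noteq> col b" by (rule two_colours)
    define C where "C = {v \<in> L. col v = col a}"
    define P where "P e \<longleftrightarrow> \<bar>fst e\<bar> \<in> C" for e :: "int \<times> int"
    define es1 where "es1 = filter P es"
    define es2 where "es2 = filter (\<lambda>e. \<not> P e) es"
    have eL: "\<bar>fst e\<bar> \<in> L" "\<bar>snd e\<bar> \<in> L" if "e \<in> set es" for e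
      using es[OF that] iffD1[OF abs_L] by (auto simp: edge_def simp del: atLeastAtMost_iff)
    have CL: "C \<subseteq> L" "L - C \<subseteq> L" "C \<noteq> {}" "L - C \<noteq> {}" using ab by (auto simp: C_def)
    have cc: "card C + card (L - C) = n"
    proof -
      have "card C \<le> card L" by (rule card_mono[OF finite_atLeastAtMost_int CL(1)])
      moreover have "card (L - C) = card L - card C" by (rule card_Diff_subset[OF finite_subset[OF CL(1)] CL(1)]) simp
      ultimately show ?thesis by simp
    qed
    have l: "length es1 + length es2 = n - 1" unfolding es1_def es2_def sum_length_filter_compl len ..
    have m1: "\<bar>fst e\<bar> \<in> C \<and> \<bar>snd e\<bar> \<in> C" if "e \<in> set es1" for e
    proof -
      have e: "e \<in> set es" "\<bar>fst e\<bar> \<in> C" using that by (auto simp: es1_def P_def)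
      then show ?thesis using eL(2)[OF e(1)] bspec[OF col e(1)] unfolding C_def by simp
    qed
    have m2: "\<bar>fst e\<bar> \<in> L - C \<and> \<bar>snd e\<bar> \<in> L - C" if "e \<in> set es2" for e
    proof -
      have e: "e \<in> set es" "\<bar>fst e\<bar> \<notin> C" using that by (auto simp: es2_def P_def)
      then show ?thesis using eL[OF e(1)] bspec[OF col e(1)] unfolding C_def by simp
    qed
    have ed: "edge e" if "e \<in> set es1 \<union> set es2" for e
      by (rule es) (use that in \<open>auto simp: es1_def es2_def\<close>)
    have split: "(\<Prod>e\<leftarrow>es. edge_fun e x) = (\<Prod>e\<leftarrow>es1. edge_fun e x) * (\<Prod>e\<leftarrow>es2. edge_fun e x)" for x
      unfolding es1_def es2_def by (rule prod_list_filter_split)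
    have "prod_fun n (map edge_fun es) \<in> sp residual"
    proof (cases "card C \<le> length es1")
      case True
      have "prod_fun n (map edge_fun es1 @ map edge_fun es2) \<in> sp residual" by (rule split_span[OF CL(1,3) ed m1 True l])
      moreover have "prod_fun n (map edge_fun es1 @ map edge_fun es2) = prod_fun n (map edge_fun es)"
        unfolding prod_fun_def by (rule restrict_ext) (simp add: split comp_def)
      ultimately show ?thesis by simp
    next
      case False
      \<comment> \<open>There are \<open>n - 1\<close> edges and \<open>n\<close> letters, so it is
        impossible that both sides have fewer edges than letters.\<close>
      then have c: "card (L - C) \<le> length es2" using cc l n_pos by linarith
      have "prod_fun n (map edge_fun es2 @ map edge_fun es1) \<in> sp residual"
        by (rule split_span[OF CL(2,4) _ m2 c]) (use ed l in auto)
      moreover have "prod_fun n (map edge_fun es2 @ map edge_fun es1) = prod_fun n (map edge_fun es)"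
        unfolding prod_fun_def by (rule restrict_ext) (simp add: split comp_def)
      ultimately show ?thesis by simp
    qed
    then show ?thesis using mono by blast
  next
    assume bal: "n \<le> card (col ` L) + length es \<and> (\<forall>e\<in>set es. 0 < w0_on J (fst e) \<longleftrightarrow> 0 < w0_on J (snd e))"
    define fl where "fl e \<longleftrightarrow> \<not> 0 < w0_on J (fst e)" for e :: "int \<times> int"
    define es' where "es' = map (\<lambda>e. if fl e then bar e else e) es"
    have "edge e \<and> 0 < w0_on J (fst e) \<and> 0 < w0_on J (snd e)" if e: "e \<in> set es'" for e
    proof -
      obtain d where d: "d \<in> set es" "e = (if fl d then bar d else d)"
        using e unfolding es'_def set_map by blast
      have "0 < w0_on J (fst d) \<longleftrightarrow> 0 < w0_on J (snd d)" using bal d(1) by blast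
      moreover have "fst d \<noteq> 0" "snd d \<noteq> 0" using es[OF d(1)] by (auto simp: edge_def signed_set_iff)
      ultimately show ?thesis using es[OF d(1)] edge_bar[OF es[OF d(1)]] d(2)
        by (auto simp: fl_def bar_def w0_on_def split: if_splits)
    qed
    then have n1: "prod_fun n (map edge_fun es') \<in> sp (chain ` B)" by (rule normalized_span[OF J])
    have "(\<lambda>x\<in>Z. prod_fun n ([] @ map edge_fun es) x - prod_fun n ([] @ map (\<lambda>e. edge_fun (if fl e then bar e else e)) es) x) \<in> sp residual"
      by (rule flip_edges) (use es len in auto)
    moreover have "map (\<lambda>e. edge_fun (if fl e then bar e else e)) es = map edge_fun es'" by (simp add: es'_def)
    ultimately have n2: "(\<lambda>x\<in>Z. prod_fun n (map edge_fun es) x - prod_fun n (map edge_fun es') x) \<in> sp residual" by (simp only: append_Nil)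
    have "(\<lambda>x\<in>Z. (\<lambda>x\<in>Z. prod_fun n (map edge_fun es) x - prod_fun n (map edge_fun es') x) x + prod_fun n (map edge_fun es') x) \<in> sp (residual \<union> chain ` B)"
      by (rule sp_add[OF residual_chain_in_H mono[OF disjI1[OF n2]] mono[OF disjI2[OF n1]]])
    moreover have "prod_fun n (map edge_fun es) \<in> carrier H" by (rule prod_fun_in_H[OF edges_gens[OF es]])
    ultimately show ?thesis by (rule sp_eq[OF residual_chain_in_H]) simp
  qed
qed

text \<open>Only products of exactly \<open>n - 1\<close> edges need rewriting; every other product
  of at most \<open>n - 1\<close> generators is residual.\<close>

lemma low_span:
  assumes "f \<in> low_prods (int (n - 1))"
  shows "f \<in> sp (residual \<union> chain ` B)"
proof -
  have mono: "f \<in> sp (residual \<union> chain ` B)" if "f \<in> sp residual" for f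
    using that lin_span_mono[of residual "residual \<union> chain ` B" H] by blast
  obtain fs where fs: "f = prod_fun n fs" "set fs \<subseteq> gens" "length fs \<le> n - 1" using assms by (auto simp: low_prods_def)
  show ?thesis
  proof (cases "length fs = n - 1")
    case len: True
    show ?thesis
    proof (cases "\<exists>f\<in>set fs. f \<in> gens_one n")
      case True
      then show ?thesis unfolding fs(1) using residual_one[OF fs(2) len] mono by blast
    next
      case False
      obtain es where es: "filter (\<lambda>f. f \<notin> gens_one n) fs = map (\<lambda>e. z2 (fst e) (snd e)) es"
        "\<forall>e\<in>set es. fst e \<in> ss \<and> snd e \<in> ss \<and> \<bar>fst e\<bar> \<noteq> \<bar>snd e\<bar>" using edges_of[OF fs(2)] by blast
      have "filter (\<lambda>f. f \<notin> gens_one n) fs = fs" using False by (simp add: filter_id_conv)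
      then have fs': "fs = map edge_fun es" using es(1) by (simp add: edge_fun_def[abs_def])
      show ?thesis unfolding fs(1) fs' by (rule edges_span) (use es(2) len fs' in \<open>auto simp: edge_def\<close>)
    qed
  next
    case False
    then show ?thesis unfolding fs(1) using fs(3) by (intro mono residual_short[OF fs(2)]) linarith
  qed
qed

section \<open>Kernels\<close>

lemma sp_comb:
  assumes "X \<subseteq> carrier H" "f \<in> sp X" "g \<in> sp X"
  shows "(\<lambda>x\<in>Z. a * f x + b * g x) \<in> sp X"
proof -
  have "(\<lambda>x\<in>Z. (\<lambda>x\<in>Z. a * f x) x + (\<lambda>x\<in>Z. b * g x) x) \<in> sp X" by (intro sp_add sp_smult assms)
  moreover have "(\<lambda>x\<in>Z. (\<lambda>x\<in>Z. a * f x) x + (\<lambda>x\<in>Z. b * g x) x) = (\<lambda>x\<in>Z. a * f x + b * g x)" by auto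
  ultimately show ?thesis by metis
qed

text \<open>Pairing \<open>a \<star> prim s = 0\<close> with \<open>F\<close> and expanding by
  \<open>dl_prim\<close> and \<open>FG\<close> shows that the sum of \<open>a u\<close> times half
  of \<open>F u + s F (u \<circ> w0 n) + R u\<close> is zero, where \<open>R u\<close> collects the
  functions \<open>G A\<close> with \<open>A\<close> nonempty. Modulo the span of \<open>X\<close>,
  \<open>R u\<close> vanishes and \<open>s F (u \<circ> w0 n)\<close> equals \<open>F u\<close>, so
  the sum of \<open>a u\<close> times \<open>F u\<close> lies in that span.\<close>

lemma kernel_span:
  assumes X: "X \<subseteq> carrier H" and a: "a \<star> prim s = (\<lambda>_. 0)"
    and FG: "\<And>u A x. u \<in> B \<Longrightarrow> A \<subseteq> E \<Longrightarrow> x \<in> Z \<Longrightarrow> (\<Sum>v\<in>B. ind (Mset u A) v * F v x) = G A u x"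
    and D: "\<And>u. u \<in> B \<Longrightarrow> (\<lambda>x\<in>Z. F u x - of_int s * F (u \<circ> w0 n) x) \<in> sp X"
    and G: "\<And>u A. u \<in> B \<Longrightarrow> A \<subseteq> E \<Longrightarrow> A \<noteq> {} \<Longrightarrow> G A u \<in> sp X"
  shows "(\<lambda>x\<in>Z. \<Sum>u\<in>B. a u * F u x) \<in> sp X"
proof -
  define c :: "int set \<Rightarrow> complex" where "c A = (-1) ^ card A / of_nat (card A + 1)" for A
  define N where "N = Pow E - {{}}"
  have N: "finite N" "Pow E = insert {} N" "{} \<notin> N" by (auto simp: N_def)
  define GG where "GG A u = (\<lambda>x\<in>Z. 1 * G A u x + of_int s * G A (u \<circ> w0 n) x)" for A u
  define R where "R u = (\<lambda>x\<in>Z. \<Sum>A\<in>N. c A * GG A u x)" for u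
  define D' where "D' u = (\<lambda>x\<in>Z. F u x - of_int s * F (u \<circ> w0 n) x)" for u
  have GG: "GG A u \<in> sp X" if "u \<in> B" "A \<in> N" for u A
    unfolding GG_def by (rule sp_comb[OF X]) (use that in \<open>auto intro!: G simp: N_def\<close>)
  have R: "R u \<in> sp X" if "u \<in> B" for u
    unfolding R_def by (rule sp_sum[OF X N(1) GG[OF that]])
  \<comment> \<open>This is \<open>F u\<close> minus half of
    \<open>F u + s F (u \<circ> w0 n) + R u\<close>.\<close>
  have T: "(\<lambda>x\<in>Z. 1/2 * D' u x + (-1/2) * R u x) \<in> sp X" if "u \<in> B" for u
    unfolding D'_def by (rule sp_comb[OF X D[OF that] R[OF that]])
  have F0: "G {} u x = F u x" if "u \<in> B" "x \<in> Z" for u x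
  proof -
    have "G {} u x = (\<Sum>v\<in>B. ind {u} v * F v x)" using FG[of u "{}" x] that by (simp only: Mset_empty empty_subsetI)
    also have "\<dots> = (\<Sum>v\<in>B. if v = u then F u x else 0)" by (rule sum.cong) auto
    also have "\<dots> = F u x" using that fin by simp
    finally show ?thesis .
  qed
  have "(\<lambda>x\<in>Z. \<Sum>u\<in>B. a u * (\<lambda>x\<in>Z. 1/2 * D' u x + (-1/2) * R u x) x) \<in> sp X"
    by (rule sp_sum[OF X fin T])
  moreover have "(\<lambda>x\<in>Z. \<Sum>u\<in>B. a u * (\<lambda>x\<in>Z. 1/2 * D' u x + (-1/2) * R u x) x) = (\<lambda>x\<in>Z. \<Sum>u\<in>B. a u * F u x)"
  proof (rule restrict_ext)
    fix x assume x: "x \<in> Z"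
    have step: "(\<Sum>v\<in>B. (dl u \<star> prim s) v * F v x) = (F u x + of_int s * F (u \<circ> w0 n) x + R u x) / 2" if u: "u \<in> B" for u
    proof -
      have ub: "u \<circ> w0 n \<in> B" using u by simp
      have "(\<Sum>v\<in>B. (dl u \<star> prim s) v * F v x) = (\<Sum>v\<in>B. \<Sum>A\<in>Pow E. c A *
        (ind (Mset u A) v * F v x + of_int s * (ind (Mset (u \<circ> w0 n) A) v * F v x)) / 2)"
        by (rule sum.cong[OF refl]) (simp add: dl_prim[OF u] c_def sum_distrib_right sum_divide_distrib distrib_left distrib_right mult.assoc)
      also have "\<dots> = (\<Sum>A\<in>Pow E. \<Sum>v\<in>B. c A *
        (ind (Mset u A) v * F v x + of_int s * (ind (Mset (u \<circ> w0 n) A) v * F v x)) / 2)" by (rule sum.swap)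
      also have "\<dots> = (\<Sum>A\<in>Pow E. c A * (G A u x + of_int s * G A (u \<circ> w0 n) x) / 2)"
      proof (rule sum.cong[OF refl])
        fix A assume "A \<in> Pow E"
        then have A: "A \<subseteq> E" by simp
        have "(\<Sum>v\<in>B. c A * (ind (Mset u A) v * F v x + of_int s * (ind (Mset (u \<circ> w0 n) A) v * F v x)) / 2) =
          c A * ((\<Sum>v\<in>B. ind (Mset u A) v * F v x) + of_int s * (\<Sum>v\<in>B. ind (Mset (u \<circ> w0 n) A) v * F v x)) / 2"
          by (simp only: sum_distrib_left sum.distrib sum_divide_distrib distrib_left add_divide_distrib)
        then show "(\<Sum>v\<in>B. c A * (ind (Mset u A) v * F v x + of_int s * (ind (Mset (u \<circ> w0 n) A) v * F v x)) / 2) =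
          c A * (G A u x + of_int s * G A (u \<circ> w0 n) x) / 2" by (simp only: FG[OF u A x] FG[OF ub A x])
      qed
      also have "\<dots> = (\<Sum>A\<in>Pow E. c A * (G A u x + of_int s * G A (u \<circ> w0 n) x)) / 2" by (rule sum_divide_distrib[symmetric])
      also have "(\<Sum>A\<in>Pow E. c A * (G A u x + of_int s * G A (u \<circ> w0 n) x)) =
        (F u x + of_int s * F (u \<circ> w0 n) x) + (\<Sum>A\<in>N. c A * (G A u x + of_int s * G A (u \<circ> w0 n) x))"
        unfolding N(2) sum.insert[OF N(1,3)] F0[OF u x] F0[OF ub x] by (simp add: c_def)
      also have "(\<Sum>A\<in>N. c A * (G A u x + of_int s * G A (u \<circ> w0 n) x)) = R u x"
        unfolding R_def GG_def restrict_apply'[OF x] by simp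
      finally show ?thesis .
    qed
    have "0 = (\<Sum>v\<in>B. (a \<star> prim s) v * F v x)" unfolding a by simp
    also have "\<dots> = (\<Sum>v\<in>B. \<Sum>u\<in>B. a u * ((dl u \<star> prim s) v * F v x))"
      unfolding conv_expand[of a] by (simp only: sum_distrib_right mult.assoc)
    also have "\<dots> = (\<Sum>u\<in>B. \<Sum>v\<in>B. a u * ((dl u \<star> prim s) v * F v x))" by (rule sum.swap)
    also have "\<dots> = (\<Sum>u\<in>B. a u * ((F u x + of_int s * F (u \<circ> w0 n) x + R u x) / 2))"
      by (rule sum.cong[OF refl]) (simp only: sum_distrib_left[symmetric] step)
    finally have zero: "(\<Sum>u\<in>B. a u * ((F u x + of_int s * F (u \<circ> w0 n) x + R u x) / 2)) = 0" by simp
    have "(\<Sum>u\<in>B. a u * F u x) = (\<Sum>u\<in>B. a u * (\<lambda>x\<in>Z. 1/2 * D' u x + (-1/2) * R u x) x +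
      a u * ((F u x + of_int s * F (u \<circ> w0 n) x + R u x) / 2))"
      unfolding D'_def restrict_apply'[OF x] by (rule sum.cong[OF refl]) (simp add: field_simps)
    also have "\<dots> = (\<Sum>u\<in>B. a u * (\<lambda>x\<in>Z. 1/2 * D' u x + (-1/2) * R u x) x)"
      unfolding sum.distrib zero by simp
    finally show "(\<Sum>u\<in>B. a u * (\<lambda>x\<in>Z. 1/2 * D' u x + (-1/2) * R u x) x) = (\<Sum>u\<in>B. a u * F u x)" by simp
  qed
  ultimately show ?thesis by metis
qed

lemma span_decompose:
  assumes X: "X \<subseteq> carrier H" and F: "\<And>u. u \<in> B \<Longrightarrow> F u \<in> carrier H" and f: "f \<in> sp (X \<union> F ` B)"
  shows "\<exists>k\<in>sp X. \<exists>a. \<forall>x\<in>Z. f x = k x + (\<Sum>u\<in>B. a u * F u x)"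
proof -
  have XF: "X \<union> F ` B \<subseteq> carrier H" using X F by blast
  show ?thesis
    using XF f
  proof (induction rule: sp_induct)
    case zero
    show ?case by (rule bexI[OF _ sp_zero[OF X]], rule exI[of _ "\<lambda>_. 0"]) simp
  next
    case (gen f)
    then show ?case
    proof
      assume "f \<in> X"
      then show ?case by (intro bexI[OF _ sp_gen[of f X]] exI[of _ "\<lambda>_. 0"]) simp
    next
      assume "f \<in> F ` B"
      then obtain v where v: "v \<in> B" "f = F v" by blast
      have "(\<Sum>u\<in>B. of_bool (u = v) * F u x) = (\<Sum>u\<in>B. if u = v then F v x else 0)" for x by (rule sum.cong) auto
      then have "(\<Sum>u\<in>B. of_bool (u = v) * F u x) = F v x" for x using v(1) fin by simp
      then show ?case by (intro bexI[OF _ sp_zero[OF X]] exI[of _ "\<lambda>u. of_bool (u = v)"]) (simp add: v(2))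
    qed
  next
    case (add f g)
    obtain k a where k: "k \<in> sp X" "\<forall>x\<in>Z. f x = k x + (\<Sum>u\<in>B. a u * F u x)" using add by blast
    obtain l b where l: "l \<in> sp X" "\<forall>x\<in>Z. g x = l x + (\<Sum>u\<in>B. b u * F u x)" using add by blast
    show ?case
      by (rule bexI[OF _ sp_add[OF X k(1) l(1)]], rule exI[of _ "\<lambda>u. a u + b u"])
        (use k(2) l(2) in \<open>simp add: distrib_right sum.distrib\<close>)
  next
    case (smult c f)
    obtain k a where k: "k \<in> sp X" "\<forall>x\<in>Z. f x = k x + (\<Sum>u\<in>B. a u * F u x)" using smult by blast
    show ?case
      by (rule bexI[OF _ sp_smult[OF X k(1), of c]], rule exI[of _ "\<lambda>u. c * a u"])
        (use k(2) in \<open>simp add: distrib_left sum_distrib_left mult.assoc\<close>)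
  qed
qed

lemma phi_residual:
  assumes "f \<in> residual"
  shows "phi s f = (\<lambda>_. 0)"
proof -
  obtain fs where fs: "f = prod_fun n fs" "set fs \<subseteq> gens" "length (filter (\<lambda>f. f \<notin> gens_one n) fs) + 2 \<le> n"
  proof -
    from assms consider "f \<in> low_prods (int (n - 1) - 1)" | "f \<in> top_prods (n - 1) 1" by (auto simp: residual_def)
    then show thesis
    proof cases
      case 1
      then obtain fs where fs: "f = prod_fun n fs" "set fs \<subseteq> gens" "int (length fs) \<le> int (n - 1) - 1"
        by (auto simp: low_prods_def)
      have "length (filter (\<lambda>f. f \<notin> gens_one n) fs) \<le> length fs" by simp
      then show thesis using fs n_pos by (intro that[OF fs(1,2)]) linarith
    next
      case 2
      then obtain fs where fs: "f = prod_fun n fs" "set fs \<subseteq> gens" "length fs = n - 1"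
        "1 \<le> length (filter (\<lambda>f. f \<in> gens_one n) fs)" by (auto simp: top_prods_def)
      then show thesis using sum_length_filter_compl[of "\<lambda>f. f \<in> gens_one n" fs] by (intro that[OF fs(1,2)]) linarith
    qed
  qed
  then show ?thesis using few_edges_zero by simp
qed

lemma phi_top2:
  assumes "f \<in> top_prods n 2"
  shows "phi s f = (\<lambda>_. 0)"
proof -
  obtain fs where fs: "f = prod_fun n fs" "set fs \<subseteq> gens" "length fs = n"
    "2 \<le> length (filter (\<lambda>f. f \<in> gens_one n) fs)" using assms by (auto simp: top_prods_def)
  then have "length (filter (\<lambda>f. f \<notin> gens_one n) fs) + 2 \<le> n"
    using sum_length_filter_compl[of "\<lambda>f. f \<in> gens_one n" fs] by linarith
  then show ?thesis unfolding fs(1) by (rule few_edges_zero[OF fs(2)])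
qed

lemma left_ideal_simps:
  "carrier (left_ideal_rep r) = {b \<star> r | b. b \<in> GA}" "\<zero>\<^bsub>left_ideal_rep r\<^esub> = (\<lambda>_. 0)"
  "f \<oplus>\<^bsub>left_ideal_rep r\<^esub> g = (\<lambda>x. f x + g x)" "k \<odot>\<^bsub>left_ideal_rep r\<^esub> f = (\<lambda>x. k * f x)"
  "act (left_ideal_rep r) h f = dl h \<star> f"
  by (simp_all add: left_ideal_rep_def)

lemma phi_G_piece_iso:
  assumes ker1: "\<And>f. f \<in> low_prods (int k - 1) \<union> top_prods k (l + 1) \<Longrightarrow> phi s f = (\<lambda>_. 0)"
    and surj: "\<And>b. b \<in> GA \<Longrightarrow> \<exists>f\<in>sp (top_prods k l). phi s f = b \<star> prim s"
    and ker2: "\<And>f. f \<in> sp (top_prods k l) \<Longrightarrow> phi s f = (\<lambda>_. 0) \<Longrightarrow> f \<in> sp (low_prods (int k - 1) \<union> top_prods k (l + 1))"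
  shows "rep_isomorphic (hyperoct n) (G_piece n k l) (left_ideal_rep (prim s))"
proof (rule G_piece_iso[OF left_ideal_representation])
  show "phi s f \<in> carrier (left_ideal_rep (prim s))" for f
    unfolding left_ideal_simps phi_def using ev_in_GA by blast
  show "phi s (\<lambda>x\<in>Z. f x + g x) = phi s f \<oplus>\<^bsub>left_ideal_rep (prim s)\<^esub> phi s g" for f g
    unfolding left_ideal_simps by (rule phi_add)
  show "phi s (\<lambda>x\<in>Z. c * f x) = c \<odot>\<^bsub>left_ideal_rep (prim s)\<^esub> phi s f" for c f
    unfolding left_ideal_simps by (rule phi_smult)
  show "phi s (act H g f) = act (left_ideal_rep (prim s)) g (phi s f)" if "g \<in> B" for g f
    unfolding left_ideal_simps by (rule phi_act[OF that])
  show "phi s f = \<zero>\<^bsub>left_ideal_rep (prim s)\<^esub>" if "f \<in> low_prods (int k - 1) \<union> top_prods k (l + 1)" for f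
    unfolding left_ideal_simps by (rule ker1[OF that])
  show "carrier (left_ideal_rep (prim s)) \<subseteq> phi s ` sp (top_prods k l)"
    unfolding left_ideal_simps using surj by (force simp: image_iff)
  show "f \<in> sp (low_prods (int k - 1) \<union> top_prods k (l + 1))"
    if "f \<in> sp (top_prods k l)" "phi s f = \<zero>\<^bsub>left_ideal_rep (prim s)\<^esub>" for f
    using ker2 that unfolding left_ideal_simps by blast
qed

section \<open>The two bigraded pieces as left ideals\<close>

lemma G_pos_iso: "rep_isomorphic (hyperoct n) (G_piece n (n - 1) 0) (left_ideal_rep (prim 1))"
proof (rule phi_G_piece_iso)
  have eq: "low_prods (int (n - 1) - 1) \<union> top_prods (n - 1) (0 + 1) = residual" by (simp add: residual_def)
  show "phi 1 f = (\<lambda>_. 0)" if "f \<in> low_prods (int (n - 1) - 1) \<union> top_prods (n - 1) (0 + 1)" for f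
    using that unfolding eq by (rule phi_residual)
  have pc: "phi 1 (chain u) = (\<lambda>g. 2 * (dl u \<star> prim 1) g)" if "u \<in> B" for u
    using phi_chain[OF that, of 1] by simp
  show "\<exists>f\<in>sp (top_prods (n - 1) 0). phi 1 f = b \<star> prim 1" for b
  proof
    \<comment> \<open>The division by 2 compensates the factor \<open>1 + s\<close> of
      \<open>phi_chain\<close>.\<close>
    show "(\<lambda>x\<in>Z. \<Sum>u\<in>B. (b u / 2) * chain u x) \<in> sp (top_prods (n - 1) 0)"
      by (rule sp_sum[OF prods_in_H(1) fin sp_gen[OF chain_top]])
    have "phi 1 (\<lambda>x\<in>Z. \<Sum>u\<in>B. (b u / 2) * chain u x) = (\<lambda>w. \<Sum>u\<in>B. (b u / 2) * phi 1 (chain u) w)" by (rule phi_sum)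
    also have "\<dots> = b \<star> prim 1" unfolding conv_expand[of b] by (rule ext, rule sum.cong[OF refl]) (simp add: pc)
    finally show "phi 1 (\<lambda>x\<in>Z. \<Sum>u\<in>B. (b u / 2) * chain u x) = b \<star> prim 1" .
  qed
  show "f \<in> sp (low_prods (int (n - 1) - 1) \<union> top_prods (n - 1) (0 + 1))"
    if f: "f \<in> sp (top_prods (n - 1) 0)" and z: "phi 1 f = (\<lambda>_. 0)" for f
    unfolding eq
  proof -
    have fH: "f \<in> carrier H" by (rule sp_H[OF prods_in_H(1) f])
    have "f \<in> sp (residual \<union> chain ` B)"
      using prods_in_H(1) f
    proof (induction rule: sp_induct)
      case (gen f)
      then show ?case using top_low(1)[of "n - 1" 0] low_span by blast
    qed (simp_all only: sp_zero sp_add sp_smult residual_chain_in_H)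
    then have "\<exists>k\<in>sp residual. \<exists>a. \<forall>x\<in>Z. f x = k x + (\<Sum>u\<in>B. a u * chain u x)"
      by (rule span_decompose[where F = chain, OF residual_in_H cut_chain_in_H, rotated])
    then obtain k where k: "k \<in> sp residual" and "\<exists>a. \<forall>x\<in>Z. f x = k x + (\<Sum>u\<in>B. a u * chain u x)"
      by (rule bexE)
    then obtain a where fk: "\<forall>x\<in>Z. f x = k x + (\<Sum>u\<in>B. a u * chain u x)" by (elim exE)
    \<comment> \<open>The chain part of \<open>f\<close> has the same image as \<open>f\<close>,
      namely twice \<open>a \<star> prim 1\<close>; its vanishing makes \<open>kernel_span\<close>
      applicable to \<open>a\<close>.\<close>
    define q where "q = (\<lambda>x\<in>Z. \<Sum>u\<in>B. a u * chain u x)"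
    have "f = (\<lambda>x\<in>Z. k x + q x)"
      by (rule ext) (use fk H_ext[OF fH] in \<open>simp add: q_def restrict_def\<close>)
    moreover have "phi 1 k = (\<lambda>_. 0)" by (rule phi_zero_sp[OF residual_in_H phi_residual k])
    ultimately have "phi 1 q = (\<lambda>_. 0)" using z by (simp only: phi_add) (simp add: fun_eq_iff)
    moreover have "phi 1 q = (\<lambda>w. 2 * (a \<star> prim 1) w)"
      unfolding q_def phi_sum conv_expand[of a] sum_distrib_left
      by (rule ext, rule sum.cong[OF refl]) (simp add: pc)
    ultimately have a0: "a \<star> prim 1 = (\<lambda>_. 0)" by (simp add: fun_eq_iff)
    have "q \<in> sp residual"
      unfolding q_def
    proof (rule kernel_span[OF residual_in_H a0, where G = cut_chain])
      show "(\<Sum>v\<in>B. ind (Mset u A) v * chain v x) = cut_chain A u x" if "u \<in> B" "A \<subseteq> E" "x \<in> Z" for u A x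
        by (rule Mset_sums(1)[OF that(3,1,2)])
      show "(\<lambda>x\<in>Z. chain u x - of_int 1 * chain (u \<circ> w0 n) x) \<in> sp residual" if "u \<in> B" for u
        using chain_flip[OF that] by (simp only: of_int_1 mult_1)
      show "cut_chain A u \<in> sp residual" if "u \<in> B" "A \<subseteq> E" "A \<noteq> {}" for u A
        by (rule sp_gen) (use cut_chain_low[OF that] in \<open>simp add: residual_def\<close>)
    qed
    then have "(\<lambda>x\<in>Z. k x + q x) \<in> sp residual" by (rule sp_add[OF residual_in_H k])
    then show "f \<in> sp residual" using \<open>f = (\<lambda>x\<in>Z. k x + q x)\<close> by simp
  qed
qed

text \<open>Products of generators take at \<open>x\<close> the value they take at the chosen point
  of its component, and positive chains are the indicators of the components.\<close>

lemma expand_pos_chain: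
  assumes f: "f \<in> sp (top_prods k l)" and x: "x \<in> Z"
  shows "f x = (\<Sum>u\<in>B. ev f u * pos_chain {} u x)"
proof -
  obtain w where w: "w \<in> B" and p1: "\<And>i. i \<in> ss \<Longrightarrow> 0 < coord x i \<longleftrightarrow> 0 < coord (pt w) i"
    and p2: "\<And>i j. i \<in> ss \<Longrightarrow> j \<in> ss \<Longrightarrow> coord x i < coord x j \<longleftrightarrow> coord (pt w) i < coord (pt w) j"
    using component_exists[OF x] by blast
  have pw: "pt w \<in> Z" by (rule pt_in_Z[OF w])
  have gen: "g x = g (pt w)" if "g \<in> gens" for g
    using gens_cases[OF that] p1 p2 by (auto simp: z1_apply[OF x] z1_apply[OF pw] z2_apply[OF x] z2_apply[OF pw])
  have prod: "prod_fun n fs x = prod_fun n fs (pt w)" if "set fs \<subseteq> gens" for fs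
  proof -
    have "map (\<lambda>g. g x) fs = map (\<lambda>g. g (pt w)) fs" using gen that by (intro map_cong) auto
    then have "(\<Prod>g\<leftarrow>fs. g x) = (\<Prod>g\<leftarrow>fs. g (pt w))" by (rule arg_cong)
    then show ?thesis by (simp only: prod_fun_apply[OF x] prod_fun_apply[OF pw])
  qed
  have "f x = f (pt w)"
    using prods_in_H(1) f
  proof (induction rule: sp_induct)
    case (gen f)
    then show ?case using prod by (auto simp: top_prods_def)
  qed (simp_all add: x pw)
  moreover have "pos_chain {} u x = of_bool (u = w)" if u: "u \<in> B" for u
  proof -
    have "pos_chain {} u \<in> top_prods n (1 + card ({} :: int set))" by (rule pos_chain_top[OF u]) simp
    then have "pos_chain {} u x = pos_chain {} u (pt w)" using prod by (auto simp: top_prods_def)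
    also have "\<dots> = ev (pos_chain {} u) w" using w by (simp add: ev_def)
    also have "\<dots> = of_bool (u = w)" unfolding ev_pos_chain[OF u] by auto
    finally show ?thesis .
  qed
  then have "(\<Sum>u\<in>B. ev f u * pos_chain {} u x) = (\<Sum>u\<in>B. if u = w then ev f w else 0)"
    by (intro sum.cong) auto
  moreover have "\<dots> = f (pt w)" using w fin by (simp add: ev_def)
  ultimately show ?thesis by simp
qed

lemma G_neg_iso: "rep_isomorphic (hyperoct n) (G_piece n n 1) (left_ideal_rep (prim (- 1)))"
proof (rule phi_G_piece_iso)
  have nn: "int n - 1 = int (n - 1)" using n_pos by simp
  define X where "X = low_prods (int n - 1) \<union> top_prods n 2"
  have XX: "low_prods (int n - 1) \<union> top_prods n (1 + 1) = X" by (simp add: X_def numeral_2_eq_2)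
  have X: "X \<subseteq> carrier H" unfolding X_def using prods_in_H by blast
  show "phi (- 1) f = (\<lambda>_. 0)" if f: "f \<in> low_prods (int n - 1) \<union> top_prods n (1 + 1)" for f
  proof -
    \<comment> \<open>For \<open>s = -1\<close> the factor \<open>1 + s\<close> vanishes, so chains
      die and with them all products of fewer than \<open>n\<close> generators.\<close>
    have "phi (- 1) g = (\<lambda>_. 0)" if "g \<in> residual \<union> chain ` B" for g
      using that phi_residual phi_chain[of _ "- 1"] by auto
    then have "phi (- 1) f = (\<lambda>_. 0)" if "f \<in> low_prods (int n - 1)"
      using low_span phi_zero_sp[OF residual_chain_in_H] that unfolding nn by blast
    then show ?thesis using f phi_top2 unfolding XX X_def by blast
  qed
  have pd: "phi (- 1) (pos_chain {} u) = dl u \<star> prim (- 1)" if "u \<in> B" for u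
    unfolding phi_def ev_pos_chain[OF that] ..
  show "\<exists>f\<in>sp (top_prods n 1). phi (- 1) f = b \<star> prim (- 1)" for b
  proof
    have "pos_chain {} u \<in> top_prods n 1" if "u \<in> B" for u using pos_chain_top[OF that, of "{}"] by simp
    then show "(\<lambda>x\<in>Z. \<Sum>u\<in>B. b u * pos_chain {} u x) \<in> sp (top_prods n 1)"
      by (intro sp_sum[OF prods_in_H(1) fin] sp_gen)
    show "phi (- 1) (\<lambda>x\<in>Z. \<Sum>u\<in>B. b u * pos_chain {} u x) = b \<star> prim (- 1)"
      unfolding phi_sum conv_expand[of b] by (rule ext, rule sum.cong[OF refl]) (simp add: pd)
  qed
  show "f \<in> sp (low_prods (int n - 1) \<union> top_prods n (1 + 1))"
    if f: "f \<in> sp (top_prods n 1)" and z: "phi (- 1) f = (\<lambda>_. 0)" for f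
    unfolding XX
  proof -
    have "(\<lambda>x\<in>Z. \<Sum>u\<in>B. ev f u * pos_chain {} u x) \<in> sp X"
    proof (rule kernel_span[OF X, where s = "- 1" and G = pos_chain])
      show "ev f \<star> prim (- 1) = (\<lambda>_. 0)" using z by (simp only: phi_def)
      show "(\<Sum>v\<in>B. ind (Mset u A) v * pos_chain {} v x) = pos_chain A u x" if "u \<in> B" "A \<subseteq> E" "x \<in> Z" for u A x
        by (rule Mset_sums(2)[OF that(3,1,2)])
      show "pos_chain A u \<in> sp X" if "u \<in> B" "A \<subseteq> E" "A \<noteq> {}" for u A
      proof -
        have "finite A" by (rule finite_subset[OF that(2)]) simp
        then have "2 \<le> 1 + card A" using that(3) by (simp add: Suc_le_eq card_gt_0_iff)
        then have "pos_chain A u \<in> top_prods n 2" using pos_chain_top[OF that(1,2)] top_prods_mono by blast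
        then show ?thesis by (intro sp_gen) (simp add: X_def)
      qed
      \<comment> \<open>By \<open>chain_decompose\<close> the sum of the two positive chains is a
        chain, a product of \<open>n - 1\<close> generators, minus sign changes, which carry two
        sign factors.\<close>
      show "(\<lambda>x\<in>Z. pos_chain {} u x - of_int (- 1) * pos_chain {} (u \<circ> w0 n) x) \<in> sp X" if u: "u \<in> B" for u
      proof -
        have "chain u \<in> low_prods (int (n - 1))" using chain_top[OF u] top_low(1)[of "n - 1" 0] by blast
        then have c: "chain u \<in> sp X" by (intro sp_gen) (simp add: X_def nn)
        have m: "(\<lambda>x\<in>Z. \<Sum>j\<in>E. 1 * sign_change j u x) \<in> sp X"
          by (rule sp_sum[OF X finite_atLeastAtMost_int]) (use sign_change_facts(1)[OF u] in \<open>auto intro!: sp_gen simp: X_def\<close>)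
        have "(\<lambda>x\<in>Z. chain u x - (\<lambda>x\<in>Z. \<Sum>j\<in>E. 1 * sign_change j u x) x) \<in> sp X" by (rule sp_diff[OF X c m])
        moreover have "(\<lambda>x\<in>Z. chain u x - (\<lambda>x\<in>Z. \<Sum>j\<in>E. 1 * sign_change j u x) x) =
          (\<lambda>x\<in>Z. pos_chain {} u x - of_int (- 1) * pos_chain {} (u \<circ> w0 n) x)"
        proof (rule restrict_ext)
          fix x assume x: "x \<in> Z"
          show "chain u x - (\<lambda>x\<in>Z. \<Sum>j\<in>E. 1 * sign_change j u x) x = pos_chain {} u x - of_int (- 1) * pos_chain {} (u \<circ> w0 n) x"
            unfolding chain_decompose[OF x u] restrict_apply'[OF x] by simp
        qed
        ultimately show ?thesis by metis
      qed
    qed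
    then show "f \<in> sp X" by (rule sp_eq[OF X _ sp_H[OF prods_in_H(1) f] expand_pos_chain[OF f]])
  qed
qed

end

theorem theorem6p21:
  fixes n :: nat
  assumes "n \<ge> 1"
  shows "rep_isomorphic (hyperoct n) (G_piece n n 1) (ind_rep (hyperoct n) (Z_neg n) (rho_neg n)) \<and>
         rep_isomorphic (hyperoct n) (ind_rep (hyperoct n) (Z_neg n) (rho_neg n))
           (right_ideal_rep (hyperoct n) (g_elt n ([], [int n]))) \<and>
         rep_isomorphic (hyperoct n) (G_piece n (n - 1) 0) (ind_rep (hyperoct n) (Z_pos n) (rho_pos n)) \<and>
         rep_isomorphic (hyperoct n) (ind_rep (hyperoct n) (Z_pos n) (rho_pos n))
           (right_ideal_rep (hyperoct n) (g_elt n ([int n], [])))"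
proof -
  interpret hyperoctahedral n by standard (rule assms)
  note via_ideal = rep_isomorphic_trans[OF _ rep_isomorphic_sym]
  show ?thesis
    by (intro conjI via_ideal[OF G_neg_iso ind_neg_iso] via_ideal[OF ind_neg_iso g_iso(1)]
      via_ideal[OF G_pos_iso ind_pos_iso] via_ideal[OF ind_pos_iso g_iso(2)])
qed

end
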